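(* Let $X\subset\mathbb{R}^N$ be a compact polyhedron and let $K,K'$ be two PLCW decompositions of $X$. Then $K\underset{e}{\sim}K'$; that is, $K$ can be obtained from $K'$ by a finite sequence of elementary subdivisions and their inverses.
   Context: All maps and homeomorphisms are piecewise linear (PL). $B^n=[-1,1]^n\subset\mathbb{R}^n$, with interior $\mathrm{Int}(B^n)$ and boundary $\partial B^n=S^{n-1}$ (for $n=0$, $B^0$ is a point, $\mathrm{Int}(B^0)=B^0$, $\partial B^0=\varnothing$). Generalized cells. A PL map $\varphi\colon B^n\to\mathbb{R}^N$ is regular if its restriction to $\mathrm{Int}(B^n)$ is injective. A generalized $n$-cell is a subset $C\subset\mathbb{R}^N$ with a decomposition into disjoint subsets $C=\overset{\circ}{C}\sqcup\dot{C}$ such that $\overset{\circ}{C}=\varphi(\mathrm{Int}(B^n))$ and $\dot{C}=\varphi(\partial B^n)$ for some regular map $\varphi$; such a $\varphi$ is called a characteristic map of $C$. Below "cell" means generalized cell. Generalized cell complexes. A generalized cell complex (g.c.c.) is a finite collection $K$ of cells in $\mathbb{R}^N$ such that (1) $\overset{\circ}{A}\cap\overset{\circ}{B}=\varnothing$ for distinct $A,B\in K$; (2) for every $C\in K$, $\dot{C}$ is a union of cells of $K$. Its support is $|K|=\bigcup_{C\in K}C$; $\dim K$ is the maximal dimension of its cells; the $n$-skeleton $K^n$ consists of its cells of dimension $\le n$. A g.c.c. decomposition of a compact polyhedron $P$ is a g.c.c. $K$ with $|K|=P$. A regular cellular map $f\colon L\to K$ of g.c.c. is a PL map $f\colon|L|\to|K|$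 such that for every cell $C\in L$ with characteristic map $\varphi\colon B^k\to C$ there is a cell $C'\in K$ with $C'=f(C)$ and such that $f\circ\varphi\colon B^k\to C'$ is a characteristic map of $C'$. PLCW complexes (inductive definition). A g.c.c. $K$ (respectively, a g.c.c. decomposition) is a PLCW complex (respectively, a PLCW decomposition) if $\dim K=0$, or $\dim K=n>0$ and: (1) $K^{n-1}$ is a PLCW complex; (2) for every $n$-cell $A\in K$ with characteristic map $\varphi\colon B^n\to A$, there is a PLCW decomposition $L$ of $\partial B^n$ such that $\varphi|_{\partial B^n}\colon L\to K^{n-1}$ is a regular cellular map. For each cell $A$ of a PLCW complex $K$, of dimension $n>0$, and each characteristic map $\varphi\colon B^n\to A$, this $L$ is unique (its cells are the closures of the connected components of $\varphi^{-1}(\overset{\circ}{K_i})$, taken in $\partial B^n$, for $K_i\in K^{n-1}$); it is called the pullback decomposition and denoted $\varphi^{-1}(K)$. Elementary subdivisions. For $n\ge1$ let $H_0=\{x_n=0\}$, $H_+=\{x_n\ge0\}$, $H_-=\{x_n\le0\}$ in $\mathbb{R}^n$, and $B^n_\pm=B^n\cap H_\pm$, $B^n_0=B^n\cap H_0$, $E=\partial B^n\cap H_0$ (the equator; empty if $n=1$). Let $K$ be a PLCW complex and $C\in K$ an $n$-cell with a characteristic map $\varphi\colon B^n\to C$ such that $E$ is a union of cells of the pullback decomposition $\varphi^{-1}(K)$ of $\partial B^n$. Let $K'$ be obtained from $K$ by replacing the cell $C$ by the three cells $C_+=\varphi(B^n_+)$, $C_-=\varphi(B^n_-)$, $C_0=\varphi(B^n_0)$.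 Then $K'$ is a PLCW complex with $|K'|=|K|$, and $K'$ is said to be obtained from $K$ by an elementary subdivision of the cell $C$. Write $K\underset{e}{\sim}L$ if $K$ can be obtained from $L$ by a finite sequence of elementary subdivisions and their inverses. *)

theory Defs
  imports "HOL-Analysis.Analysis" "HOL-Analysis.Finite_Function_Topology"
begin

text \<open>
  All spaces live in the real vector space of finitely supported sequences, the union
  of the chain $R^0 \subset R^1 \subset R^2 \subset \dots$. This gives one type for the
  ambient space of a complex and for the boundary spheres, of varying dimension, that carry
  the pullback decompositions. Coordinates are numbered from 0, so the last coordinate of a
  point of $R^n$ has index n - 1.
\<close>

type_synonym point = "nat \<Rightarrow>\<^sub>0 real"

definition Rn :: "nat \<Rightarrow> point set" where
  "Rn n = {x. Poly_Mapping.keys x \<subseteq> {..<n}}"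


subsection \<open>Compact polyhedra and piecewise linear maps\<close>

definition compact_polyhedron :: "point set \<Rightarrow> bool" where
  "compact_polyhedron X \<longleftrightarrow> (\<exists>\<P>. finite \<P> \<and> (\<forall>P\<in>\<P>. polytope P) \<and> X = \<Union>\<P>)"

text \<open>
  Maps are total functions, of which only the values on the domain \<open>X\<close> matter.
  Continuity on \<open>X\<close> is automatic, since the pieces are finitely many closed sets.
\<close>

definition PL_on :: "point set \<Rightarrow> (point \<Rightarrow> point) \<Rightarrow> bool" where
  "PL_on X f \<longleftrightarrow>
     (\<exists>\<P>. finite \<P> \<and> (\<forall>P\<in>\<P>. polytope P) \<and> X = \<Union>\<P> \<and>
          (\<forall>P\<in>\<P>. \<exists>g c. linear g \<and> (\<forall>x\<in>P. f x = g x + c)))"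

definition PL_map :: "point set \<Rightarrow> point set \<Rightarrow> (point \<Rightarrow> point) \<Rightarrow> bool" where
  "PL_map X Y f \<longleftrightarrow> PL_on X f \<and> f ` X \<subseteq> Y"


subsection \<open>Generalized cells\<close>

definition cube :: "nat \<Rightarrow> point set" where
  "cube n = {x \<in> Rn n. \<forall>i<n. \<bar>Poly_Mapping.lookup x i\<bar> \<le> 1}"

definition int_cube :: "nat \<Rightarrow> point set" where
  "int_cube n = {x \<in> Rn n. \<forall>i<n. \<bar>Poly_Mapping.lookup x i\<bar> < 1}"

definition bd_cube :: "nat \<Rightarrow> point set" \<comment> \<open>the boundary of \<open>cube n\<close>; empty for \<open>n = 0\<close>\<close> where
  "bd_cube n = cube n - int_cube n"

definition regular_map :: "nat \<Rightarrow> (point \<Rightarrow> point) \<Rightarrow> bool" where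
  "regular_map n \<phi> \<longleftrightarrow> PL_on (cube n) \<phi> \<and> inj_on \<phi> (int_cube n)"

text \<open>
  The decomposition into interior and boundary is part of the data of a generalized cell: it
  is not determined by the underlying set. For example, a polygonal circle is a generalized
  1-cell with any one of its points as boundary.
\<close>

datatype gcell = GCell (cell_int: "point set") (cell_bd: "point set")

definition carrier :: "gcell \<Rightarrow> point set" where
  "carrier C = cell_int C \<union> cell_bd C"

definition characteristic_map :: "nat \<Rightarrow> (point \<Rightarrow> point) \<Rightarrow> gcell \<Rightarrow> bool" where
  "characteristic_map n \<phi> C \<longleftrightarrow>
     regular_map n \<phi> \<and> cell_int C = \<phi> ` int_cube n \<and> cell_bd C = \<phi> ` bd_cube n \<and>
     cell_int C \<inter> cell_bd C = {}"

definition is_cell :: "nat \<Rightarrow> gcell \<Rightarrow> bool" where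
  "is_cell n C \<longleftrightarrow> (\<exists>\<phi>. characteristic_map n \<phi> C)"

text \<open>The dimension is unique, since a piecewise linear injection preserves dimension.\<close>

definition cell_dim :: "gcell \<Rightarrow> nat" where
  "cell_dim C = (THE n. is_cell n C)"


subsection \<open>Generalized cell complexes\<close>

definition union_of_cells :: "gcell set \<Rightarrow> point set \<Rightarrow> bool" where
  "union_of_cells K S \<longleftrightarrow> (\<exists>J\<subseteq>K. S = \<Union>(carrier ` J))"

definition gcc :: "gcell set \<Rightarrow> bool" where
  "gcc K \<longleftrightarrow>
     finite K \<and> (\<forall>C\<in>K. \<exists>n. is_cell n C) \<and>
     (\<forall>A\<in>K. \<forall>C\<in>K. A \<noteq> C \<longrightarrow> cell_int A \<inter> cell_int C = {}) \<and>
     (\<forall>C\<in>K. union_of_cells K (cell_bd C))"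

definition support :: "gcell set \<Rightarrow> point set" where
  "support K = \<Union>(carrier ` K)"

text \<open>The inserted 0 only serves to give the empty complex a dimension.\<close>

definition gcc_dim :: "gcell set \<Rightarrow> nat" where
  "gcc_dim K = Max (insert 0 (cell_dim ` K))"

definition skeleton :: "nat \<Rightarrow> gcell set \<Rightarrow> gcell set" where
  "skeleton n K = {C \<in> K. cell_dim C \<le> n}"

definition regular_cellular_map :: "gcell set \<Rightarrow> gcell set \<Rightarrow> (point \<Rightarrow> point) \<Rightarrow> bool" where
  "regular_cellular_map L K f \<longleftrightarrow>
     PL_map (support L) (support K) f \<and>
     (\<forall>C\<in>L. \<forall>k \<phi>. characteristic_map k \<phi> C \<longrightarrow>
        (\<exists>C'\<in>K. carrier C' = f ` carrier C \<and> characteristic_map k (f \<circ> \<phi>) C'))"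


subsection \<open>PLCW complexes\<close>

inductive PLCW :: "gcell set \<Rightarrow> bool" where
  PLCW_0: "PLCW K" if "gcc K" "gcc_dim K = 0"
| PLCW_Suc: "PLCW K" if "gcc K" "gcc_dim K = n" "n > 0" "PLCW (skeleton (n - 1) K)"
    "\<forall>A\<in>K. \<forall>\<phi>. characteristic_map n \<phi> A \<longrightarrow>
       (\<exists>L. PLCW L \<and> support L = bd_cube n \<and> regular_cellular_map L (skeleton (n - 1) K) \<phi>)"

definition PLCW_decomposition :: "point set \<Rightarrow> gcell set \<Rightarrow> bool" where
  "PLCW_decomposition X K \<longleftrightarrow> PLCW K \<and> support K = X"

text \<open>
  \<open>pullback_decomposition K n \<phi> L\<close> says that \<open>L\<close> is the pullback decomposition along the
  characteristic map \<open>\<phi>\<close> of an n-cell of \<open>K\<close>; it is determined by \<open>K\<close> and \<open>\<phi>\<close>.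
\<close>

definition pullback_decomposition ::
    "gcell set \<Rightarrow> nat \<Rightarrow> (point \<Rightarrow> point) \<Rightarrow> gcell set \<Rightarrow> bool" where
  "pullback_decomposition K n \<phi> L \<longleftrightarrow>
     PLCW_decomposition (bd_cube n) L \<and> regular_cellular_map L (skeleton (n - 1) K) \<phi>"


subsection \<open>Elementary subdivisions\<close>

definition equator :: "nat \<Rightarrow> point set" where
  "equator n = {x \<in> bd_cube n. Poly_Mapping.lookup x (n - 1) = 0}"

text \<open>
  The interior of a half ball is the part of \<open>int_cube n\<close> strictly on one side of the
  equatorial hyperplane; its boundary is the rest, including the equatorial disc.
\<close>

definition upper_cell :: "nat \<Rightarrow> (point \<Rightarrow> point) \<Rightarrow> gcell" where
  "upper_cell n \<phi> =
     (let H = {x \<in> cube n. Poly_Mapping.lookup x (n - 1) \<ge> 0};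
          I = {x \<in> int_cube n. Poly_Mapping.lookup x (n - 1) > 0}
      in GCell (\<phi> ` I) (\<phi> ` (H - I)))"

definition lower_cell :: "nat \<Rightarrow> (point \<Rightarrow> point) \<Rightarrow> gcell" where
  "lower_cell n \<phi> =
     (let H = {x \<in> cube n. Poly_Mapping.lookup x (n - 1) \<le> 0};
          I = {x \<in> int_cube n. Poly_Mapping.lookup x (n - 1) < 0}
      in GCell (\<phi> ` I) (\<phi> ` (H - I)))"

definition middle_cell :: "nat \<Rightarrow> (point \<Rightarrow> point) \<Rightarrow> gcell" where
  "middle_cell n \<phi> =
     GCell (\<phi> ` {x \<in> int_cube n. Poly_Mapping.lookup x (n - 1) = 0}) (\<phi> ` equator n)"

definition elementary_subdivision :: "gcell set \<Rightarrow> gcell set \<Rightarrow> bool" where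
  "elementary_subdivision K K' \<longleftrightarrow>
     PLCW K \<and>
     (\<exists>C\<in>K. \<exists>n\<ge>1. \<exists>\<phi> L.
        characteristic_map n \<phi> C \<and> pullback_decomposition K n \<phi> L \<and>
        union_of_cells L (equator n) \<and>
        K' = (K - {C}) \<union> {upper_cell n \<phi>, lower_cell n \<phi>, middle_cell n \<phi>})"

abbreviation elementary_equivalent :: "gcell set \<Rightarrow> gcell set \<Rightarrow> bool"  (infix "\<sim>\<^sub>e" 50) where
  "elementary_equivalent \<equiv> equivclp elementary_subdivision"

end

theory Submission
  imports Defs
begin

text \<open>
  Both complexes have a common iterated elementary subdivision. Call a cell convex if its interior
  is a relatively open convex polytope. If a hyperplane meets the interior of a convex cell but no
  cell of its boundary crosses the hyperplane, then the cell has a characteristic map taking the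
  equator of the cube to the hyperplane, so cutting along the hyperplane is an elementary
  subdivision. Inductively, a complex of convex cells can be cut along any hyperplane, lower
  dimensional cells first.

  To make the cells of a complex convex, take a cell \<open>A\<close> that is not convex while all cells in its
  boundary are. Cut these cells along the images of the hyperplanes that bound the affine pieces of a
  characteristic map of \<open>A\<close>; the pullback decomposition of the boundary of the cube then consists of
  convex cells, and cutting the cube together with it along the same hyperplanes subdivides \<open>A\<close> into
  affine images of convex cells. Finally, cutting two convex decompositions of \<open>X\<close> along all hyperplanes
  that occur in either of them makes them equal: both then consist of the sign classes of these
  hyperplanes in \<open>X\<close>.
\<close>

text \<open>Three obstacles shape the proof. Subdividing one cell changes the pullback
  decompositions of all cells above it, which may run over that cell several times; so complexes are
  handled through a definition that recurses along pullbacks, and several cells of one dimension are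
  subdivided at once. Characteristic maps are neither canonical nor injective on the boundary. Two
  of them for one cell differ by a PL homeomorphism of the cube, so a condition on all of them can
  be checked on one; but because of the gluing the boundary of the cube cannot be cut upstairs. This
  is why the boundary of a nonconvex cell is cut downstairs beforehand, finely enough that no cell
  in the boundary of the cube is crossed later. Finally, an elementary subdivision has to halve a
  cube. For a convex cell and a hyperplane the required map goes between the unit balls of two
  piecewise linear gauges, the maximum norm and the gauge of the cell around a point of the
  hyperplane. Radial rescaling is in general not PL, so it is replaced by a map that is linear on
  the cones of a simplicial fan.\<close>

abbreviation coord :: "point \<Rightarrow> nat \<Rightarrow> real" where
  "coord \<equiv> Poly_Mapping.lookup"

section \<open>Affine maps\<close>

definition aff :: "('a::real_vector \<Rightarrow> 'b::real_vector) \<Rightarrow> bool" where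
  "aff f \<longleftrightarrow> (\<exists>g c. linear g \<and> (\<forall>x. f x = g x + c))"

lemma aff_linear: "linear g \<Longrightarrow> aff g"
  unfolding aff_def by (metis add.right_neutral)

lemma aff_const: "aff (\<lambda>x. c)"
  unfolding aff_def by (rule exI[of _ "\<lambda>x. 0"]) (auto simp: linear_zero)

lemma aff_id: "aff (\<lambda>x. x)"
  by (simp add: aff_linear linear_ident)

lemma aff_add: "aff f \<Longrightarrow> aff g \<Longrightarrow> aff (\<lambda>x. f x + g x)"
  unfolding aff_def
proof clarsimp
  fix g1 c1 g2 c2 assume "linear g1" "linear g2"
    and "\<forall>x. f x = g1 x + c1" "\<forall>x. g x = g2 x + c2"
  then show "\<exists>h. linear h \<and> (\<exists>c. \<forall>x. g1 x + c1 + (g2 x + c2) = h x + c)"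
    by (intro exI[of _ "\<lambda>x. g1 x + g2 x"] conjI linear_compose_add exI[of _ "c1 + c2"]) auto
qed

lemma aff_scaleR: "aff f \<Longrightarrow> aff (\<lambda>x. r *\<^sub>R f x)"
  unfolding aff_def
proof clarsimp
  fix g1 c1 assume "linear g1"
  then show "\<exists>h. linear h \<and> (\<exists>c. \<forall>x. r *\<^sub>R (g1 x + c1) = h x + c)"
    by (intro exI[of _ "\<lambda>x. r *\<^sub>R g1 x"] conjI linear_compose_scale_right exI[of _ "r *\<^sub>R c1"])
      (auto simp: scaleR_add_right)
qed

lemma aff_diff: "aff f \<Longrightarrow> aff g \<Longrightarrow> aff (\<lambda>x. f x - g x)"
  using aff_add[of f "\<lambda>x. (-1) *\<^sub>R g x"] aff_scaleR[of g "-1"] by simp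

lemma aff_mult: "aff (f :: 'a::real_vector \<Rightarrow> real) \<Longrightarrow> aff (\<lambda>x. r * f x)"
  using aff_scaleR[of f r] by simp

lemma aff_divide: "aff (f :: 'a::real_vector \<Rightarrow> real) \<Longrightarrow> aff (\<lambda>x. f x / r)"
  using aff_mult[of f "1/r"] by simp

lemma aff_compose: "aff f \<Longrightarrow> aff g \<Longrightarrow> aff (\<lambda>x. f (g x))"
  unfolding aff_def
proof clarsimp
  fix g1 :: "'a \<Rightarrow> 'b" and c1 and g2 :: "'c \<Rightarrow> 'a" and c2
  assume l: "linear g1" "linear g2"
  then show "\<exists>h. linear h \<and> (\<exists>c. \<forall>x. g1 (g2 x + c2) + c1 = h x + c)"
    by (intro exI[of _ "\<lambda>x. g1 (g2 x)"] conjI linear_compose[OF l(2) l(1), unfolded o_def]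
        exI[of _ "g1 c2 + c1"]) (auto simp: linear_add)
qed

lemma coord_scaleR [simp]: "coord (c *\<^sub>R x) i = c * coord x i"
proof -
  have "finite {i. c *\<^sub>R coord x i \<noteq> 0}"
    by (rule finite_subset[OF _ finite_keys[of x]]) (auto simp: in_keys_iff)
  then show ?thesis by (simp add: scaleR_poly_mapping_def)
qed

lemma linear_coord: "linear (\<lambda>x. coord x i)"
  by (rule linearI) (auto simp: lookup_add)

lemma aff_coord: "aff (\<lambda>x. coord x i)"
  by (simp add: aff_linear linear_coord)

lemma aff_segment:
  assumes "aff f" shows "f (x + t *\<^sub>R (y - x)) = f x + t *\<^sub>R (f y - f x)"
proof -
  from assms obtain g c where g: "linear g" "\<And>x. f x = g x + c" unfolding aff_def by auto
  show ?thesis by (simp add: g(2) linear_add[OF g(1)] linear_scale[OF g(1)] linear_diff[OF g(1)])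
qed

lemma aff_convex_comb:
  assumes "aff f" "u + v = 1" shows "f (u *\<^sub>R x + v *\<^sub>R y) = u *\<^sub>R f x + v *\<^sub>R f y"
proof -
  have u: "u = 1 - v" using assms(2) by simp
  have "u *\<^sub>R x + v *\<^sub>R y = x + v *\<^sub>R (y - x)" unfolding u by (simp add: algebra_simps)
  then show ?thesis unfolding u using aff_segment[OF assms(1), of x v y]
    by (simp add: algebra_simps)
qed

lemma aff_image_convex_hull: assumes "aff f" shows "f ` (convex hull S) = convex hull (f ` S)"
proof -
  from assms obtain g c where g: "linear g" "\<And>x. f x = g x + c" unfolding aff_def by auto
  have f: "f ` T = (+) c ` g ` T" for T by (auto simp: g(2) image_image add.commute)
  show ?thesis by (simp add: f convex_hull_linear_image[OF g(1)] convex_hull_translation)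
qed

lemma polytope_aff_image: "aff f \<Longrightarrow> polytope P \<Longrightarrow> polytope (f ` P)"
  unfolding polytope_def using aff_image_convex_hull by (metis finite_imageI)

lemma convex_aff_vimage: assumes "aff f" "convex S" shows "convex {x. f x \<in> S}"
proof (rule convexI)
  fix x y and u v :: real assume "x \<in> {x. f x \<in> S}" "y \<in> {x. f x \<in> S}" "0 \<le> u" "0 \<le> v" "u + v = 1"
  then show "u *\<^sub>R x + v *\<^sub>R y \<in> {x. f x \<in> S}"
    using assms(2) by (auto simp: aff_convex_comb[OF assms(1)] convex_def)
qed

lemma convex_aff_image: assumes "aff f" "convex S" shows "convex (f ` S)"
  using aff_image_convex_hull[OF assms(1), of S] assms(2) by (metis convex_convex_hull convex_hull_eq)

section \<open>Polytopes\<close>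

text \<open>The point where the segment from \<open>y\<close> to \<open>z\<close> crosses the zero set of \<open>f\<close>.\<close>

definition crossing :: "('a::real_vector \<Rightarrow> real) \<Rightarrow> 'a \<Rightarrow> 'a \<Rightarrow> 'a" where
  "crossing f y z = (f y / (f y - f z)) *\<^sub>R z - (f z / (f y - f z)) *\<^sub>R y"

lemma crossing_aux: "t *\<^sub>R z - (t - 1) *\<^sub>R y = y + t *\<^sub>R (z - (y::'a::real_vector))"
  by (simp add: scaleR_diff_left scaleR_diff_right)

lemma crossing_aux2:
  "y + (r * t) *\<^sub>R (z - y) = (1 - r) *\<^sub>R y + r *\<^sub>R (y + t *\<^sub>R (z - (y::'a::real_vector)))"
  by (simp add: algebra_simps)

lemma crossing_swap: "crossing f y z = crossing f z y"
proof -
  have "f y / (f y - f z) = - (f y / (f z - f y))" "f z / (f z - f y) = - (f z / (f y - f z))"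
    by (metis minus_diff_eq minus_divide_right)+
  then show ?thesis by (simp add: crossing_def)
qed

text \<open>For fixed \<open>z\<close> the map sending \<open>y\<close> to
  \<open>crossing f y z\<close> is the central projection from \<open>z\<close> to the hyperplane
  \<open>f = 0\<close>. It maps segments to segments but changes the weights: \<open>u\<close>
  becomes \<open>u * (f y - f z) / d\<close>.\<close>

lemma crossing_comb:
  assumes f: "aff f" and uv: "0 \<le> u" "0 \<le> v" "u + v = 1"
    and s: "f y > f z" "f y' > f z"
  shows "\<exists>a b. 0 \<le> a \<and> 0 \<le> b \<and> a + b = 1 \<and>
    crossing f (u *\<^sub>R y + v *\<^sub>R y') z = a *\<^sub>R crossing f y z + b *\<^sub>R crossing f y' z"
proof -
  define d where "d = u * (f y - f z) + v * (f y' - f z)"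
  have d: "d > 0"
  proof (cases "u = 0")
    case True then show ?thesis using uv s by (simp add: d_def)
  next
    case False then show ?thesis using uv s unfolding d_def
      by (intro add_pos_nonneg mult_pos_pos mult_nonneg_nonneg) auto
  qed
  have fy: "f (u *\<^sub>R y + v *\<^sub>R y') = u * f y + v * f y'"
    using aff_convex_comb[OF f uv(3)] by simp
  have fd: "u * f y + v * f y' - f z = d"
  proof -
    have "f z = (u + v) * f z" by (simp add: uv(3))
    then show ?thesis unfolding d_def by (simp add: algebra_simps)
  qed
  let ?a = "u * (f y - f z) / d" and ?b = "v * (f y' - f z) / d"
  have 1: "?a *\<^sub>R crossing f y z = (u * f y / d) *\<^sub>R z - (u * f z / d) *\<^sub>R y"
    using s by (simp add: crossing_def scaleR_diff_right)
  have 2: "?b *\<^sub>R crossing f y' z = (v * f y' / d) *\<^sub>R z - (v * f z / d) *\<^sub>R y'"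
    using s by (simp add: crossing_def scaleR_diff_right)
  have "crossing f (u *\<^sub>R y + v *\<^sub>R y') z = ?a *\<^sub>R crossing f y z + ?b *\<^sub>R crossing f y' z"
    unfolding 1 2 by (simp add: crossing_def fy fd scaleR_add_right add_divide_distrib algebra_simps)
  moreover have "?a + ?b = 1" using d by (simp add: d_def flip: add_divide_distrib)
  ultimately show ?thesis using uv s d
    by (intro exI[of _ ?a] exI[of _ ?b]) (auto intro!: divide_nonneg_pos mult_nonneg_nonneg)
qed

text \<open>Generating points of the intersection can be written down: \<open>A\<close> holds those
  of \<open>P\<close> in the half-space, and \<open>W\<close> holds the points where segments from
  \<open>A\<close> to the remaining points \<open>B\<close> meet the hyperplane. The intersection is
  the hull \<open>Q\<close> of both.\<close>

lemma polytope_Int_halfspace: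
  assumes "polytope P" and f: "aff (f :: 'a::real_vector \<Rightarrow> real)"
  shows "polytope (P \<inter> {x. f x \<ge> 0})"
proof -
  obtain V where V: "finite V" "P = convex hull V" using assms(1) unfolding polytope_def by auto
  define A B where "A = {v\<in>V. f v \<ge> 0}" and "B = {v\<in>V. f v < 0}"
  define W where "W = (\<lambda>(u,v). crossing f u v) ` (A \<times> B)"
  define Q where "Q = convex hull (A \<union> W)"
  have fin: "finite (A \<union> W)" using V by (auto simp: A_def B_def W_def)
  have cQ: "convex Q" by (simp add: Q_def)
  have pos: "convex {x. f x \<ge> 0}" using convex_aff_vimage[OF f, of "{0..}"] by simp
  have neg: "convex {x. f x < 0}" using convex_aff_vimage[OF f, of "{..<0}"] by simp
  have hA: "convex hull A \<subseteq> {x. f x \<ge> 0}" by (intro hull_minimal pos) (auto simp: A_def)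
  have hB: "convex hull B \<subseteq> {x. f x < 0}" by (intro hull_minimal neg) (auto simp: B_def)
  have cross_in: "crossing f y z \<in> closed_segment y z \<and> f (crossing f y z) = 0"
    if "f y \<ge> 0" "f z < 0" for y z
  proof -
    let ?t = "f y / (f y - f z)"
    have c: "crossing f y z = y + ?t *\<^sub>R (z - y)"
    proof -
      have "f z / (f y - f z) = ?t - 1" using that by (simp add: field_simps)
      then show ?thesis unfolding crossing_def by (metis (no_types) crossing_aux)
    qed
    have t: "0 \<le> ?t" "?t \<le> 1" using that by (auto simp: field_simps)
    have "y + ?t *\<^sub>R (z - y) = (1 - ?t) *\<^sub>R y + ?t *\<^sub>R z"
      by (simp add: scaleR_diff_left scaleR_diff_right)
    moreover have "f y + ?t * (f z - f y) = 0" using that by (simp add: field_simps)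
    ultimately show ?thesis unfolding c aff_segment[OF f] in_segment using t by auto
  qed
  have QP: "Q \<subseteq> P \<inter> {x. f x \<ge> 0}"
    unfolding Q_def
  proof (rule hull_minimal)
    show "convex (P \<inter> {x. f x \<ge> 0})" by (intro convex_Int pos) (simp add: V)
    have "A \<subseteq> P \<inter> {x. 0 \<le> f x}" using hull_subset[of V convex] by (auto simp: V A_def)
    moreover have "crossing f u v \<in> P \<inter> {x. 0 \<le> f x}" if "u \<in> A" "v \<in> B" for u v
    proof -
      have "u \<in> P" "v \<in> P" using that hull_subset[of V convex] by (auto simp: V A_def B_def)
      then have "closed_segment u v \<subseteq> P" by (simp add: V closed_segment_subset)
      then show ?thesis using cross_in[of u v] that by (auto simp: A_def B_def)
    qed
    ultimately show "A \<union> W \<subseteq> P \<inter> {x. 0 \<le> f x}" by (auto simp: W_def)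
  qed
  \<comment> \<open>The points \<open>y\<close> on the nonnegative side whose projection from
    \<open>v\<close> lies in \<open>Q\<close> form a convex set containing \<open>A\<close>, so the
    hull of \<open>A\<close> may replace \<open>A\<close>. The same argument for the other end point
    gives \<open>step2\<close>.\<close>
  have step1: "crossing f y v \<in> Q" if v: "v \<in> B" and y: "y \<in> convex hull A" for y v
  proof -
    have "convex hull A \<subseteq> {y. f y \<ge> 0 \<and> crossing f y v \<in> Q}"
    proof (rule hull_minimal)
      show "A \<subseteq> {y. f y \<ge> 0 \<and> crossing f y v \<in> Q}"
      proof
        fix y assume y: "y \<in> A"
        then have "crossing f y v \<in> W" using v by (force simp: W_def)
        then show "y \<in> {y. f y \<ge> 0 \<and> crossing f y v \<in> Q}"
          using y hull_subset[of "A \<union> W" convex] unfolding Q_def by (auto simp: A_def)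
      qed
      show "convex {y. f y \<ge> 0 \<and> crossing f y v \<in> Q}"
      proof (rule convexI)
        fix y y' and s t :: real
        assume yy: "y \<in> {y. f y \<ge> 0 \<and> crossing f y v \<in> Q}" "y' \<in> {y. f y \<ge> 0 \<and> crossing f y v \<in> Q}"
          and st: "0 \<le> s" "0 \<le> t" "s + t = 1"
        have fv: "f v < 0" using v by (simp add: B_def)
        have "f y > f v" "f y' > f v" using yy fv by auto
        from crossing_comb[OF f st this] obtain a b where
          "0 \<le> a" "0 \<le> b" "a + b = 1"
          "crossing f (s *\<^sub>R y + t *\<^sub>R y') v = a *\<^sub>R crossing f y v + b *\<^sub>R crossing f y' v" by auto
        then have "crossing f (s *\<^sub>R y + t *\<^sub>R y') v \<in> Q"
          using yy cQ by (auto simp: convex_def)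
        moreover have "s *\<^sub>R y + t *\<^sub>R y' \<in> {x. f x \<ge> 0}"
          using pos yy st by (auto simp: convex_def)
        ultimately show "s *\<^sub>R y + t *\<^sub>R y' \<in> {y. f y \<ge> 0 \<and> crossing f y v \<in> Q}" by auto
      qed
    qed
    then show ?thesis using y by auto
  qed
  have step2: "crossing f y z \<in> Q" if z: "z \<in> convex hull B" and y: "y \<in> convex hull A" for y z
  proof -
    have fy: "f y \<ge> 0" using y hA by auto
    have "convex hull B \<subseteq> {z. f z < 0 \<and> crossing f y z \<in> Q}"
    proof (rule hull_minimal)
      show "B \<subseteq> {z. f z < 0 \<and> crossing f y z \<in> Q}"
        using step1 y by (auto simp: B_def)
      show "convex {z. f z < 0 \<and> crossing f y z \<in> Q}"
      proof (rule convexI)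
        fix z z' and s t :: real
        assume zz: "z \<in> {z. f z < 0 \<and> crossing f y z \<in> Q}" "z' \<in> {z. f z < 0 \<and> crossing f y z \<in> Q}"
          and st: "0 \<le> s" "0 \<le> t" "s + t = 1"
        \<comment> \<open>\<open>crossing\<close> does not change when \<open>f\<close> is replaced
          by its negative, and this exchanges the roles of the two end points in
          \<open>crossing_comb\<close>.\<close>
        let ?f = "\<lambda>x. - f x"
        have nf: "aff ?f" using aff_mult[OF f, of "-1"] by simp
        have cn: "crossing ?f a b = crossing f a b" for a b
          by (simp only: crossing_def minus_diff_minus minus_divide_divide)
        have "?f z > ?f y" "?f z' > ?f y" using zz fy by auto
        from crossing_comb[OF nf st this] obtain a b where
          "0 \<le> a" "0 \<le> b" "a + b = 1"
          "crossing f (s *\<^sub>R z + t *\<^sub>R z') y = a *\<^sub>R crossing f z y + b *\<^sub>R crossing f z' y"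
          unfolding cn by auto
        then have "crossing f y (s *\<^sub>R z + t *\<^sub>R z') \<in> Q"
          using zz cQ by (auto simp: convex_def crossing_swap[of f y])
        moreover have "s *\<^sub>R z + t *\<^sub>R z' \<in> {x. f x < 0}"
          using neg zz st by (auto simp: convex_def)
        ultimately show "s *\<^sub>R z + t *\<^sub>R z' \<in> {z. f z < 0 \<and> crossing f y z \<in> Q}" by auto
      qed
    qed
    then show ?thesis using z by auto
  qed
  have "x \<in> Q" if x: "x \<in> P" "f x \<ge> 0" for x
  proof -
    have "A \<union> B = V" by (auto simp: A_def B_def)
    then have PAB: "P = convex hull (A \<union> B)" using V by simp
    show ?thesis
    proof (cases "B = {}")
      case True
      then have "x \<in> convex hull A" using x PAB by simp
      then show ?thesis using hull_mono[of A "A \<union> W" convex] unfolding Q_def by blast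
    next
      case nB: False
      show ?thesis
      proof (cases "A = {}")
        case True
        have "P \<subseteq> {x. f x < 0}"
          unfolding PAB True by (intro hull_minimal neg) (auto simp: B_def)
        then show ?thesis using x by auto
      next
        case nA: False
        \<comment> \<open>\<open>P\<close> is the join of the two hulls: every point lies on a
          segment from the hull of \<open>A\<close> to the hull of \<open>B\<close>. A point with
          \<open>f x \<ge> 0\<close> comes no later than the crossing point, and up to there the
          segment runs inside \<open>Q\<close>.\<close>
        have "\<exists>y\<in>convex hull A. \<exists>z\<in>convex hull B. \<exists>s. 0 \<le> s \<and> s \<le> 1 \<and> x = y + s *\<^sub>R (z - y)"
        proof -
          have "convex hull (A \<union> B) \<subseteq> {x. \<exists>y\<in>convex hull A. \<exists>z\<in>convex hull B. \<exists>s. 0 \<le> s \<and> s \<le> 1 \<and> x = y + s *\<^sub>R (z - y)}"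
            (is "_ \<subseteq> ?S")
          proof (rule hull_minimal)
            obtain a0 b0 where ab: "a0 \<in> A" "b0 \<in> B" using nA nB by auto
            have ab': "a0 \<in> convex hull A" "b0 \<in> convex hull B" using ab by (auto simp: hull_inc)
            show "A \<union> B \<subseteq> ?S"
            proof safe
              fix x assume "x \<in> A"
              then show "\<exists>y\<in>convex hull A. \<exists>z\<in>convex hull B. \<exists>s\<ge>0. s \<le> 1 \<and> x = y + s *\<^sub>R (z - y)"
                using ab'(2) by (intro bexI[of _ x] bexI[of _ b0] exI[of _ 0]) (auto simp: hull_inc)
            next
              fix x assume "x \<in> B"
              then show "\<exists>y\<in>convex hull A. \<exists>z\<in>convex hull B. \<exists>s\<ge>0. s \<le> 1 \<and> x = y + s *\<^sub>R (z - y)"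
                using ab'(1) by (intro bexI[of _ a0] bexI[of _ x] exI[of _ 1]) (auto simp: hull_inc)
            qed
            show "convex ?S"
            proof -
              show ?thesis
              proof (rule convexI)
                fix p q and u v :: real assume "p \<in> ?S" "q \<in> ?S" and uv: "0 \<le> u" "0 \<le> v" "u + v = 1"
                then obtain y y' :: 'a and z z' :: 'a and s s' :: real where
                  1: "y \<in> convex hull A" "z \<in> convex hull B" "0 \<le> s" "s \<le> 1" "p = y + s *\<^sub>R (z - y)" and
                  2: "y' \<in> convex hull A" "z' \<in> convex hull B" "0 \<le> s'" "s' \<le> 1" "q = y' + s' *\<^sub>R (z' - y')"
                  by auto
                define r where "r = u * s + v * s'"
                have r: "0 \<le> r" "r \<le> 1"
                  using uv 1 2 convex_bound_le[of s 1 s' u v] by (auto simp: r_def)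
                have r': "1 - r = u * (1 - s) + v * (1 - s')" using uv(3) by (auto simp: r_def algebra_simps)
                have ex: "\<exists>w\<in>convex hull C. (a + b) *\<^sub>R w = a *\<^sub>R c + b *\<^sub>R c'"
                  if "c \<in> convex hull C" "c' \<in> convex hull C" "0 \<le> a" "0 \<le> b" for a b c c' and C :: "'a set"
                proof (cases "a + b = 0")
                  case True
                  then have "a = 0" "b = 0" using that add_nonneg_eq_0_iff[of a b] by auto
                  then show ?thesis using that(1) by auto
                next
                  case False
                  have "(a/(a+b)) *\<^sub>R c + (b/(a+b)) *\<^sub>R c' \<in> convex hull C"
                    using that False by (intro convexD) (auto simp flip: add_divide_distrib)
                  then show ?thesis using False by (intro bexI) (auto simp: scaleR_add_right)
                qed
                obtain w where w: "w \<in> convex hull A" "(1 - r) *\<^sub>R w = (u * (1 - s)) *\<^sub>R y + (v * (1 - s')) *\<^sub>R y'"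
                  using ex[OF 1(1) 2(1), of "u * (1 - s)" "v * (1 - s')"] 1 2 uv unfolding r' by auto
                obtain w' where w': "w' \<in> convex hull B" "r *\<^sub>R w' = (u * s) *\<^sub>R z + (v * s') *\<^sub>R z'"
                  using ex[OF 1(2) 2(2), of "u * s" "v * s'"] 1 2 uv unfolding r_def by auto
                have "u *\<^sub>R p + v *\<^sub>R q = (1 - r) *\<^sub>R w + r *\<^sub>R w'"
                  unfolding w w' 1 2 by (simp add: algebra_simps)
                also have "\<dots> = w + r *\<^sub>R (w' - w)" by (simp add: algebra_simps)
                finally show "u *\<^sub>R p + v *\<^sub>R q \<in> ?S" using w(1) w'(1) r by blast
              qed
            qed
          qed
          then show ?thesis using x PAB by auto
        qed
        then obtain y z s where yz: "y \<in> convex hull A" "z \<in> convex hull B" "0 \<le> s" "s \<le> 1"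
          "x = y + s *\<^sub>R (z - y)" by auto
        have fy: "f y \<ge> 0" using yz(1) hA by auto
        have fz: "f z < 0" using yz(2) hB by auto
        have yQ: "y \<in> Q" using yz(1) hull_mono[of A "A \<union> W" convex] unfolding Q_def by blast
        let ?t = "f y / (f y - f z)"
        have fx: "f x = f y + s * (f z - f y)" using aff_segment[OF f, of y s z] yz by simp
        have st: "s \<le> ?t" using x fx fy fz by (simp add: field_simps)
        have c: "crossing f y z = y + ?t *\<^sub>R (z - y)"
        proof -
          have "f z / (f y - f z) = ?t - 1" using fy fz by (simp add: field_simps)
          then show ?thesis unfolding crossing_def by (metis (no_types) crossing_aux)
        qed
        show ?thesis
        proof (cases "?t = 0")
          case True
          then have "s = 0" using st yz(3) by linarith
          then show ?thesis using yz(5) yQ by simp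
        next
          case False
          have "f y \<noteq> 0" using False by auto
          then have t0: "?t > 0" using fy fz by (intro divide_pos_pos) linarith+
          have tt: "s / ?t * ?t = s" using t0 by (simp only: times_divide_eq_left nonzero_mult_div_cancel_right less_imp_neq[symmetric] not_False_eq_True)
          have xe: "x = (1 - s / ?t) *\<^sub>R y + (s / ?t) *\<^sub>R crossing f y z"
            using yz(5) crossing_aux2[of y "s / ?t" ?t z] unfolding c tt by (rule trans)
          have "0 \<le> s / ?t" using yz(3) t0 by (rule divide_nonneg_pos)
          moreover have "s / ?t \<le> 1" using st t0 by (simp only: divide_le_eq_1_pos)
          ultimately show ?thesis unfolding xe
            by (intro convexD[OF cQ yQ step2[OF yz(2,1)]]) linarith+
        qed
      qed
    qed
  qed
  then have "P \<inter> {x. f x \<ge> 0} = Q" using QP by auto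
  then show ?thesis using fin unfolding polytope_def Q_def by auto
qed

lemma polytope_Int_halfspaces:
  assumes "finite S" "polytope P" "\<And>f. f \<in> S \<Longrightarrow> aff (f :: 'a::real_vector \<Rightarrow> real)"
  shows "polytope {x\<in>P. \<forall>f\<in>S. f x \<ge> 0}"
  using assms
proof (induction S rule: finite_induct)
  case empty then show ?case by simp
next
  case (insert f S)
  have eq: "{x\<in>P. \<forall>g\<in>insert f S. g x \<ge> 0} = {x\<in>P. \<forall>g\<in>S. g x \<ge> 0} \<inter> {x. f x \<ge> 0}" by auto
  have "polytope {x\<in>P. \<forall>g\<in>S. g x \<ge> 0}" using insert by blast
  then show ?case unfolding eq using insert.prems(2)[OF insertI1] by (rule polytope_Int_halfspace)
qed

lemma aff_translate:
  assumes "aff f" shows "f (x + t *\<^sub>R (y - z)) = f x + t *\<^sub>R (f y - f z)"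
proof -
  from assms obtain g c where g: "linear g" "\<And>x. f x = g x + c" unfolding aff_def by auto
  show ?thesis by (simp add: g(2) linear_add[OF g(1)] linear_scale[OF g(1)] linear_diff[OF g(1)])
qed

section \<open>Coordinates in the finite-dimensional subspaces\<close>

lemma Rn_iff: "x \<in> Rn n \<longleftrightarrow> (\<forall>i\<ge>n. coord x i = 0)"
  unfolding Rn_def by (auto simp: in_keys_iff not_less[symmetric])

lemma subspace_Rn: "subspace (Rn n)"
  by (auto simp: subspace_def Rn_iff lookup_add)

lemma convex_Rn: "convex (Rn n)"
  using subspace_Rn subspace_imp_convex by blast

lemma Rn_mono: "m \<le> n \<Longrightarrow> Rn m \<subseteq> Rn n"
  by (auto simp: Rn_iff)

lemma Rn_0 [simp]: "0 \<in> Rn n"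
  by (simp add: Rn_iff)

lemma Rn_add: "x \<in> Rn n \<Longrightarrow> y \<in> Rn n \<Longrightarrow> x + y \<in> Rn n"
  and Rn_diff: "x \<in> Rn n \<Longrightarrow> y \<in> Rn n \<Longrightarrow> x - y \<in> Rn n"
  and Rn_scaleR: "x \<in> Rn n \<Longrightarrow> c *\<^sub>R x \<in> Rn n"
  by (auto simp: Rn_iff lookup_add lookup_minus)

lemma finite_subset_Rn: "finite V \<Longrightarrow> \<exists>n. V \<subseteq> Rn n"
proof (induction V rule: finite_induct)
  case (insert v V)
  then obtain n where n: "V \<subseteq> Rn n" by auto
  have "\<exists>m. \<forall>i\<in>Poly_Mapping.keys v. i < m"
    using Poly_Mapping.finite_keys[of v] unfolding finite_nat_set_iff_bounded .
  then obtain m where "\<forall>i\<in>Poly_Mapping.keys v. i < m" ..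
  then have "v \<in> Rn m" unfolding Rn_def by auto
  then have "insert v V \<subseteq> Rn (max m n)" using n Rn_mono[of m "max m n"] Rn_mono[of n "max m n"] by auto
  then show ?case by blast
qed auto

lemma polytope_subset_Rn: assumes "polytope P" shows "\<exists>n. P \<subseteq> Rn n"
proof -
  obtain V where V: "finite V" "P = convex hull V" using assms unfolding polytope_def by auto
  obtain n where n: "V \<subseteq> Rn n" using finite_subset_Rn V by blast
  have "P \<subseteq> Rn n" unfolding V by (intro hull_minimal n convex_Rn)
  then show ?thesis by blast
qed

definition unit :: "nat \<Rightarrow> point" where
  "unit i = Poly_Mapping.single i 1"

lemma coord_unit: "coord (unit i) j = (if i = j then 1 else 0)"
  by (simp add: unit_def lookup_single)

lemma unit_in_Rn: "i < n \<Longrightarrow> unit i \<in> Rn n"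
  by (auto simp: Rn_iff coord_unit)

lemma Rn_expand: assumes "x \<in> Rn n" shows "x = (\<Sum>i<n. coord x i *\<^sub>R unit i)"
proof (rule poly_mapping_eqI)
  fix k
  have "coord (\<Sum>i<n. coord x i *\<^sub>R unit i) k = (\<Sum>i<n. if i = k then coord x k else 0)"
    unfolding lookup_sum by (rule sum.cong) (auto simp: coord_unit)
  then show "coord x k = coord (\<Sum>i<n. coord x i *\<^sub>R unit i) k"
    using assms by (auto simp: Rn_iff)
qed

lemma linear_expand: "linear g \<Longrightarrow> x \<in> Rn n \<Longrightarrow> g x = (\<Sum>i<n. coord x i *\<^sub>R g (unit i))"
  by (subst Rn_expand[of x n]) (simp_all add: linear_sum linear_scale)

lemma aff_maps_Rn: assumes "aff a" shows "\<exists>m. a ` Rn n \<subseteq> Rn m"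
proof -
  from assms obtain g c where g: "linear g" "\<And>x. a x = g x + c" unfolding aff_def by auto
  obtain m where m: "insert c ((\<lambda>i. g (unit i)) ` {..<n}) \<subseteq> Rn m"
    using finite_subset_Rn[of "insert c ((\<lambda>i. g (unit i)) ` {..<n})"] by auto
  have "a x \<in> Rn m" if "x \<in> Rn n" for x
    unfolding g(2) linear_expand[OF g(1) that] using m
    by (intro Rn_add subspace_sum[OF subspace_Rn] Rn_scaleR) auto
  then show ?thesis by blast
qed

subsection \<open>Continuity\<close>

lemma coord_le_norm: "\<bar>coord x i\<bar> \<le> norm x"
proof (cases "i \<in> Poly_Mapping.keys x")
  case True
  have "\<bar>coord x i\<bar> \<le> (\<Sum>j\<in>Poly_Mapping.keys x. \<bar>coord x j\<bar>)"
    by (rule member_le_sum[OF True _ Poly_Mapping.finite_keys]) simp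
  then show ?thesis by (simp add: norm_poly_mapping_def dist_poly_mapping_def)
qed (simp add: in_keys_iff)

lemma continuous_on_coord: "continuous_on S (\<lambda>x. coord x i)"
proof -
  have "bounded_linear (\<lambda>x. coord x i)"
    by (rule bounded_linear_intro[of _ 1]) (auto simp: lookup_add coord_le_norm)
  then show ?thesis by (rule bounded_linear.continuous_on[OF _ continuous_on_id])
qed

text \<open>A linear map on the whole infinite-dimensional space need not be continuous. On
  \<open>Rn n\<close> it is determined by the images of finitely many unit vectors, and their norms
  add up to a Lipschitz constant because each coordinate is bounded by the norm.\<close>

lemma aff_lipschitz:
  fixes a :: "point \<Rightarrow> 'b::real_normed_vector"
  assumes "aff a"
  shows "\<exists>M\<ge>0. \<forall>x\<in>Rn n. \<forall>y\<in>Rn n. norm (a x - a y) \<le> M * norm (x - y)"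
proof -
  from assms obtain g c where g: "linear g" "\<And>x. a x = g x + c" unfolding aff_def by auto
  have "norm (a x - a y) \<le> (\<Sum>i<n. norm (g (unit i))) * norm (x - y)"
    if "x \<in> Rn n" "y \<in> Rn n" for x y
  proof -
    have "a x - a y = g (x - y)" by (simp add: g(2) linear_diff[OF g(1)])
    also have "\<dots> = (\<Sum>i<n. coord (x - y) i *\<^sub>R g (unit i))"
      by (rule linear_expand[OF g(1)]) (simp add: that Rn_diff)
    also have "norm \<dots> \<le> (\<Sum>i<n. norm (g (unit i)) * norm (x - y))"
      by (rule sum_norm_le) (auto simp: mult.commute[of "norm (g _)"] intro!: mult_right_mono coord_le_norm)
    finally show ?thesis by (simp add: sum_distrib_right)
  qed
  then show ?thesis by (intro exI[of _ "\<Sum>i<n. norm (g (unit i))"]) (auto intro: sum_nonneg)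
qed

lemma continuous_on_aff:
  fixes a :: "point \<Rightarrow> 'b::real_normed_vector"
  assumes "aff a" "S \<subseteq> Rn n" shows "continuous_on S a"
proof -
  obtain M where M: "M \<ge> 0" "\<And>x y. x\<in>Rn n \<Longrightarrow> y\<in>Rn n \<Longrightarrow> norm (a x - a y) \<le> M * norm (x - y)"
    using aff_lipschitz[OF assms(1), of n] by blast
  have "M-lipschitz_on S a"
    using M assms(2) by (intro lipschitz_onI) (auto simp: dist_norm subset_iff)
  then show ?thesis by (rule lipschitz_on_continuous_on)
qed

subsection \<open>Halfspace representations\<close>

text \<open>\<open>Rn n\<close> is part of the definition because finitely many affine functionals
  cannot cut a nonempty bounded set out of the infinite-dimensional space.\<close>

definition hset :: "nat \<Rightarrow> (point \<Rightarrow> real) set \<Rightarrow> point set" where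
  "hset n S = {x \<in> Rn n. \<forall>f\<in>S. f x \<ge> 0}"

text \<open>Elimination of the variable \<open>t\<close>: inequalities with positive coefficient
  bound it from above, those with negative coefficient from below, and those without
  \<open>t\<close> remain. A solution exists if every lower bound is at most every upper bound. The
  inequality \<open>c0\<close> supplies an upper bound, so the least one can be taken for
  \<open>t\<close>.\<close>

lemma fourier_motzkin:
  fixes C :: "(real \<times> real) set"
  assumes C: "finite C" "c0 \<in> C" "snd c0 > 0"
  shows "(\<exists>t. \<forall>c\<in>C. t * snd c \<le> fst c) \<longleftrightarrow>
    (\<forall>c\<in>C. snd c = 0 \<longrightarrow> 0 \<le> fst c) \<and>
    (\<forall>c\<in>C. \<forall>d\<in>C. snd c > 0 \<longrightarrow> snd d < 0 \<longrightarrow> fst d / snd d \<le> fst c / snd c)"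
    (is "?L \<longleftrightarrow> ?R1 \<and> ?R2")
proof
  assume ?L
  then obtain t where t: "\<And>c. c \<in> C \<Longrightarrow> t * snd c \<le> fst c" by auto
  have "fst d / snd d \<le> fst c / snd c" if "c \<in> C" "d \<in> C" "snd c > 0" "snd d < 0" for c d
  proof -
    have "fst d / snd d \<le> t" using t[OF that(2)] that(4) by (simp add: neg_divide_le_eq)
    also have "t \<le> fst c / snd c" using t[OF that(1)] that(3) by (simp add: pos_le_divide_eq)
    finally show ?thesis .
  qed
  moreover have "0 \<le> fst c" if "c \<in> C" "snd c = 0" for c using t[OF that(1)] that(2) by simp
  ultimately show "?R1 \<and> ?R2" by blast
next
  assume R: "?R1 \<and> ?R2"
  define M where "M = (\<lambda>c. fst c / snd c) ` {c\<in>C. snd c > 0}"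
  have M: "finite M" "M \<noteq> {}" unfolding M_def using C by (blast intro: finite_imageI finite_subset)+
  have "Min M * snd c \<le> fst c" if "c \<in> C" for c
  proof (cases "snd c" "0::real" rule: linorder_cases)
    case less
    obtain d where d: "d \<in> C" "snd d > 0" "Min M = fst d / snd d" using Min_in[OF M] by (auto simp: M_def)
    then have "fst c / snd c \<le> Min M" using R that less by auto
    then show ?thesis using less by (simp add: neg_divide_le_eq)
  next
    case equal then show ?thesis using R that by auto
  next
    case greater
    then have "Min M \<le> fst c / snd c" using M that by (auto simp: M_def)
    then show ?thesis using greater by (simp add: pos_le_divide_eq)
  qed
  then show ?L by blast
qed

lemma convex_hset: assumes "\<And>f. f \<in> S \<Longrightarrow> aff f" shows "convex (hset n S)"
proof -
  have "hset n S = Rn n \<inter> (\<Inter>f\<in>S. {x. f x \<in> {0..}})" by (auto simp: hset_def)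
  then show ?thesis using convex_aff_vimage[of _ "{0::real..}"] assms convex_Rn
    by (auto intro!: convex_Int convex_INT)
qed

text \<open>For \<open>t < 1\<close> the equation \<open>x = t v + (1 - t) b\<close> determines
  \<open>b\<close>, and \<open>b\<close> satisfies the inequalities exactly if
  \<open>t * f v \<le> f x\<close> for all \<open>f\<close>. For \<open>t = 1\<close> they say that
  the polyhedron contains rays in the direction \<open>x - v\<close>, and boundedness forces
  \<open>x = v\<close>.\<close>

lemma hull_insert_hset_iff:
  assumes S: "\<And>f. f \<in> S \<Longrightarrow> aff f" and v: "v \<in> Rn n"
    and P: "hset n S \<noteq> {}" "bounded (hset n S)"
  shows "x \<in> convex hull (insert v (hset n S)) \<longleftrightarrow>
    x \<in> Rn n \<and> (\<exists>t. 0 \<le> t \<and> t \<le> 1 \<and> (\<forall>f\<in>S. t * f v \<le> f x))" (is "?L \<longleftrightarrow> ?R")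
proof
  have hP: "convex hull (hset n S) = hset n S" using convex_hset[OF S] by (simp add: convex_hull_eq)
  {
    assume ?L
    then obtain t u b where h: "0 \<le> t" "0 \<le> u" "t + u = 1" "b \<in> hset n S" "x = t *\<^sub>R v + u *\<^sub>R b"
      unfolding convex_hull_insert[OF P(1)] hP by auto
    have "x \<in> Rn n" unfolding h using v h(4) by (auto simp: hset_def intro: Rn_add Rn_scaleR)
    moreover have "t * f v \<le> f x" if "f \<in> S" for f
    proof -
      have "f x = t * f v + u * f b" unfolding h using aff_convex_comb[OF S[OF that] h(3)] by simp
      then show ?thesis using h that by (auto simp: hset_def)
    qed
    ultimately show ?R using h by auto
  }
  assume ?R
  then obtain t where x: "x \<in> Rn n" and t: "0 \<le> t" "t \<le> 1" "\<And>f. f \<in> S \<Longrightarrow> t * f v \<le> f x" by auto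
  show ?L
  proof (cases "t = 1")
    case True
    obtain y where y: "y \<in> hset n S" using P by auto
    obtain B where B: "\<And>z. z \<in> hset n S \<Longrightarrow> norm z \<le> B" using P(2) by (auto simp: bounded_iff)
    have ray: "y + s *\<^sub>R (x - v) \<in> hset n S" if "s \<ge> 0" for s
    proof -
      have "f (y + s *\<^sub>R (x - v)) \<ge> 0" if "f \<in> S" for f
        unfolding aff_translate[OF S[OF that]] using y \<open>s \<ge> 0\<close> t(3)[OF that] that True
        by (auto simp: hset_def)
      then show ?thesis using x v y by (auto simp: hset_def intro: Rn_add Rn_scaleR Rn_diff)
    qed
    have "x = v"
    proof (rule ccontr)
      assume "x \<noteq> v"
      then have p: "norm (x - v) > 0" by simp
      define s where "s = (\<bar>B\<bar> + norm y + 1) / norm (x - v)"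
      have s: "s \<ge> 0" by (simp add: s_def)
      have "norm (s *\<^sub>R (x - v)) = s * norm (x - v)" using s by simp
      also have "\<dots> = \<bar>B\<bar> + norm y + 1" unfolding s_def using p by (rule nonzero_eq_divide_eq[THEN iffD1, OF less_imp_neq[THEN not_sym]]) simp
      finally have "norm (s *\<^sub>R (x - v)) = \<bar>B\<bar> + norm y + 1" .
      moreover have "norm (s *\<^sub>R (x - v)) \<le> norm (y + s *\<^sub>R (x - v)) + norm y"
        by (metis add_diff_cancel_left' norm_triangle_ineq4)
      ultimately show False using B[OF ray[OF s]] by linarith
    qed
    then show ?thesis by (simp add: hull_inc)
  next
    case False
    then have t1: "t < 1" using t by simp
    define b where "b = x + (t / (1 - t)) *\<^sub>R (x - v)"
    have "f b \<ge> 0" if "f \<in> S" for f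
    proof -
      have "f b = f x + (t / (1 - t)) * (f x - f v)" unfolding b_def aff_translate[OF S[OF that]] by simp
      also have "\<dots> = (f x - t * f v) / (1 - t)" using t1 by (simp add: field_simps)
      finally show ?thesis using t(3)[OF that] t1 by simp
    qed
    then have b: "b \<in> hset n S" using x v by (auto simp: hset_def b_def intro: Rn_add Rn_scaleR Rn_diff)
    have "(1 - t) *\<^sub>R b = (1 - t) *\<^sub>R x + t *\<^sub>R (x - v)"
      unfolding b_def scaleR_add_right using t1 by simp
    then have "x = t *\<^sub>R v + (1 - t) *\<^sub>R b" by (simp add: algebra_simps)
    moreover have "b \<in> convex hull (insert v (hset n S))" "v \<in> convex hull (insert v (hset n S))"
      using b by (auto simp: hull_inc)
    moreover have "0 \<le> 1 - t" "t + (1 - t) = 1" using t1 by auto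
    ultimately show ?thesis using convexD[OF convex_convex_hull _ _ t(1), of v _ b "1 - t"] by simp
  qed
qed

lemma hrep_insert:
  assumes S: "finite S" "\<And>f. f \<in> S \<Longrightarrow> aff f" and v: "v \<in> Rn n"
    and P: "hset n S \<noteq> {}" "bounded (hset n S)"
  shows "\<exists>S'. finite S' \<and> (\<forall>f\<in>S'. aff f) \<and> convex hull (insert v (hset n S)) = hset n S'"
proof -
  \<comment> \<open>A pair \<open>(g, s)\<close> stands for the inequality
    \<open>t * s \<le> g x\<close>. The two extra pairs encode \<open>0 \<le> t\<close> and
    \<open>t \<le> 1\<close>; the second is the upper bound required by the elimination.
    \<open>S'\<close> is the resulting system.\<close>
  define T where "T = insert ((\<lambda>x. 0), -1) (insert ((\<lambda>x. 1), 1) ((\<lambda>f. (f, f v)) ` S))"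
  define S' where "S' = fst ` {c\<in>T. snd c = 0} \<union>
    (\<Union>c\<in>{c\<in>T. snd c > 0}. (\<lambda>d x. fst c x / snd c - fst d x / snd d) ` {d\<in>T. snd d < 0})"
  have fT: "finite T" using S by (auto simp: T_def)
  then have fS': "finite S'" by (auto simp: S'_def)
  have aT: "aff (fst c)" if "c \<in> T" for c using that S by (auto simp: T_def aff_const)
  have aS': "\<forall>f\<in>S'. aff f"
    unfolding S'_def by (safe intro!: aff_diff aff_divide) (auto dest: aT)
  have eq: "(\<exists>t. 0 \<le> t \<and> t \<le> 1 \<and> (\<forall>f\<in>S. t * f v \<le> f x)) \<longleftrightarrow> (\<forall>f\<in>S'. f x \<ge> 0)" for x
  proof -
    let ?C = "(\<lambda>c. (fst c x, snd c)) ` T"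
    have "(\<exists>t. 0 \<le> t \<and> t \<le> 1 \<and> (\<forall>f\<in>S. t * f v \<le> f x)) \<longleftrightarrow> (\<exists>t. \<forall>c\<in>?C. t * snd c \<le> fst c)"
      by (auto simp: T_def)
    also have "\<dots> \<longleftrightarrow> (\<forall>c\<in>?C. snd c = 0 \<longrightarrow> 0 \<le> fst c) \<and>
      (\<forall>c\<in>?C. \<forall>d\<in>?C. snd c > 0 \<longrightarrow> snd d < 0 \<longrightarrow> fst d / snd d \<le> fst c / snd c)"
      by (rule fourier_motzkin[where ?c0.0 = "(1,1)"]) (use fT in \<open>auto simp: T_def image_iff\<close>)
    also have "\<dots> \<longleftrightarrow> (\<forall>f\<in>S'. f x \<ge> 0)"
    proof -
      have a: "(\<forall>c\<in>{c\<in>T. P c}. \<forall>d\<in>{d\<in>T. Q d}. R c d) \<longleftrightarrow> (\<forall>c\<in>T. \<forall>d\<in>T. P c \<longrightarrow> Q d \<longrightarrow> R c d)"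
        and b: "(\<forall>c\<in>{c\<in>T. P c}. Q c) \<longleftrightarrow> (\<forall>c\<in>T. P c \<longrightarrow> Q c)" for P Q R
        by blast+
      show ?thesis
        unfolding S'_def ball_Un ball_UN ball_simps(9) a b fst_conv snd_conv diff_ge_0_iff_ge by blast
    qed
    finally show ?thesis .
  qed
  have "convex hull (insert v (hset n S)) = hset n S'"
    using hull_insert_hset_iff[OF S(2) v P] eq unfolding hset_def by blast
  then show ?thesis using fS' aS' by blast
qed

text \<open>The generating points are added one by one, and each addition takes the hull of a point
  and a bounded nonempty polyhedron. The induction really starts with a single point, which is
  described by its coordinates.\<close>

lemma polytope_hrep:
  assumes "polytope P" "P \<subseteq> Rn n"
  shows "\<exists>S. finite S \<and> (\<forall>f\<in>S. aff f) \<and> P = hset n S"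
proof -
  obtain V where V: "finite V" "P = convex hull V" using assms unfolding polytope_def by auto
  have "V \<subseteq> Rn n" using assms(2) V hull_subset[of V convex] by auto
  with V(1) have "\<exists>S. finite S \<and> (\<forall>f\<in>S. aff f) \<and> convex hull V = hset n S"
  proof (induction V rule: finite_induct)
    case empty
    show ?case by (rule exI[of _ "{\<lambda>x. -1}"]) (auto simp: hset_def aff_const)
  next
    case (insert v V)
    then obtain S where S: "finite S" "\<And>f. f \<in> S \<Longrightarrow> aff f" "convex hull V = hset n S" by auto
    show ?case
    proof (cases "V = {}")
      case True
      let ?S = "(\<lambda>i x. coord x i - coord v i) ` {..<n} \<union> (\<lambda>i x. coord v i - coord x i) ` {..<n}"
      have vn: "v \<in> Rn n" using insert.prems by simp
      have iff: "x \<in> hset n ?S \<longleftrightarrow> x \<in> Rn n \<and> (\<forall>i\<in>{..<n}. 0 \<le> coord x i - coord v i) \<and>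
          (\<forall>i\<in>{..<n}. 0 \<le> coord v i - coord x i)" for x
        unfolding hset_def mem_Collect_eq ball_Un ball_simps(9) by (rule refl)
      have xv: "x = v" if x: "x \<in> hset n ?S" for x
      proof (rule poly_mapping_eqI)
        fix i
        show "coord x i = coord v i"
        proof (cases "i < n")
          case True
          then have "coord x i - coord v i \<ge> 0" "coord v i - coord x i \<ge> 0"
            using x unfolding iff by blast+
          then show ?thesis by linarith
        next
          case False
          have "x \<in> Rn n" using x unfolding iff by blast
          then show ?thesis using False vn by (simp add: Rn_iff)
        qed
      qed
      have "v \<in> hset n ?S" unfolding iff using vn by simp
      then have e1: "{v} = hset n ?S" using xv by blast
      have e2: "\<forall>f\<in>?S. aff f" unfolding ball_Un ball_simps(9)
        by (intro conjI ballI aff_diff aff_coord aff_const)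
      have e3: "finite ?S" by simp
      have "convex hull (insert v V) = {v}" unfolding True by simp
      then show ?thesis unfolding e1 using e2 e3 by (intro exI[of _ ?S] conjI)
    next
      case False
      have "bounded (convex hull V)" using insert.hyps(1) by (simp add: finite_imp_bounded_convex_hull)
      then have b: "bounded (hset n S)" "hset n S \<noteq> {}" using S(3) False by auto
      have "convex hull (insert v V) = convex hull (insert v (convex hull V))"
        by (rule hull_insert)
      then show ?thesis
        using hrep_insert[OF S(1,2) _ b(2,1), of v] insert.prems unfolding S(3) by auto
    qed
  qed
  then show ?thesis using V by simp
qed

text \<open>Preimages are immediate for half-spaces but not for hulls, so \<open>Q\<close> is taken
  in half-space form and \<open>P\<close> in vertex form. Intersections of polytopes and
  compositions of PL maps rest on this.\<close>

lemma polytope_preimage: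
  assumes P: "polytope P" and Q: "polytope Q" and a: "aff (a :: point \<Rightarrow> point)"
  shows "polytope {x\<in>P. a x \<in> Q}"
proof -
  obtain k where "P \<subseteq> Rn k" using polytope_subset_Rn[OF P] by auto
  obtain n where n: "a ` P \<union> Q \<subseteq> Rn n"
  proof -
    obtain n1 n2 where "a ` P \<subseteq> Rn n1" "Q \<subseteq> Rn n2"
      using polytope_subset_Rn[OF polytope_aff_image[OF a P]] polytope_subset_Rn[OF Q] by auto
    then have "a ` P \<union> Q \<subseteq> Rn (max n1 n2)"
      using Rn_mono[of n1 "max n1 n2"] Rn_mono[of n2 "max n1 n2"] by auto
    then show ?thesis using that by blast
  qed
  then obtain S where S: "finite S" "\<forall>f\<in>S. aff f" "Q = hset n S" using polytope_hrep[OF Q] by auto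
  have "{x\<in>P. a x \<in> Q} = {x\<in>P. \<forall>f\<in>(\<lambda>f x. f (a x)) ` S. f x \<ge> 0}"
    using n by (auto simp: S(3) hset_def)
  moreover have "polytope \<dots>"
  proof (rule polytope_Int_halfspaces[OF _ P])
    show "aff g" if g: "g \<in> (\<lambda>f x. f (a x)) ` S" for g
    proof -
      obtain f where f: "f \<in> S" "g = (\<lambda>x. f (a x))" using g by auto
      show ?thesis unfolding f(2) using S(2) f(1) by (intro aff_compose[OF _ a]) blast
    qed
  qed (use S in simp)
  ultimately show ?thesis by simp
qed

lemma polytope_Int': "polytope P \<Longrightarrow> polytope Q \<Longrightarrow> polytope (P \<inter> (Q :: point set))"
  using polytope_preimage[of P Q "\<lambda>x. x"] by (simp add: aff_id Int_def)

text \<open>By convexity the differences of points of \<open>P\<close>, scaled by nonnegative reals,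
  already form a subspace \<open>V\<close>, the direction space of the affine hull. The linear part
  of \<open>a\<close> is injective on \<open>V\<close>, so it has a linear left inverse with values
  in \<open>V\<close>, which only has to be translated. The values in \<open>V\<close> keep the
  range inside \<open>Rn n\<close>.\<close>

lemma aff_left_inverse:
  fixes a :: "point \<Rightarrow> point"
  assumes a: "aff a" and P: "convex P" "inj_on a P"
  shows "\<exists>b. aff b \<and> (\<forall>x\<in>P. b (a x) = x) \<and> (\<forall>n. P \<subseteq> Rn n \<longrightarrow> range b \<subseteq> Rn n)"
proof (cases "P = {}")
  case True then show ?thesis by (intro exI[of _ "\<lambda>x. 0"]) (auto simp: aff_const)
next
  case False
  then obtain x0 where x0: "x0 \<in> P" by auto
  from a obtain g c where g: "linear g" "\<And>x. a x = g x + c" unfolding aff_def by auto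
  define V where "V = {r *\<^sub>R (x - y) | r x y. r \<ge> 0 \<and> x \<in> P \<and> y \<in> P}"
  have V_I: "r *\<^sub>R (x - y) \<in> V" if "r \<ge> 0" "x \<in> P" "y \<in> P" for r x y
    using that unfolding V_def by blast
  have V0: "subspace V"
    unfolding subspace_def
  proof (intro conjI ballI allI)
    show "0 \<in> V" using V_I[of 0 x0 x0] x0 by simp
  next
    fix v w assume "v \<in> V" "w \<in> V"
    then obtain r x y r' x' y' where 1: "v = r *\<^sub>R (x - y)" "r \<ge> 0" "x \<in> P" "y \<in> P"
      and 2: "w = r' *\<^sub>R (x' - y')" "r' \<ge> 0" "x' \<in> P" "y' \<in> P" unfolding V_def by auto
    show "v + w \<in> V"
    proof (cases "r + r' = 0")
      case True
      then have "r = 0" "r' = 0" using 1 2 by auto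
      then show ?thesis unfolding 1(1) 2(1) using V_I[of 0 x0 x0] x0 by simp
    next
      case False
      then have p: "r + r' > 0" using 1 2 by linarith
      let ?x = "(r/(r+r')) *\<^sub>R x + (r'/(r+r')) *\<^sub>R x'" and ?y = "(r/(r+r')) *\<^sub>R y + (r'/(r+r')) *\<^sub>R y'"
      have w: "0 \<le> r/(r+r')" "0 \<le> r'/(r+r')" "r/(r+r') + r'/(r+r') = 1"
        using 1 2 p by (auto simp flip: add_divide_distrib)
      have xy: "?x \<in> P" "?y \<in> P"
        using convexD[OF P(1) 1(3) 2(3) w] convexD[OF P(1) 1(4) 2(4) w] by auto
      have r: "(r + r') * (r/(r+r')) = r" "(r + r') * (r'/(r+r')) = r'" using p by auto
      have "v + w = (r + r') *\<^sub>R (?x - ?y)"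
        unfolding 1(1) 2(1) by (simp only: scaleR_diff_right scaleR_add_right scaleR_scaleR r) simp
      then show ?thesis using V_I[OF less_imp_le[OF p] xy] by simp
    qed
  next
    fix s v assume "v \<in> V"
    then obtain r x y where 1: "v = r *\<^sub>R (x - y)" "r \<ge> 0" "x \<in> P" "y \<in> P" unfolding V_def by auto
    have "s *\<^sub>R v = (s * r) *\<^sub>R (x - y)" "s *\<^sub>R v = (- s * r) *\<^sub>R (y - x)"
      by (auto simp: 1 algebra_simps)
    then show "s *\<^sub>R v \<in> V"
      using V_I[of "s * r" x y] V_I[of "- s * r" y x] 1 by (cases "s \<ge> 0") (auto simp: mult_nonpos_nonneg)
  qed
  have inj: "inj_on g V"
  proof -
    have "v = 0" if "v \<in> V" "g v = 0" for v
    proof -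
      obtain r x y where 1: "v = r *\<^sub>R (x - y)" "r \<ge> 0" "x \<in> P" "y \<in> P" using \<open>v \<in> V\<close> unfolding V_def by auto
      have "r *\<^sub>R (g x - g y) = 0" using that by (simp add: 1 linear_scale[OF g(1)] linear_diff[OF g(1)])
      then have "r = 0 \<or> a x = a y" by (simp add: g(2))
      then have "r = 0 \<or> x = y" using P(2) 1 by (auto dest: inj_onD)
      then show ?thesis by (auto simp: 1)
    qed
    note z = this
    show ?thesis
    proof (rule inj_onI)
      fix v w assume "v \<in> V" "w \<in> V" "g v = g w"
      then have "v - w = 0" using V0 by - (rule z, simp_all add: subspace_diff linear_diff[OF g(1)])
      then show "v = w" by simp
    qed
  qed
  obtain h where h: "range h \<subseteq> V" "linear h" "\<And>v. v \<in> V \<Longrightarrow> h (g v) = v"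
    using linear_exists_left_inverse_on[OF g(1) V0 inj] by auto
  define b where "b = (\<lambda>y. h y + (x0 - h (a x0)))"
  have "aff b" unfolding b_def aff_def using h(2) by blast
  moreover have "b (a x) = x" if "x \<in> P" for x
  proof -
    have "x - x0 \<in> V" using V_I[of 1 x x0] that x0 by simp
    then have "h (g (x - x0)) = x - x0" by (rule h(3))
    moreover have "g (x - x0) = a x - a x0" by (simp add: g(2) linear_diff[OF g(1)])
    ultimately have "h (a x) - h (a x0) = x - x0" by (simp add: linear_diff[OF h(2)])
    then show ?thesis by (simp add: b_def algebra_simps)
  qed
  moreover have "range b \<subseteq> Rn n" if "P \<subseteq> Rn n" for n
  proof -
    have "V \<subseteq> Rn n" using that by (auto simp: V_def intro!: Rn_scaleR Rn_diff)
    then show ?thesis using h(1) x0 that by (auto simp: b_def intro!: Rn_add Rn_diff)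
  qed
  ultimately show ?thesis by blast
qed

section \<open>Piecewise linear maps\<close>

lemma PL_onI:
  assumes "finite I" "\<And>i. i \<in> I \<Longrightarrow> polytope (P i)" "\<And>i. i \<in> I \<Longrightarrow> aff (a i)"
    and "X = (\<Union>i\<in>I. P i)" "\<And>i x. i \<in> I \<Longrightarrow> x \<in> P i \<Longrightarrow> f x = a i x"
  shows "PL_on X f"
  unfolding PL_on_def
proof (intro exI[of _ "P ` I"] conjI ballI)
  fix Q assume "Q \<in> P ` I"
  then obtain i where i: "i \<in> I" "Q = P i" by blast
  obtain g c where "linear g" "\<forall>x. a i x = g x + c" using assms(3)[OF i(1)] unfolding aff_def by blast
  then show "\<exists>g c. linear g \<and> (\<forall>x\<in>Q. f x = g x + c)" using assms(5)[OF i(1)] i(2) by auto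
qed (use assms in auto)

lemma PL_onE:
  assumes "PL_on X f"
  obtains \<P> A where "finite \<P>" "\<And>P. P \<in> \<P> \<Longrightarrow> polytope P" "X = \<Union>\<P>"
    "\<And>P. P \<in> \<P> \<Longrightarrow> aff (A P)" "\<And>P x. P \<in> \<P> \<Longrightarrow> x \<in> P \<Longrightarrow> f x = A P x"
proof -
  obtain \<P> where P: "finite \<P>" "\<forall>P\<in>\<P>. polytope P" "X = \<Union>\<P>"
    "\<forall>P\<in>\<P>. \<exists>g c. linear g \<and> (\<forall>x\<in>P. f x = g x + c)" using assms unfolding PL_on_def by blast
  have "\<forall>P\<in>\<P>. \<exists>a. aff a \<and> (\<forall>x\<in>P. f x = a x)"
  proof
    fix Q assume "Q \<in> \<P>"
    then obtain g c where "linear g" "\<forall>x\<in>Q. f x = g x + c" using P(4) by blast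
    then show "\<exists>a. aff a \<and> (\<forall>x\<in>Q. f x = a x)" unfolding aff_def
      by (intro exI[of _ "\<lambda>x. g x + c"]) blast
  qed
  then obtain A where "\<forall>P\<in>\<P>. aff (A P) \<and> (\<forall>x\<in>P. f x = A P x)" by metis
  then show ?thesis using that P by blast
qed

lemma PL_on_cong: assumes "PL_on X f" "\<And>x. x \<in> X \<Longrightarrow> g x = f x" shows "PL_on X g"
proof -
  obtain \<P> A where P: "finite \<P>" "\<And>P. P \<in> \<P> \<Longrightarrow> polytope P" "X = \<Union>\<P>"
    "\<And>P. P \<in> \<P> \<Longrightarrow> aff (A P)" "\<And>P x. P \<in> \<P> \<Longrightarrow> x \<in> P \<Longrightarrow> f x = A P x"
    using PL_onE[OF assms(1)] by metis
  show ?thesis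
  proof (rule PL_onI[where I = \<P> and P = "\<lambda>P. P" and a = A])
    show "g x = A Q x" if "Q \<in> \<P>" "x \<in> Q" for Q x
      using P(5)[OF that] assms(2)[of x] that P(3) by auto
  qed (use P in auto)
qed

lemma PL_on_aff: "polytope P \<Longrightarrow> aff a \<Longrightarrow> PL_on P a"
  by (rule PL_onI[where I = "{0}" and P = "\<lambda>_. P" and a = "\<lambda>_. a"]) auto

lemma polytope_compact_polyhedron: "polytope P \<Longrightarrow> compact_polyhedron P"
  unfolding compact_polyhedron_def by (rule exI[of _ "{P}"]) auto

lemma compact_polyhedron_UN:
  assumes "finite I" "\<And>i. i \<in> I \<Longrightarrow> compact_polyhedron (P i)"
  shows "compact_polyhedron (\<Union>i\<in>I. P i)"
proof -
  have "\<forall>i\<in>I. \<exists>\<P>. finite \<P> \<and> (\<forall>Q\<in>\<P>. polytope Q) \<and> P i = \<Union>\<P>"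
    using assms(2) unfolding compact_polyhedron_def by blast
  then obtain F where F: "\<forall>i\<in>I. finite (F i) \<and> (\<forall>Q\<in>F i. polytope Q) \<and> P i = \<Union>(F i)" by metis
  show ?thesis unfolding compact_polyhedron_def
    by (rule exI[of _ "\<Union>i\<in>I. F i"]) (use F assms(1) in auto)
qed

lemma PL_on_subset:
  assumes "PL_on X f" "compact_polyhedron Y" "Y \<subseteq> X" shows "PL_on Y f"
proof -
  obtain \<P> A where P: "finite \<P>" "\<And>P. P \<in> \<P> \<Longrightarrow> polytope P" "X = \<Union>\<P>"
    "\<And>P. P \<in> \<P> \<Longrightarrow> aff (A P)" "\<And>P x. P \<in> \<P> \<Longrightarrow> x \<in> P \<Longrightarrow> f x = A P x"
    using PL_onE[OF assms(1)] by metis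
  obtain \<Q> where Q: "finite \<Q>" "\<And>P. P \<in> \<Q> \<Longrightarrow> polytope P" "Y = \<Union>\<Q>"
    using assms(2) unfolding compact_polyhedron_def by metis
  show ?thesis
  proof (rule PL_onI[where I = "\<P> \<times> \<Q>" and P = "\<lambda>(P,Q). P \<inter> Q" and a = "\<lambda>(P,Q). A P"])
    show "Y = (\<Union>i\<in>\<P> \<times> \<Q>. case i of (P, Q) \<Rightarrow> P \<inter> Q)" using assms(3) P(3) Q(3) by auto
  qed (use P Q in \<open>auto intro: polytope_Int'\<close>)
qed

lemma PL_on_compose:
  assumes "PL_on X f" "PL_on Y g" "f ` X \<subseteq> Y" shows "PL_on X (g \<circ> f)"
proof -
  obtain \<P> A where P: "finite \<P>" "\<And>P. P \<in> \<P> \<Longrightarrow> polytope P" "X = \<Union>\<P>"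
    "\<And>P. P \<in> \<P> \<Longrightarrow> aff (A P)" "\<And>P x. P \<in> \<P> \<Longrightarrow> x \<in> P \<Longrightarrow> f x = A P x"
    using PL_onE[OF assms(1)] by metis
  obtain \<Q> B where Q: "finite \<Q>" "\<And>P. P \<in> \<Q> \<Longrightarrow> polytope P" "Y = \<Union>\<Q>"
    "\<And>P. P \<in> \<Q> \<Longrightarrow> aff (B P)" "\<And>P x. P \<in> \<Q> \<Longrightarrow> x \<in> P \<Longrightarrow> g x = B P x"
    using PL_onE[OF assms(2)] by metis
  show ?thesis
  proof (rule PL_onI[where I = "\<P> \<times> \<Q>" and P = "\<lambda>(P,Q). {x\<in>P. A P x \<in> Q}" and a = "\<lambda>(P,Q) x. B Q (A P x)"])
    show "finite (\<P> \<times> \<Q>)" using P Q by simp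
    show "polytope (case i of (P, Q) \<Rightarrow> {x \<in> P. A P x \<in> Q})" if "i \<in> \<P> \<times> \<Q>" for i
      using that P(2,4) Q(2) polytope_preimage by (cases i) simp
    show "aff (case i of (P, Q) \<Rightarrow> \<lambda>x. B Q (A P x))" if "i \<in> \<P> \<times> \<Q>" for i
      using that aff_compose[OF Q(4) P(4)] by (cases i) simp
    show "X = (\<Union>i\<in>\<P> \<times> \<Q>. case i of (P, Q) \<Rightarrow> {x \<in> P. A P x \<in> Q})"
    proof
      show "X \<subseteq> (\<Union>i\<in>\<P> \<times> \<Q>. case i of (P, Q) \<Rightarrow> {x \<in> P. A P x \<in> Q})"
      proof
        fix x assume x: "x \<in> X"
        then obtain p where p: "p \<in> \<P>" "x \<in> p" using P(3) by auto
        have "f x \<in> Y" using x assms(3) by auto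
        then obtain q where q: "q \<in> \<Q>" "f x \<in> q" using Q(3) by auto
        show "x \<in> (\<Union>i\<in>\<P> \<times> \<Q>. case i of (P, Q) \<Rightarrow> {x \<in> P. A P x \<in> Q})"
          using p q P(5)[OF p] by (intro UN_I[of "(p,q)"]) auto
      qed
    qed (use P(3) in auto)
    show "(g \<circ> f) x = (case i of (P, Q) \<Rightarrow> \<lambda>x. B Q (A P x)) x"
      if i: "i \<in> \<P> \<times> \<Q>" "x \<in> (case i of (P, Q) \<Rightarrow> {x \<in> P. A P x \<in> Q})" for i x
    proof -
      obtain p q where pq: "i = (p,q)" "p \<in> \<P>" "q \<in> \<Q>" "x \<in> p" "A p x \<in> q" using i by auto
      have "f x = A p x" using P(5) pq by blast
      then show ?thesis using Q(5)[OF pq(3), of "f x"] pq by simp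
    qed
  qed
qed

lemma PL_on_continuous: assumes "PL_on X f" shows "continuous_on X f"
proof -
  obtain \<P> A where P: "finite \<P>" "\<And>P. P \<in> \<P> \<Longrightarrow> polytope P" "X = \<Union>\<P>"
    "\<And>P. P \<in> \<P> \<Longrightarrow> aff (A P)" "\<And>P x. P \<in> \<P> \<Longrightarrow> x \<in> P \<Longrightarrow> f x = A P x"
    using PL_onE[OF assms(1)] by metis
  have "continuous_on (\<Union>P\<in>\<P>. P) f"
  proof (rule continuous_on_closed_Union)
    fix Q assume Q: "Q \<in> \<P>"
    show "closed Q" using P(2)[OF Q] by (simp add: polytope_imp_closed)
    obtain n where "Q \<subseteq> Rn n" using polytope_subset_Rn P(2)[OF Q] by blast
    then have "continuous_on Q (A Q)" using continuous_on_aff P(4)[OF Q] by blast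
    then show "continuous_on Q f" using P(5)[OF Q] by (simp cong: continuous_on_cong)
  qed (use P in auto)
  then show ?thesis using P(3) by simp
qed

lemma PL_on_image: assumes "PL_on X f" shows "compact_polyhedron (f ` X)"
proof -
  obtain \<P> A where P: "finite \<P>" "\<And>P. P \<in> \<P> \<Longrightarrow> polytope P" "X = \<Union>\<P>"
    "\<And>P. P \<in> \<P> \<Longrightarrow> aff (A P)" "\<And>P x. P \<in> \<P> \<Longrightarrow> x \<in> P \<Longrightarrow> f x = A P x"
    using PL_onE[OF assms(1)] by metis
  have "f ` X = (\<Union>i\<in>\<P>. A i ` i)" unfolding P(3) image_Union using P(5) by (intro SUP_cong image_cong) auto
  then show ?thesis
    using compact_polyhedron_UN[OF P(1), of "\<lambda>i. A i ` i"]
      polytope_compact_polyhedron[OF polytope_aff_image[OF P(4) P(2)]] by simp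
qed

section \<open>Cubes\<close>

lemma zero_in_int_cube [simp]: "0 \<in> int_cube n"
  by (simp add: int_cube_def)

lemma int_cube_nonempty: "int_cube n \<noteq> {}"
  using zero_in_int_cube by blast

lemma int_cube_subset: "int_cube n \<subseteq> cube n"
  by (auto simp: int_cube_def cube_def)

lemma cube_subset_Rn: "cube n \<subseteq> Rn n" and int_cube_subset_Rn: "int_cube n \<subseteq> Rn n"
  by (auto simp: int_cube_def cube_def)

lemma bd_cube_subset: "bd_cube n \<subseteq> cube n"
  by (auto simp: bd_cube_def)

lemma cube_decomp: "cube n = int_cube n \<union> bd_cube n" and int_bd_disjoint: "int_cube n \<inter> bd_cube n = {}"
  using int_cube_subset by (auto simp: bd_cube_def)

lemma cube_0: "cube 0 = {0}" and int_cube_0: "int_cube 0 = {0}" and bd_cube_0: "bd_cube 0 = {}"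
proof -
  have "x = 0" if "x \<in> Rn 0" for x using that by (intro poly_mapping_eqI) (simp add: Rn_iff)
  then show 1: "cube 0 = {0}" "int_cube 0 = {0}" by (auto simp: cube_def int_cube_def)
  show "bd_cube 0 = {}" unfolding bd_cube_def 1 by simp
qed

lemma polytope_cube: "polytope (cube n)"
proof (induction n)
  case 0 then show ?case using polytope_convex_hull[of "{0}"] by (simp add: cube_0)
next
  case (Suc n)
  let ?S = "convex hull {- unit n, unit n}"
  have S: "?S = (\<lambda>t. t *\<^sub>R unit n) ` {-1..1}"
  proof -
    have "?S = closed_segment (- unit n) (unit n)" by (simp add: segment_convex_hull)
    also have "\<dots> = (\<lambda>t. t *\<^sub>R unit n) ` {-1..1}"
    proof (intro set_eqI iffI)
      fix x assume "x \<in> closed_segment (- unit n) (unit n)"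
      then obtain u where u: "0 \<le> u" "u \<le> 1" "x = (1 - u) *\<^sub>R (- unit n) + u *\<^sub>R unit n"
        by (auto simp: in_segment)
      have "x = (2 * u - 1) *\<^sub>R unit n" unfolding u(3) by (simp add: algebra_simps flip: scaleR_2)
      then show "x \<in> (\<lambda>t. t *\<^sub>R unit n) ` {-1..1}" using u by (intro image_eqI[of _ _ "2 * u - 1"]) auto
    next
      fix x assume "x \<in> (\<lambda>t. t *\<^sub>R unit n) ` {-1..1}"
      then obtain t where t: "-1 \<le> t" "t \<le> 1" "x = t *\<^sub>R unit n" by auto
      have "x = (1 - (t + 1) / 2) *\<^sub>R (- unit n) + ((t + 1) / 2) *\<^sub>R unit n"
      proof -
        have *: "(1 - s) *\<^sub>R (- u) + s *\<^sub>R u = (s - (1 - s)) *\<^sub>R u" for s and u :: point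
        proof (rule poly_mapping_eqI)
          fix k show "coord ((1 - s) *\<^sub>R (- u) + s *\<^sub>R u) k = coord ((s - (1 - s)) *\<^sub>R u) k"
            unfolding lookup_add coord_scaleR lookup_uminus by (simp add: algebra_simps)
        qed
        have "(1 - (t + 1) / 2) *\<^sub>R (- unit n) + ((t + 1) / 2) *\<^sub>R unit n = ((t + 1) / 2 - (1 - (t + 1) / 2)) *\<^sub>R unit n"
          by (rule *)
        also have "(t + 1) / 2 - (1 - (t + 1) / 2) = t" by (simp add: field_simps)
        finally show ?thesis using t by simp
      qed
      then show "x \<in> closed_segment (- unit n) (unit n)" unfolding in_segment
        using t by (intro exI[of _ "(t + 1) / 2"]) auto
    qed
    finally show ?thesis .
  qed
  have "cube (Suc n) = (\<lambda>(x,y). x + y) ` (cube n \<times> ?S)"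
  proof (intro set_eqI iffI)
    fix x assume x: "x \<in> cube (Suc n)"
    let ?y = "coord x n *\<^sub>R unit n"
    have "coord x n \<in> {-1..1}" using x by (auto simp: cube_def abs_le_iff)
    then have "?y \<in> ?S" unfolding S by (rule imageI)
    moreover have "x - ?y \<in> cube n"
      using x by (auto simp: cube_def Rn_iff lookup_minus coord_unit)
    ultimately show "x \<in> (\<lambda>(x,y). x + y) ` (cube n \<times> ?S)" by (intro image_eqI[of _ _ "(x - ?y, ?y)"]) auto
  next
    fix x assume "x \<in> (\<lambda>(x,y). x + y) ` (cube n \<times> ?S)"
    then obtain y t where yt: "y \<in> cube n" "-1 \<le> t" "t \<le> 1" "x = y + t *\<^sub>R unit n" unfolding S by auto
    then show "x \<in> cube (Suc n)" by (auto simp: cube_def Rn_iff lookup_add coord_unit less_Suc_eq)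
  qed
  moreover have "linear (\<lambda>(x,y). x + y :: point)" by (rule linearI) (auto simp: algebra_simps)
  moreover have "polytope ?S" by (simp add: polytope_convex_hull)
  ultimately show ?case using polytope_linear_image polytope_Times Suc by metis
qed

lemma compact_cube: "compact (cube n)"
  using polytope_cube polytope_imp_compact by blast

lemma cube_shrink:
  assumes "x \<in> cube n" "z \<in> int_cube n" "0 < t" "t \<le> 1" shows "x + t *\<^sub>R (z - x) \<in> int_cube n"
proof -
  have "\<bar>coord (x + t *\<^sub>R (z - x)) i\<bar> < 1" if "i < n" for i
  proof -
    have c: "\<bar>coord x i\<bar> \<le> 1" "\<bar>coord z i\<bar> < 1" using assms that by (auto simp: cube_def int_cube_def)
    have "coord (x + t *\<^sub>R (z - x)) i = (1 - t) * coord x i + t * coord z i"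
      by (simp add: lookup_add lookup_minus algebra_simps)
    also have "\<bar>\<dots>\<bar> \<le> (1 - t) * \<bar>coord x i\<bar> + t * \<bar>coord z i\<bar>"
      using assms abs_triangle_ineq[of "(1 - t) * coord x i" "t * coord z i"] by (simp add: abs_mult)
    also have "\<dots> < (1 - t) * 1 + t * 1"
      using c assms by (intro add_le_less_mono mult_left_mono mult_strict_left_mono) auto
    finally show ?thesis by simp
  qed
  moreover have "x + t *\<^sub>R (z - x) \<in> Rn n"
    using assms cube_subset_Rn int_cube_subset_Rn by (intro Rn_add Rn_scaleR Rn_diff) auto
  ultimately show ?thesis by (simp add: int_cube_def)
qed

lemma convex_int_cube: "convex (int_cube n)"
proof (rule convexI)
  fix x y and u v :: real
  assume h: "x \<in> int_cube n" "y \<in> int_cube n" "0 \<le> u" "0 \<le> v" "u + v = 1"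
  show "u *\<^sub>R x + v *\<^sub>R y \<in> int_cube n"
  proof (cases "v = 0")
    case True then show ?thesis using h by simp
  next
    case False
    have u: "u = 1 - v" using h by simp
    have "u *\<^sub>R x + v *\<^sub>R y = x + v *\<^sub>R (y - x)" unfolding u by (simp add: algebra_simps)
    then show ?thesis using cube_shrink[of x n y v] h False int_cube_subset by auto
  qed
qed

lemma segment_limit:
  fixes x z :: point
  shows "((\<lambda>t. x + t *\<^sub>R (z - x)) \<longlongrightarrow> x) (at_right 0)"
proof -
  have "((\<lambda>t. x + t *\<^sub>R (z - x)) \<longlongrightarrow> x + 0 *\<^sub>R (z - x)) (at_right 0)"
    by (intro tendsto_intros)
  then show ?thesis by simp
qed

lemma closure_segment:
  fixes x :: point
  assumes "\<And>t. 0 < t \<Longrightarrow> t \<le> 1 \<Longrightarrow> x + t *\<^sub>R (z - x) \<in> S" shows "x \<in> closure S"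
proof (rule Lim_in_closed_set[OF closed_closure _ _ segment_limit[of x z]])
  show "\<forall>\<^sub>F t in at_right 0. x + t *\<^sub>R (z - x) \<in> closure S"
    unfolding eventually_at_right_field
    by (intro exI[of _ 1]) (use assms closure_subset[of S] in \<open>auto intro!: subsetD[OF closure_subset]\<close>)
qed simp

lemma closure_int_cube: "closure (int_cube n) = cube n"
proof
  show "closure (int_cube n) \<subseteq> cube n"
    using int_cube_subset compact_cube by (intro closure_minimal compact_imp_closed)
  show "cube n \<subseteq> closure (int_cube n)"
  proof
    fix x assume "x \<in> cube n"
    then show "x \<in> closure (int_cube n)" using cube_shrink[of x n 0] by (intro closure_segment[of x 0]) auto
  qed
qed

lemma eq_on_cube:
  fixes f g :: "point \<Rightarrow> 'b::real_normed_vector"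
  assumes "continuous_on (cube n) f" "continuous_on (cube n) g"
    and "\<And>x. x \<in> int_cube n \<Longrightarrow> f x = g x" "x \<in> cube n"
  shows "f x = g x"
proof -
  let ?S = "{x \<in> cube n. f x - g x = 0}"
  have "closed ?S"
    using assms(1,2) compact_cube
    by (intro continuous_closed_preimage_constant continuous_on_diff compact_imp_closed)
  moreover have "int_cube n \<subseteq> ?S" using assms(3) int_cube_subset by auto
  ultimately have "cube n \<subseteq> ?S" using closure_minimal closure_int_cube by metis
  then show ?thesis using assms(4) by auto
qed

lemma half_way: "x + (1/2) *\<^sub>R (z - x) = (1/2) *\<^sub>R x + (1/2) *\<^sub>R (z::'a::real_vector)"
proof -
  have "x + (1/2) *\<^sub>R (z - x) = (1 - 1/2) *\<^sub>R x + (1/2) *\<^sub>R z"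
    unfolding scaleR_diff_left scaleR_diff_right by simp
  then show ?thesis by simp
qed

text \<open>Pieces inside the boundary are discarded, so that the affine pieces are injective.\<close>

definition pieces :: "nat \<Rightarrow> (point \<Rightarrow> point) \<Rightarrow> point set set \<Rightarrow> (point set \<Rightarrow> point \<Rightarrow> point) \<Rightarrow>
    (point set \<Rightarrow> point \<Rightarrow> point) \<Rightarrow> bool" where
  "pieces n \<phi> \<P> A B \<longleftrightarrow> finite \<P> \<and> cube n = \<Union>\<P> \<and>
    (\<forall>P\<in>\<P>. polytope P \<and> P \<inter> int_cube n \<noteq> {} \<and> aff (A P) \<and> aff (B P) \<and> range (B P) \<subseteq> Rn n \<and>
      (\<forall>x\<in>P. \<phi> x = A P x \<and> B P (A P x) = x))"

lemma piecesD:
  assumes "pieces n \<phi> \<P> A B"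
  shows "finite \<P>" "cube n = \<Union>\<P>" "\<And>P. P \<in> \<P> \<Longrightarrow> polytope P"
    "\<And>P. P \<in> \<P> \<Longrightarrow> P \<inter> int_cube n \<noteq> {}" "\<And>P. P \<in> \<P> \<Longrightarrow> aff (A P)"
    "\<And>P. P \<in> \<P> \<Longrightarrow> aff (B P)" "\<And>P. P \<in> \<P> \<Longrightarrow> range (B P) \<subseteq> Rn n"
    "\<And>P x. P \<in> \<P> \<Longrightarrow> x \<in> P \<Longrightarrow> \<phi> x = A P x" "\<And>P x. P \<in> \<P> \<Longrightarrow> x \<in> P \<Longrightarrow> B P (A P x) = x"
  using assms unfolding pieces_def by simp_all

text \<open>Injectivity of \<open>\<phi>\<close> is given on the open cube only, but an affine map
  inherits it on all of a piece \<open>Q\<close> that meets the open cube: moving two points half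
  way towards an interior point \<open>z\<close> brings them into the interior, and affine maps
  respect this motion. The pieces that are kept cover the cube, since their union is closed and
  contains the dense open cube.\<close>

lemma regular_pieces:
  assumes "regular_map n \<phi>" shows "\<exists>\<P> A B. pieces n \<phi> \<P> A B"
proof -
  have PL: "PL_on (cube n) \<phi>" and inj: "inj_on \<phi> (int_cube n)" using assms by (auto simp: regular_map_def)
  obtain \<Q> A where P: "finite \<Q>" "\<And>P. P \<in> \<Q> \<Longrightarrow> polytope P" "cube n = \<Union>\<Q>"
    "\<And>P. P \<in> \<Q> \<Longrightarrow> aff (A P)" "\<And>P x. P \<in> \<Q> \<Longrightarrow> x \<in> P \<Longrightarrow> \<phi> x = A P x"
    using PL_onE[OF PL] by metis
  define \<P> where "\<P> = {P\<in>\<Q>. P \<inter> int_cube n \<noteq> {}}"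
  have fin: "finite \<P>" using P by (simp add: \<P>_def)
  have "closed (\<Union>\<P>)" using fin P(2) by (auto simp: \<P>_def polytope_imp_closed)
  moreover have "int_cube n \<subseteq> \<Union>\<P>" using int_cube_subset[of n] unfolding P(3) \<P>_def by blast
  ultimately have "cube n \<subseteq> \<Union>\<P>" using closure_minimal closure_int_cube by metis
  then have cover: "cube n = \<Union>\<P>" unfolding P(3) \<P>_def by blast
  have "\<forall>P\<in>\<P>. \<exists>b. aff b \<and> range b \<subseteq> Rn n \<and> (\<forall>x\<in>P. b (A P x) = x)"
  proof
    fix Q assume Q: "Q \<in> \<P>"
    then have Q': "Q \<in> \<Q>" by (simp add: \<P>_def)
    have sub: "Q \<subseteq> cube n" using cover Q by auto
    obtain z where z: "z \<in> Q" "z \<in> int_cube n" using Q by (auto simp: \<P>_def)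
    have cQ: "convex Q" using P(2)[OF Q'] polytope_imp_convex by blast
    have "inj_on (A Q) Q"
    proof (rule inj_onI)
      fix x y assume xy: "x \<in> Q" "y \<in> Q" "A Q x = A Q y"
      define s where "s = (\<lambda>u::point. u + (1/2) *\<^sub>R (z - u))"
      have s: "s u \<in> Q \<and> s u \<in> int_cube n \<and> A Q (s u) = A Q u + (1/2) *\<^sub>R (A Q z - A Q u)" if u: "u \<in> Q" for u
      proof -
        have e: "s u = (1/2) *\<^sub>R u + (1/2) *\<^sub>R z"
          unfolding s_def by (rule half_way)
        have "s u \<in> Q" unfolding e using cQ u z(1) by (intro convexD) auto
        moreover have "s u \<in> int_cube n" unfolding s_def using u z sub by (intro cube_shrink) auto
        moreover have "A Q (s u) = A Q u + (1/2) *\<^sub>R (A Q z - A Q u)"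
          unfolding s_def using aff_segment[OF P(4)[OF Q'], of u "1/2" z] .
        ultimately show ?thesis by blast
      qed
      have "\<phi> (s x) = \<phi> (s y)" using s[OF xy(1)] s[OF xy(2)] xy(3) P(5)[OF Q'] by simp
      then have "s x = s y" using inj s[OF xy(1)] s[OF xy(2)] by (auto dest: inj_onD)
      then have "(1/2) *\<^sub>R x = (1/2) *\<^sub>R y" unfolding s_def half_way by simp
      then show "x = y" by simp
    qed
    from aff_left_inverse[OF P(4)[OF Q'] cQ this]
    obtain b where b: "aff b" "\<forall>x\<in>Q. b (A Q x) = x" "\<forall>n. Q \<subseteq> Rn n \<longrightarrow> range b \<subseteq> Rn n" by (elim exE conjE)
    have "Q \<subseteq> Rn n" using sub cube_subset_Rn[of n] by (rule order_trans)
    then have "range b \<subseteq> Rn n" using b(3) by blast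
    then show "\<exists>b. aff b \<and> range b \<subseteq> Rn n \<and> (\<forall>x\<in>Q. b (A Q x) = x)" using b(1,2) by (intro exI[of _ b] conjI)
  qed
  then obtain B where "\<forall>P\<in>\<P>. aff (B P) \<and> range (B P) \<subseteq> Rn n \<and> (\<forall>x\<in>P. B P (A P x) = x)" by metis
  then have B: "aff (B P)" "range (B P) \<subseteq> Rn n" "\<And>x. x \<in> P \<Longrightarrow> B P (A P x) = x" if "P \<in> \<P>" for P
    using that by blast+
  have PQ: "P \<in> \<Q>" "P \<inter> int_cube n \<noteq> {}" if "P \<in> \<P>" for P using that unfolding \<P>_def by blast+
  have "pieces n \<phi> \<P> A B" unfolding pieces_def
    using fin cover B PQ P(2)[OF PQ(1)] P(4)[OF PQ(1)] P(5)[OF PQ(1)]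
    by (intro conjI ballI) assumption+
  then show ?thesis by blast
qed

section \<open>Dimension\<close>

lemma affine_line: "affine A \<Longrightarrow> a \<in> A \<Longrightarrow> b \<in> A \<Longrightarrow> a + r *\<^sub>R (b - a) \<in> A"
  using mem_affine[of A a b "1 - r" r] by (simp add: algebra_simps)

lemma convex_subset_Union_affine:
  assumes "finite \<A>" "\<And>A. A \<in> \<A> \<Longrightarrow> affine A" "convex C" "C \<noteq> {}" "C \<subseteq> \<Union>\<A>"
  shows "\<exists>A\<in>\<A>. C \<subseteq> A"
  using assms
proof (induction \<A> rule: finite_induct)
  case empty then show ?case by auto
next
  case (insert A F)
  show ?case
  proof (cases "C \<subseteq> A")
    case False
    then obtain x where x: "x \<in> C" "x \<notin> A" by auto
    have "C \<subseteq> \<Union>F"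
    proof
      fix y assume y: "y \<in> C"
      show "y \<in> \<Union>F"
      proof (cases "y \<in> A")
        case False then show ?thesis using y insert.prems(4) by auto
      next
        case True
        define p where "p = (\<lambda>t::real. y + t *\<^sub>R (x - y))"
        have "\<exists>D\<in>F. p t \<in> D" if t: "t \<in> {0<..1}" for t
        proof -
          have "(1 - t) *\<^sub>R y + t *\<^sub>R x \<in> C" using insert.prems(2) x y t by (intro convexD) auto
          then have "p t \<in> C" by (simp add: p_def algebra_simps)
          moreover have "p t \<notin> A"
          proof
            assume "p t \<in> A"
            then have "y + (1 / t) *\<^sub>R (p t - y) \<in> A" using True insert.prems(1)[of A] by (intro affine_line) auto
            then show False using x t by (simp add: p_def)
          qed
          ultimately show ?thesis using insert.prems(4) by auto
        qed
        then obtain c where c: "\<And>t. t \<in> {0<..1} \<Longrightarrow> c t \<in> F \<and> p t \<in> c t" by metis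
        have inf: "infinite {0<..1::real}" by (simp add: infinite_Ioc)
        have "finite (c ` {0<..1})" by (rule finite_subset[OF _ insert.hyps(1)]) (use c in auto)
        from pigeonhole_infinite[OF inf this] obtain s where
          s: "s \<in> {0<..1}" "infinite {a \<in> {0<..1}. c a = c s}" by blast
        have "infinite ({a \<in> {0<..1}. c a = c s} - {s})" using s(2) by simp
        then have "{a \<in> {0<..1}. c a = c s} - {s} \<noteq> {}" using finite.emptyI by metis
        then obtain t where t: "t \<in> {0<..1}" "c t = c s" "t \<noteq> s" by blast
        have "p s \<in> c s" "p t \<in> c s" using c s t by (metis)+
        then have "p s + (- s / (t - s)) *\<^sub>R (p t - p s) \<in> c s"
          using c[OF s(1)] insert.prems(1) by (intro affine_line) auto
        moreover have "p s + (- s / (t - s)) *\<^sub>R (p t - p s) = y"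
        proof -
          have "p t - p s = (t - s) *\<^sub>R (x - y)" by (simp add: p_def algebra_simps)
          then show ?thesis using t(3) by (simp add: p_def)
        qed
        ultimately show ?thesis using c[OF s(1)] by auto
      qed
    qed
    then have "\<exists>A\<in>F. C \<subseteq> A" using insert.prems by (intro insert.IH) auto
    then show ?thesis by blast
  qed auto
qed

text \<open>An affine subspace of dimension at most \<open>m\<close>; counting spanning vectors
  expresses the bound inside an infinite-dimensional space.\<close>

definition flat :: "nat \<Rightarrow> point set \<Rightarrow> bool" where
  "flat m A \<longleftrightarrow> (\<exists>p B. finite B \<and> card B \<le> m \<and> A = (\<lambda>v. p + v) ` span B)"

lemma flat_affine: "flat m A \<Longrightarrow> affine A"
  unfolding flat_def by (metis affine_translation subspace_imp_affine subspace_span)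

lemma span_units: "span (unit ` {..<n}) = Rn n"
proof
  show "span (unit ` {..<n}) \<subseteq> Rn n"
    by (rule span_minimal[OF _ subspace_Rn]) (auto intro: unit_in_Rn)
  show "Rn n \<subseteq> span (unit ` {..<n})"
  proof
    fix x assume x: "x \<in> Rn n"
    show "x \<in> span (unit ` {..<n})"
      by (subst Rn_expand[OF x]) (intro span_sum span_scale span_base imageI)
  qed
qed

lemma flat_aff_image: assumes "aff a" shows "flat m (a ` Rn m)"
proof -
  from assms obtain g c where g: "linear g" "\<And>x. a x = g x + c" unfolding aff_def by auto
  have "a ` Rn m = (\<lambda>v. c + v) ` g ` span (unit ` {..<m})"
    by (auto simp: span_units g(2) image_image add.commute)
  also have "g ` span (unit ` {..<m}) = span (g ` unit ` {..<m})" by (rule linear_span_image[OF g(1), symmetric])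
  finally have "a ` Rn m = (\<lambda>v. c + v) ` span (g ` unit ` {..<m})" .
  moreover have "card (g ` unit ` {..<m}) \<le> m"
    by (metis card_image_le card_lessThan finite_imageI finite_lessThan image_image)
  ultimately show ?thesis unfolding flat_def
    by (intro exI[of _ c] exI[of _ "g ` unit ` {..<m}"]) simp
qed

lemma independent_units: "independent (unit ` {..<n})"
proof (rule independent_if_scalars_zero)
  fix f x assume z: "(\<Sum>x\<in>unit ` {..<n}. f x *\<^sub>R x) = 0" and x: "x \<in> unit ` {..<n}"
  have inj: "inj_on unit {..<n}" by (rule inj_onI) (metis coord_unit zero_neq_one)
  obtain i where i: "i < n" "x = unit i" using x by auto
  have "0 = coord (\<Sum>j<n. f (unit j) *\<^sub>R unit j) i" using z by (simp add: sum.reindex[OF inj])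
  also have "\<dots> = (\<Sum>j<n. if j = i then f (unit i) else 0)"
    unfolding lookup_sum by (rule sum.cong) (auto simp: coord_unit)
  also have "\<dots> = f (unit i)" using i by simp
  finally show "f x = 0" using i by simp
qed simp

lemma card_units: "card (unit ` {..<n}) = n"
proof -
  have "inj_on unit {..<n}" by (rule inj_onI) (metis coord_unit zero_neq_one)
  then show ?thesis by (simp add: card_image)
qed

text \<open>Invariance of dimension for PL maps, reduced to linear algebra. Among the affine hulls
  of the pieces one contains the whole open cube, and the image of that piece lies in a single flat.
  The affine left inverse works on the whole hull, so the \<open>n\<close> unit vectors lie in the
  image of a space spanned by at most \<open>m\<close> vectors.\<close>

lemma regular_map_dim_le:
  assumes reg: "regular_map n \<phi>" and fin: "finite \<A>" and fl: "\<And>A. A \<in> \<A> \<Longrightarrow> flat m A"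
    and cover: "\<phi> ` int_cube n \<subseteq> \<Union>\<A>"
  shows "n \<le> m"
proof -
  obtain \<P> A B where pc: "pieces n \<phi> \<P> A B" using regular_pieces[OF reg] by blast
  note P = piecesD(1,2,3,4,5,6,8,9)[OF pc]
  have "int_cube n \<subseteq> \<Union>((\<lambda>P. affine hull (P \<inter> int_cube n)) ` \<P>)"
  proof
    fix x assume x: "x \<in> int_cube n"
    then obtain Q where "Q \<in> \<P>" "x \<in> Q" using P(2) int_cube_subset by blast
    moreover have "x \<in> affine hull (Q \<inter> int_cube n)" using x \<open>x \<in> Q\<close> by (intro hull_inc) simp
    ultimately show "x \<in> \<Union>((\<lambda>P. affine hull (P \<inter> int_cube n)) ` \<P>)" by blast
  qed
  then have "\<exists>D\<in>(\<lambda>P. affine hull (P \<inter> int_cube n)) ` \<P>. int_cube n \<subseteq> D"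
    by (intro convex_subset_Union_affine convex_int_cube) (use P(1) int_cube_nonempty[of n] in \<open>auto simp: affine_affine_hull\<close>)
  then obtain Q where Q: "Q \<in> \<P>" "int_cube n \<subseteq> affine hull (Q \<inter> int_cube n)" by auto
  let ?Y = "Q \<inter> int_cube n"
  have cY: "convex ?Y" using P(3)[OF Q(1)] polytope_imp_convex convex_int_cube by (blast intro: convex_Int)
  have "A Q ` ?Y = \<phi> ` ?Y" using P(7)[OF Q(1)] by (intro image_cong) auto
  then have "A Q ` ?Y \<subseteq> \<Union>\<A>" using cover by blast
  then have "\<exists>F\<in>\<A>. A Q ` ?Y \<subseteq> F"
    using fl P(4)[OF Q(1)] by (intro convex_subset_Union_affine fin flat_affine convex_aff_image P(5)[OF Q(1)] cY) auto
  then obtain F where F: "F \<in> \<A>" "A Q ` ?Y \<subseteq> F" by blast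
  obtain p S where S: "finite S" "card S \<le> m" "F = (\<lambda>v. p + v) ` span S" using fl[OF F(1)] unfolding flat_def by blast
  \<comment> \<open>Both conditions are preserved by affine combinations, so they extend from the
    piece to its affine hull.\<close>
  have "affine hull ?Y \<subseteq> {x. A Q x \<in> F \<and> B Q (A Q x) = x}"
  proof (rule hull_minimal)
    show "?Y \<subseteq> {x. A Q x \<in> F \<and> B Q (A Q x) = x}" using F(2) P(8)[OF Q(1)] by auto
    show "affine {x. A Q x \<in> F \<and> B Q (A Q x) = x}"
      unfolding affine_def
    proof (intro ballI allI impI)
      fix x y and u v :: real
      assume x: "x \<in> {x. A Q x \<in> F \<and> B Q (A Q x) = x}" and y: "y \<in> {x. A Q x \<in> F \<and> B Q (A Q x) = x}"
        and uv: "u + v = 1"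
      have "A Q (u *\<^sub>R x + v *\<^sub>R y) = u *\<^sub>R A Q x + v *\<^sub>R A Q y"
        by (rule aff_convex_comb[OF P(5)[OF Q(1)] uv])
      moreover have "u *\<^sub>R A Q x + v *\<^sub>R A Q y \<in> F" using flat_affine[OF fl[OF F(1)]] x y uv
        unfolding affine_def by blast
      moreover have "B Q (u *\<^sub>R A Q x + v *\<^sub>R A Q y) = u *\<^sub>R x + v *\<^sub>R y"
        using aff_convex_comb[OF P(6)[OF Q(1)] uv, of "A Q x" "A Q y"] x y by simp
      ultimately show "u *\<^sub>R x + v *\<^sub>R y \<in> {x. A Q x \<in> F \<and> B Q (A Q x) = x}" by simp
    qed
  qed
  then have AB: "A Q x \<in> F" "B Q (A Q x) = x" if "x \<in> int_cube n" for x using Q(2) that by auto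
  obtain h d where h: "linear h" "\<And>x. B Q x = h x + d" using P(6)[OF Q(1)] unfolding aff_def by auto
  have "unit i \<in> span (h ` S)" if i: "i < n" for i
  proof -
    \<comment> \<open>The factor 1/2 keeps the point inside the open cube; \<open>unit i\<close>
      itself lies on the boundary.\<close>
    have e: "(1/2) *\<^sub>R unit i \<in> int_cube n"
      using i unit_in_Rn[OF i] by (auto simp: int_cube_def coord_unit Rn_scaleR)
    obtain v where v: "v \<in> span S" "A Q ((1/2) *\<^sub>R unit i) = p + v" using AB(1)[OF e] S(3) by auto
    obtain w where w: "w \<in> span S" "A Q 0 = p + w" using AB(1)[OF zero_in_int_cube] S(3) by auto
    have "h (v - w) = (1/2) *\<^sub>R unit i"
    proof -
      have "h (v - w) = h (p + v) - h (p + w)" by (simp add: linear_diff[OF h(1)] linear_add[OF h(1)])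
      also have "\<dots> = B Q (p + v) - B Q (p + w)" by (simp add: h(2))
      also have "\<dots> = (1/2) *\<^sub>R unit i - 0"
        using AB(2)[OF e] AB(2)[OF zero_in_int_cube] v w by simp
      finally show ?thesis by simp
    qed
    moreover have "h (v - w) \<in> span (h ` S)"
      unfolding linear_span_image[OF h(1)] using v w by (intro imageI span_diff)
    ultimately have "2 *\<^sub>R ((1/2) *\<^sub>R unit i) \<in> span (h ` S)" by (metis span_scale)
    then show ?thesis by simp
  qed
  then have "unit ` {..<n} \<subseteq> span (h ` S)" by auto
  then have "card (unit ` {..<n}) \<le> card (h ` S)"
    using independent_span_bound[of "h ` S" "unit ` {..<n}"] independent_units S(1) by simp
  also have "\<dots> \<le> m" using S card_image_le[OF S(1), of h] by simp
  finally show ?thesis by (simp add: card_units)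
qed

lemma is_cell_dim_unique:
  assumes "is_cell n C" "is_cell m C" shows "n = m"
proof -
  have "n \<le> m" if h: "characteristic_map n \<phi> C" "characteristic_map m \<psi> C" for n m \<phi> \<psi>
  proof -
    have r: "regular_map n \<phi>" "regular_map m \<psi>" and i: "\<phi> ` int_cube n = \<psi> ` int_cube m"
      using h by (auto simp: characteristic_map_def)
    obtain \<P> A B where pc: "pieces m \<psi> \<P> A B" using regular_pieces[OF r(2)] by blast
    note P = piecesD(1,2,5,8)[OF pc]
    show ?thesis
    proof (rule regular_map_dim_le[OF r(1), of "(\<lambda>P. A P ` Rn m) ` \<P>"])
      show "flat m F" if "F \<in> (\<lambda>P. A P ` Rn m) ` \<P>" for F using that P(3) flat_aff_image by auto
      show "\<phi> ` int_cube n \<subseteq> \<Union>((\<lambda>P. A P ` Rn m) ` \<P>)"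
      proof
        fix y assume "y \<in> \<phi> ` int_cube n"
        then obtain x where x: "x \<in> int_cube m" "y = \<psi> x" unfolding i by blast
        then obtain Q where Q: "Q \<in> \<P>" "x \<in> Q" using int_cube_subset P(2) by blast
        have "y = A Q x" using x P(4)[OF Q] by simp
        then show "y \<in> \<Union>((\<lambda>P. A P ` Rn m) ` \<P>)" using Q x(1) int_cube_subset_Rn by blast
      qed
    qed (use P in simp)
  qed
  then show ?thesis using assms unfolding is_cell_def by (meson le_antisym)
qed

lemma cell_dim_eq: "is_cell n C \<Longrightarrow> cell_dim C = n"
  unfolding cell_dim_def using is_cell_dim_unique by blast

lemma flat_face: assumes "i < n" shows "flat (n - 1) {x \<in> Rn n. coord x i = s}"
proof -
  have "{x \<in> Rn n. coord x i = s} = (\<lambda>v. s *\<^sub>R unit i + v) ` span (unit ` ({..<n} - {i}))"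
  proof (intro set_eqI iffI)
    fix x assume x: "x \<in> {x \<in> Rn n. coord x i = s}"
    have "x - s *\<^sub>R unit i \<in> span (unit ` ({..<n} - {i}))"
    proof -
      have "x = (\<Sum>j<n. coord x j *\<^sub>R unit j)" using x by (intro Rn_expand) simp
      also have "\<dots> = coord x i *\<^sub>R unit i + (\<Sum>j\<in>{..<n} - {i}. coord x j *\<^sub>R unit j)"
        using assms by (simp add: sum.remove)
      finally have "x - s *\<^sub>R unit i = (\<Sum>j\<in>{..<n} - {i}. coord x j *\<^sub>R unit j)"
        using x by (simp add: algebra_simps)
      moreover have "(\<Sum>j\<in>{..<n} - {i}. coord x j *\<^sub>R unit j) \<in> span (unit ` ({..<n} - {i}))"
        by (intro span_sum span_scale span_base imageI)
      ultimately show ?thesis by simp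
    qed
    then show "x \<in> (\<lambda>v. s *\<^sub>R unit i + v) ` span (unit ` ({..<n} - {i}))"
      by (intro image_eqI[of _ _ "x - s *\<^sub>R unit i"]) auto
  next
    fix x assume "x \<in> (\<lambda>v. s *\<^sub>R unit i + v) ` span (unit ` ({..<n} - {i}))"
    then obtain v where v: "v \<in> span (unit ` ({..<n} - {i}))" "x = s *\<^sub>R unit i + v" by auto
    have "span (unit ` ({..<n} - {i})) \<subseteq> {v \<in> Rn n. coord v i = 0}"
    proof (rule span_minimal)
      show "unit ` ({..<n} - {i}) \<subseteq> {v \<in> Rn n. coord v i = 0}" by (auto simp: coord_unit unit_in_Rn)
      show "subspace {v \<in> Rn n. coord v i = 0}"
        by (auto simp: subspace_def lookup_add Rn_add Rn_scaleR)
    qed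
    then have "v \<in> Rn n" "coord v i = 0" using v by auto
    then show "x \<in> {x \<in> Rn n. coord x i = s}"
      using v unit_in_Rn[OF assms] by (auto simp: lookup_add coord_unit intro: Rn_add Rn_scaleR)
  qed
  moreover have "card (unit ` ({..<n} - {i})) \<le> n - 1"
    using assms card_image_le[of "{..<n} - {i}" unit] by simp
  moreover have "finite (unit ` ({..<n} - {i}))" by simp
  ultimately show ?thesis unfolding flat_def by blast
qed

lemma bd_cube_iff: "x \<in> bd_cube n \<longleftrightarrow> x \<in> cube n \<and> (\<exists>i<n. \<bar>coord x i\<bar> = 1)"
  unfolding bd_cube_def cube_def int_cube_def by (auto simp: not_less) (metis order_antisym less_irrefl)+

text \<open>The boundary is covered by the hyperplanes of its faces, which have dimension
  \<open>n - 1\<close>. The case \<open>n = 0\<close> is excluded because then the boundary is empty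
  while an open cell is not.\<close>

lemma regular_map_into_bd_cube:
  assumes "regular_map k \<psi>" "\<psi> ` int_cube k \<subseteq> bd_cube n" shows "k < n"
proof -
  have n: "n > 0"
  proof (rule ccontr)
    assume "\<not> n > 0"
    then have "bd_cube n = {}" by (simp add: bd_cube_0)
    then show False using assms(2) zero_in_int_cube[of k] by auto
  qed
  have "k \<le> n - 1"
  proof (rule regular_map_dim_le[OF assms(1), of "(\<lambda>(i,s). {x \<in> Rn n. coord x i = s}) ` ({..<n} \<times> {-1,1})"])
    show "flat (n - 1) F" if "F \<in> (\<lambda>(i,s). {x \<in> Rn n. coord x i = s}) ` ({..<n} \<times> {-1,1})" for F
      using that flat_face by auto
    show "\<psi> ` int_cube k \<subseteq> \<Union>((\<lambda>(i,s). {x \<in> Rn n. coord x i = s}) ` ({..<n} \<times> {-1,1}))"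
    proof
      fix y assume "y \<in> \<psi> ` int_cube k"
      then have "y \<in> bd_cube n" using assms(2) by auto
      then obtain i where "i < n" "\<bar>coord y i\<bar> = 1" "y \<in> Rn n"
        using cube_subset_Rn by (auto simp: bd_cube_iff)
      then show "y \<in> \<Union>((\<lambda>(i,s). {x \<in> Rn n. coord x i = s}) ` ({..<n} \<times> {-1,1}))"
        by (intro UN_I[of "(i, coord y i)"]) auto
    qed
  qed simp
  then show ?thesis using n by simp
qed

lemma compact_polyhedron_bd_cube: "compact_polyhedron (bd_cube n)"
proof -
  have "bd_cube n = (\<Union>(i,s)\<in>{..<n} \<times> {-1,1}. {x \<in> cube n. \<forall>f\<in>{\<lambda>x. s * coord x i - 1}. f x \<ge> 0})"
  proof (intro set_eqI iffI)
    fix x assume "x \<in> bd_cube n"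
    then obtain i where i: "x \<in> cube n" "i < n" "\<bar>coord x i\<bar> = 1" by (auto simp: bd_cube_iff)
    then show "x \<in> (\<Union>(i,s)\<in>{..<n} \<times> {-1,1}. {x \<in> cube n. \<forall>f\<in>{\<lambda>x. s * coord x i - 1}. f x \<ge> 0})"
      by (intro UN_I[of "(i, coord x i)"]) (auto simp: abs_if split: if_splits)
  next
    fix x assume "x \<in> (\<Union>(i,s)\<in>{..<n} \<times> {-1,1}. {x \<in> cube n. \<forall>f\<in>{\<lambda>x. s * coord x i - 1}. f x \<ge> 0})"
    then obtain p where p: "p \<in> {..<n} \<times> {-1,1}"
      "x \<in> (case p of (i,s) \<Rightarrow> {x \<in> cube n. \<forall>f\<in>{\<lambda>x. s * coord x i - 1}. f x \<ge> 0})" by blast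
    obtain i s where "p = (i,s)" by force
    then have i: "i < n" "s \<in> {-1,1}" "x \<in> cube n" "s * coord x i \<ge> 1" using p by auto
    have "\<bar>coord x i\<bar> \<le> 1" using i by (auto simp: cube_def)
    then have "\<bar>coord x i\<bar> = 1" using i by auto
    then show "x \<in> bd_cube n" using i by (auto simp: bd_cube_iff)
  qed
  moreover have "compact_polyhedron \<dots>"
  proof (rule compact_polyhedron_UN)
    fix p :: "nat \<times> real" assume "p \<in> {..<n} \<times> {-1,1}"
    obtain i s where p: "p = (i,s)" by force
    have "polytope {x \<in> cube n. \<forall>f\<in>{\<lambda>x. s * coord x i - 1}. f x \<ge> 0}"
      by (rule polytope_Int_halfspaces[OF _ polytope_cube]) (auto intro!: aff_diff aff_mult aff_coord aff_const)
    then show "compact_polyhedron (case p of (i, s) \<Rightarrow> {x \<in> cube n. \<forall>f\<in>{\<lambda>x. s * coord x i - 1}. f x \<ge> 0})"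
      unfolding p by (simp add: polytope_compact_polyhedron)
  qed simp
  ultimately show ?thesis by simp
qed

section \<open>Characteristic maps\<close>

abbreviation char :: "nat \<Rightarrow> (point \<Rightarrow> point) \<Rightarrow> gcell \<Rightarrow> bool" where
  "char \<equiv> characteristic_map"

lemma charD:
  assumes "char n \<phi> C"
  shows "regular_map n \<phi>" "PL_on (cube n) \<phi>" "inj_on \<phi> (int_cube n)"
    "cell_int C = \<phi> ` int_cube n" "cell_bd C = \<phi> ` bd_cube n" "cell_int C \<inter> cell_bd C = {}"
  using assms unfolding characteristic_map_def regular_map_def by blast+

lemma charI:
  assumes "PL_on (cube n) \<phi>" "inj_on \<phi> (int_cube n)" "cell_int C = \<phi> ` int_cube n"
    "cell_bd C = \<phi> ` bd_cube n" "cell_int C \<inter> cell_bd C = {}"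
  shows "char n \<phi> C"
  using assms by (simp add: characteristic_map_def regular_map_def)

lemma char_carrier: "char n \<phi> C \<Longrightarrow> carrier C = \<phi> ` cube n"
  unfolding carrier_def cube_decomp by (simp add: charD(4,5) image_Un)

lemma char_is_cell: "char n \<phi> C \<Longrightarrow> is_cell n C"
  unfolding is_cell_def by blast

lemma char_dim_unique: "char n \<phi> C \<Longrightarrow> char m \<psi> C \<Longrightarrow> n = m"
  using is_cell_dim_unique char_is_cell by blast

lemma char_int_nonempty: "char n \<phi> C \<Longrightarrow> cell_int C \<noteq> {}"
  using int_cube_nonempty by (simp add: charD(4))

lemma char_continuous: "char n \<phi> C \<Longrightarrow> continuous_on (cube n) \<phi>"
  by (rule PL_on_continuous[OF charD(2)])

lemma char_closure: assumes "char n \<phi> C" shows "carrier C = closure (cell_int C)"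
proof
  have "\<phi> ` closure (int_cube n) \<subseteq> closure (cell_int C)"
    by (rule image_closure_subset) (use char_continuous[OF assms] charD(4)[OF assms] closure_subset[of "cell_int C"] closure_int_cube in auto)
  then show "carrier C \<subseteq> closure (cell_int C)" using char_carrier[OF assms] closure_int_cube by simp
  have "closed (carrier C)" using char_carrier[OF assms] compact_continuous_image[OF char_continuous[OF assms] compact_cube]
    by (simp add: compact_imp_closed)
  then show "closure (cell_int C) \<subseteq> carrier C" by (intro closure_minimal) (simp_all add: carrier_def)
qed

text \<open>The carrier is compact and the open cell is dense in it, so the open cell determines the
  boundary. Cells can therefore be compared by their interiors, as in
  \<open>cell_eqI\<close>.\<close>

lemma is_cell_bd: assumes "is_cell n C" shows "cell_bd C = closure (cell_int C) - cell_int C"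
proof -
  obtain \<phi> where c: "char n \<phi> C" using assms unfolding is_cell_def by blast
  have "cell_int C \<union> cell_bd C = closure (cell_int C)" using char_closure[OF c] by (simp add: carrier_def)
  then show ?thesis using charD(6)[OF c] by blast
qed

lemma cell_eqI: "is_cell n C \<Longrightarrow> is_cell m D \<Longrightarrow> cell_int C = cell_int D \<Longrightarrow> C = D"
  using is_cell_bd[of n C] is_cell_bd[of m D] by (simp add: gcell.expand)

lemma char_cong:
  assumes c: "char n \<phi> C" and e: "\<And>x. x \<in> cube n \<Longrightarrow> \<psi> x = \<phi> x" shows "char n \<psi> C"
proof (rule charI)
  show "PL_on (cube n) \<psi>" by (rule PL_on_cong[OF charD(2)[OF c] e])
  have 1: "\<psi> x = \<phi> x" if "x \<in> int_cube n" for x using that int_cube_subset e by blast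
  have 2: "\<psi> x = \<phi> x" if "x \<in> bd_cube n" for x using that bd_cube_subset e by blast
  show "inj_on \<psi> (int_cube n)" using charD(3)[OF c] inj_on_cong[of "int_cube n" \<psi> \<phi>] 1 by simp
  have "\<psi> ` int_cube n = \<phi> ` int_cube n" by (rule image_cong[OF refl 1])
  then show "cell_int C = \<psi> ` int_cube n" using charD(4)[OF c] by simp
  have "\<psi> ` bd_cube n = \<phi> ` bd_cube n" by (rule image_cong[OF refl 2])
  then show "cell_bd C = \<psi> ` bd_cube n" using charD(5)[OF c] by simp
qed (rule charD(6)[OF c])

lemma char_eq: "char n \<phi> C \<Longrightarrow> char n \<phi> D \<Longrightarrow> C = D"
  by (simp add: gcell.expand charD(4,5))

text \<open>Naming the image cell replaces the existential quantifier in
  \<open>regular_cellular_map\<close>: by \<open>char_compose_eq\<close> the cell \<open>C'\<close>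
  there must be this one.\<close>

definition gmap :: "(point \<Rightarrow> point) \<Rightarrow> gcell \<Rightarrow> gcell" where
  "gmap f C = GCell (f ` cell_int C) (f ` cell_bd C)"

lemma gmap_simps [simp]: "cell_int (gmap f C) = f ` cell_int C" "cell_bd (gmap f C) = f ` cell_bd C"
  "carrier (gmap f C) = f ` carrier C"
  by (simp_all add: gmap_def carrier_def image_Un)

lemma gmap_gmap: "gmap f (gmap g C) = gmap (f \<circ> g) C"
  by (simp add: gmap_def image_comp)

lemma gmap_cong: assumes "\<And>x. x \<in> carrier C \<Longrightarrow> f x = g x" shows "gmap f C = gmap g C"
proof -
  have "f ` cell_int C = g ` cell_int C" "f ` cell_bd C = g ` cell_bd C"
    by (rule image_cong[OF refl]; use assms in \<open>simp add: carrier_def\<close>)+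
  then show ?thesis by (simp add: gmap_def)
qed

lemma gmap_id: "gmap (\<lambda>x. x) C = C"
  by (simp add: gmap_def)

lemma char_compose_eq: assumes "char k \<psi> D" "char k (f \<circ> \<psi>) C" shows "C = gmap f D"
  using charD(4,5)[OF assms(1)] charD(4,5)[OF assms(2)] by (simp add: gmap_def gcell.expand image_comp)

lemma char_image:
  assumes c: "char n \<phi> C" and f: "PL_on (carrier C) f" "inj_on f (carrier C)"
  shows "char n (f \<circ> \<phi>) (gmap f C)"
proof (rule charI)
  show "PL_on (cube n) (f \<circ> \<phi>)"
    by (rule PL_on_compose[OF charD(2)[OF c] f(1)]) (simp add: char_carrier[OF c])
  have s: "\<phi> ` int_cube n \<subseteq> carrier C" using charD(4)[OF c] by (simp add: carrier_def)
  show "inj_on (f \<circ> \<phi>) (int_cube n)"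
    by (rule comp_inj_on[OF charD(3)[OF c] inj_on_subset[OF f(2) s]])
  show "cell_int (gmap f C) \<inter> cell_bd (gmap f C) = {}"
  proof -
    have "f ` cell_int C \<inter> f ` cell_bd C = f ` (cell_int C \<inter> cell_bd C)"
      by (rule inj_on_image_Int[OF f(2), symmetric]) (simp_all add: carrier_def)
    then show ?thesis using charD(6)[OF c] by simp
  qed
qed (simp_all add: charD(4,5)[OF c] image_comp)

definition cube_homeo :: "nat \<Rightarrow> (point \<Rightarrow> point) \<Rightarrow> bool" where
  "cube_homeo n h \<longleftrightarrow> PL_on (cube n) h \<and> inj_on h (cube n) \<and> h ` int_cube n = int_cube n \<and> h ` bd_cube n = bd_cube n"

lemma cube_homeo_image: "cube_homeo n h \<Longrightarrow> h ` cube n = cube n"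
  unfolding cube_homeo_def cube_decomp image_Un by simp

lemma char_reparam:
  assumes c: "char n \<phi> C" and h: "cube_homeo n h" shows "char n (\<phi> \<circ> h) C"
proof (rule charI)
  have h': "PL_on (cube n) h" "inj_on h (cube n)" "h ` int_cube n = int_cube n" "h ` bd_cube n = bd_cube n"
    using h by (simp_all add: cube_homeo_def)
  show "PL_on (cube n) (\<phi> \<circ> h)"
    by (rule PL_on_compose[OF h'(1) charD(2)[OF c]]) (simp add: cube_homeo_image[OF h])
  show "inj_on (\<phi> \<circ> h) (int_cube n)"
    by (rule comp_inj_on[OF inj_on_subset[OF h'(2) int_cube_subset]]) (simp add: h'(3) charD(3)[OF c])
  show "cell_int C = (\<phi> \<circ> h) ` int_cube n" "cell_bd C = (\<phi> \<circ> h) ` bd_cube n"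
    unfolding image_comp[symmetric] h' charD(4,5)[OF c] by (rule refl)+
qed (rule charD(6)[OF c])

lemma small_bound:
  fixes a K :: real
  assumes "\<And>t. 0 < t \<Longrightarrow> t \<le> 1 \<Longrightarrow> a \<le> t * K" and K: "0 \<le> K" shows "a \<le> 0"
proof (rule ccontr)
  assume "\<not> a \<le> 0"
  then have a: "a > 0" by simp
  define t where "t = min 1 (a / (2 * (K + 1)))"
  have t: "0 < t" "t \<le> 1" "t \<le> a / (2 * (K + 1))" using a K by (auto simp: t_def)
  have "a \<le> t * K" using assms(1) t by blast
  also have "\<dots> \<le> a / (2 * (K + 1)) * K" by (rule mult_right_mono[OF t(3) K])
  also have "\<dots> < a" using a K by (simp add: field_simps add_nonneg_pos)
  finally show False by simp
qed

text \<open>On the interior \<open>\<psi>\<^sup>-\<^sup>1 \<circ> \<phi>\<close> is Lipschitz, so the affine pieces of it fit together over the boundary.\<close>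

lemma char_lift:
  assumes c: "char n \<phi> C" and d: "char n \<psi> C"
  shows "\<exists>h. PL_on (cube n) h \<and> h ` cube n \<subseteq> cube n \<and> h ` int_cube n \<subseteq> int_cube n \<and>
    (\<forall>x\<in>cube n. \<psi> (h x) = \<phi> x)"
proof -
  obtain \<P> A B where pc: "pieces n \<phi> \<P> A B" using regular_pieces[OF charD(1)[OF c]] by blast
  obtain \<Q> A' B' where qc: "pieces n \<psi> \<Q> A' B'" using regular_pieces[OF charD(1)[OF d]] by blast
  note P = piecesD[OF pc] and Q = piecesD[OF qc]
  define h0 where "h0 = (\<lambda>x. inv_into (int_cube n) \<psi> (\<phi> x))"
  have img: "\<phi> ` int_cube n = \<psi> ` int_cube n" using charD(4)[OF c] charD(4)[OF d] by simp
  have h0: "h0 x \<in> int_cube n" "\<psi> (h0 x) = \<phi> x" if "x \<in> int_cube n" for x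
  proof -
    have "\<phi> x \<in> \<psi> ` int_cube n" using that img by blast
    then show "h0 x \<in> int_cube n" "\<psi> (h0 x) = \<phi> x" unfolding h0_def by (rule inv_into_into, rule f_inv_into_f)
  qed
  \<comment> \<open>\<open>R (p,q)\<close> is the part of the piece \<open>p\<close> that
    \<open>\<phi>\<close> maps into the image of the piece \<open>q\<close> of
    \<open>\<psi>\<close>. On it \<open>H (p,q)\<close> is an affine lift, because
    \<open>B' q\<close> inverts \<open>\<psi>\<close> on \<open>q\<close>.\<close>
  define R where "R = (\<lambda>(p,q). {x\<in>p. A p x \<in> A' q ` q})"
  define H where "H = (\<lambda>(p,q) x. B' q (A p x))"
  define I where "I = \<P> \<times> \<Q>"
  have fI: "finite I" using P(1) Q(1) by (simp add: I_def)
  have Rp: "polytope (R i)" if ii: "i \<in> I" for i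
  proof -
    obtain p q where i: "i = (p,q)" "p \<in> \<P>" "q \<in> \<Q>" using ii by (auto simp: I_def)
    show ?thesis unfolding i R_def prod.case
      by (rule polytope_preimage[OF P(3)[OF i(2)] polytope_aff_image[OF Q(5)[OF i(3)] Q(3)[OF i(3)]] P(5)[OF i(2)]])
  qed
  have Ha: "aff (H i)" if ii: "i \<in> I" for i
  proof -
    obtain p q where i: "i = (p,q)" "p \<in> \<P>" "q \<in> \<Q>" using ii by (auto simp: I_def)
    show ?thesis unfolding i H_def prod.case by (rule aff_compose[OF Q(6)[OF i(3)] P(5)[OF i(2)]])
  qed
  have RH: "x \<in> cube n \<and> H i x \<in> cube n \<and> \<psi> (H i x) = \<phi> x" if x: "i \<in> I" "x \<in> R i" for i x
  proof -
    obtain p q where i: "i = (p,q)" "p \<in> \<P>" "q \<in> \<Q>" using x by (auto simp: I_def)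
    have x': "x \<in> p" "A p x \<in> A' q ` q" using x(2) by (simp_all add: i R_def)
    obtain y where y: "y \<in> q" "A p x = A' q y" using x'(2) by blast
    have "H i x = y" unfolding i H_def prod.case y(2) by (rule Q(9)[OF i(3) y(1)])
    moreover have "\<psi> y = \<phi> x" using Q(8)[OF i(3) y(1)] P(8)[OF i(2) x'(1)] y(2) by simp
    moreover have "y \<in> cube n" "x \<in> cube n" using y(1) i x'(1) P(2) Q(2) by blast+
    ultimately show ?thesis by simp
  qed
  have Hh0: "H i x = h0 x" if x: "i \<in> I" "x \<in> R i" "x \<in> int_cube n" for i x
  proof -
    have y: "H i x \<in> cube n" "\<psi> (H i x) = \<phi> x" using RH[OF x(1,2)] by auto
    have "\<phi> x \<in> cell_int C" using x(3) charD(4)[OF c] by simp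
    then have "H i x \<notin> bd_cube n" using y(2) charD(5,6)[OF d] by (metis IntI empty_iff imageI)
    then have "H i x \<in> int_cube n" using y(1) cube_decomp by blast
    moreover have "\<psi> (H i x) = \<psi> (h0 x)" using y(2) h0(2)[OF x(3)] by simp
    ultimately show ?thesis using inj_onD[OF charD(3)[OF d]] h0(1)[OF x(3)] by blast
  qed
  have cov: "\<exists>i\<in>I. x \<in> R i" if x: "x \<in> int_cube n" for x
  proof -
    obtain p where p: "p \<in> \<P>" "x \<in> p" using x int_cube_subset P(2) by blast
    obtain q where q: "q \<in> \<Q>" "h0 x \<in> q" using h0(1)[OF x] int_cube_subset Q(2) by blast
    have "A p x = A' q (h0 x)" using P(8)[OF p] Q(8)[OF q] h0(2)[OF x] by simp
    then have "x \<in> R (p,q)" using p q by (simp add: R_def)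
    then show ?thesis using p q unfolding I_def by blast
  qed
  obtain M where M: "M \<ge> 0" "\<And>i x y. i \<in> I \<Longrightarrow> x \<in> Rn n \<Longrightarrow> y \<in> Rn n \<Longrightarrow> norm (H i x - H i y) \<le> M * norm (x - y)"
  proof -
    have "\<forall>i\<in>I. \<exists>M\<ge>0. \<forall>x\<in>Rn n. \<forall>y\<in>Rn n. norm (H i x - H i y) \<le> M * norm (x - y)"
      using aff_lipschitz Ha by blast
    then obtain m where m: "\<forall>i\<in>I. m i \<ge> 0 \<and> (\<forall>x\<in>Rn n. \<forall>y\<in>Rn n. norm (H i x - H i y) \<le> m i * norm (x - y))"
      by metis
    have "norm (H i x - H i y) \<le> (\<Sum>i\<in>I. m i) * norm (x - y)" if h: "i \<in> I" "x \<in> Rn n" "y \<in> Rn n" for i x y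
    proof -
      have "norm (H i x - H i y) \<le> m i * norm (x - y)" using m h by blast
      also have "\<dots> \<le> (\<Sum>i\<in>I. m i) * norm (x - y)"
        by (intro mult_right_mono member_le_sum[OF h(1) _ fI]) (use m in auto)
      finally show ?thesis .
    qed
    moreover have "(\<Sum>i\<in>I. m i) \<ge> 0" by (rule sum_nonneg) (use m in blast)
    ultimately show ?thesis using that by blast
  qed
  have lip: "norm (h0 x - h0 y) \<le> M * norm (x - y)" if xy: "x \<in> int_cube n" "y \<in> int_cube n" for x y
  proof -
    let ?c = "\<lambda>t::real. x + t *\<^sub>R (y - x)"
    have c: "?c t \<in> int_cube n" if "t \<in> {0..1}" for t
    proof -
      have "(1 - t) *\<^sub>R x + t *\<^sub>R y \<in> int_cube n" by (rule convexD[OF convex_int_cube xy]) (use that in auto)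
      then show ?thesis by (simp add: algebra_simps)
    qed
    \<comment> \<open>A segment in the open cube is covered by finitely many closed parts on each of
      which \<open>h0\<close> is one of the affine maps; Lipschitz bounds on such parts of an
      interval combine with the same constant.\<close>
    have "(M * norm (y - x))-lipschitz_on {0..1} (\<lambda>t. h0 (?c t))"
    proof (rule lipschitz_on_closed_Union[where I = I and U = "\<lambda>i. {0..1} \<inter> ?c -` R i"])
      fix i assume i: "i \<in> I"
      show "closed ({0..1} \<inter> ?c -` R i)"
        by (intro continuous_closed_preimage continuous_intros polytope_imp_closed Rp i)
      show "(M * norm (y - x))-lipschitz_on ({0..1} \<inter> ?c -` R i) (\<lambda>t. h0 (?c t))"
      proof (rule lipschitz_onI)
        fix s t assume st: "s \<in> {0..1} \<inter> ?c -` R i" "t \<in> {0..1} \<inter> ?c -` R i"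
        have ic: "?c s \<in> int_cube n" "?c t \<in> int_cube n" by (rule c; use st in blast)+
        have ri: "?c s \<in> R i" "?c t \<in> R i" using st by blast+
        have e: "H i (?c s) = h0 (?c s)" "H i (?c t) = h0 (?c t)"
          using Hh0[OF i ri(1) ic(1)] Hh0[OF i ri(2) ic(2)] .
        have "dist (h0 (?c s)) (h0 (?c t)) = norm (H i (?c s) - H i (?c t))"
          by (simp only: e dist_norm)
        also have "\<dots> \<le> M * norm (?c s - ?c t)"
          by (rule M(2)[OF i subsetD[OF int_cube_subset_Rn ic(1)] subsetD[OF int_cube_subset_Rn ic(2)]])
        also have "?c s - ?c t = (s - t) *\<^sub>R (y - x)" by (simp add: algebra_simps)
        also have "M * norm ((s - t) *\<^sub>R (y - x)) = M * norm (y - x) * dist s t"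
          by (simp add: dist_norm)
        finally show "dist (h0 (?c s)) (h0 (?c t)) \<le> M * norm (y - x) * dist s t" .
      qed (use M(1) in simp)
    next
      show "{0..1} \<subseteq> (\<Union>i\<in>I. {0..1} \<inter> ?c -` R i)" using c cov by blast
    qed (use fI M(1) in auto)
    from lipschitz_onD[OF this, of 1 0] show ?thesis by (simp add: dist_norm norm_minus_commute)
  qed
  \<comment> \<open>Only parts that meet the open cube are kept. On a part inside the boundary
    \<open>H i\<close> may select a wrong preimage, as \<open>\<psi>\<close> need not be injective
    there.\<close>
  define G where "G = {i\<in>I. R i \<inter> int_cube n \<noteq> {}}"
  have GI: "i \<in> I" if "i \<in> G" for i using that by (simp add: G_def)
  have fG: "finite G" using fI by (simp add: G_def)
  have agree: "H i x = H j x" if ij: "i \<in> G" "j \<in> G" and x: "x \<in> R i" "x \<in> R j" for i j x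
  proof -
    obtain z where z: "z \<in> R i" "z \<in> int_cube n" using ij(1) by (auto simp: G_def)
    obtain w where w: "w \<in> R j" "w \<in> int_cube n" using ij(2) by (auto simp: G_def)
    have xc: "x \<in> cube n" using RH[OF GI[OF ij(1)] x(1)] by blast
    define D where "D = H i x - H j x"
    define F where "F = (H i z - H i x) - (H j w - H j x)"
    \<comment> \<open>The points reached from \<open>x\<close> after a fraction \<open>t\<close> of
      the way to \<open>z\<close> and to \<open>w\<close> have distance
      \<open>t * norm (z - w)\<close>, and the Lipschitz bound applies to them. As \<open>t\<close>
      tends to 0, the two affine maps are seen to agree at \<open>x\<close>.\<close>
    have "norm D \<le> t * (norm F + M * norm (z - w))" if t: "0 < t" "t \<le> 1" for t
    proof -
      have in1: "x + t *\<^sub>R (z - x) \<in> R i \<inter> int_cube n"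
      proof -
        have "(1 - t) *\<^sub>R x + t *\<^sub>R z \<in> R i"
          by (rule convexD[OF polytope_imp_convex[OF Rp[OF GI[OF ij(1)]]] x(1) z(1)]) (use t in auto)
        moreover have "(1 - t) *\<^sub>R x + t *\<^sub>R z = x + t *\<^sub>R (z - x)" by (simp add: algebra_simps)
        ultimately show ?thesis using cube_shrink[OF xc z(2) t] by simp
      qed
      have in2: "x + t *\<^sub>R (w - x) \<in> R j \<inter> int_cube n"
      proof -
        have "(1 - t) *\<^sub>R x + t *\<^sub>R w \<in> R j"
          by (rule convexD[OF polytope_imp_convex[OF Rp[OF GI[OF ij(2)]]] x(2) w(1)]) (use t in auto)
        moreover have "(1 - t) *\<^sub>R x + t *\<^sub>R w = x + t *\<^sub>R (w - x)" by (simp add: algebra_simps)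
        ultimately show ?thesis using cube_shrink[OF xc w(2) t] by simp
      qed
      have "norm (H i (x + t *\<^sub>R (z - x)) - H j (x + t *\<^sub>R (w - x))) \<le> M * norm ((x + t *\<^sub>R (z - x)) - (x + t *\<^sub>R (w - x)))"
        using lip[of "x + t *\<^sub>R (z - x)" "x + t *\<^sub>R (w - x)"] in1 in2
          Hh0[OF GI[OF ij(1)], of "x + t *\<^sub>R (z - x)"] Hh0[OF GI[OF ij(2)], of "x + t *\<^sub>R (w - x)"] by simp
      also have "(x + t *\<^sub>R (z - x)) - (x + t *\<^sub>R (w - x)) = t *\<^sub>R (z - w)" by (simp add: algebra_simps)
      also have "H i (x + t *\<^sub>R (z - x)) - H j (x + t *\<^sub>R (w - x)) = D + t *\<^sub>R F"
        unfolding D_def F_def aff_segment[OF Ha[OF GI[OF ij(1)]]] aff_segment[OF Ha[OF GI[OF ij(2)]]]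
        by (simp add: algebra_simps)
      finally have b: "norm (D + t *\<^sub>R F) \<le> M * (t * norm (z - w))" using t by simp
      have "norm D \<le> norm (D + t *\<^sub>R F) + norm (t *\<^sub>R F)"
        using norm_triangle_ineq4[of "D + t *\<^sub>R F" "t *\<^sub>R F"] by simp
      also have "norm (t *\<^sub>R F) = t * norm F" using t by simp
      also have "norm (D + t *\<^sub>R F) + t * norm F \<le> t * (norm F + M * norm (z - w))"
        using b by (simp add: algebra_simps)
      finally show ?thesis by simp
    qed
    then have "norm D \<le> 0" using M(1) small_bound[of "norm D" "norm F + M * norm (z - w)"] by auto
    then show ?thesis by (simp add: D_def)
  qed
  have cube_G: "cube n = (\<Union>i\<in>G. R i)"
  proof
    have 1: "closed (\<Union>i\<in>G. R i)" by (intro closed_UN fG ballI polytope_imp_closed Rp GI)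
    have 2: "int_cube n \<subseteq> (\<Union>i\<in>G. R i)"
    proof
      fix x assume x: "x \<in> int_cube n"
      then obtain i where i: "i \<in> I" "x \<in> R i" using cov by blast
      then have "i \<in> G" using x by (auto simp: G_def)
      then show "x \<in> (\<Union>i\<in>G. R i)" using i(2) by (rule UN_I)
    qed
    show "cube n \<subseteq> (\<Union>i\<in>G. R i)" using closure_minimal[OF 2 1] by (simp only: closure_int_cube)
    show "(\<Union>i\<in>G. R i) \<subseteq> cube n" by (intro UN_least subsetI) (rule RH[THEN conjunct1, OF GI])
  qed
  define h where "h = (\<lambda>x. H (SOME i. i \<in> G \<and> x \<in> R i) x)"
  have hH: "h x = H i x" if "i \<in> G" "x \<in> R i" for i x
  proof -
    have "(SOME i. i \<in> G \<and> x \<in> R i) \<in> G \<and> x \<in> R (SOME i. i \<in> G \<and> x \<in> R i)"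
      by (rule someI[of _ i]) (use that in simp)
    then show ?thesis unfolding h_def using agree[OF _ that(1) _ that(2)] by blast
  qed
  have "PL_on (cube n) h"
    by (rule PL_onI[OF fG, of R H, OF Rp[OF GI] Ha[OF GI] cube_G hH])
  moreover have hc: "h x \<in> cube n \<and> \<psi> (h x) = \<phi> x" if x: "x \<in> cube n" for x
  proof -
    obtain i where i: "i \<in> G" "x \<in> R i" using x unfolding cube_G by (elim UN_E)
    show ?thesis using hH[OF i] RH[OF GI[OF i(1)] i(2)] by simp
  qed
  moreover have "h x \<in> int_cube n" if x: "x \<in> int_cube n" for x
  proof -
    obtain i where i: "i \<in> G" "x \<in> R i" using subsetD[OF int_cube_subset x] unfolding cube_G by (elim UN_E)
    show ?thesis using hH[OF i] Hh0[OF GI[OF i(1)] i(2) x] h0(1)[OF x] by simp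
  qed
  ultimately show ?thesis by (intro exI[of _ h]) auto
qed

text \<open>The lifts in the two directions are inverse to each other: on the open cube because the
  characteristic maps are injective there, and on the boundary by continuity.\<close>

lemma char_unique:
  assumes c: "char n \<phi> C" and d: "char n \<psi> C"
  shows "\<exists>h. cube_homeo n h \<and> (\<forall>x\<in>cube n. \<psi> (h x) = \<phi> x)"
proof -
  obtain h where h: "PL_on (cube n) h" "h ` cube n \<subseteq> cube n" "h ` int_cube n \<subseteq> int_cube n"
    "\<forall>x\<in>cube n. \<psi> (h x) = \<phi> x" using char_lift[OF c d] by blast
  obtain k where k: "PL_on (cube n) k" "k ` cube n \<subseteq> cube n" "k ` int_cube n \<subseteq> int_cube n"
    "\<forall>x\<in>cube n. \<phi> (k x) = \<psi> x" using char_lift[OF d c] by blast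
  have inv: "f (g x) = x" if "x \<in> cube n" "PL_on (cube n) f" "PL_on (cube n) g" "g ` cube n \<subseteq> cube n"
    "f ` int_cube n \<subseteq> int_cube n" "g ` int_cube n \<subseteq> int_cube n"
    "\<forall>x\<in>cube n. \<theta> (f x) = \<eta> x" "\<forall>x\<in>cube n. \<eta> (g x) = \<theta> x" "inj_on \<theta> (int_cube n)" for f g \<theta> \<eta> x
  proof -
    have "(f \<circ> g) x = (\<lambda>x. x) x"
    proof (rule eq_on_cube[of n])
      show "continuous_on (cube n) (f \<circ> g)"
        by (rule PL_on_continuous[OF PL_on_compose[OF that(3,2,4)]])
      show "(f \<circ> g) x = x" if x: "x \<in> int_cube n" for x
      proof -
        have "x \<in> cube n" "g x \<in> cube n" "f (g x) \<in> int_cube n"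
          using x \<open>f ` int_cube n \<subseteq> int_cube n\<close> \<open>g ` int_cube n \<subseteq> int_cube n\<close> \<open>g ` cube n \<subseteq> cube n\<close> int_cube_subset by blast+
        moreover from this have "\<theta> (f (g x)) = \<theta> x"
          using \<open>\<forall>x\<in>cube n. \<theta> (f x) = \<eta> x\<close> \<open>\<forall>x\<in>cube n. \<eta> (g x) = \<theta> x\<close> by simp
        ultimately show ?thesis using \<open>inj_on \<theta> (int_cube n)\<close> x by (auto dest: inj_onD)
      qed
    qed (use that(1) in \<open>auto intro: continuous_on_id\<close>)
    then show ?thesis by simp
  qed
  have kh: "k (h x) = x" if "x \<in> cube n" for x
    by (rule inv[OF that k(1) h(1) h(2) k(3) h(3) k(4) h(4) charD(3)[OF c]])
  have hk: "h (k x) = x" if "x \<in> cube n" for x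
    by (rule inv[OF that h(1) k(1) k(2) h(3) k(3) h(4) k(4) charD(3)[OF d]])
  have "cube_homeo n h"
    unfolding cube_homeo_def
  proof (intro conjI h(1))
    show "inj_on h (cube n)" by (rule inj_on_inverseI[of _ k]) (rule kh)
    show "h ` int_cube n = int_cube n"
    proof
      show "int_cube n \<subseteq> h ` int_cube n"
      proof
        fix x assume x: "x \<in> int_cube n"
        then have "h (k x) = x" "k x \<in> int_cube n" using hk k(3) int_cube_subset by blast+
        then show "x \<in> h ` int_cube n" by force
      qed
    qed (rule h(3))
    show "h ` bd_cube n = bd_cube n"
    proof
      show "h ` bd_cube n \<subseteq> bd_cube n"
      proof
        fix y assume "y \<in> h ` bd_cube n"
        then obtain x where x: "x \<in> bd_cube n" "y = h x" by blast
        have xc: "x \<in> cube n" using x(1) bd_cube_subset by blast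
        have "y \<notin> int_cube n"
        proof
          assume "y \<in> int_cube n"
          then have "k y \<in> int_cube n" using k(3) by blast
          then show False using x kh[OF xc] int_bd_disjoint by auto
        qed
        then show "y \<in> bd_cube n" using h(2) xc x(2) cube_decomp by blast
      qed
      show "bd_cube n \<subseteq> h ` bd_cube n"
      proof
        fix x assume x: "x \<in> bd_cube n"
        then have xc: "x \<in> cube n" using bd_cube_subset by blast
        have "k x \<notin> int_cube n"
        proof
          assume "k x \<in> int_cube n"
          then have "h (k x) \<in> int_cube n" using h(3) by blast
          then show False using x hk[OF xc] int_bd_disjoint by auto
        qed
        then have "k x \<in> bd_cube n" using k(2) xc cube_decomp by blast
        then show "x \<in> h ` bd_cube n" using hk[OF xc] by force
      qed
    qed
  qed
  then show ?thesis using h(4) by (intro exI[of _ h] conjI)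
qed

section \<open>PLCW complexes without dimensions\<close>

text \<open>The combinatorial content of \<open>regular_cellular_map\<close>, with the image cell
  named; piecewise linearity of \<open>f\<close> is supplied separately when the two notions are
  compared.\<close>

definition cellular :: "gcell set \<Rightarrow> gcell set \<Rightarrow> (point \<Rightarrow> point) \<Rightarrow> bool" where
  "cellular L K f \<longleftrightarrow> (\<forall>D\<in>L. gmap f D \<in> K \<and> (\<forall>k \<psi>. char k \<psi> D \<longrightarrow> char k (f \<circ> \<psi>) (gmap f D)))"

lemma cellularD:
  "cellular L K f \<Longrightarrow> D \<in> L \<Longrightarrow> gmap f D \<in> K"
  "cellular L K f \<Longrightarrow> D \<in> L \<Longrightarrow> char k \<psi> D \<Longrightarrow> char k (f \<circ> \<psi>) (gmap f D)"
  unfolding cellular_def by blast+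

text \<open>One characteristic map per cell suffices because any other one arises from it by a
  homeomorphism of the cube.\<close>

lemma cellularI:
  assumes "\<And>D. D \<in> L \<Longrightarrow> \<exists>k \<psi>. char k \<psi> D \<and> char k (f \<circ> \<psi>) (gmap f D) \<and> gmap f D \<in> K"
  shows "cellular L K f"
  unfolding cellular_def
proof (intro ballI conjI allI impI)
  fix D assume D: "D \<in> L"
  then obtain k \<psi> where k: "char k \<psi> D" "char k (f \<circ> \<psi>) (gmap f D)" "gmap f D \<in> K" using assms by blast
  show "gmap f D \<in> K" by fact
  fix k' \<psi>' assume c: "char k' \<psi>' D"
  have e: "k' = k" using char_dim_unique[OF c k(1)] .
  obtain h where h: "cube_homeo k h" "\<forall>x\<in>cube k. \<psi> (h x) = \<psi>' x" using char_unique[OF c[unfolded e] k(1)] by blast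
  have "char k (f \<circ> \<psi> \<circ> h) (gmap f D)" by (rule char_reparam[OF k(2) h(1)])
  then show "char k' (f \<circ> \<psi>') (gmap f D)" unfolding e by (rule char_cong) (use h(2) in simp)
qed

lemma cellular_mono: "cellular L K f \<Longrightarrow> K \<subseteq> K' \<Longrightarrow> cellular L K' f"
  unfolding cellular_def by blast

lemma cellular_subset: "cellular L K f \<Longrightarrow> L' \<subseteq> L \<Longrightarrow> cellular L' K f"
  unfolding cellular_def by blast

lemma carrier_subset_support: "D \<in> L \<Longrightarrow> carrier D \<subseteq> support L"
  unfolding support_def by blast

lemma cellular_cong:
  assumes c: "cellular L K f" and e: "\<And>x. x \<in> support L \<Longrightarrow> g x = f x" shows "cellular L K g"
  unfolding cellular_def
proof (intro ballI conjI allI impI)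
  fix D assume D: "D \<in> L"
  have e': "g x = f x" if "x \<in> carrier D" for x using e carrier_subset_support[OF D] that by blast
  have gm: "gmap g D = gmap f D" by (rule gmap_cong) (rule e')
  show "gmap g D \<in> K" using cellularD(1)[OF c D] gm by simp
  fix k \<psi> assume k: "char k \<psi> D"
  show "char k (g \<circ> \<psi>) (gmap g D)" unfolding gm
    by (rule char_cong[OF cellularD(2)[OF c D k]]) (use e' char_carrier[OF k] in simp)
qed

lemma cellular_compose:
  assumes "cellular L K f" "cellular K M g" shows "cellular L M (g \<circ> f)"
  unfolding cellular_def
proof (intro ballI conjI allI impI)
  fix D assume D: "D \<in> L"
  have gm: "gmap (g \<circ> f) D = gmap g (gmap f D)" by (simp add: gmap_gmap)
  show "gmap (g \<circ> f) D \<in> M" unfolding gm using cellularD(1) assms D by blast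
  fix k \<psi> assume k: "char k \<psi> D"
  show "char k (g \<circ> f \<circ> \<psi>) (gmap (g \<circ> f) D)" unfolding gm o_assoc[symmetric]
    by (rule cellularD(2)[OF assms(2) cellularD(1)[OF assms(1) D] cellularD(2)[OF assms(1) D k]])
qed

lemma cellular_id: "K \<subseteq> M \<Longrightarrow> cellular K M (\<lambda>x. x)"
  unfolding cellular_def gmap_id by (auto simp: o_def)

text \<open>\<open>PLCW\<close> without dimensions and skeleta: the recursion runs along the
  pullback decompositions, so induction provides its hypothesis exactly for the decomposition of the
  boundary sphere. The two notions are shown to agree in \<open>PLCW_imp_good\<close> and
  \<open>good_imp_PLCW\<close>.\<close>

inductive good :: "gcell set \<Rightarrow> bool" where
  goodI: "good K" if "finite K" "\<forall>A\<in>K. \<forall>B\<in>K. A \<noteq> B \<longrightarrow> cell_int A \<inter> cell_int B = {}"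
    "\<forall>A\<in>K. \<exists>n. is_cell n A"
    "\<forall>A\<in>K. \<forall>n \<phi>. char n \<phi> A \<longrightarrow> (\<exists>L. good L \<and> support L = bd_cube n \<and> cellular L K \<phi>)"

lemma goodD:
  assumes "good K"
  shows "finite K" "\<And>A B. A \<in> K \<Longrightarrow> B \<in> K \<Longrightarrow> cell_int A \<inter> cell_int B \<noteq> {} \<Longrightarrow> A = B"
    "\<And>A. A \<in> K \<Longrightarrow> \<exists>n \<phi>. char n \<phi> A"
    "\<And>A n \<phi>. A \<in> K \<Longrightarrow> char n \<phi> A \<Longrightarrow> \<exists>L. good L \<and> support L = bd_cube n \<and> cellular L K \<phi>"
proof -
  from assms have *: "finite K" "\<forall>A\<in>K. \<forall>B\<in>K. A \<noteq> B \<longrightarrow> cell_int A \<inter> cell_int B = {}"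
    "\<forall>A\<in>K. \<exists>n. is_cell n A"
    "\<forall>A\<in>K. \<forall>n \<phi>. char n \<phi> A \<longrightarrow> (\<exists>L. good L \<and> support L = bd_cube n \<and> cellular L K \<phi>)"
    by (auto elim: good.cases)
  show "finite K" by (rule *(1))
  show "A = B" if "A \<in> K" "B \<in> K" "cell_int A \<inter> cell_int B \<noteq> {}" for A B using *(2) that by blast
  show "\<exists>n \<phi>. char n \<phi> A" if "A \<in> K" for A using *(3) that unfolding is_cell_def by blast
  show "\<exists>L. good L \<and> support L = bd_cube n \<and> cellular L K \<phi>" if "A \<in> K" "char n \<phi> A" for A n \<phi>
    by (rule *(4)[rule_format, OF that])
qed

lemma good_empty: "good {}"
  by (rule goodI) auto

lemma good_cell_unique: "good K \<Longrightarrow> A \<in> K \<Longrightarrow> B \<in> K \<Longrightarrow> x \<in> cell_int A \<Longrightarrow> x \<in> cell_int B \<Longrightarrow> A = B"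
  by (rule goodD(2)[of K A B]) auto

lemma bd_image_cellular:
  assumes "char n \<phi> A" "support L = bd_cube n"
  shows "cell_bd A = (\<Union>D\<in>L. carrier (gmap \<phi> D))"
proof -
  have "cell_bd A = \<phi> ` support L" using charD(5)[OF assms(1)] assms(2) by simp
  then show ?thesis unfolding support_def by (simp add: image_UN)
qed

text \<open>A boundary point of a cell is the image of a point of the sphere, which by induction
  lies in an open cell of the pullback; cellular maps take open cells to open cells.\<close>

lemma good_support: "good K \<Longrightarrow> support K = (\<Union>A\<in>K. cell_int A)"
proof (induction rule: good.induct)
  case (goodI K)
  have "carrier A \<subseteq> (\<Union>A\<in>K. cell_int A)" if A: "A \<in> K" for A
  proof -
    obtain n \<phi> where c: "char n \<phi> A" using goodI(3) A unfolding is_cell_def by blast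
    obtain L where L: "support L = (\<Union>A\<in>L. cell_int A)" "support L = bd_cube n" "cellular L K \<phi>"
      using goodI(4)[rule_format, OF A c] by blast
    have "cell_bd A = \<phi> ` support L" using charD(5)[OF c] L(2) by simp
    also have "\<dots> = (\<Union>D\<in>L. cell_int (gmap \<phi> D))" unfolding L(1) by (simp add: image_UN)
    also have "\<dots> \<subseteq> (\<Union>A\<in>K. cell_int A)" using cellularD(1)[OF L(3)] by blast
    finally show ?thesis using A unfolding carrier_def by blast
  qed
  then show ?case unfolding support_def carrier_def by blast
qed

lemma cellular_transport:
  assumes L: "\<And>D. D \<in> L \<Longrightarrow> \<exists>n \<phi>. char n \<phi> D" and h: "PL_on (support L) h" "inj_on h (support L)"
  shows "cellular L (gmap h ` L) h"
proof (rule cellularI)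
  fix D assume D: "D \<in> L"
  obtain n \<phi> where c: "char n \<phi> D" using L[OF D] by blast
  have "compact_polyhedron (carrier D)"
    using PL_on_image[OF charD(2)[OF c]] char_carrier[OF c] by simp
  then have "PL_on (carrier D) h" by (rule PL_on_subset[OF h(1) _ carrier_subset_support[OF D]])
  then have "char n (h \<circ> \<phi>) (gmap h D)"
    by (rule char_image[OF c _ inj_on_subset[OF h(2) carrier_subset_support[OF D]]])
  then show "\<exists>k \<psi>. char k \<psi> D \<and> char k (h \<circ> \<psi>) (gmap h D) \<and> gmap h D \<in> gmap h ` L" using c D by blast
qed

lemma support_gmap: "support (gmap h ` L) = h ` support L"
  unfolding support_def by auto

text \<open>By uniqueness up to a homeomorphism \<open>k\<close> of the cube, every characteristic
  map of an image cell equals \<open>h \<circ> (\<psi> \<circ> k)\<close> on the cube, so the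
  pullback along \<open>\<psi> \<circ> k\<close> serves for it as well.\<close>

lemma good_transport:
  assumes L: "good L" and h: "PL_on (support L) h" "inj_on h (support L)"
  shows "good (gmap h ` L)"
proof (rule goodI)
  note cel = cellular_transport[OF goodD(3)[OF L] h]
  show "finite (gmap h ` L)" using goodD(1)[OF L] by simp
  show "\<forall>A\<in>gmap h ` L. \<forall>B\<in>gmap h ` L. A \<noteq> B \<longrightarrow> cell_int A \<inter> cell_int B = {}"
  proof (intro ballI impI)
    fix A' B' assume AB: "A' \<in> gmap h ` L" "B' \<in> gmap h ` L" "A' \<noteq> B'"
    then obtain A B where A: "A \<in> L" "A' = gmap h A" and B: "B \<in> L" "B' = gmap h B" by blast
    have "cell_int A \<inter> cell_int B = {}" using goodD(2)[OF L A(1) B(1)] A B AB(3) by blast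
    moreover have "cell_int A \<subseteq> support L" "cell_int B \<subseteq> support L"
      using carrier_subset_support A B unfolding carrier_def by blast+
    ultimately have "h ` cell_int A \<inter> h ` cell_int B = {}"
      using inj_on_image_Int[OF h(2), of "cell_int A" "cell_int B"] by simp
    then show "cell_int A' \<inter> cell_int B' = {}" by (simp add: A B)
  qed
  show "\<forall>A\<in>gmap h ` L. \<exists>n. is_cell n A"
  proof
    fix A' assume "A' \<in> gmap h ` L"
    then obtain A where A: "A \<in> L" "A' = gmap h A" by blast
    obtain n \<phi> where "char n \<phi> A" using goodD(3)[OF L A(1)] by blast
    then show "\<exists>n. is_cell n A'" using cellularD(2)[OF cel A(1)] A(2) char_is_cell by blast
  qed
  show "\<forall>A\<in>gmap h ` L. \<forall>n \<phi>. char n \<phi> A \<longrightarrow> (\<exists>M. good M \<and> support M = bd_cube n \<and> cellular M (gmap h ` L) \<phi>)"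
  proof (intro ballI allI impI)
    fix A' n \<phi>' assume A': "A' \<in> gmap h ` L" and c': "char n \<phi>' A'"
    then obtain A where A: "A \<in> L" "A' = gmap h A" by blast
    obtain m \<psi> where p: "char m \<psi> A" using goodD(3)[OF L A(1)] by blast
    have hp: "char m (h \<circ> \<psi>) A'" using cellularD(2)[OF cel A(1) p] A(2) by simp
    have mn: "m = n" by (rule char_dim_unique[OF hp c'])
    obtain k where k: "cube_homeo n k" "\<forall>x\<in>cube n. (h \<circ> \<psi>) (k x) = \<phi>' x"
      using char_unique[OF c' hp[unfolded mn]] by blast
    have pk: "char n (\<psi> \<circ> k) A" using char_reparam[OF p[unfolded mn] k(1)] .
    obtain M where M: "good M" "support M = bd_cube n" "cellular M L (\<psi> \<circ> k)"
      using goodD(4)[OF L A(1) pk] by blast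
    have "cellular M (gmap h ` L) (h \<circ> (\<psi> \<circ> k))" by (rule cellular_compose[OF M(3) cel])
    then have "cellular M (gmap h ` L) \<phi>'"
      by (rule cellular_cong) (use k(2) M(2) subsetD[OF bd_cube_subset[of n]] in simp)
    then show "\<exists>M. good M \<and> support M = bd_cube n \<and> cellular M (gmap h ` L) \<phi>'" using M by blast
  qed
qed

text \<open>Moving the decomposition \<open>L\<close> of the sphere by the homeomorphism
  \<open>h\<close> that relates two characteristic maps turns a pullback for one into a pullback for
  the other. So one characteristic map per cell is enough.\<close>

lemma good_intro1:
  assumes fin: "finite K" and dis: "\<And>A B. A \<in> K \<Longrightarrow> B \<in> K \<Longrightarrow> cell_int A \<inter> cell_int B \<noteq> {} \<Longrightarrow> A = B"
    and ch: "\<And>A. A \<in> K \<Longrightarrow> \<exists>n \<phi> L. char n \<phi> A \<and> good L \<and> support L = bd_cube n \<and> cellular L K \<phi>"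
  shows "good K"
proof (rule goodI[OF fin])
  show "\<forall>A\<in>K. \<forall>B\<in>K. A \<noteq> B \<longrightarrow> cell_int A \<inter> cell_int B = {}" using dis by blast
  show "\<forall>A\<in>K. \<exists>n. is_cell n A" using ch char_is_cell by blast
  show "\<forall>A\<in>K. \<forall>n \<phi>. char n \<phi> A \<longrightarrow> (\<exists>L. good L \<and> support L = bd_cube n \<and> cellular L K \<phi>)"
  proof (intro ballI allI impI)
    fix A n' \<phi>' assume A: "A \<in> K" and c': "char n' \<phi>' A"
    obtain n \<phi> L where c: "char n \<phi> A" and L: "good L" "support L = bd_cube n" "cellular L K \<phi>"
      using ch[OF A] by blast
    have n': "n' = n" by (rule char_dim_unique[OF c' c])
    obtain h where h: "cube_homeo n h" "\<forall>x\<in>cube n. \<phi>' (h x) = \<phi> x"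
      using char_unique[OF c c'[unfolded n']] by blast
    have hb: "PL_on (bd_cube n) h" "inj_on h (bd_cube n)" "h ` bd_cube n = bd_cube n"
      using h(1) PL_on_subset[OF _ compact_polyhedron_bd_cube bd_cube_subset] inj_on_subset[OF _ bd_cube_subset]
      unfolding cube_homeo_def by blast+
    let ?L = "gmap h ` L"
    have "good ?L" using good_transport[OF L(1)] hb unfolding L(2) by blast
    moreover have "support ?L = bd_cube n'" unfolding support_gmap L(2) n' by (rule hb(3))
    moreover have "cellular ?L K \<phi>'"
    proof (rule cellularI)
      fix D' assume "D' \<in> ?L"
      then obtain D where D: "D \<in> L" "D' = gmap h D" by blast
      obtain k \<psi> where p: "char k \<psi> D" using goodD(3)[OF L(1) D(1)] by blast
      have cD: "carrier D \<subseteq> cube n" using carrier_subset_support[OF D(1)] L(2) bd_cube_subset by blast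
      have g: "gmap \<phi>' D' = gmap \<phi> D" unfolding D(2) gmap_gmap
        by (rule gmap_cong) (use h(2) cD in auto)
      have hp: "char k (h \<circ> \<psi>) D'" unfolding D(2)
        using cellularD(2)[OF cellular_transport[OF goodD(3)[OF L(1)]] D(1) p] hb unfolding L(2) by blast
      have "char k (\<phi>' \<circ> (h \<circ> \<psi>)) (gmap \<phi>' D')" unfolding g
        by (rule char_cong[OF cellularD(2)[OF L(3) D(1) p]]) (use h(2) cD char_carrier[OF p] in auto)
      then show "\<exists>k \<psi>. char k \<psi> D' \<and> char k (\<phi>' \<circ> \<psi>) (gmap \<phi>' D') \<and> gmap \<phi>' D' \<in> K"
        using hp g cellularD(1)[OF L(3) D(1)] by metis
    qed
    ultimately show "\<exists>L. good L \<and> support L = bd_cube n' \<and> cellular L K \<phi>'" by blast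
  qed
qed

lemma good_subcomplex:
  assumes K: "good K" and J: "J \<subseteq> K" and cl: "\<And>A D. A \<in> J \<Longrightarrow> D \<in> K \<Longrightarrow> carrier D \<subseteq> cell_bd A \<Longrightarrow> D \<in> J"
  shows "good J"
proof (rule good_intro1)
  show "finite J" using finite_subset[OF J goodD(1)[OF K]] .
  show "A = B" if "A \<in> J" "B \<in> J" "cell_int A \<inter> cell_int B \<noteq> {}" for A B using goodD(2)[OF K] that J by blast
  show "\<exists>n \<phi> L. char n \<phi> A \<and> good L \<and> support L = bd_cube n \<and> cellular L J \<phi>" if A: "A \<in> J" for A
  proof -
    have AK: "A \<in> K" using A J by blast
    obtain n \<phi> where c: "char n \<phi> A" using goodD(3)[OF K AK] by blast
    obtain L where L: "good L" "support L = bd_cube n" "cellular L K \<phi>" using goodD(4)[OF K AK c] by blast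
    have "gmap \<phi> D \<in> J" if D: "D \<in> L" for D
      by (rule cl[OF A cellularD(1)[OF L(3) D]]) (use bd_image_cellular[OF c L(2)] D in blast)
    then have "cellular L J \<phi>" using L(3) unfolding cellular_def by blast
    then show ?thesis using c L by blast
  qed
qed

section \<open>Uniqueness of the pullback\<close>

text \<open>Sets that are disjoint or equal divide \<open>S\<close> into finitely many closed, hence
  open, classes. This propagates a coincidence at one point over a whole open cell, for lifts of
  characteristic maps and for affine pieces alike.\<close>

lemma connected_finite_cover:
  assumes "connected S" "x \<in> S" "finite I" "\<And>i. i \<in> I \<Longrightarrow> closedin (top_of_set S) (U i)"
    "S \<subseteq> (\<Union>i\<in>I. U i)" "\<And>i j. i \<in> I \<Longrightarrow> j \<in> I \<Longrightarrow> U i \<inter> U j \<noteq> {} \<Longrightarrow> U i = U j"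
  shows "\<exists>i\<in>I. U i = S"
proof -
  have sub: "U i \<subseteq> S" if "i \<in> I" for i using closedin_subset[OF assms(4)[OF that]] by simp
  obtain i where i: "i \<in> I" "x \<in> U i" using assms(2,5) by blast
  let ?J = "{j\<in>I. U j \<noteq> U i}"
  have "S - U i = (\<Union>j\<in>?J. U j)"
  proof (intro equalityI subsetI)
    fix y assume y: "y \<in> S - U i"
    then obtain j where "j \<in> I" "y \<in> U j" using assms(5) by blast
    then show "y \<in> (\<Union>j\<in>?J. U j)" using y by blast
  next
    fix y assume "y \<in> (\<Union>j\<in>?J. U j)"
    then obtain j where j: "j \<in> I" "U j \<noteq> U i" "y \<in> U j" by blast
    then show "y \<in> S - U i" using sub[OF j(1)] assms(6)[OF j(1) i(1)] by blast
  qed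
  moreover have "closedin (top_of_set S) (\<Union>j\<in>?J. U j)"
    using closedin_Union[of "U ` ?J" "top_of_set S"] assms(3,4) by auto
  ultimately have "openin (top_of_set S) (U i)"
    using sub[OF i(1)] by (simp add: openin_closedin_eq)
  then have "U i = {} \<or> U i = S" using assms(1) assms(4)[OF i(1)] unfolding connected_clopen by blast
  then have "U i = S" using i(2) by blast
  then show ?thesis using i(1) by blast
qed

lemma connected_int_cube: "connected (int_cube n)"
  using convex_int_cube convex_connected by blast

lemma closedin_eq_on_int_cube:
  fixes f g :: "point \<Rightarrow> 'b::real_normed_vector"
  assumes "continuous_on (cube n) f" "continuous_on (cube n) g"
  shows "closedin (top_of_set (int_cube n)) {u\<in>int_cube n. f u = g u}"
proof -
  have "closedin (top_of_set (int_cube n)) (int_cube n \<inter> (\<lambda>u. f u - g u) -` {0})"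
    by (rule continuous_closedin_preimage[OF continuous_on_diff])
      (use assms int_cube_subset in \<open>auto intro: continuous_on_subset\<close>)
  moreover have "int_cube n \<inter> (\<lambda>u. f u - g u) -` {0} = {u\<in>int_cube n. f u = g u}" by auto
  ultimately show ?thesis by simp
qed

text \<open>After reparametrization the cell above lies over a prescribed characteristic map
  exactly, not only up to a homeomorphism of the cube; different cells over \<open>C\<close> thus
  become comparable point by point.\<close>

lemma char_lift_eq:
  assumes c: "char n \<phi> C" and d: "char k \<psi> D" and fd: "char k (f \<circ> \<psi>) C"
  shows "k = n \<and> (\<exists>\<theta>. char n \<theta> D \<and> (\<forall>x\<in>cube n. f (\<theta> x) = \<phi> x))"
proof -
  have kn: "k = n" by (rule char_dim_unique[OF fd c])
  obtain h where h: "cube_homeo n h" "\<forall>x\<in>cube n. (f \<circ> \<psi>) (h x) = \<phi> x"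
    using char_unique[OF c fd[unfolded kn]] by blast
  have "char n (\<psi> \<circ> h) D" using char_reparam[OF d[unfolded kn] h(1)] .
  then show ?thesis using kn h(2) by (intro conjI exI[of _ "\<psi> \<circ> h"]) auto
qed

text \<open>Uniqueness of lifts, as for coverings. All cells \<open>E\<close> of \<open>M\<close>
  over the same cell as \<open>D\<close> receive characteristic maps \<open>\<theta> E\<close> with
  one common composite with \<open>f\<close>. The sets where \<open>\<psi>\<close> agrees with some
  \<open>\<theta> E\<close> are closed, pairwise disjoint or equal, and cover the open cube; so one
  of them is everything and \<open>D = E\<close>.\<close>

lemma pullback_subset:
  assumes L: "good L" "cellular L K f" and M: "good M" "cellular M K f" and s: "support L \<subseteq> support M"
    and K: "\<And>A B. A \<in> K \<Longrightarrow> B \<in> K \<Longrightarrow> cell_int A \<inter> cell_int B \<noteq> {} \<Longrightarrow> A = B"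
  shows "L \<subseteq> M"
proof
  fix D assume D: "D \<in> L"
  obtain k \<psi> where p: "char k \<psi> D" using goodD(3)[OF L(1) D] by blast
  let ?C = "gmap f D"
  have fp: "char k (f \<circ> \<psi>) ?C" by (rule cellularD(2)[OF L(2) D p])
  define I where "I = {E\<in>M. gmap f E = ?C}"
  have "\<forall>E\<in>I. \<exists>\<theta>. char k \<theta> E \<and> (\<forall>x\<in>cube k. f (\<theta> x) = f (\<psi> x))"
  proof
    fix E assume "E \<in> I"
    then have E: "E \<in> M" "gmap f E = ?C" by (auto simp: I_def)
    obtain m \<theta> where q: "char m \<theta> E" using goodD(3)[OF M(1) E(1)] by blast
    have "char m (f \<circ> \<theta>) ?C" using cellularD(2)[OF M(2) E(1) q] E(2) by simp
    from char_lift_eq[OF fp q this] show "\<exists>\<theta>. char k \<theta> E \<and> (\<forall>x\<in>cube k. f (\<theta> x) = f (\<psi> x))" by simp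
  qed
  then obtain \<theta> where T: "\<And>E. E \<in> I \<Longrightarrow> char k (\<theta> E) E" "\<And>E x. E \<in> I \<Longrightarrow> x \<in> cube k \<Longrightarrow> f (\<theta> E x) = f (\<psi> x)"
    by metis
  have "\<exists>E\<in>I. {u\<in>int_cube k. \<psi> u = \<theta> E u} = int_cube k"
  proof (rule connected_finite_cover[OF connected_int_cube zero_in_int_cube])
    show "finite I" using goodD(1)[OF M(1)] by (simp add: I_def)
    show "closedin (top_of_set (int_cube k)) {u\<in>int_cube k. \<psi> u = \<theta> E u}" if E: "E \<in> I" for E
      by (rule closedin_eq_on_int_cube[OF char_continuous[OF p] char_continuous[OF T(1)[OF E]]])
    show "int_cube k \<subseteq> (\<Union>E\<in>I. {u\<in>int_cube k. \<psi> u = \<theta> E u})"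
    proof
      fix u assume u: "u \<in> int_cube k"
      have uD: "\<psi> u \<in> cell_int D" using charD(4)[OF p] u by simp
      have "\<psi> u \<in> support M" using uD carrier_subset_support[OF D] s unfolding carrier_def by blast
      then obtain E where E: "E \<in> M" "\<psi> u \<in> cell_int E" using good_support[OF M(1)] by blast
      have "f (\<psi> u) \<in> cell_int (gmap f E) \<inter> cell_int ?C" using uD E(2) by simp
      then have "gmap f E = ?C" using K cellularD(1)[OF M(2) E(1)] cellularD(1)[OF L(2) D] by blast
      then have EI: "E \<in> I" using E(1) by (simp add: I_def)
      obtain v where v: "v \<in> int_cube k" "\<psi> u = \<theta> E v" using E(2) charD(4)[OF T(1)[OF EI]] by blast
      \<comment> \<open>The composite is injective on the open cube, so two lifts can meet only at
        equal parameters.\<close>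
      have "(f \<circ> \<psi>) v = (f \<circ> \<psi>) u" using T(2)[OF EI subsetD[OF int_cube_subset v(1)]] v(2) by simp
      then have "v = u" by (rule inj_onD[OF charD(3)[OF fp] _ v(1) u])
      then show "u \<in> (\<Union>E\<in>I. {u\<in>int_cube k. \<psi> u = \<theta> E u})" using u v(2) EI by blast
    qed
    show "{u\<in>int_cube k. \<psi> u = \<theta> E u} = {u\<in>int_cube k. \<psi> u = \<theta> E' u}"
      if E: "E \<in> I" "E' \<in> I" "{u\<in>int_cube k. \<psi> u = \<theta> E u} \<inter> {u\<in>int_cube k. \<psi> u = \<theta> E' u} \<noteq> {}" for E E'
    proof -
      obtain u where u: "u \<in> int_cube k" "\<psi> u = \<theta> E u" "\<psi> u = \<theta> E' u" using E(3) by blast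
      have "\<psi> u \<in> cell_int E" "\<psi> u \<in> cell_int E'"
        using charD(4)[OF T(1)[OF E(1)]] charD(4)[OF T(1)[OF E(2)]] u by (metis imageI)+
      then have "E = E'" using good_cell_unique[OF M(1)] E(1,2) by (auto simp: I_def)
      then show ?thesis by simp
    qed
  qed
  then obtain E where E: "E \<in> I" "\<And>u. u \<in> int_cube k \<Longrightarrow> \<psi> u = \<theta> E u" by blast
  have "\<psi> x = \<theta> E x" if "x \<in> cube k" for x
    by (rule eq_on_cube[OF char_continuous[OF p] char_continuous[OF T(1)[OF E(1)]] E(2) that])
  then have "char k \<psi> E" using char_cong[OF T(1)[OF E(1)]] by blast
  then have "D = E" using char_eq[OF p] by blast
  then show "D \<in> M" using E(1) by (simp add: I_def)
qed

lemma pullback_unique: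
  assumes "good K" "good L" "cellular L K f" "good M" "cellular M K f" "support L = support M"
  shows "L = M"
  using pullback_subset[OF assms(2,3,4,5) _ goodD(2)[OF assms(1)]]
    pullback_subset[OF assms(4,5,2,3) _ goodD(2)[OF assms(1)]] assms(6) by blast

section \<open>Comparison with PLCW complexes\<close>

lemma regular_cellular_imp_cellular:
  assumes r: "regular_cellular_map L K f" and L: "\<And>D. D \<in> L \<Longrightarrow> \<exists>n \<phi>. char n \<phi> D"
  shows "cellular L K f"
proof (rule cellularI)
  fix D assume D: "D \<in> L"
  obtain k \<psi> where p: "char k \<psi> D" using L[OF D] by blast
  obtain C where C: "C \<in> K" "char k (f \<circ> \<psi>) C"
    using r D p unfolding regular_cellular_map_def by blast
  have "C = gmap f D" by (rule char_compose_eq[OF p C(2)])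
  then show "\<exists>k \<psi>. char k \<psi> D \<and> char k (f \<circ> \<psi>) (gmap f D) \<and> gmap f D \<in> K" using p C by blast
qed

lemma cellular_imp_regular_cellular:
  assumes c: "cellular L K f" and f: "PL_on (support L) f"
  shows "regular_cellular_map L K f"
  unfolding regular_cellular_map_def PL_map_def
proof (intro conjI ballI allI impI f)
  show "f ` support L \<subseteq> support K"
    unfolding support_gmap[symmetric] unfolding support_def using cellularD(1)[OF c] by blast
  fix D k \<psi> assume D: "D \<in> L" and p: "char k \<psi> D"
  show "\<exists>C'\<in>K. carrier C' = f ` carrier D \<and> char k (f \<circ> \<psi>) C'"
    by (rule bexI[OF _ cellularD(1)[OF c D]]) (simp add: cellularD(2)[OF c D p])
qed

lemma cell_dim_le: "gcc K \<Longrightarrow> A \<in> K \<Longrightarrow> cell_dim A \<le> gcc_dim K"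
  unfolding gcc_def gcc_dim_def by (intro Max_ge) auto

text \<open>Cells of top dimension have pullbacks by definition; all others belong to the skeleton,
  which is good by induction.\<close>

lemma PLCW_imp_good: "PLCW K \<Longrightarrow> good K"
proof (induction rule: PLCW.induct)
  case (PLCW_0 K)
  show ?case
  proof (rule good_intro1)
    fix A assume A: "A \<in> K"
    obtain n where n: "is_cell n A" using PLCW_0(1) A unfolding gcc_def by blast
    have "n = 0" using cell_dim_le[OF PLCW_0(1) A] cell_dim_eq[OF n] PLCW_0(2) by simp
    then obtain \<phi> where "char 0 \<phi> A" using n unfolding is_cell_def by blast
    moreover have "support {} = bd_cube 0" by (simp add: support_def bd_cube_0)
    moreover have "cellular {} K \<phi>" by (simp add: cellular_def)
    ultimately show "\<exists>n \<phi> L. char n \<phi> A \<and> good L \<and> support L = bd_cube n \<and> cellular L K \<phi>"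
      using good_empty by blast
  next
    show "finite K" using PLCW_0(1) unfolding gcc_def by blast
    show "A = B" if "A \<in> K" "B \<in> K" "cell_int A \<inter> cell_int B \<noteq> {}" for A B
      using PLCW_0(1) that unfolding gcc_def by blast
  qed
next
  case (PLCW_Suc K n)
  let ?S = "skeleton (n - 1) K"
  have S: "?S \<subseteq> K" unfolding skeleton_def by blast
  show ?case
  proof (rule good_intro1)
    fix A assume A: "A \<in> K"
    obtain m where m: "is_cell m A" using PLCW_Suc(1) A unfolding gcc_def by blast
    have mn: "m \<le> n" using cell_dim_le[OF PLCW_Suc(1) A] cell_dim_eq[OF m] PLCW_Suc(2) by simp
    show "\<exists>n \<phi> L. char n \<phi> A \<and> good L \<and> support L = bd_cube n \<and> cellular L K \<phi>"
    proof (cases "m = n")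
      case True
      then obtain \<phi> where c: "char n \<phi> A" using m unfolding is_cell_def by blast
      obtain L where L: "good L" "support L = bd_cube n" "regular_cellular_map L ?S \<phi>"
        using PLCW_Suc(6)[rule_format, OF A c] by blast
      have "cellular L K \<phi>"
        by (rule cellular_mono[OF regular_cellular_imp_cellular[OF L(3) goodD(3)[OF L(1)]] S])
      then show ?thesis using c L by blast
    next
      case False
      then have AS: "A \<in> ?S" using mn A cell_dim_eq[OF m] unfolding skeleton_def by auto
      obtain \<phi> where c: "char m \<phi> A" using m unfolding is_cell_def by blast
      obtain L where L: "good L" "support L = bd_cube m" "cellular L ?S \<phi>"
        using goodD(4)[OF PLCW_Suc(5) AS c] by blast
      then show ?thesis using c cellular_mono[OF L(3) S] by blast
    qed
  next
    show "finite K" using PLCW_Suc(1) unfolding gcc_def by blast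
    show "A = B" if "A \<in> K" "B \<in> K" "cell_int A \<inter> cell_int B \<noteq> {}" for A B
      using PLCW_Suc(1) that unfolding gcc_def by blast
  qed
qed

lemma skeleton_skeleton: "d \<le> m \<Longrightarrow> skeleton d (skeleton m K) = skeleton d K"
  unfolding skeleton_def by auto

lemma skeleton_large: assumes "finite K" shows "\<exists>m. skeleton m K = K"
proof -
  have "A \<in> skeleton (Max (insert 0 (cell_dim ` K))) K" if "A \<in> K" for A
    unfolding skeleton_def using that assms by auto
  then show ?thesis unfolding skeleton_def by blast
qed

lemma pullback_dim_less:
  assumes "good L" "support L = bd_cube n" "D \<in> L" "char k \<psi> D" shows "k < n"
proof (rule regular_map_into_bd_cube[OF charD(1)[OF assms(4)]])
  show "\<psi> ` int_cube k \<subseteq> bd_cube n"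
    using charD(4)[OF assms(4)] carrier_subset_support[OF assms(3)] assms(2) unfolding carrier_def by blast
qed

lemma cellular_skeleton:
  assumes L: "good L" "support L = bd_cube n" and c: "cellular L K f" and m: "n \<le> Suc m"
  shows "cellular L (skeleton m K) f"
  unfolding cellular_def
proof (intro ballI conjI allI impI)
  fix D assume D: "D \<in> L"
  obtain k \<psi> where p: "char k \<psi> D" using goodD(3)[OF L(1) D] by blast
  have "cell_dim (gmap f D) = k" by (rule cell_dim_eq[OF char_is_cell[OF cellularD(2)[OF c D p]]])
  then show "gmap f D \<in> skeleton m K"
    using pullback_dim_less[OF L D p] m cellularD(1)[OF c D] unfolding skeleton_def by simp
qed (rule cellularD(2)[OF c])

text \<open>The pullback of an \<open>n\<close>-cell contains only cells of dimension less than
  \<open>n\<close>, so its image lies in the skeleton that \<open>PLCW\<close> asks for. All skeleta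
  are treated together by strong induction on \<open>m\<close>, because the dimension of a skeleton
  may be smaller than its index.\<close>

lemma good_imp_PLCW: "good K \<Longrightarrow> PLCW K"
proof (induction rule: good.induct)
  case (goodI K)
  have ch: "\<exists>L. good L \<and> PLCW L \<and> support L = bd_cube n \<and> cellular L K \<phi>"
    if "A \<in> K" "char n \<phi> A" for A n \<phi> using goodI(4)[rule_format, OF that] by blast
  have K: "good K"
  proof (rule good.goodI[OF goodI(1,2,3)], intro ballI allI impI)
    fix A n \<phi> assume "A \<in> K" "char n \<phi> A"
    from ch[OF this] show "\<exists>L. good L \<and> support L = bd_cube n \<and> cellular L K \<phi>" by blast
  qed
  have gS: "gcc (skeleton m K)" for m
    unfolding gcc_def
  proof (intro conjI ballI impI)
    show "finite (skeleton m K)" using goodI(1) unfolding skeleton_def by simp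
    fix A assume "A \<in> skeleton m K"
    then have A: "A \<in> K" "cell_dim A \<le> m" unfolding skeleton_def by auto
    show "\<exists>n. is_cell n A" using goodI(3) A by blast
    show "cell_int A \<inter> cell_int C = {}" if "C \<in> skeleton m K" "A \<noteq> C" for C
      using goodI(2) A that unfolding skeleton_def by blast
    obtain n \<phi> where c: "char n \<phi> A" using goodD(3)[OF K A(1)] by blast
    have n: "n \<le> m" using A(2) cell_dim_eq[OF char_is_cell[OF c]] by simp
    obtain L where L: "good L" "support L = bd_cube n" "cellular L K \<phi>" using ch[OF A(1) c] by blast
    have "cellular L (skeleton m K) \<phi>" by (rule cellular_skeleton[OF L]) (use n in simp)
    then have "gmap \<phi> ` L \<subseteq> skeleton m K" using cellularD(1) by blast
    moreover have "cell_bd A = \<Union>(carrier ` gmap \<phi> ` L)" unfolding bd_image_cellular[OF c L(2)] by simp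
    ultimately show "union_of_cells (skeleton m K) (cell_bd A)" unfolding union_of_cells_def by blast
  qed
  have "PLCW (skeleton m K)" for m
  proof (induction m rule: less_induct)
    case (less m)
    let ?S = "skeleton m K" and ?d = "gcc_dim (skeleton m K)"
    show ?case
    proof (cases "?d = 0")
      case True then show ?thesis by (rule PLCW_0[OF gS])
    next
      case False
      have "?d \<le> m"
      proof -
        have "finite (insert 0 (cell_dim ` ?S))" using gS[of m] unfolding gcc_def by simp
        then show ?thesis unfolding gcc_dim_def by (simp add: skeleton_def)
      qed
      then have d: "?d - 1 < m" "?d - 1 \<le> m" using False by auto
      have sk: "skeleton (?d - 1) ?S = skeleton (?d - 1) K" by (rule skeleton_skeleton[OF d(2)])
      show ?thesis
      proof (rule PLCW_Suc[OF gS refl])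
        show "0 < ?d" using False by simp
        show "PLCW (skeleton (?d - 1) ?S)" unfolding sk by (rule less[OF d(1)])
        show "\<forall>A\<in>?S. \<forall>\<phi>. char ?d \<phi> A \<longrightarrow>
          (\<exists>L. PLCW L \<and> support L = bd_cube ?d \<and> regular_cellular_map L (skeleton (?d - 1) ?S) \<phi>)"
        proof (intro ballI allI impI)
          fix A \<phi> assume A: "A \<in> ?S" and c: "char ?d \<phi> A"
          obtain L where L: "good L" "PLCW L" "support L = bd_cube ?d" "cellular L K \<phi>"
            using ch[of A ?d \<phi>, OF _ c] A unfolding skeleton_def by blast
          have "cellular L (skeleton (?d - 1) K) \<phi>" by (rule cellular_skeleton[OF L(1,3,4)]) simp
          moreover have "PL_on (support L) \<phi>" unfolding L(3)
            by (rule PL_on_subset[OF charD(2)[OF c] compact_polyhedron_bd_cube bd_cube_subset])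
          ultimately have "regular_cellular_map L (skeleton (?d - 1) ?S) \<phi>"
            unfolding sk by (rule cellular_imp_regular_cellular)
          then show "\<exists>L. PLCW L \<and> support L = bd_cube ?d \<and> regular_cellular_map L (skeleton (?d - 1) ?S) \<phi>"
            using L by blast
        qed
      qed
    qed
  qed
  then show ?case using skeleton_large[OF goodI(1)] by metis
qed

section \<open>Elementary subdivisions\<close>

lemma aff_scaleR_left: assumes "aff (f :: point \<Rightarrow> real)" shows "aff (\<lambda>x. f x *\<^sub>R (v :: point))"
proof -
  have "aff (\<lambda>t::real. t *\<^sub>R v)" by (rule aff_linear[OF linear_scaleR_left])
  from aff_compose[OF this assms] show ?thesis .
qed

text \<open>The sign \<open>s\<close> selects the upper or the lower half of the cube; \<open>fold_half\<close> and \<open>unfold_half\<close>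
  are inverse affine maps between the cube and this half.\<close>

definition half_int :: "real \<Rightarrow> nat \<Rightarrow> point set" where
  "half_int s n = {x \<in> int_cube n. s * coord x (n - 1) > 0}"

definition half_bd :: "real \<Rightarrow> nat \<Rightarrow> point set" where
  "half_bd s n = {x \<in> cube n. s * coord x (n - 1) \<ge> 0} - half_int s n"

definition half_cell :: "real \<Rightarrow> nat \<Rightarrow> (point \<Rightarrow> point) \<Rightarrow> gcell" where
  "half_cell s n \<phi> = GCell (\<phi> ` half_int s n) (\<phi> ` half_bd s n)"

definition fold_half :: "real \<Rightarrow> nat \<Rightarrow> point \<Rightarrow> point" where
  "fold_half s n x = x + ((s - coord x (n - 1)) / 2) *\<^sub>R unit (n - 1)"

definition unfold_half :: "real \<Rightarrow> nat \<Rightarrow> point \<Rightarrow> point" where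
  "unfold_half s n x = x + (coord x (n - 1) - s) *\<^sub>R unit (n - 1)"

definition subdiv :: "nat \<Rightarrow> (point \<Rightarrow> point) \<Rightarrow> gcell set" where
  "subdiv n \<phi> = {half_cell 1 n \<phi>, half_cell (-1) n \<phi>, middle_cell n \<phi>}"

section \<open>Coordinates of the half cubes and of the equatorial disc\<close>

lemma upper_cell_eq: "upper_cell n \<phi> = half_cell 1 n \<phi>"
  by (simp add: upper_cell_def half_cell_def half_int_def half_bd_def Let_def)

lemma lower_cell_eq: "lower_cell n \<phi> = half_cell (-1) n \<phi>"
  by (simp add: lower_cell_def half_cell_def half_int_def half_bd_def Let_def)

lemma coord_fold: "coord (fold_half s n x) i = (if i = n - 1 then (coord x i + s) / 2 else coord x i)"
  by (simp add: fold_half_def lookup_add coord_unit field_simps)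

lemma coord_unfold: "coord (unfold_half s n x) i = (if i = n - 1 then 2 * coord x i - s else coord x i)"
  by (simp add: unfold_half_def lookup_add coord_unit)

lemma fold_unfold: "fold_half s n (unfold_half s n x) = x"
  by (rule poly_mapping_eqI) (simp add: coord_fold coord_unfold)

lemma unfold_fold: "unfold_half s n (fold_half s n x) = x"
  by (rule poly_mapping_eqI) (simp add: coord_fold coord_unfold field_simps)

lemma aff_fold_half: "aff (fold_half s n)"
  unfolding fold_half_def by (intro aff_add aff_id aff_scaleR_left aff_divide aff_diff aff_const aff_coord)

lemma aff_unfold_half: "aff (unfold_half s n)"
  unfolding unfold_half_def by (intro aff_add aff_id aff_scaleR_left aff_diff aff_const aff_coord)

lemma unfold_in_Rn: "1 \<le> n \<Longrightarrow> unfold_half s n x \<in> Rn n \<longleftrightarrow> x \<in> Rn n"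
proof -
  assume n: "1 \<le> n"
  have "coord (unfold_half s n x) i = coord x i" if i: "i \<ge> n" for i
  proof -
    have "i \<noteq> n - 1" using n i by arith
    then show ?thesis by (simp add: coord_unfold)
  qed
  then show ?thesis by (simp add: Rn_iff)
qed

lemma unfold_int: assumes n: "1 \<le> n" and s: "s = 1 \<or> s = -1"
  shows "unfold_half s n x \<in> int_cube n \<longleftrightarrow> x \<in> half_int s n"
proof -
  have c: "\<bar>2 * c - s\<bar> < 1 \<longleftrightarrow> \<bar>c\<bar> < 1 \<and> s * c > 0" for c using s by auto
  have *: "(\<forall>i<n. \<bar>coord (unfold_half s n x) i\<bar> < 1) \<longleftrightarrow> (\<forall>i<n. \<bar>coord x i\<bar> < 1) \<and> s * coord x (n - 1) > 0"
  proof
    assume h: "\<forall>i<n. \<bar>coord (unfold_half s n x) i\<bar> < 1"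
    have l: "\<bar>coord x (n - 1)\<bar> < 1 \<and> s * coord x (n - 1) > 0"
      using h[rule_format, of "n - 1"] n c[of "coord x (n - 1)"] by (simp add: coord_unfold)
    have "\<bar>coord x i\<bar> < 1" if "i < n" for i
      using h[rule_format, OF that] l by (cases "i = n - 1") (simp_all add: coord_unfold)
    then show "(\<forall>i<n. \<bar>coord x i\<bar> < 1) \<and> s * coord x (n - 1) > 0" using l by blast
  next
    assume h: "(\<forall>i<n. \<bar>coord x i\<bar> < 1) \<and> s * coord x (n - 1) > 0"
    show "\<forall>i<n. \<bar>coord (unfold_half s n x) i\<bar> < 1" using h c by (simp add: coord_unfold)
  qed
  show ?thesis unfolding int_cube_def half_int_def using unfold_in_Rn[OF n, of s x] * by simp
qed

lemma unfold_cube: assumes n: "1 \<le> n" and s: "s = 1 \<or> s = -1"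
  shows "unfold_half s n x \<in> cube n \<longleftrightarrow> x \<in> cube n \<and> s * coord x (n - 1) \<ge> 0"
proof -
  have c: "\<bar>2 * c - s\<bar> \<le> 1 \<longleftrightarrow> \<bar>c\<bar> \<le> 1 \<and> s * c \<ge> 0" for c using s by auto
  have *: "(\<forall>i<n. \<bar>coord (unfold_half s n x) i\<bar> \<le> 1) \<longleftrightarrow> (\<forall>i<n. \<bar>coord x i\<bar> \<le> 1) \<and> s * coord x (n - 1) \<ge> 0"
  proof
    assume h: "\<forall>i<n. \<bar>coord (unfold_half s n x) i\<bar> \<le> 1"
    have l: "\<bar>coord x (n - 1)\<bar> \<le> 1 \<and> s * coord x (n - 1) \<ge> 0"
      using h[rule_format, of "n - 1"] n c[of "coord x (n - 1)"] by (simp add: coord_unfold)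
    have "\<bar>coord x i\<bar> \<le> 1" if "i < n" for i
      using h[rule_format, OF that] l by (cases "i = n - 1") (simp_all add: coord_unfold)
    then show "(\<forall>i<n. \<bar>coord x i\<bar> \<le> 1) \<and> s * coord x (n - 1) \<ge> 0" using l by blast
  next
    assume h: "(\<forall>i<n. \<bar>coord x i\<bar> \<le> 1) \<and> s * coord x (n - 1) \<ge> 0"
    show "\<forall>i<n. \<bar>coord (unfold_half s n x) i\<bar> \<le> 1" using h c by (simp add: coord_unfold)
  qed
  show ?thesis unfolding cube_def using unfold_in_Rn[OF n, of s x] * by simp
qed

lemma fold_image: "fold_half s n ` S = {y. unfold_half s n y \<in> S}"
proof (intro equalityI subsetI)
  fix y assume "y \<in> fold_half s n ` S" then show "y \<in> {y. unfold_half s n y \<in> S}" by (auto simp: unfold_fold)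
next
  fix y assume "y \<in> {y. unfold_half s n y \<in> S}"
  then show "y \<in> fold_half s n ` S" by (intro image_eqI[of _ _ "unfold_half s n y"]) (auto simp: fold_unfold)
qed

lemma fold_int: "1 \<le> n \<Longrightarrow> s = 1 \<or> s = -1 \<Longrightarrow> fold_half s n ` int_cube n = half_int s n"
  unfolding fold_image using unfold_int by blast

lemma fold_bd: assumes "1 \<le> n" "s = 1 \<or> s = -1" shows "fold_half s n ` bd_cube n = half_bd s n"
  unfolding fold_image bd_cube_def half_bd_def using unfold_int[OF assms] unfold_cube[OF assms] by blast

lemma unfold_bd: assumes "1 \<le> n" "s = 1 \<or> s = -1" shows "unfold_half s n ` half_bd s n = bd_cube n"
  unfolding fold_bd[OF assms, symmetric] image_image unfold_fold by simp

lemma half_int_subset: "half_int s n \<subseteq> int_cube n" and half_bd_subset: "half_bd s n \<subseteq> cube n"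
  unfolding half_int_def half_bd_def by blast+

lemma Rn_pred: "1 \<le> n \<Longrightarrow> x \<in> Rn (n - 1) \<longleftrightarrow> x \<in> Rn n \<and> coord x (n - 1) = 0"
proof -
  assume n: "1 \<le> n"
  have "(\<forall>i\<ge>n - 1. coord x i = 0) \<longleftrightarrow> (\<forall>i\<ge>n. coord x i = 0) \<and> coord x (n - 1) = 0"
  proof (intro iffI conjI allI impI)
    fix i assume h: "(\<forall>i\<ge>n. coord x i = 0) \<and> coord x (n - 1) = 0" "n - 1 \<le> i"
    then show "coord x i = 0" by (cases "i = n - 1") auto
  qed auto
  then show ?thesis by (simp add: Rn_iff)
qed

lemma all_less_pred: "1 \<le> n \<Longrightarrow> P (n - 1) \<Longrightarrow> (\<forall>i<n. P i) \<longleftrightarrow> (\<forall>i<n - 1. P (i::nat))"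
  by (cases n) (auto simp: less_Suc_eq)

lemma cube_pred: assumes n: "1 \<le> n" shows "cube (n - 1) = {x \<in> cube n. coord x (n - 1) = 0}"
proof -
  have "(\<forall>i<n. \<bar>coord x i\<bar> \<le> 1) \<longleftrightarrow> (\<forall>i<n - 1. \<bar>coord x i\<bar> \<le> 1)" if "coord x (n - 1) = 0" for x
    by (rule all_less_pred[OF n]) (use that in simp)
  then show ?thesis unfolding cube_def using Rn_pred[OF n] by blast
qed

lemma int_cube_pred: assumes n: "1 \<le> n" shows "int_cube (n - 1) = {x \<in> int_cube n. coord x (n - 1) = 0}"
proof -
  have "(\<forall>i<n. \<bar>coord x i\<bar> < 1) \<longleftrightarrow> (\<forall>i<n - 1. \<bar>coord x i\<bar> < 1)" if "coord x (n - 1) = 0" for x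
    by (rule all_less_pred[OF n]) (use that in simp)
  then show ?thesis unfolding int_cube_def using Rn_pred[OF n] by blast
qed

lemma bd_cube_pred: assumes n: "1 \<le> n" shows "bd_cube (n - 1) = equator n"
  unfolding bd_cube_def equator_def cube_pred[OF n] int_cube_pred[OF n] by blast

text \<open>Inside the chain of the \<open>Rn n\<close> the equatorial disc of the cube is literally
  the cube of one dimension less, so \<open>\<phi>\<close> itself is a characteristic map of the
  middle cell.\<close>

lemma middle_cell_eq: "1 \<le> n \<Longrightarrow> middle_cell n \<phi> = GCell (\<phi> ` int_cube (n - 1)) (\<phi> ` bd_cube (n - 1))"
  by (simp only: middle_cell_def int_cube_pred bd_cube_pred)

lemma cube_pred_subset: assumes "1 \<le> n"
  shows "cube (n - 1) \<subseteq> cube n" "int_cube (n - 1) \<subseteq> int_cube n" "bd_cube (n - 1) \<subseteq> bd_cube n"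
  unfolding cube_pred[OF assms] int_cube_pred[OF assms] bd_cube_pred[OF assms] equator_def by blast+

lemma half_bd_eq: assumes n: "1 \<le> n" and s: "s = 1 \<or> s = -1"
  shows "half_bd s n = {x \<in> bd_cube n. s * coord x (n - 1) \<ge> 0} \<union> int_cube (n - 1)"
proof -
  have z: "s * c = 0 \<longleftrightarrow> c = 0" for c :: real using s by auto
  show ?thesis
  proof (rule set_eqI)
    fix x
    have "x \<in> cube n \<longleftrightarrow> x \<in> int_cube n \<or> x \<in> bd_cube n" "\<not> (x \<in> int_cube n \<and> x \<in> bd_cube n)"
      using cube_decomp[of n] int_bd_disjoint[of n] by blast+
    then show "x \<in> half_bd s n \<longleftrightarrow> x \<in> {x \<in> bd_cube n. s * coord x (n - 1) \<ge> 0} \<union> int_cube (n - 1)"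
      unfolding half_bd_def half_int_def int_cube_pred[OF n] using z[of "coord x (n - 1)"]
      by (cases "x \<in> int_cube n") (auto simp: less_le)
  qed
qed

lemma char_half:
  assumes c: "char n \<phi> C" and n: "1 \<le> n" and s: "s = 1 \<or> s = -1"
  shows "char n (\<phi> \<circ> fold_half s n) (half_cell s n \<phi>)"
proof (rule charI)
  have sub: "fold_half s n ` cube n \<subseteq> cube n"
    unfolding cube_decomp[of n] image_Un fold_int[OF n s] fold_bd[OF n s]
    using half_int_subset half_bd_subset unfolding cube_decomp by blast
  show "PL_on (cube n) (\<phi> \<circ> fold_half s n)"
    by (rule PL_on_compose[OF PL_on_aff[OF polytope_cube aff_fold_half] charD(2)[OF c] sub])
  show "inj_on (\<phi> \<circ> fold_half s n) (int_cube n)"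
  proof (rule comp_inj_on)
    show "inj_on (fold_half s n) (int_cube n)" by (rule inj_on_inverseI[where g = "unfold_half s n"]) (rule unfold_fold)
    show "inj_on \<phi> (fold_half s n ` int_cube n)" unfolding fold_int[OF n s]
      by (rule inj_on_subset[OF charD(3)[OF c] half_int_subset])
  qed
  show "cell_int (half_cell s n \<phi>) = (\<phi> \<circ> fold_half s n) ` int_cube n"
    "cell_bd (half_cell s n \<phi>) = (\<phi> \<circ> fold_half s n) ` bd_cube n"
    unfolding image_comp[symmetric] fold_int[OF n s] fold_bd[OF n s] by (simp_all add: half_cell_def)
  have "\<phi> ` half_int s n \<inter> \<phi> ` half_bd s n = {}"
  proof (rule ccontr)
    assume "\<phi> ` half_int s n \<inter> \<phi> ` half_bd s n \<noteq> {}"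
    then obtain x y where xy: "x \<in> half_int s n" "y \<in> half_bd s n" "\<phi> x = \<phi> y" by (auto simp: disjoint_iff)
    have x: "x \<in> int_cube n" using xy(1) half_int_subset by blast
    have y: "y \<in> cube n" "y \<notin> half_int s n" using xy(2) unfolding half_bd_def by blast+
    show False
    proof (cases "y \<in> int_cube n")
      case True
      have "x = y" by (rule inj_onD[OF charD(3)[OF c] xy(3) x True])
      then show False using xy(1) y(2) by simp
    next
      case False
      then have "y \<in> bd_cube n" using y(1) cube_decomp by blast
      then have "\<phi> y \<in> cell_bd C" unfolding charD(5)[OF c] by (rule imageI)
      moreover have "\<phi> x \<in> cell_int C" unfolding charD(4)[OF c] using x by (rule imageI)
      ultimately show False using charD(6)[OF c] xy(3) by auto
    qed
  qed
  then show "cell_int (half_cell s n \<phi>) \<inter> cell_bd (half_cell s n \<phi>) = {}" by (simp add: half_cell_def)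
qed

lemma char_middle:
  assumes c: "char n \<phi> C" and n: "1 \<le> n"
  shows "char (n - 1) \<phi> (middle_cell n \<phi>)"
proof (rule charI)
  note sub = cube_pred_subset[OF n]
  show "PL_on (cube (n - 1)) \<phi>"
    by (rule PL_on_subset[OF charD(2)[OF c] polytope_compact_polyhedron[OF polytope_cube] sub(1)])
  show "inj_on \<phi> (int_cube (n - 1))" by (rule inj_on_subset[OF charD(3)[OF c] sub(2)])
  have "\<phi> ` int_cube (n - 1) \<subseteq> cell_int C" "\<phi> ` bd_cube (n - 1) \<subseteq> cell_bd C"
    unfolding charD(4,5)[OF c] using sub by (simp_all add: image_mono)
  then show "cell_int (middle_cell n \<phi>) \<inter> cell_bd (middle_cell n \<phi>) = {}"
    unfolding middle_cell_eq[OF n] gcell.sel using charD(6)[OF c] by blast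
qed (simp_all add: middle_cell_eq[OF n])

text \<open>No cell crosses the equator. For a good decomposition of the sphere this makes the
  equator a union of cells, see \<open>sub_equator\<close>, and it can be checked cell by
  cell.\<close>

definition saturated :: "nat \<Rightarrow> gcell set \<Rightarrow> bool" where
  "saturated n L \<longleftrightarrow> (\<forall>D\<in>L. cell_int D \<inter> equator n \<noteq> {} \<longrightarrow> carrier D \<subseteq> equator n)"

lemma cellular_shift:
  assumes L: "good L" and c: "cellular L K f" and h: "PL_on (support L) h" "inj_on h (support L)"
    and g: "\<And>x. x \<in> support L \<Longrightarrow> g (h x) = f x"
  shows "cellular (gmap h ` L) K g"
proof (rule cellularI)
  fix D' assume "D' \<in> gmap h ` L"
  then obtain D where D: "D \<in> L" "D' = gmap h D" by blast
  obtain k \<psi> where p: "char k \<psi> D" using goodD(3)[OF L D(1)] by blast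
  have e: "g (h x) = f x" if "x \<in> carrier D" for x using g carrier_subset_support[OF D(1)] that by blast
  have gm: "gmap g D' = gmap f D" unfolding D(2) gmap_gmap by (rule gmap_cong) (simp add: e)
  have hp: "char k (h \<circ> \<psi>) D'" unfolding D(2)
    by (rule cellularD(2)[OF cellular_transport[OF goodD(3)[OF L] h] D(1) p])
  have "char k (g \<circ> (h \<circ> \<psi>)) (gmap g D')" unfolding gm
    by (rule char_cong[OF cellularD(2)[OF c D(1) p]]) (use e char_carrier[OF p] in simp)
  moreover have "gmap g D' \<in> K" unfolding gm by (rule cellularD(1)[OF c D(1)])
  ultimately show "\<exists>k \<psi>. char k \<psi> D' \<and> char k (g \<circ> \<psi>) (gmap g D') \<and> gmap g D' \<in> K" using hp
    by (intro exI[of _ k] exI[of _ "h \<circ> \<psi>"]) simp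
qed

lemma sub_equator:
  assumes L: "good L" "support L = bd_cube n" and sat: "saturated n L" and n: "1 \<le> n"
  defines "J \<equiv> {D\<in>L. carrier D \<subseteq> equator n}"
  shows "good J" "support J = bd_cube (n - 1)"
proof -
  show "good J"
    by (rule good_subcomplex[OF L(1)]) (auto simp: J_def carrier_def)
  have eq: "equator n \<subseteq> bd_cube n" unfolding equator_def by blast
  show "support J = bd_cube (n - 1)" unfolding bd_cube_pred[OF n]
  proof
    show "support J \<subseteq> equator n" unfolding support_def J_def by blast
    show "equator n \<subseteq> support J"
    proof
      fix x assume x: "x \<in> equator n"
      then have "x \<in> support L" using eq L(2) by blast
      then obtain D where D: "D \<in> L" "x \<in> cell_int D" using good_support[OF L(1)] by blast
      then have "D \<in> J" using x sat unfolding saturated_def J_def by blast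
      then show "x \<in> support J" using D(2) unfolding support_def carrier_def by blast
    qed
  qed
qed

text \<open>An open cell is connected, so a continuous function without zeros on it has one sign
  there, and the weak inequality passes to the closure.\<close>

lemma cell_sign:
  assumes c: "char k \<psi> D" and g: "continuous_on (closure (cell_int D)) (g :: point \<Rightarrow> real)"
    and nz: "\<And>x. x \<in> cell_int D \<Longrightarrow> g x \<noteq> 0" and x: "x \<in> cell_int D" "g x > 0"
  shows "y \<in> carrier D \<Longrightarrow> g y \<ge> 0"
proof -
  have con: "connected (cell_int D)" unfolding charD(4)[OF c]
    by (rule connected_continuous_image[OF continuous_on_subset[OF char_continuous[OF c] int_cube_subset] connected_int_cube])
  have "connected (g ` cell_int D)"
    by (rule connected_continuous_image[OF continuous_on_subset[OF g closure_subset] con])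
  have pos: "g z > 0" if z: "z \<in> cell_int D" for z
  proof (rule ccontr)
    assume "\<not> g z > 0"
    then have "g z \<le> 0" "0 \<le> g x" using x by auto
    then have "0 \<in> g ` cell_int D"
      using connectedD_interval[OF \<open>connected (g ` cell_int D)\<close>, of "g z" "g x" 0] x z by blast
    then show False using nz by force
  qed
  assume y: "y \<in> carrier D"
  have "closed {z \<in> closure (cell_int D). g z \<ge> 0}"
    by (rule continuous_on_closed_Collect_le[OF continuous_on_const g closed_closure])
  moreover have "cell_int D \<subseteq> {z \<in> closure (cell_int D). g z \<ge> 0}"
    using pos closure_subset by force
  ultimately have "closure (cell_int D) \<subseteq> {z \<in> closure (cell_int D). g z \<ge> 0}" by (intro closure_minimal)
  then show "g y \<ge> 0" using y unfolding char_closure[OF c] by blast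
qed

text \<open>The boundary of a half cube consists of the cells \<open>J\<close> of \<open>L\<close>
  on its side and the equatorial disc \<open>B\<close>; unfolding the half cube turns them into a
  decomposition of the sphere. It is independent of \<open>K\<close> and \<open>\<phi>\<close>, so
  it serves for every map with pullback \<open>L\<close>.\<close>

lemma half_pullback:
  assumes n: "1 \<le> n" and s: "s = 1 \<or> s = -1"
    and L: "good L" "support L = bd_cube n" and sat: "saturated n L"
  shows "\<exists>M. good M \<and> support M = bd_cube n \<and>
    (\<forall>K \<phi>. cellular L K \<phi> \<longrightarrow> char (n - 1) \<phi> (middle_cell n \<phi>) \<longrightarrow> middle_cell n \<phi> \<in> K \<longrightarrow> cellular M K (\<phi> \<circ> fold_half s n))"
proof -
  define J where "J = {D\<in>L. carrier D \<subseteq> {x. s * coord x (n - 1) \<ge> 0}}"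
  define E where "E = {D\<in>L. carrier D \<subseteq> equator n}"
  define B where "B = GCell (int_cube (n - 1)) (bd_cube (n - 1))"
  define L0 where "L0 = insert B J"
  have cB: "char (n - 1) (\<lambda>x. x) B"
    by (rule charI) (simp_all add: B_def int_bd_disjoint PL_on_aff polytope_cube aff_id)
  have carB: "carrier B = cube (n - 1)" by (simp add: B_def carrier_def cube_decomp)
  have JL: "J \<subseteq> L" unfolding J_def by blast
  have gJ: "good J"
    by (rule good_subcomplex[OF L(1) JL]) (auto simp: J_def carrier_def)
  have E: "good E" "support E = bd_cube (n - 1)" using sub_equator[OF L sat n] unfolding E_def by blast+
  have EJ: "E \<subseteq> J" unfolding E_def J_def equator_def by fastforce
  have sJ: "support J = {x \<in> bd_cube n. s * coord x (n - 1) \<ge> 0}"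
  proof
    show "support J \<subseteq> {x \<in> bd_cube n. s * coord x (n - 1) \<ge> 0}"
      unfolding L(2)[symmetric] support_def J_def by blast
    show "{x \<in> bd_cube n. s * coord x (n - 1) \<ge> 0} \<subseteq> support J"
    proof
      fix x assume x: "x \<in> {x \<in> bd_cube n. s * coord x (n - 1) \<ge> 0}"
      then have "x \<in> support L" using L(2) by blast
      then obtain D where D: "D \<in> L" "x \<in> cell_int D" using good_support[OF L(1)] by blast
      have Dbd: "carrier D \<subseteq> bd_cube n" using carrier_subset_support[OF D(1)] L(2) by simp
      have "D \<in> J"
      proof (cases "cell_int D \<inter> equator n = {}")
        case False
        then have "carrier D \<subseteq> equator n" using sat D(1) unfolding saturated_def by blast
        then show ?thesis using D(1) unfolding J_def equator_def by fastforce
      next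
        case True
        have nz: "s * coord z (n - 1) \<noteq> 0" if z: "z \<in> cell_int D" for z
        proof
          assume "s * coord z (n - 1) = 0"
          then have "coord z (n - 1) = 0" using s by auto
          moreover have "z \<in> bd_cube n" using z Dbd unfolding carrier_def by blast
          ultimately show False using True z unfolding equator_def by blast
        qed
        obtain k \<psi> where p: "char k \<psi> D" using goodD(3)[OF L(1) D(1)] by blast
        have "s * coord x (n - 1) \<ge> 0" using x by blast
        then have pos: "s * coord x (n - 1) > 0" by (rule order_le_neq_trans[OF _ nz[OF D(2), THEN not_sym]])
        have g: "continuous_on (closure (cell_int D)) (\<lambda>x. s * coord x (n - 1))"
          by (intro continuous_on_mult continuous_on_const continuous_on_coord)
        have "s * coord y (n - 1) \<ge> 0" if y: "y \<in> carrier D" for y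
          by (rule cell_sign[OF p g nz D(2) pos y])
        then show ?thesis using D(1) unfolding J_def by blast
      qed
      then show "x \<in> support J" using D(2) unfolding support_def carrier_def by blast
    qed
  qed
  have sL0: "support L0 = half_bd s n"
  proof -
    have "support L0 = carrier B \<union> support J" unfolding L0_def support_def by simp
    also have "\<dots> = {x \<in> bd_cube n. s * coord x (n - 1) \<ge> 0} \<union> int_cube (n - 1)"
      unfolding carB sJ cube_decomp bd_cube_pred[OF n] equator_def by auto
    also have "\<dots> = half_bd s n" using half_bd_eq[OF n s] by simp
    finally show ?thesis .
  qed
  have gL0: "good L0"
  proof (rule good_intro1)
    show "finite L0" unfolding L0_def using goodD(1)[OF gJ] by simp
    have BJ: "cell_int B \<inter> cell_int D = {}" if "D \<in> J" for D
    proof -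
      have "cell_int D \<subseteq> bd_cube n" using that JL carrier_subset_support L(2) unfolding carrier_def by blast
      moreover have "cell_int B \<subseteq> int_cube n" using cube_pred_subset(2)[OF n] by (simp add: B_def)
      ultimately show ?thesis using int_bd_disjoint by blast
    qed
    show "A = A'" if "A \<in> L0" "A' \<in> L0" "cell_int A \<inter> cell_int A' \<noteq> {}" for A A'
      using that BJ goodD(2)[OF gJ, of A A'] unfolding L0_def by blast
    show "\<exists>n \<phi> M. char n \<phi> A \<and> good M \<and> support M = bd_cube n \<and> cellular M L0 \<phi>" if A: "A \<in> L0" for A
    proof (cases "A = B")
      case True
      have "cellular E L0 (\<lambda>x. x)" by (rule cellular_id) (use EJ L0_def in blast)
      then show ?thesis unfolding True using cB E by (intro exI[of _ "n - 1"] exI[of _ "\<lambda>x. x"] exI[of _ E]) simp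
    next
      case False
      then have AJ: "A \<in> J" using A unfolding L0_def by blast
      obtain m \<phi> where c: "char m \<phi> A" using goodD(3)[OF gJ AJ] by blast
      obtain M where M: "good M" "support M = bd_cube m" "cellular M J \<phi>" using goodD(4)[OF gJ AJ c] by blast
      have "cellular M L0 \<phi>" by (rule cellular_mono[OF M(3)]) (use L0_def in blast)
      then show ?thesis using c M by (intro exI[of _ m] exI[of _ \<phi>] exI[of _ M]) simp
    qed
  qed
  let ?d = "unfold_half s n"
  have hp: "PL_on (support L0) ?d"
  proof -
    have "compact_polyhedron (half_bd s n)" unfolding fold_bd[OF n s, symmetric]
      by (rule PL_on_image[OF PL_on_subset[OF PL_on_aff[OF polytope_cube aff_fold_half] compact_polyhedron_bd_cube bd_cube_subset]])
    then show ?thesis unfolding sL0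
      by (rule PL_on_subset[OF PL_on_aff[OF polytope_cube aff_unfold_half] _ half_bd_subset])
  qed
  have hi: "inj_on ?d (support L0)" by (rule inj_on_inverseI[where g = "fold_half s n"]) (rule fold_unfold)
  let ?M = "gmap ?d ` L0"
  have 1: "good ?M" by (rule good_transport[OF gL0 hp hi])
  have 2: "support ?M = bd_cube n" unfolding support_gmap sL0 by (rule unfold_bd[OF n s])
  have 3: "cellular ?M K (\<phi> \<circ> fold_half s n)"
    if c: "cellular L K \<phi>" and m: "char (n - 1) \<phi> (middle_cell n \<phi>)" "middle_cell n \<phi> \<in> K" for K \<phi>
  proof -
    have gB: "gmap \<phi> B = middle_cell n \<phi>" by (simp add: gmap_def B_def middle_cell_eq[OF n])
    have "cellular L0 K \<phi>"
    proof (rule cellularI)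
      fix D assume D: "D \<in> L0"
      show "\<exists>k \<psi>. char k \<psi> D \<and> char k (\<phi> \<circ> \<psi>) (gmap \<phi> D) \<and> gmap \<phi> D \<in> K"
      proof (cases "D = B")
        case True
        show ?thesis unfolding True gB using cB m
          by (intro exI[of _ "n - 1"] exI[of _ "\<lambda>x. x"]) (simp add: o_def)
      next
        case False
        then have DL: "D \<in> L" using D JL unfolding L0_def by blast
        obtain k \<psi> where p: "char k \<psi> D" using goodD(3)[OF L(1) DL] by blast
        show ?thesis using p cellularD(1)[OF c DL] cellularD(2)[OF c DL p] by (intro exI[of _ k] exI[of _ \<psi>]) simp
      qed
    qed
    then show ?thesis by (rule cellular_shift[OF gL0 _ hp hi]) (simp add: fold_unfold)
  qed
  show ?thesis by (intro exI[of _ ?M] conjI allI impI 1 2 3)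
qed

text \<open>The three open cells are the sign classes of the last coordinate on the open cube.
  Stating the sign \<open>t\<close> together with the cell that belongs to it reduces disjointness
  to a comparison of signs.\<close>

lemma subdiv_int: assumes n: "1 \<le> n" and D: "D \<in> subdiv n \<phi>"
  shows "\<exists>S. cell_int D = \<phi> ` S \<and> S \<subseteq> int_cube n \<and> (\<exists>t. S = {x\<in>int_cube n. sgn (coord x (n - 1)) = t} \<and>
    D = (if t = 1 then half_cell 1 n \<phi> else if t = -1 then half_cell (-1) n \<phi> else middle_cell n \<phi>))"
proof -
  have "half_int 1 n = {x\<in>int_cube n. sgn (coord x (n - 1)) = 1}"
    "half_int (-1) n = {x\<in>int_cube n. sgn (coord x (n - 1)) = -1}"
    unfolding half_int_def by (auto simp: sgn_if)
  moreover have "int_cube (n - 1) = {x\<in>int_cube n. sgn (coord x (n - 1)) = 0}"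
    unfolding int_cube_pred[OF n] by (auto simp: sgn_if)
  moreover have "D = half_cell 1 n \<phi> \<or> D = half_cell (-1) n \<phi> \<or> D = middle_cell n \<phi>"
    using D unfolding subdiv_def by blast
  ultimately show ?thesis
  proof (elim disjE)
    assume h: "half_int 1 n = {x\<in>int_cube n. sgn (coord x (n - 1)) = 1}" "D = half_cell 1 n \<phi>"
    show ?thesis by (rule exI[of _ "half_int 1 n"], intro conjI exI[of _ 1]) (use h half_int_subset in \<open>simp_all add: half_cell_def\<close>)
  next
    assume h: "half_int (-1) n = {x\<in>int_cube n. sgn (coord x (n - 1)) = -1}" "D = half_cell (-1) n \<phi>"
    show ?thesis by (rule exI[of _ "half_int (-1) n"], intro conjI exI[of _ "-1"]) (use h half_int_subset in \<open>simp_all add: half_cell_def\<close>)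
  next
    assume h: "int_cube (n - 1) = {x\<in>int_cube n. sgn (coord x (n - 1)) = 0}" "D = middle_cell n \<phi>"
    show ?thesis by (rule exI[of _ "int_cube (n - 1)"], intro conjI exI[of _ 0])
        (use h cube_pred_subset[OF n] in \<open>simp_all add: middle_cell_eq[OF n]\<close>)
  qed
qed

lemma subdiv_int_subset: "1 \<le> n \<Longrightarrow> D \<in> subdiv n \<phi> \<Longrightarrow> cell_int D \<subseteq> \<phi> ` int_cube n"
  using subdiv_int[of n D \<phi>] by blast

lemma subdiv_disjoint:
  assumes n: "1 \<le> n" and inj: "inj_on \<phi> (int_cube n)" and D: "D \<in> subdiv n \<phi>" "D' \<in> subdiv n \<phi>"
    and i: "cell_int D \<inter> cell_int D' \<noteq> {}"
  shows "D = D'"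
proof -
  obtain S t where S: "cell_int D = \<phi> ` S" "S = {x\<in>int_cube n. sgn (coord x (n - 1)) = t}"
    "D = (if t = 1 then half_cell 1 n \<phi> else if t = -1 then half_cell (-1) n \<phi> else middle_cell n \<phi>)"
    using subdiv_int[OF n D(1)] by (elim exE conjE)
  obtain S' t' where S': "cell_int D' = \<phi> ` S'" "S' = {x\<in>int_cube n. sgn (coord x (n - 1)) = t'}"
    "D' = (if t' = 1 then half_cell 1 n \<phi> else if t' = -1 then half_cell (-1) n \<phi> else middle_cell n \<phi>)"
    using subdiv_int[OF n D(2)] by (elim exE conjE)
  obtain z where z: "z \<in> \<phi> ` S" "z \<in> \<phi> ` S'" using i S(1) S'(1) by blast
  then obtain x y where xy: "x \<in> S" "y \<in> S'" "\<phi> x = \<phi> y" by (metis imageE)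
  have "x = y" by (rule inj_onD[OF inj xy(3)]) (use xy S(2) S'(2) in simp_all)
  then have "t = t'" using xy S(2) S'(2) by simp
  then show ?thesis using S(3) S'(3) by simp
qed

lemma subdiv_carrier: assumes n: "1 \<le> n" shows "(\<Union>D\<in>subdiv n \<phi>. carrier D) = \<phi> ` cube n"
proof -
  have h: "carrier (half_cell s n \<phi>) = \<phi> ` {x\<in>cube n. s * coord x (n - 1) \<ge> 0}" for s
  proof -
    have "half_int s n \<subseteq> {x\<in>cube n. s * coord x (n - 1) \<ge> 0}"
      unfolding half_int_def using int_cube_subset by fastforce
    then have "half_int s n \<union> half_bd s n = {x\<in>cube n. s * coord x (n - 1) \<ge> 0}"
      unfolding half_bd_def by blast
    then show ?thesis unfolding carrier_def half_cell_def gcell.sel image_Un[symmetric] by simp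
  qed
  have m: "carrier (middle_cell n \<phi>) = \<phi> ` cube (n - 1)"
    unfolding carrier_def middle_cell_eq[OF n] gcell.sel image_Un[symmetric] cube_decomp ..
  have "(\<Union>D\<in>subdiv n \<phi>. carrier D) = \<phi> ` ({x\<in>cube n. 1 * coord x (n - 1) \<ge> 0} \<union> {x\<in>cube n. (-1) * coord x (n - 1) \<ge> 0} \<union> cube (n - 1))"
    unfolding subdiv_def by (simp only: UN_insert UN_empty h m image_Un Un_empty_right Un_assoc)
  also have "{x\<in>cube n. 1 * coord x (n - 1) \<ge> 0} \<union> {x\<in>cube n. (-1) * coord x (n - 1) \<ge> 0} \<union> cube (n - 1) = cube n"
    using cube_pred_subset(1)[OF n] by auto
  finally show ?thesis .
qed

text \<open>The new cells have characteristic maps \<open>\<phi> \<circ> u\<close> with a map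
  \<open>u\<close> that works for every \<open>\<psi>\<close> in place of \<open>\<phi>\<close>.
  Hence subdivision commutes with cellular maps, and a cell and the cells lying over it can be
  subdivided compatibly.\<close>

lemma char_subdiv:
  assumes c: "char n \<phi> C" and n: "1 \<le> n" and D: "D \<in> subdiv n \<phi>"
  shows "\<exists>k u. aff u \<and> u ` cube k \<subseteq> cube n \<and>
    (\<forall>\<psi> C'. char n \<psi> C' \<longrightarrow> (\<exists>D'\<in>subdiv n \<psi>. char k (\<psi> \<circ> u) D')) \<and> char k (\<phi> \<circ> u) D"
proof -
  have half: ?thesis if s: "s = 1 \<or> s = -1" and Ds: "D = half_cell s n \<phi>" for s
  proof (intro exI[of _ n] exI[of _ "fold_half s n"] conjI allI impI)
    show "fold_half s n ` cube n \<subseteq> cube n"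
      unfolding cube_decomp[of n] image_Un fold_int[OF n s] fold_bd[OF n s]
      using half_int_subset half_bd_subset unfolding cube_decomp by blast
    show "char n (\<phi> \<circ> fold_half s n) D" unfolding Ds by (rule char_half[OF c n s])
    fix \<psi> C' assume "char n \<psi> C'"
    then show "\<exists>D'\<in>subdiv n \<psi>. char n (\<psi> \<circ> fold_half s n) D'"
      by (intro bexI[of _ "half_cell s n \<psi>"] char_half n s) (use s in \<open>auto simp: subdiv_def\<close>)
  qed (rule aff_fold_half)
  have mid: ?thesis if Ds: "D = middle_cell n \<phi>"
  proof (intro exI[of _ "n - 1"] exI[of _ "\<lambda>x. x"] conjI allI impI)
    show "(\<lambda>x. x) ` cube (n - 1) \<subseteq> cube n" using cube_pred_subset(1)[OF n] by simp
    show "char (n - 1) (\<phi> \<circ> (\<lambda>x. x)) D" unfolding Ds o_def by (rule char_middle[OF c n])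
    fix \<psi> C' assume "char n \<psi> C'"
    then show "\<exists>D'\<in>subdiv n \<psi>. char (n - 1) (\<psi> \<circ> (\<lambda>x. x)) D'"
      unfolding o_def by (intro bexI[of _ "middle_cell n \<psi>"] char_middle n) (auto simp: subdiv_def)
  qed (rule aff_id)
  show ?thesis using D half[of 1] half[of "-1"] mid unfolding subdiv_def by blast
qed

text \<open>A cell over which a cell of a pullback lies is subdivided together with all cells lying over it,
  so the induction needs the simultaneous subdivision of several cells of the same dimension.\<close>

lemma good_subdivide:
  assumes "good K" and n: "1 \<le> n" and "\<C> \<subseteq> K" and "\<And>C. C \<in> \<C> \<Longrightarrow> char n (\<Phi> C) C"
    and "\<And>C L. C \<in> \<C> \<Longrightarrow> good L \<Longrightarrow> support L = bd_cube n \<Longrightarrow> cellular L K (\<Phi> C) \<Longrightarrow> saturated n L"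
  shows "good ((K - \<C>) \<union> (\<Union>C\<in>\<C>. subdiv n (\<Phi> C)))"
  using assms(1,3-5)
proof (induction arbitrary: \<C> \<Phi> rule: good.induct)
  case (goodI K)
  have K: "good K"
  proof (rule good.goodI[OF goodI(1,2,3)], intro ballI allI impI)
    fix A m \<phi> assume A: "A \<in> K" "char m \<phi> A"
    from goodI(4)[rule_format, OF A] show "\<exists>L. good L \<and> support L = bd_cube m \<and> cellular L K \<phi>" by blast
  qed
  note ch = goodI.prems(2) and st = goodI.prems(3)
  let ?K' = "(K - \<C>) \<union> (\<Union>C\<in>\<C>. subdiv n (\<Phi> C))"
  have par: "\<exists>p\<in>K. cell_int A \<subseteq> cell_int p \<and> (if p \<in> \<C> then A \<in> subdiv n (\<Phi> p) else A = p)" if A: "A \<in> ?K'" for A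
  proof (cases "A \<in> K - \<C>")
    case True then show ?thesis by (intro bexI[of _ A]) auto
  next
    case False
    then obtain C where C: "C \<in> \<C>" "A \<in> subdiv n (\<Phi> C)" using A by blast
    have "cell_int A \<subseteq> cell_int C" using subdiv_int_subset[OF n C(2)] charD(4)[OF ch[OF C(1)]] by simp
    then show ?thesis using C goodI.prems(1) by (intro bexI[of _ C]) auto
  qed
  show ?case
  proof (rule good_intro1)
    show "finite ?K'" using goodI(1) finite_subset[OF goodI.prems(1) goodI(1)] by (auto simp: subdiv_def)
  next
    fix A B assume AB: "A \<in> ?K'" "B \<in> ?K'" "cell_int A \<inter> cell_int B \<noteq> {}"
    obtain p where p: "p \<in> K" "cell_int A \<subseteq> cell_int p" "if p \<in> \<C> then A \<in> subdiv n (\<Phi> p) else A = p"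
      using par[OF AB(1)] by blast
    obtain q where q: "q \<in> K" "cell_int B \<subseteq> cell_int q" "if q \<in> \<C> then B \<in> subdiv n (\<Phi> q) else B = q"
      using par[OF AB(2)] by blast
    have pq: "p = q" by (rule goodD(2)[OF K p(1) q(1)]) (use AB(3) p(2) q(2) in blast)
    show "A = B"
    proof (cases "p \<in> \<C>")
      case True
      show ?thesis by (rule subdiv_disjoint[OF n charD(3)[OF ch[OF True]] _ _ AB(3)]) (use p q pq True in auto)
    next
      case False then show ?thesis using p q pq by simp
    qed
  next
    fix A assume A: "A \<in> ?K'"
    show "\<exists>m \<phi> L. char m \<phi> A \<and> good L \<and> support L = bd_cube m \<and> cellular L ?K' \<phi>"
    proof (cases "A \<in> K - \<C>")
      case True
      then have AK: "A \<in> K" by blast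
      obtain m \<phi> where c: "char m \<phi> A" using goodD(3)[OF K AK] by blast
      obtain L where L: "good L" "support L = bd_cube m" "cellular L K \<phi>" and
        IH: "\<And>\<C> \<Phi>. \<C> \<subseteq> L \<Longrightarrow> (\<And>C. C \<in> \<C> \<Longrightarrow> char n (\<Phi> C) C) \<Longrightarrow>
          (\<And>C M. C \<in> \<C> \<Longrightarrow> good M \<Longrightarrow> support M = bd_cube n \<Longrightarrow> cellular M L (\<Phi> C) \<Longrightarrow> saturated n M) \<Longrightarrow>
          good ((L - \<C>) \<union> (\<Union>C\<in>\<C>. subdiv n (\<Phi> C)))"
        using goodI(4)[rule_format, OF AK c] by (elim exE conjE) metis
      \<comment> \<open>The cells of the pullback that lie over subdivided cells. Their
        characteristic maps \<open>\<Psi> D\<close> are chosen to lie exactly over the given maps of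
        the cells below, so that equators correspond to equators.\<close>
      define \<D> where "\<D> = {D\<in>L. gmap \<phi> D \<in> \<C>}"
      have "\<forall>D\<in>\<D>. \<exists>\<theta>. char n \<theta> D \<and> (\<forall>x\<in>cube n. \<phi> (\<theta> x) = \<Phi> (gmap \<phi> D) x)"
      proof
        fix D assume "D \<in> \<D>"
        then have D: "D \<in> L" "gmap \<phi> D \<in> \<C>" unfolding \<D>_def by blast+
        obtain k \<psi> where p: "char k \<psi> D" using goodD(3)[OF L(1) D(1)] by blast
        from char_lift_eq[OF ch[OF D(2)] p cellularD(2)[OF L(3) D(1) p]]
        show "\<exists>\<theta>. char n \<theta> D \<and> (\<forall>x\<in>cube n. \<phi> (\<theta> x) = \<Phi> (gmap \<phi> D) x)" by (rule conjunct2)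
      qed
      from bchoice[OF this] obtain \<Psi> where
        \<Psi>: "\<forall>D\<in>\<D>. char n (\<Psi> D) D \<and> (\<forall>x\<in>cube n. \<phi> (\<Psi> D x) = \<Phi> (gmap \<phi> D) x)" by (rule exE)
      have P1: "char n (\<Psi> D) D" and P2: "\<And>x. x \<in> cube n \<Longrightarrow> \<phi> (\<Psi> D x) = \<Phi> (gmap \<phi> D) x" if "D \<in> \<D>" for D
        using \<Psi>[rule_format, OF that] by simp_all
      let ?L = "(L - \<D>) \<union> (\<Union>D\<in>\<D>. subdiv n (\<Psi> D))"
      have DL: "\<D> \<subseteq> L" unfolding \<D>_def by blast
      have gL: "good ?L"
      proof (rule IH[OF DL P1])
        fix D M assume D: "D \<in> \<D>" and M: "good M" "support M = bd_cube n" "cellular M L (\<Psi> D)"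
        \<comment> \<open>A pullback for a cell \<open>D\<close> upstairs is also a pullback for the
          cell below it, so the saturation hypothesis passes to the cells in
          \<open>\<D>\<close>.\<close>
        have "cellular M K (\<phi> \<circ> \<Psi> D)" by (rule cellular_compose[OF M(3) L(3)])
        then have "cellular M K (\<Phi> (gmap \<phi> D))"
          by (rule cellular_cong) (use P2[OF D] M(2) subsetD[OF bd_cube_subset[of n]] in simp)
        then show "saturated n M" using st[OF _ M(1,2)] D unfolding \<D>_def by blast
      qed
      have sL: "support ?L = bd_cube m"
      proof -
        have "support ?L = (\<Union>D\<in>L - \<D>. carrier D) \<union> (\<Union>D\<in>\<D>. \<Union>E\<in>subdiv n (\<Psi> D). carrier E)"
          unfolding support_def by blast
        also have "(\<Union>D\<in>\<D>. \<Union>E\<in>subdiv n (\<Psi> D). carrier E) = (\<Union>D\<in>\<D>. carrier D)"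
          using subdiv_carrier[OF n] char_carrier[OF P1] by simp
        also have "(\<Union>D\<in>L - \<D>. carrier D) \<union> (\<Union>D\<in>\<D>. carrier D) = support L"
          unfolding support_def using DL by blast
        finally show ?thesis using L(2) by simp
      qed
      have "cellular ?L ?K' \<phi>"
      proof (rule cellularI)
        fix E assume E: "E \<in> ?L"
        show "\<exists>k \<psi>. char k \<psi> E \<and> char k (\<phi> \<circ> \<psi>) (gmap \<phi> E) \<and> gmap \<phi> E \<in> ?K'"
        proof (cases "E \<in> L - \<D>")
          case True
          then have EL: "E \<in> L" "gmap \<phi> E \<notin> \<C>" unfolding \<D>_def by blast+
          obtain k \<psi> where p: "char k \<psi> E" using goodD(3)[OF L(1) EL(1)] by blast
          show ?thesis
            by (intro exI[of _ k] exI[of _ \<psi>] conjI p cellularD(2)[OF L(3) EL(1) p]) (use cellularD(1)[OF L(3) EL(1)] EL(2) in blast)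
        next
          case False
          then obtain D where D: "D \<in> \<D>" "E \<in> subdiv n (\<Psi> D)" using E by blast
          let ?C = "gmap \<phi> D"
          have C: "?C \<in> \<C>" using D(1) unfolding \<D>_def by blast
          obtain k u where u: "u ` cube k \<subseteq> cube n"
            "\<forall>\<psi> C'. char n \<psi> C' \<longrightarrow> (\<exists>D'\<in>subdiv n \<psi>. char k (\<psi> \<circ> u) D')" "char k (\<Psi> D \<circ> u) E"
            using char_subdiv[OF P1[OF D(1)] n D(2)] by (elim exE conjE)
          obtain F where F: "F \<in> subdiv n (\<Phi> ?C)" "char k (\<Phi> ?C \<circ> u) F" using u(2)[rule_format, OF ch[OF C]] by blast
          have F2: "char k (\<phi> \<circ> (\<Psi> D \<circ> u)) F"
            by (rule char_cong[OF F(2)]) (use P2[OF D(1)] u(1) in \<open>simp add: image_subset_iff\<close>)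
          have "F = gmap \<phi> E" by (rule char_compose_eq[OF u(3) F2])
          then show ?thesis using u(3) F2 F(1) C by (intro exI[of _ k] exI[of _ "\<Psi> D \<circ> u"]) auto
        qed
      qed
      then show ?thesis using c gL sL by (intro exI[of _ m] exI[of _ \<phi>] exI[of _ ?L]) simp
    next
      case False
      then obtain C where C: "C \<in> \<C>" "A \<in> subdiv n (\<Phi> C)" using A by blast
      let ?\<phi> = "\<Phi> C"
      have CK: "C \<in> K" using C(1) goodI.prems(1) by blast
      note c = ch[OF C(1)]
      obtain L where L: "good L" "support L = bd_cube n" "cellular L K ?\<phi>" using goodD(4)[OF K CK c] by blast
      have sat: "saturated n L" by (rule st[OF C(1) L])
      have cel: "cellular L ?K' ?\<phi>"
        unfolding cellular_def
      proof (intro ballI conjI allI impI)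
        fix D assume D: "D \<in> L"
        obtain k \<psi> where p: "char k \<psi> D" using goodD(3)[OF L(1) D] by blast
        \<comment> \<open>All subdivided cells have dimension \<open>n\<close>, whereas boundary
          cells have smaller dimension; so the boundary of a subdivided cell stays as it
          was.\<close>
        have "gmap ?\<phi> D \<notin> \<C>"
        proof
          assume "gmap ?\<phi> D \<in> \<C>"
          then have "k = n" using char_dim_unique[OF cellularD(2)[OF L(3) D p] ch] by blast
          then show False using pullback_dim_less[OF L(1,2) D p] by simp
        qed
        then show "gmap ?\<phi> D \<in> ?K'" using cellularD(1)[OF L(3) D] by blast
      qed (rule cellularD(2)[OF L(3)])
      have mid: "char (n - 1) ?\<phi> (middle_cell n ?\<phi>)" "middle_cell n ?\<phi> \<in> ?K'"
        using char_middle[OF c n] C(1) unfolding subdiv_def by blast+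
      have half: ?thesis if s: "s = 1 \<or> s = -1" and As: "A = half_cell s n ?\<phi>" for s
      proof -
        obtain M where M: "good M" "support M = bd_cube n" "\<forall>K \<phi>. cellular L K \<phi> \<longrightarrow> char (n - 1) \<phi> (middle_cell n \<phi>) \<longrightarrow>
          middle_cell n \<phi> \<in> K \<longrightarrow> cellular M K (\<phi> \<circ> fold_half s n)"
          using half_pullback[OF n s L(1,2) sat] by (elim exE conjE)
        show ?thesis unfolding As using M(1,2) M(3)[rule_format, OF cel mid] char_half[OF c n s]
          by (intro exI[of _ n] exI[of _ "?\<phi> \<circ> fold_half s n"] exI[of _ M]) simp
      qed
      have midc: ?thesis if As: "A = middle_cell n ?\<phi>"
      proof -
        let ?J = "{D\<in>L. carrier D \<subseteq> equator n}"
        have "cellular ?J ?K' ?\<phi>" by (rule cellular_subset[OF cel]) blast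
        then show ?thesis unfolding As using mid(1) sub_equator[OF L(1,2) sat n]
          by (intro exI[of _ "n - 1"] exI[of _ ?\<phi>] exI[of _ ?J]) simp
      qed
      show ?thesis using C(2) half[of 1] half[of "-1"] midc unfolding subdiv_def by blast
    qed
  qed
qed

text \<open>\<open>good_subdivide\<close> asks for saturation of every pullback; by uniqueness the
  given \<open>L\<close> is the only one.\<close>

lemma elementary_subdivision_step:
  assumes K: "good K" and C: "C \<in> K" and n: "1 \<le> n" and c: "char n \<phi> C"
    and L: "good L" "support L = bd_cube n" "cellular L K \<phi>" and sat: "saturated n L"
  shows "elementary_subdivision K ((K - {C}) \<union> subdiv n \<phi>)" "good ((K - {C}) \<union> subdiv n \<phi>)"
proof -
  have "good ((K - {C}) \<union> (\<Union>C\<in>{C}. subdiv n \<phi>))"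
  proof (rule good_subdivide[OF K n, of "{C}" "\<lambda>_. \<phi>"])
    fix C' M assume M: "good M" "support M = bd_cube n" "cellular M K \<phi>"
    have "M = L" by (rule pullback_unique[OF K M(1,3) L(1,3)]) (simp add: M L)
    then show "saturated n M" using sat by simp
  qed (use C c in auto)
  then show "good ((K - {C}) \<union> subdiv n \<phi>)" by simp
  have "pullback_decomposition K n \<phi> L"
    unfolding pullback_decomposition_def PLCW_decomposition_def
  proof (intro conjI L(2) good_imp_PLCW L(1))
    have "PL_on (support L) \<phi>" unfolding L(2)
      by (rule PL_on_subset[OF charD(2)[OF c] compact_polyhedron_bd_cube bd_cube_subset])
    moreover have "cellular L (skeleton (n - 1) K) \<phi>" by (rule cellular_skeleton[OF L]) (use n in simp)
    ultimately show "regular_cellular_map L (skeleton (n - 1) K) \<phi>" by (intro cellular_imp_regular_cellular)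
  qed
  moreover have "union_of_cells L (equator n)"
    unfolding union_of_cells_def
  proof (intro exI[of _ "{D\<in>L. carrier D \<subseteq> equator n}"] conjI)
    show "equator n = \<Union>(carrier ` {D\<in>L. carrier D \<subseteq> equator n})"
      using sub_equator(2)[OF L(1,2) sat n] bd_cube_pred[OF n] unfolding support_def by simp
  qed blast
  ultimately show "elementary_subdivision K ((K - {C}) \<union> subdiv n \<phi>)"
    unfolding elementary_subdivision_def subdiv_def upper_cell_eq[symmetric] lower_cell_eq[symmetric]
    using good_imp_PLCW[OF K] C n c
    by (intro conjI bexI[of _ C] exI[of _ n] exI[of _ \<phi>] exI[of _ L]) simp_all
qed

section \<open>Piecewise linear homeomorphisms between convex polytopes\<close>

text \<open>A central arrangement \<open>F\<close> of hyperplanes decomposes \<open>Rn k\<close> into open cones, the classes of \<open>same\<close>.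
  Choosing a center \<open>B z\<close> in every cone subdivides the arrangement barycentrically into simplicial cones, spanned
  by the chains of centers. Moving each center to another one \<open>B' z\<close> in the same cone and
  extending linearly over the simplicial cones (the relation \<open>rep\<close>) gives a piecewise linear homeomorphism.\<close>

locale fan =
  fixes k :: nat and F :: "(point \<Rightarrow> real) set"
  assumes finF: "finite F" and linF: "f \<in> F \<Longrightarrow> linear f"
    and sepF: "x \<in> Rn k \<Longrightarrow> (\<And>f. f \<in> F \<Longrightarrow> f x = 0) \<Longrightarrow> x = 0"
begin

definition same :: "point \<Rightarrow> point \<Rightarrow> bool" where
  "same x z \<longleftrightarrow> (\<forall>f\<in>F. sgn (f x) = sgn (f z))"

text \<open>\<open>x\<close> lies in the closure of the open cone of \<open>z\<close>; equivalently,
  the cone of \<open>x\<close> is a face of the cone of \<open>z\<close>.\<close>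

definition low :: "point \<Rightarrow> point \<Rightarrow> bool" where
  "low x z \<longleftrightarrow> (\<forall>f\<in>F. f x \<noteq> 0 \<longrightarrow> sgn (f x) = sgn (f z))"

definition centers :: "(point \<Rightarrow> point) \<Rightarrow> bool" where
  "centers B \<longleftrightarrow> (\<forall>z\<in>Rn k. B z \<in> Rn k \<and> same (B z) z) \<and> (\<forall>x\<in>Rn k. \<forall>z\<in>Rn k. same x z \<longrightarrow> B x = B z)"

text \<open>\<open>x\<close> is a positive combination of the centers of a flag of cones, and
  \<open>y\<close> is the combination of the moved centers with the same coefficients. The
  functional \<open>f\<close> certifies that the cone of \<open>x\<close> is a proper face of the
  cone of \<open>z\<close>.\<close>

inductive rep :: "(point \<Rightarrow> point) \<Rightarrow> (point \<Rightarrow> point) \<Rightarrow> point \<Rightarrow> point \<Rightarrow> bool" for B B' where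
  rep0: "rep B B' 0 0"
| repS: "rep B B' x y \<Longrightarrow> z \<in> Rn k \<Longrightarrow> low x z \<Longrightarrow> f \<in> F \<Longrightarrow> f x = 0 \<Longrightarrow> f z \<noteq> 0 \<Longrightarrow> t > 0 \<Longrightarrow>
    rep B B' (t *\<^sub>R B z + x) (t *\<^sub>R B' z + y)"

text \<open>The centers of a flag of cones. The functional that certifies a proper face vanishes on
  all earlier centers but not on the new one, which yields linear independence.\<close>

inductive chain :: "(point \<Rightarrow> point) \<Rightarrow> point set \<Rightarrow> bool" for B where
  chain0: "chain B {}"
| chainS: "chain B T \<Longrightarrow> z \<in> Rn k \<Longrightarrow> (\<And>b. b \<in> T \<Longrightarrow> low b z) \<Longrightarrow> f \<in> F \<Longrightarrow> f z \<noteq> 0 \<Longrightarrow>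
    (\<And>b. b \<in> T \<Longrightarrow> f b = 0) \<Longrightarrow> chain B (insert (B z) T)"

lemma same_sym: "same x z \<Longrightarrow> same z x"
  and same_trans: "same x y \<Longrightarrow> same y z \<Longrightarrow> same x z"
  unfolding same_def by auto

lemma same_low: "same x y \<Longrightarrow> low y z \<Longrightarrow> low x z"
  and low_same: "low x y \<Longrightarrow> same y z \<Longrightarrow> low x z"
  unfolding low_def same_def by (metis sgn_0_0)+

lemma low_trans: "low x y \<Longrightarrow> low y z \<Longrightarrow> low x z"
  unfolding low_def by (metis sgn_0_0)

lemma centersD: "centers B \<Longrightarrow> z \<in> Rn k \<Longrightarrow> B z \<in> Rn k" "centers B \<Longrightarrow> z \<in> Rn k \<Longrightarrow> same (B z) z"
  "centers B \<Longrightarrow> x \<in> Rn k \<Longrightarrow> z \<in> Rn k \<Longrightarrow> same x z \<Longrightarrow> B x = B z"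
  unfolding centers_def by blast+

lemma F_comb: "f \<in> F \<Longrightarrow> f (t *\<^sub>R b + x) = t * f b + f x"
  using linF[of f] by (simp add: linear_add linear_scale)

lemma F_0: "f \<in> F \<Longrightarrow> f 0 = 0"
  using linF[of f] by (simp add: linear_0)

lemma low_add: assumes b: "same b z" and l: "low x z" and t: "t > 0" shows "same (t *\<^sub>R b + x) z"
  unfolding same_def
proof
  fix f assume f: "f \<in> F"
  have s: "sgn (f b) = sgn (f z)" using b f unfolding same_def by blast
  have s': "f x = 0 \<or> sgn (f x) = sgn (f z)" using l f unfolding low_def by blast
  show "sgn (f (t *\<^sub>R b + x)) = sgn (f z)"
  proof (cases "f z" "0::real" rule: linorder_cases)
    case less
    then have "f b < 0" using s by (simp add: sgn_if split: if_splits)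
    moreover have "f x \<le> 0" using s' less by (auto simp: sgn_if split: if_splits)
    ultimately have "t * f b + f x < 0" using t by (simp add: add_neg_nonpos mult_pos_neg)
    then show ?thesis unfolding F_comb[OF f] using less by simp
  next
    case equal
    then have "f b = 0" "f x = 0" using s s' by (auto simp: sgn_0_0)
    then show ?thesis unfolding F_comb[OF f] using equal by simp
  next
    case greater
    then have "f b > 0" using s by (simp add: sgn_if split: if_splits)
    moreover have "f x \<ge> 0" using s' greater by (auto simp: sgn_if split: if_splits)
    ultimately have "t * f b + f x > 0" using t by (simp add: add_pos_nonneg)
    then show ?thesis unfolding F_comb[OF f] using greater by simp
  qed
qed

lemma same_zero: "f \<in> F \<Longrightarrow> same x z \<Longrightarrow> f x = 0 \<longleftrightarrow> f z = 0"
  unfolding same_def by (metis sgn_0_0)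

lemma rep_props:
  assumes B: "centers B" and B': "centers B'"
  shows "rep B B' x y \<Longrightarrow> x \<in> Rn k \<and> y \<in> Rn k \<and> same x y"
proof (induction rule: rep.induct)
  case rep0 then show ?case by (simp add: same_def)
next
  case (repS x y z f t)
  have "same (t *\<^sub>R B z + x) z" by (rule low_add[OF centersD(2)[OF B repS(2)] repS(3,7)])
  moreover have "low y z" by (rule same_low[OF same_sym repS(3)]) (use repS.IH in blast)
  then have "same (t *\<^sub>R B' z + y) z" by (rule low_add[OF centersD(2)[OF B' repS(2)] _ repS(7)])
  ultimately have "same (t *\<^sub>R B z + x) (t *\<^sub>R B' z + y)" using same_sym same_trans by blast
  then show ?case using repS.IH centersD(1)[OF B repS(2)] centersD(1)[OF B' repS(2)] by (simp add: Rn_add Rn_scaleR)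
qed

lemma rep_sym:
  assumes B: "centers B" and B': "centers B'"
  shows "rep B B' x y \<Longrightarrow> rep B' B y x"
proof (induction rule: rep.induct)
  case rep0 show ?case by (rule rep.rep0)
next
  case (repS x y z f t)
  have s: "same x y" using rep_props[OF B B' repS(1)] by blast
  show ?case
    by (rule rep.repS[OF repS.IH repS(2) same_low[OF same_sym[OF s] repS(3)] repS(4) _ repS(6,7)])
      (use same_zero[OF repS(4) s] repS(5) in simp)
qed

text \<open>The top coefficients are compared by a functional that vanishes on the remainder
  \<open>x\<close> but not at the center. The other remainder \<open>x'\<close> lies in the closed
  cone, so the value of the functional at it is 0 or has the sign of \<open>f b\<close>.\<close>

lemma rep_coeff_le:
  assumes f: "f \<in> F" "f x = 0" "f z \<noteq> 0" and b: "same b z" and l: "low x' z"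
    and e: "t *\<^sub>R b + x = t' *\<^sub>R b + x'"
  shows "t' \<le> t"
proof -
  have e': "t * f b = t' * f b + f x'" using arg_cong[OF e, of f] unfolding F_comb[OF f(1)] using f(2) by simp
  have s: "sgn (f b) = sgn (f z)" using b f(1) unfolding same_def by blast
  have s': "f x' = 0 \<or> sgn (f x') = sgn (f z)" using l f(1) unfolding low_def by blast
  show ?thesis
  proof (cases "f z > 0")
    case True
    then have "f b > 0" "f x' \<ge> 0" using s s' by (auto simp: sgn_if split: if_splits)
    then have "t' * f b \<le> t * f b" using e' by simp
    then show ?thesis using \<open>f b > 0\<close> by simp
  next
    case False
    then have "f b < 0" "f x' \<le> 0" using s s' f(3) by (auto simp: sgn_if split: if_splits)
    then have "t * f b \<le> t' * f b" using e' by simp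
    then show ?thesis using \<open>f b < 0\<close> by simp
  qed
qed

text \<open>The top cone is the cone of the point itself, two applications of
  \<open>rep_coeff_le\<close> fix the top coefficient, and the remainders are compared by
  induction.\<close>

lemma rep_unique:
  assumes B: "centers B" and B': "centers B'"
  shows "rep B B' x y \<Longrightarrow> rep B B' x y' \<Longrightarrow> y = y'"
proof (induction arbitrary: y' rule: rep.induct)
  case rep0
  from rep0 show ?case
  proof (cases rule: rep.cases)
    case (repS x y z f t)
    have "same (0::point) z" unfolding repS(1) by (rule low_add[OF centersD(2)[OF B repS(4)] repS(5,9)])
    then show ?thesis using same_zero[OF repS(6), of 0 z] repS(8) F_0[OF repS(6)] by blast
  qed simp
next
  case (repS x y z f t)
  have s1: "same (t *\<^sub>R B z + x) z" by (rule low_add[OF centersD(2)[OF B repS(2)] repS(3,7)])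
  from repS.prems show ?case
  proof (cases rule: rep.cases)
    case rep0
    then have "same (0::point) z" using s1 by simp
    then show ?thesis using same_zero[OF repS(4), of 0 z] repS(6) F_0[OF repS(4)] by blast
  next
    case r: (repS x1 y1 z1 f1 t1)
    have s2: "same (t *\<^sub>R B z + x) z1" unfolding r(1) by (rule low_add[OF centersD(2)[OF B r(4)] r(5,9)])
    have zz: "same z z1" using s1 s2 same_sym same_trans by blast
    have BB: "B z1 = B z" "B' z1 = B' z"
      using centersD(3)[OF B repS(2) r(4) zz] centersD(3)[OF B' repS(2) r(4) zz] by simp_all
    have e: "t *\<^sub>R B z + x = t1 *\<^sub>R B z + x1" using r(1) BB(1) by simp
    have l1: "low x1 z" by (rule low_same[OF r(5) same_sym[OF zz]])
    have "t1 \<le> t" by (rule rep_coeff_le[OF repS(4,5,6) centersD(2)[OF B repS(2)] l1 e])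
    moreover have "t \<le> t1"
      by (rule rep_coeff_le[OF r(6,7) _ centersD(2)[OF B repS(2)] repS(3) e[symmetric]])
        (use same_zero[OF r(6) zz] r(8) in blast)
    ultimately have "t = t1" by simp
    then have "x = x1" using e by simp
    then have "y = y1" using repS.IH r(3) by blast
    then show ?thesis using r(2) BB(2) \<open>t = t1\<close> by simp
  qed
qed

lemma rep_exists:
  assumes B: "centers B"
  shows "x \<in> Rn k \<Longrightarrow> \<exists>y. rep B B' x y"
proof (induction "card {f\<in>F. f x \<noteq> 0}" arbitrary: x rule: less_induct)
  case less
  show ?case
  proof (cases "\<exists>f\<in>F. f x \<noteq> 0")
    case False
    then have "x = 0" using sepF[OF less.prems] by blast
    then show ?thesis using rep.rep0[of B B'] by (intro exI[of _ 0]) simp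
  next
    case True
    let ?R = "{f\<in>F. f x \<noteq> 0}" and ?b = "B x"
    have sb: "same ?b x" by (rule centersD(2)[OF B less.prems])
    define Q where "Q = (\<lambda>f. f x / f ?b) ` ?R"
    have Q: "finite Q" "Q \<noteq> {}" using finF True by (auto simp: Q_def)
    \<comment> \<open>The largest multiple of the center that can be subtracted without leaving the
      closed cone. At this value some \<open>f0\<close> vanishes, so the remainder lies in a proper
      face and fewer functionals are nonzero at it.\<close>
    define t where "t = Min Q"
    obtain f0 where f0: "f0 \<in> F" "f0 x \<noteq> 0" "t = f0 x / f0 ?b" using Min_in[OF Q] by (auto simp: t_def Q_def)
    have pos: "f x / f ?b > 0" if f: "f \<in> F" "f x \<noteq> 0" for f
    proof -
      have "sgn (f ?b) = sgn (f x)" using sb f(1) unfolding same_def by blast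
      then show ?thesis using f(2) by (auto simp: sgn_if zero_less_divide_iff split: if_splits)
    qed
    have tpos: "t > 0" unfolding f0(3) by (rule pos[OF f0(1,2)])
    have tle: "t \<le> f x / f ?b" if "f \<in> F" "f x \<noteq> 0" for f
      unfolding t_def by (rule Min_le[OF Q(1)]) (use that in \<open>simp add: Q_def\<close>)
    define x' where "x' = x - t *\<^sub>R ?b"
    have fx': "f x' = f x - t * f ?b" if "f \<in> F" for f
      unfolding x'_def using linF[OF that] by (simp add: linear_diff linear_scale)
    have low: "low x' x"
      unfolding low_def
    proof (intro ballI impI)
      fix f assume f: "f \<in> F" "f x' \<noteq> 0"
      have s: "sgn (f ?b) = sgn (f x)" using sb f(1) unfolding same_def by blast
      have fx: "f x \<noteq> 0"
      proof
        assume "f x = 0"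
        then have "f ?b = 0" using s by (simp add: sgn_0_0)
        then show False using f fx'[OF f(1)] \<open>f x = 0\<close> by simp
      qed
      have tl: "t \<le> f x / f ?b" by (rule tle[OF f(1) fx])
      show "sgn (f x') = sgn (f x)"
      proof (cases "f x > 0")
        case True
        then have "f ?b > 0" using s by (simp add: sgn_if split: if_splits)
        then have "t * f ?b \<le> f x" using tl by (simp add: pos_le_divide_eq)
        then have "f x' > 0" using f(2) fx'[OF f(1)] by simp
        then show ?thesis using True by simp
      next
        case False
        then have b: "f x < 0" using fx by simp
        then have "f ?b < 0" using s by (simp add: sgn_if split: if_splits)
        then have "f x \<le> t * f ?b" using tl by (simp add: neg_le_divide_eq)
        then have "f x' < 0" using f(2) fx'[OF f(1)] by simp
        then show ?thesis using b by simp
      qed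
    qed
    have z0: "f0 x' = 0"
    proof -
      have "f0 ?b \<noteq> 0" using same_zero[OF f0(1) sb] f0(2) by blast
      then show ?thesis using fx'[OF f0(1)] f0(3) by simp
    qed
    have "{f\<in>F. f x' \<noteq> 0} \<subset> ?R"
    proof
      show "{f\<in>F. f x' \<noteq> 0} \<subseteq> ?R"
      proof
        fix f assume "f \<in> {f\<in>F. f x' \<noteq> 0}"
        then have f: "f \<in> F" "f x' \<noteq> 0" by auto
        then have "sgn (f x') = sgn (f x)" using low unfolding low_def by blast
        then have "f x \<noteq> 0" using f(2) by (metis sgn_0_0)
        then show "f \<in> ?R" using f by simp
      qed
      show "{f\<in>F. f x' \<noteq> 0} \<noteq> ?R" using f0 z0 by blast
    qed
    then have "card {f\<in>F. f x' \<noteq> 0} < card ?R" using finF by (intro psubset_card_mono) auto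
    moreover have "x' \<in> Rn k" unfolding x'_def by (intro Rn_diff Rn_scaleR less.prems centersD(1)[OF B])
    ultimately obtain y where "rep B B' x' y" using less.hyps by blast
    then have "rep B B' (t *\<^sub>R B x + x') (t *\<^sub>R B' x + y)"
      by (rule rep.repS[OF _ less.prems low f0(1) z0 f0(2) tpos])
    moreover have "t *\<^sub>R B x + x' = x" by (simp add: x'_def)
    ultimately show ?thesis by (intro exI[of _ "t *\<^sub>R B' x + y"]) simp
  qed
qed

section \<open>Flags of centers and the simplicial cones they span\<close>

lemma chain_props:
  assumes B: "centers B"
  shows "chain B T \<Longrightarrow> finite T \<and> T \<subseteq> B ` Rn k \<and> 0 \<notin> T \<and> independent T"
proof (induction rule: chain.induct)
  case chain0 then show ?case by (simp add: independent_empty)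
next
  case (chainS T z f)
  have fb: "f (B z) \<noteq> 0" using same_zero[OF chainS(4) centersD(2)[OF B chainS(2)]] chainS(5) by blast
  have "subspace {x. f x = 0}" using linF[OF chainS(4)] by (rule linear_subspace_kernel)
  then have "span T \<subseteq> {x. f x = 0}" by (intro span_minimal) (use chainS(6) in blast)+
  then have "B z \<notin> span T" using fb by blast
  then have "independent (insert (B z) T)" using chainS.IH by (simp add: independent_insertI)
  moreover have "0 \<noteq> B z" using fb F_0[OF chainS(4)] by metis
  ultimately show ?case using chainS.IH chainS(2) by blast
qed

text \<open>A center depends only on the sign vector of its cone, and finitely many functionals have
  finitely many sign vectors.\<close>

lemma finite_centers: assumes B: "centers B" shows "finite (B ` Rn k)"
proof -
  define sig where "sig = (\<lambda>z f. if f \<in> F then sgn (f z) else (0::real))"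
  have "finite {s. \<forall>f. (f \<in> F \<longrightarrow> s f \<in> {-1,0,1::real}) \<and> (f \<notin> F \<longrightarrow> s f = 0)}"
    by (rule finite_set_of_finite_funs[OF finF]) simp
  then have fs: "finite (sig ` Rn k)"
  proof (rule finite_subset[rotated])
    have "sgn r \<in> {-1,0,1}" for r :: real by (simp add: sgn_if)
    then show "sig ` Rn k \<subseteq> {s. \<forall>f. (f \<in> F \<longrightarrow> s f \<in> {-1,0,1::real}) \<and> (f \<notin> F \<longrightarrow> s f = 0)}"
      unfolding sig_def by (simp add: image_subset_iff)
  qed
  have "B z = B (SOME w. w \<in> Rn k \<and> sig w = sig z)" if z: "z \<in> Rn k" for z
  proof -
    have "(SOME w. w \<in> Rn k \<and> sig w = sig z) \<in> Rn k \<and> sig (SOME w. w \<in> Rn k \<and> sig w = sig z) = sig z"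
      by (rule someI[of _ z]) (use z in simp)
    then have w: "(SOME w. w \<in> Rn k \<and> sig w = sig z) \<in> Rn k" "sig z = sig (SOME w. w \<in> Rn k \<and> sig w = sig z)" by simp_all
    have "same z (SOME w. w \<in> Rn k \<and> sig w = sig z)" unfolding same_def
    proof
      fix f assume "f \<in> F"
      then show "sgn (f z) = sgn (f (SOME w. w \<in> Rn k \<and> sig w = sig z))"
        using fun_cong[OF w(2), of f] unfolding sig_def by simp
    qed
    then show ?thesis by (rule centersD(3)[OF B z w(1)])
  qed
  then have "B ` Rn k \<subseteq> (\<lambda>s. B (SOME w. w \<in> Rn k \<and> sig w = s)) ` sig ` Rn k" by blast
  then show ?thesis using fs by (blast intro: finite_subset)
qed

lemma low_sum:
  assumes T: "finite T" and l: "\<And>b. b \<in> T \<Longrightarrow> low b z" and c: "\<And>b. b \<in> T \<Longrightarrow> c b \<ge> 0"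
  shows "low (\<Sum>b\<in>T. c b *\<^sub>R b) z"
  unfolding low_def
proof (intro ballI impI)
  fix f assume f: "f \<in> F" "f (\<Sum>b\<in>T. c b *\<^sub>R b) \<noteq> 0"
  have e: "f (\<Sum>b\<in>T. c b *\<^sub>R b) = (\<Sum>b\<in>T. c b * f b)"
    using linF[OF f(1)] by (simp add: linear_sum linear_scale)
  have s: "f b = 0 \<or> sgn (f b) = sgn (f z)" if "b \<in> T" for b using l[OF that] f(1) unfolding low_def by blast
  show "sgn (f (\<Sum>b\<in>T. c b *\<^sub>R b)) = sgn (f z)"
  proof (cases "f z" "0::real" rule: linorder_cases)
    case less
    have "(\<Sum>b\<in>T. c b * f b) \<le> 0"
    proof (rule sum_nonpos)
      fix b assume b: "b \<in> T"
      have "f b \<le> 0" using s[OF b] less by (auto simp: sgn_if split: if_splits)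
      then show "c b * f b \<le> 0" using c[OF b] by (simp add: mult_nonneg_nonpos)
    qed
    then show ?thesis using less f(2) unfolding e by (simp add: sgn_if)
  next
    case equal
    have "f b = 0" if "b \<in> T" for b using s[OF that] equal by (auto simp: sgn_0_0)
    then show ?thesis using f(2) unfolding e by simp
  next
    case greater
    have "(\<Sum>b\<in>T. c b * f b) \<ge> 0"
    proof (rule sum_nonneg)
      fix b assume b: "b \<in> T"
      have "f b \<ge> 0" using s[OF b] greater by (auto simp: sgn_if split: if_splits)
      then show "c b * f b \<ge> 0" using c[OF b] by simp
    qed
    then show ?thesis using greater f(2) unfolding e by (simp add: sgn_if)
  qed
qed

text \<open>On the cone spanned by a chain, \<open>rep\<close> is the graph of the linear map that
  moves each center; this supplies the affine pieces of the homeomorphism.\<close>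

lemma chain_rep:
  assumes B: "centers B" and B': "centers B'"
  shows "chain B T \<Longrightarrow> linear g \<Longrightarrow> (\<And>b. b \<in> T \<Longrightarrow> g b = B' b) \<Longrightarrow> (\<And>b. b \<in> T \<Longrightarrow> c b \<ge> 0) \<Longrightarrow>
    rep B B' (\<Sum>b\<in>T. c b *\<^sub>R b) (g (\<Sum>b\<in>T. c b *\<^sub>R b))"
proof (induction rule: chain.induct)
  case chain0 then show ?case using rep.rep0 by (simp add: linear_0)
next
  case (chainS T z f)
  have fT: "finite T" using chain_props[OF B chainS(1)] by blast
  have sb: "same (B z) z" by (rule centersD(2)[OF B chainS(2)])
  have fb: "f (B z) \<noteq> 0" using same_zero[OF chainS(4) sb] chainS(5) by blast
  then have nT: "B z \<notin> T" using chainS(6) by blast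
  let ?x = "\<Sum>b\<in>T. c b *\<^sub>R b"
  have e: "(\<Sum>b\<in>insert (B z) T. c b *\<^sub>R b) = c (B z) *\<^sub>R B z + ?x" using fT nT by simp
  have r: "rep B B' ?x (g ?x)" using chainS.IH chainS.prems by blast
  show ?case
  proof (cases "c (B z) = 0")
    case True then show ?thesis unfolding e using r by simp
  next
    case False
    then have t: "c (B z) > 0" using chainS.prems(3)[of "B z"] by simp
    have l: "low ?x z" by (rule low_sum[OF fT chainS(3)]) (use chainS.prems(3) in auto)
    have "f ?x = (\<Sum>b\<in>T. c b * f b)" using linF[OF chainS(4)] by (simp add: linear_sum linear_scale)
    then have "f ?x = 0" using chainS(6) by simp
    from rep.repS[OF r chainS(2) l chainS(4) this chainS(5) t]
    have "rep B B' (c (B z) *\<^sub>R B z + ?x) (c (B z) *\<^sub>R B' z + g ?x)" .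
    moreover have "g (c (B z) *\<^sub>R B z + ?x) = c (B z) *\<^sub>R B' z + g ?x"
    proof -
      have "g (B z) = B' (B z)" using chainS.prems(2)[of "B z"] by simp
      also have "\<dots> = B' z" by (rule centersD(3)[OF B' centersD(1)[OF B chainS(2)] chainS(2) sb])
      finally show ?thesis using chainS.prems(1) by (simp add: linear_add linear_scale)
    qed
    ultimately show ?thesis unfolding e by simp
  qed
qed

section \<open>Polyhedral gauges and the homeomorphism between their unit balls\<close>

definition gauge :: "(point \<Rightarrow> real) set \<Rightarrow> point \<Rightarrow> real" where
  "gauge G x = Max ((\<lambda>g. g x) ` G)"

text \<open>Since the differences belong to \<open>F\<close>, a functional that attains the maximum
  at a point of an open cone attains it on the whole closed cone. The gauge is therefore linear
  there, see \<open>gauge_add\<close>.\<close>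

definition adapted :: "(point \<Rightarrow> real) set \<Rightarrow> bool" where
  "adapted G \<longleftrightarrow> finite G \<and> G \<noteq> {} \<and> (\<forall>g\<in>G. linear g) \<and> (\<forall>g\<in>G. \<forall>g'\<in>G. (\<lambda>x. g x - g' x) \<in> F)"

lemma gauge_add:
  assumes G: "adapted G" and l: "low x z" and t: "t \<ge> 0"
  shows "gauge G (t *\<^sub>R z + x) = t * gauge G z + gauge G x"
proof -
  have fG: "finite ((\<lambda>g. g u) ` G)" "(\<lambda>g. g u) ` G \<noteq> {}" for u :: point using G unfolding adapted_def by auto
  obtain g where g: "g \<in> G" "gauge G z = g z" using Max_in[OF fG[of z]] unfolding gauge_def by blast
  have mz: "g' z \<le> g z" if "g' \<in> G" for g' using Max_ge[OF fG(1), of "g' z" z] that g(2) unfolding gauge_def by simp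
  have mx: "g' x \<le> g x" if g': "g' \<in> G" for g'
  proof (rule ccontr)
    assume n: "\<not> g' x \<le> g x"
    have "(\<lambda>x. g x - g' x) \<in> F" using G g(1) g' unfolding adapted_def by blast
    then have "sgn (g x - g' x) = sgn (g z - g' z)" using l n unfolding low_def by force
    then show False using n mz[OF g'] by (simp add: sgn_if split: if_splits)
  qed
  have val: "gauge G u = g u" if "\<And>g'. g' \<in> G \<Longrightarrow> g' u \<le> g u" for u
    unfolding gauge_def by (rule Max_eqI[OF fG(1)]) (use that g(1) in auto)
  have lin: "g' (t *\<^sub>R z + x) = t * g' z + g' x" if "g' \<in> G" for g'
    using G that unfolding adapted_def by (simp add: linear_add linear_scale)
  have "gauge G (t *\<^sub>R z + x) = g (t *\<^sub>R z + x)"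
    by (rule val) (use mz mx t in \<open>simp add: lin g(1) add_mono mult_left_mono\<close>)
  then show ?thesis using lin[OF g(1)] val[of z] val[of x] mz mx by simp
qed

lemma gauge_0: assumes G: "adapted G" shows "gauge G 0 = 0"
proof -
  have "(\<lambda>g. g 0) ` G = {0::real}" using G unfolding adapted_def by (auto simp: linear_0 image_iff)
  then show ?thesis by (simp add: gauge_def)
qed

lemma gauge_le_iff: assumes G: "adapted G" shows "gauge G x \<le> r \<longleftrightarrow> (\<forall>g\<in>G. g x \<le> r)"
  and "gauge G x < r \<longleftrightarrow> (\<forall>g\<in>G. g x < r)"
  using G unfolding adapted_def gauge_def by auto

lemma gauge_scale: assumes G: "adapted G" and t: "t \<ge> 0" shows "gauge G (t *\<^sub>R z) = t * gauge G z"
  using gauge_add[OF G, of 0 z t] t gauge_0[OF G] F_0 by (simp add: low_def)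

lemma low_refl: "low z z" unfolding low_def by blast

text \<open>Centers on the unit sphere of the gauge, so that a map matching the centers matches the
  gauges. The zero cone is excepted, as its only point has gauge 0.\<close>

definition unit_centers :: "(point \<Rightarrow> real) set \<Rightarrow> (point \<Rightarrow> point) \<Rightarrow> bool" where
  "unit_centers G B \<longleftrightarrow> centers B \<and> (\<forall>z\<in>Rn k. z \<noteq> 0 \<longrightarrow> gauge G (B z) = 1)"

lemma unit_centers_exist:
  assumes G: "adapted G" and pos: "\<And>x. x \<in> Rn k \<Longrightarrow> x \<noteq> 0 \<Longrightarrow> gauge G x > 0"
  shows "\<exists>B. unit_centers G B"
proof -
  define c where "c = (\<lambda>z. SOME y. y \<in> Rn k \<and> same y z)"
  have c: "c z \<in> Rn k" "same (c z) z" if "z \<in> Rn k" for z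
  proof -
    have "c z \<in> Rn k \<and> same (c z) z" unfolding c_def
      by (rule someI[of _ z]) (use that in \<open>simp add: same_def\<close>)
    then show "c z \<in> Rn k" "same (c z) z" by simp_all
  qed
  have cc: "c x = c z" if "same x z" for x z
  proof -
    have "same y x \<longleftrightarrow> same y z" for y using that same_sym same_trans by blast
    then show ?thesis unfolding c_def by simp
  qed
  have c0: "c z \<noteq> 0" if z: "z \<in> Rn k" "z \<noteq> 0" for z
  proof
    assume "c z = 0"
    then have "same 0 z" using c(2)[OF z(1)] by simp
    then have "f z = 0" if "f \<in> F" for f using same_zero[OF that] F_0[OF that] by blast
    then show False using sepF z by blast
  qed
  define B where "B = (\<lambda>z. (if z = 0 then 0 else (1 / gauge G (c z)) *\<^sub>R c z))"
  have s0: "z = 0" if "same 0 z" "z \<in> Rn k" for z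
    using sepF[OF that(2)] same_zero[OF _ that(1)] F_0 by blast
  have "unit_centers G B"
    unfolding unit_centers_def centers_def
  proof (intro conjI ballI impI)
    fix z assume z: "z \<in> Rn k"
    show "B z \<in> Rn k" using c(1)[OF z] by (simp add: B_def Rn_scaleR)
    show "same (B z) z"
    proof (cases "z = 0")
      case True then show ?thesis by (simp add: B_def same_def)
    next
      case False
      have "gauge G (c z) > 0" by (rule pos[OF c(1)[OF z] c0[OF z False]])
      then have "same (B z) (c z)" using False linF by (auto simp: B_def same_def linear_scale sgn_mult)
      then show ?thesis using c(2)[OF z] same_trans by blast
    qed
    show "gauge G (B z) = 1" if "z \<noteq> 0"
    proof -
      have "gauge G (c z) > 0" by (rule pos[OF c(1)[OF z] c0[OF z that]])
      then show ?thesis using that by (simp add: B_def gauge_scale[OF G])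
    qed
  next
    fix x z assume xz: "x \<in> Rn k" "z \<in> Rn k" "same x z"
    have "x = 0 \<longleftrightarrow> z = 0" using s0[of z] s0[of x] xz same_sym by blast
    then show "B x = B z" using cc[OF xz(3)] by (simp add: B_def)
  qed
  then show ?thesis by (rule exI[of _ B])
qed

lemma nonzero_of: "f \<in> F \<Longrightarrow> f z \<noteq> 0 \<Longrightarrow> z \<noteq> 0"
  using F_0 by metis

text \<open>By linearity on cones the gauge of a point is the sum of its coefficients over the unit
  centers, and \<open>x\<close> and \<open>y\<close> have the same coefficients.\<close>

lemma rep_gauge:
  assumes B: "unit_centers G B" "adapted G" and B': "unit_centers G' B'" "adapted G'"
  shows "rep B B' x y \<Longrightarrow> gauge G x = gauge G' y"
proof (induction rule: rep.induct)
  case rep0 then show ?case using gauge_0 B B' by simp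
next
  case (repS x y z f t)
  have cB: "centers B" "centers B'" using B B' unfolding unit_centers_def by blast+
  have z: "z \<noteq> 0" using nonzero_of repS(4,6) by blast
  have l: "low x (B z)" by (rule low_same[OF repS(3) same_sym[OF centersD(2)[OF cB(1) repS(2)]]])
  have "same x y" using rep_props[OF cB repS(1)] by blast
  then have l': "low y (B' z)"
    using same_low[OF same_sym low_same[OF repS(3) same_sym[OF centersD(2)[OF cB(2) repS(2)]]]] by blast
  have "gauge G (B z) = 1" "gauge G' (B' z) = 1" using B(1) B'(1) repS(2) z unfolding unit_centers_def by blast+
  then show ?case using gauge_add[OF B(2) l, of t] gauge_add[OF B'(2) l', of t] repS(7) repS.IH by simp
qed

lemma rep_chain:
  assumes B: "unit_centers G B" "adapted G" and B': "centers B'"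
  shows "rep B B' x y \<Longrightarrow> \<exists>T c. chain B T \<and> (\<forall>b\<in>T. c b \<ge> 0) \<and> x = (\<Sum>b\<in>T. c b *\<^sub>R b) \<and> (\<forall>b\<in>T. low b x) \<and>
    gauge G x = sum c T"
proof (induction rule: rep.induct)
  case rep0
  show ?case by (intro exI[of _ "{}"] exI[of _ "\<lambda>_. 0"]) (simp add: chain.chain0 gauge_0[OF B(2)])
next
  case (repS x y z f t)
  have cB: "centers B" using B unfolding unit_centers_def by blast
  obtain T c where T: "chain B T" "\<forall>b\<in>T. c b \<ge> 0" "x = (\<Sum>b\<in>T. c b *\<^sub>R b)" "\<forall>b\<in>T. low b x" "gauge G x = sum c T"
    using repS.IH by (elim exE conjE)
  have fT: "finite T" using chain_props[OF cB T(1)] by blast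
  have sb: "same (B z) z" by (rule centersD(2)[OF cB repS(2)])
  have z: "z \<noteq> 0" using nonzero_of repS(4,6) by blast
  have fT0: "f b = 0" if "b \<in> T" for b
  proof (rule ccontr)
    assume "f b \<noteq> 0"
    then have "sgn (f b) = sgn (f x)" using T(4) that repS(4) unfolding low_def by blast
    then show False using \<open>f b \<noteq> 0\<close> repS(5) by (simp add: sgn_0_0)
  qed
  have fb: "f (B z) \<noteq> 0" using same_zero[OF repS(4) sb] repS(6) by blast
  then have nT: "B z \<notin> T" using fT0 by blast
  have lz: "low b z" if "b \<in> T" for b using low_trans[OF _ repS(3)] T(4) that by blast
  have ch: "chain B (insert (B z) T)" by (rule chain.chainS[OF T(1) repS(2) lz repS(4,6) fT0])
  have s1: "same (t *\<^sub>R B z + x) z" by (rule low_add[OF sb repS(3,7)])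
  let ?c = "c(B z := t)"
  have "(\<Sum>b\<in>insert (B z) T. ?c b *\<^sub>R b) = t *\<^sub>R B z + (\<Sum>b\<in>T. ?c b *\<^sub>R b)" using fT nT by simp
  also have "(\<Sum>b\<in>T. ?c b *\<^sub>R b) = x" unfolding T(3) by (rule sum.cong) (use nT in auto)
  finally have sx: "t *\<^sub>R B z + x = (\<Sum>b\<in>insert (B z) T. ?c b *\<^sub>R b)" ..
  have "sum ?c (insert (B z) T) = t + sum ?c T" using fT nT by simp
  also have "sum ?c T = sum c T" by (rule sum.cong) (use nT in auto)
  finally have sc: "sum ?c (insert (B z) T) = t + gauge G x" using T(5) by simp
  have l: "low x (B z)" by (rule low_same[OF repS(3) same_sym[OF sb]])
  have "gauge G (B z) = 1" using B(1) repS(2) z unfolding unit_centers_def by blast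
  then have g: "gauge G (t *\<^sub>R B z + x) = t + gauge G x" using gauge_add[OF B(2) l, of t] repS(7) by simp
  show ?case
  proof (intro exI[of _ "insert (B z) T"] exI[of _ ?c] conjI)
    show "\<forall>b\<in>insert (B z) T. ?c b \<ge> 0" using T(2) repS(7) by simp
    show "\<forall>b\<in>insert (B z) T. low b (t *\<^sub>R B z + x)"
    proof
      fix b assume "b \<in> insert (B z) T"
      then have "low b z" using lz same_low[OF sb low_refl] by blast
      then show "low b (t *\<^sub>R B z + x)" by (rule low_same[OF _ same_sym[OF s1]])
    qed
  qed (use ch sx g sc in simp_all)
qed

text \<open>The unit ball of \<open>G\<close> is the union of the simplices spanned by 0 and a chain
  of unit centers, and the map is linear on each of them. Injectivity and surjectivity come from
  exchanging the roles of \<open>B\<close> and \<open>B'\<close>.\<close>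

lemma fan_homeo:
  assumes G: "adapted G" "\<And>x. x \<in> Rn k \<Longrightarrow> x \<noteq> 0 \<Longrightarrow> gauge G x > 0"
    and G': "adapted G'" "\<And>x. x \<in> Rn k \<Longrightarrow> x \<noteq> 0 \<Longrightarrow> gauge G' x > 0"
  shows "\<exists>h. PL_on {x\<in>Rn k. gauge G x \<le> 1} h \<and> inj_on h (Rn k) \<and> h ` Rn k = Rn k \<and>
    (\<forall>x\<in>Rn k. gauge G' (h x) = gauge G x \<and> same (h x) x)"
proof -
  obtain B where uB: "unit_centers G B" using unit_centers_exist[OF G] by blast
  obtain B' where uB': "unit_centers G' B'" using unit_centers_exist[OF G'] by blast
  have B: "centers B" and B': "centers B'" using uB uB' unfolding unit_centers_def by blast+
  define h where "h = (\<lambda>x. THE y. rep B B' x y)"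
  have hI: "h x = y" if r: "rep B B' x y" for x y
    unfolding h_def using r
  proof (rule the_equality[where P = "rep B B' x"])
    fix y' assume "rep B B' x y'"
    then show "y' = y" by (rule rep_unique[OF B B' _ r])
  qed
  have hr: "rep B B' x (h x)" if x: "x \<in> Rn k" for x
  proof -
    obtain y where y: "rep B B' x y" using rep_exists[OF B x] by blast
    then show ?thesis using hI[OF y] by simp
  qed
  have inj: "inj_on h (Rn k)"
  proof (rule inj_onI)
    fix x y assume xy: "x \<in> Rn k" "y \<in> Rn k" "h x = h y"
    have "rep B' B (h x) x" by (rule rep_sym[OF B B' hr[OF xy(1)]])
    moreover have "rep B' B (h x) y" unfolding xy(3) by (rule rep_sym[OF B B' hr[OF xy(2)]])
    ultimately show "x = y" by (rule rep_unique[OF B' B])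
  qed
  have img: "h ` Rn k = Rn k"
  proof
    show "h ` Rn k \<subseteq> Rn k" using rep_props[OF B B' hr] by blast
    show "Rn k \<subseteq> h ` Rn k"
    proof
      fix y assume y: "y \<in> Rn k"
      obtain x where "rep B' B y x" using rep_exists[OF B' y] by blast
      then have r: "rep B B' x y" by (rule rep_sym[OF B' B])
      then have "x \<in> Rn k" using rep_props[OF B B'] by blast
      then show "y \<in> h ` Rn k" using hI[OF r] by blast
    qed
  qed
  let ?I = "{T. chain B T}"
  have chT: "finite T" "T \<subseteq> B ` Rn k" "0 \<notin> T" "independent T" if "chain B T" for T
    using chain_props[OF B that] by blast+
  have fI: "finite ?I"
    by (rule finite_subset[of _ "Pow (B ` Rn k)"]) (use chT(2) finite_centers[OF B] in auto)
  have "\<forall>T\<in>?I. \<exists>g. linear g \<and> (\<forall>b\<in>T. g b = B' b)"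
  proof
    fix T assume "T \<in> ?I"
    then show "\<exists>g. linear g \<and> (\<forall>b\<in>T. g b = B' b)" using linear_independent_extend[OF chT(4)] by blast
  qed
  from bchoice[OF this] obtain g where g: "\<forall>T\<in>?I. linear (g T) \<and> (\<forall>b\<in>T. g T b = B' b)" by (rule exE)
  have PL: "PL_on {x\<in>Rn k. gauge G x \<le> 1} h"
  proof (rule PL_onI[OF fI, of "\<lambda>T. convex hull (insert 0 T)" g])
    fix T assume T: "T \<in> ?I"
    then have T': "chain B T" by simp
    show "polytope (convex hull (insert 0 T))" using chT(1)[OF T'] by (simp add: polytope_convex_hull)
    show "aff (g T)" using g T by (blast intro: aff_linear)
    fix x assume "x \<in> convex hull (insert 0 T)"
    then obtain u where u: "\<forall>v\<in>insert 0 T. 0 \<le> u v" "(\<Sum>v\<in>insert 0 T. u v *\<^sub>R v) = x"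
      using chT(1)[OF T'] by (auto simp: convex_hull_finite)
    have x: "x = (\<Sum>v\<in>T. u v *\<^sub>R v)" using u(2) chT(1,3)[OF T'] by simp
    have "rep B B' x (g T x)" unfolding x
      by (rule chain_rep[OF B B' T']) (use g T u(1) in auto)
    then show "h x = g T x" by (rule hI)
  next
    show "{x\<in>Rn k. gauge G x \<le> 1} = (\<Union>T\<in>?I. convex hull (insert 0 T))"
    proof
      show "{x\<in>Rn k. gauge G x \<le> 1} \<subseteq> (\<Union>T\<in>?I. convex hull (insert 0 T))"
      proof
        fix x assume "x \<in> {x\<in>Rn k. gauge G x \<le> 1}"
        then have x: "x \<in> Rn k" "gauge G x \<le> 1" by auto
        obtain T c where T: "chain B T" "\<forall>b\<in>T. c b \<ge> 0" "x = (\<Sum>b\<in>T. c b *\<^sub>R b)" "gauge G x = sum c T"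
          using rep_chain[OF uB G(1) B' hr[OF x(1)]] by (elim exE conjE)
        \<comment> \<open>The vertex 0 takes up the weight missing to 1; it is not in
          \<open>T\<close>, so the other coefficients are unaffected.\<close>
        let ?u = "c(0 := 1 - sum c T)"
        note fT = chT(1,3)[OF T(1)]
        have 1: "sum ?u T = sum c T" by (rule sum.cong) (use fT in auto)
        have 2: "(\<Sum>b\<in>T. ?u b *\<^sub>R b) = (\<Sum>b\<in>T. c b *\<^sub>R b)" by (rule sum.cong) (use fT in auto)
        have "x \<in> convex hull (insert 0 T)"
          unfolding convex_hull_finite[OF finite.insertI[OF fT(1)]]
        proof (intro CollectI exI[of _ ?u] conjI)
          show "\<forall>v\<in>insert 0 T. 0 \<le> ?u v" using T(2,4) x(2) by simp
          show "sum ?u (insert 0 T) = 1" unfolding sum.insert[OF fT] 1 by simp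
          show "(\<Sum>v\<in>insert 0 T. ?u v *\<^sub>R v) = x" unfolding sum.insert[OF fT] 2 T(3)[symmetric] by simp
        qed
        then show "x \<in> (\<Union>T\<in>?I. convex hull (insert 0 T))" using T(1) by blast
      qed
      show "(\<Union>T\<in>?I. convex hull (insert 0 T)) \<subseteq> {x\<in>Rn k. gauge G x \<le> 1}"
      proof (rule UN_least)
        fix T assume "T \<in> ?I"
        then have T: "chain B T" by simp
        have "convex {x\<in>Rn k. gauge G x \<le> 1}"
        proof -
          have "{x\<in>Rn k. gauge G x \<le> 1} = Rn k \<inter> (\<Inter>g\<in>G. {x. g x \<in> {..1}})"
            unfolding gauge_le_iff(1)[OF G(1)] by auto
          moreover have "convex {x. g x \<in> {..1}}" if "g \<in> G" for g
          proof (rule convex_aff_vimage)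
            show "aff g" using G(1) that unfolding adapted_def by (blast intro: aff_linear)
          qed simp
          ultimately show ?thesis by (simp add: convex_Int convex_INT convex_Rn)
        qed
        moreover have "insert 0 T \<subseteq> {x\<in>Rn k. gauge G x \<le> 1}"
        proof -
          have "b \<in> Rn k \<and> gauge G b \<le> 1" if b: "b \<in> T" for b
          proof -
            obtain z where z: "z \<in> Rn k" "b = B z" using b chT(2)[OF T] by blast
            show ?thesis
            proof (cases "z = 0")
              case True
              have "same (B 0) 0" by (rule centersD(2)[OF B Rn_0])
              then have "B 0 = 0" using sepF[OF centersD(1)[OF B Rn_0]] same_zero F_0 by blast
              then show ?thesis using z True b chT(3)[OF T] by simp
            next
              case False
              then show ?thesis using z centersD(1)[OF B z(1)] uB unfolding unit_centers_def by simp
            qed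
          qed
          then show ?thesis using gauge_0[OF G(1)] by auto
        qed
        ultimately show "convex hull (insert 0 T) \<subseteq> {x\<in>Rn k. gauge G x \<le> 1}" by (intro hull_minimal)
      qed
    qed
  qed
  have "gauge G' (h x) = gauge G x \<and> same (h x) x" if x: "x \<in> Rn k" for x
    using rep_gauge[OF uB G(1) uB' G'(1) hr[OF x]] rep_props[OF B B' hr[OF x]] same_sym by simp
  then show ?thesis using PL inj img by (intro exI[of _ h]) simp
qed

end

section \<open>Open convex cells\<close>

definition sign_cell :: "nat \<Rightarrow> (point \<Rightarrow> real) set \<Rightarrow> point \<Rightarrow> point set" where
  "sign_cell n S x = {y \<in> Rn n. \<forall>f\<in>S. sgn (f y) = sgn (f x)}"

text \<open>A nonempty bounded relatively open convex polytope: equations are signs 0, strict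
  inequalities are signs 1 and -1, and the base point \<open>x\<close> guarantees that the set is
  nonempty.\<close>

definition opoly :: "point set \<Rightarrow> bool" where
  "opoly Q \<longleftrightarrow> (\<exists>n S x. finite S \<and> (\<forall>f\<in>S. aff f) \<and> x \<in> Rn n \<and> Q = sign_cell n S x) \<and> bounded Q"

lemma sign_cell_eq: "y \<in> sign_cell n S x \<Longrightarrow> sign_cell n S x = sign_cell n S y"
  unfolding sign_cell_def by auto

lemma opolyE:
  assumes "opoly Q" "x \<in> Q"
  obtains n S where "finite S" "\<And>f. f \<in> S \<Longrightarrow> aff f" "x \<in> Rn n" "Q = sign_cell n S x" "bounded Q"
proof -
  obtain n S x0 where "finite S" "\<forall>f\<in>S. aff f" "x0 \<in> Rn n" "Q = sign_cell n S x0" "bounded Q"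
    using assms(1) unfolding opoly_def by (elim exE conjE)
  moreover from this have "Q = sign_cell n S x" using sign_cell_eq assms(2) by blast
  moreover have "x \<in> Rn n" using assms(2) \<open>Q = sign_cell n S x0\<close> unfolding sign_cell_def by blast
  ultimately show ?thesis using that[of S n] by simp
qed

lemma opoly_nonempty: "opoly Q \<Longrightarrow> Q \<noteq> {}"
  unfolding opoly_def sign_cell_def by auto

lemma convex_sgn: "convex {r::real. sgn r = s}"
proof -
  have "{r::real. sgn r = s} = (if s = 1 then {0<..} else if s = -1 then {..<0} else if s = 0 then {0} else {})"
    by (auto simp: sgn_if split: if_splits)
  then show ?thesis by simp
qed

lemma opoly_convex: assumes "opoly Q" shows "convex Q"
proof -
  obtain n S x where S: "\<forall>f\<in>S. aff f" "Q = sign_cell n S x" using assms unfolding opoly_def by (elim exE conjE)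
  have "Q = Rn n \<inter> (\<Inter>f\<in>S. {y. f y \<in> {r. sgn r = sgn (f x)}})" unfolding S(2) sign_cell_def by auto
  moreover have "convex {y. f y \<in> {r. sgn r = sgn (f x)}}" if "f \<in> S" for f
    by (rule convex_aff_vimage[OF _ convex_sgn]) (use S(1) that in blast)
  ultimately show ?thesis by (simp add: convex_Int convex_INT convex_Rn)
qed

lemma opoly_sub:
  assumes Q: "opoly Q" and f: "aff (f :: point \<Rightarrow> real)" and x: "x \<in> Q"
  shows "opoly {y\<in>Q. sgn (f y) = sgn (f x)}"
proof -
  obtain n S where S: "finite S" "\<And>f. f \<in> S \<Longrightarrow> aff f" "x \<in> Rn n" "Q = sign_cell n S x" "bounded Q"
    using opolyE[OF Q x] by blast
  have e: "{y\<in>Q. sgn (f y) = sgn (f x)} = sign_cell n (insert f S) x" unfolding S(4) sign_cell_def by auto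
  have "bounded {y\<in>Q. sgn (f y) = sgn (f x)}" by (rule bounded_subset[OF S(5)]) blast
  moreover have "finite (insert f S)" "\<forall>g\<in>insert f S. aff g" using S(1,2) f by auto
  ultimately show ?thesis unfolding opoly_def using S(3) e by (intro conjI exI[of _ n] exI[of _ "insert f S"] exI[of _ x])
qed

text \<open>Relative openness: a segment inside \<open>Q\<close> can be prolonged beyond its end
  point, because finitely many nonzero signs survive a small change, and functionals that vanish at
  \<open>y\<close> vanish at \<open>x\<close> too.\<close>

lemma opoly_extend:
  assumes Q: "opoly Q" and xy: "x \<in> Q" "y \<in> Q"
  shows "\<exists>e>0. y + e *\<^sub>R (y - x) \<in> Q"
proof -
  obtain n S where S: "finite S" "\<And>f. f \<in> S \<Longrightarrow> aff f" "y \<in> Rn n" "Q = sign_cell n S y"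
    using opolyE[OF Q xy(2)] by blast
  have x: "x \<in> Rn n" "\<And>f. f \<in> S \<Longrightarrow> sgn (f x) = sgn (f y)" using xy(1) unfolding S(4) sign_cell_def by auto
  have "\<exists>e>0. \<forall>e'. 0 < e' \<and> e' \<le> e \<longrightarrow> (\<forall>f\<in>S. sgn (f (y + e' *\<^sub>R (y - x))) = sgn (f y))"
    using S(1,2) x(2)
  proof (induction S rule: finite_induct)
    case empty show ?case by (rule exI[of _ 1]) simp
  next
    case (insert g S)
    then obtain e where e: "e > 0" "\<And>e'. 0 < e' \<Longrightarrow> e' \<le> e \<Longrightarrow> (\<forall>f\<in>S. sgn (f (y + e' *\<^sub>R (y - x))) = sgn (f y))" by auto
    have g: "g (y + t *\<^sub>R (y - x)) = (1 + t) * g y - t * g x" for t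
      using aff_translate[OF insert.prems(1)[OF insertI1], of y t y x] by (simp add: algebra_simps)
    have s: "sgn (g x) = sgn (g y)" using insert.prems(2) by simp
    \<comment> \<open>For \<open>0 < t\<close> and \<open>t \<le> d\<close> the perturbation
      \<open>t * \<bar>g x\<bar>\<close> stays strictly below \<open>\<bar>g y\<bar>\<close>; the
      summand 1 gives strictness and avoids a division by 0.\<close>
    define d where "d = (if g y = 0 then 1 else \<bar>g y\<bar> / (\<bar>g x\<bar> + 1))"
    have d: "d > 0" unfolding d_def by simp
    have sg: "sgn (g (y + t *\<^sub>R (y - x))) = sgn (g y)" if t: "0 < t" "t \<le> d" for t
    proof (cases "g y = 0")
      case True
      then have "g x = 0" using s by (simp add: sgn_0_0)
      then show ?thesis unfolding g using True by simp
    next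
      case False
      have "t * (\<bar>g x\<bar> + 1) \<le> \<bar>g y\<bar>" using t(2) False unfolding d_def by (simp add: pos_le_divide_eq)
      then have b: "t * \<bar>g x\<bar> < \<bar>g y\<bar>" using t(1) by (simp add: distrib_left)
      show ?thesis
      proof (cases "g y > 0")
        case True
        then have "g x > 0" using s by (simp add: sgn_if split: if_splits)
        then have "t * g x < g y" using b True by simp
        moreover have "0 < t * g y" using t(1) True by simp
        ultimately have "(1 + t) * g y - t * g x > 0" by (simp add: distrib_right)
        then show ?thesis unfolding g using True by simp
      next
        case False
        then have n: "g y < 0" using \<open>g y \<noteq> 0\<close> by simp
        then have "g x < 0" using s by (simp add: sgn_if split: if_splits)
        then have "- (t * g x) < - g y" using b n by simp
        moreover have "t * g y < 0" using t(1) n by (simp add: mult_pos_neg)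
        ultimately have "(1 + t) * g y - t * g x < 0" by (simp add: distrib_right)
        then show ?thesis unfolding g using n by simp
      qed
    qed
    show ?case
    proof (intro exI[of _ "min e d"] conjI allI impI ballI)
      show "0 < min e d" using e(1) d by simp
      fix e' f assume h: "0 < e' \<and> e' \<le> min e d" "f \<in> insert g S"
      show "sgn (f (y + e' *\<^sub>R (y - x))) = sgn (f y)"
        using h sg[of e'] e(2)[of e'] by auto
    qed
  qed
  then obtain e where e: "e > 0" "\<forall>f\<in>S. sgn (f (y + e *\<^sub>R (y - x))) = sgn (f y)" by blast
  have "y + e *\<^sub>R (y - x) \<in> Rn n" by (intro Rn_add Rn_scaleR Rn_diff S(3) x(1))
  then have "y + e *\<^sub>R (y - x) \<in> Q" unfolding S(4) sign_cell_def using e(2) by simp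
  then show ?thesis using e(1) by blast
qed

lemma opoly_aff_image:
  assumes Q: "opoly Q" and b: "aff b" "b ` Q \<subseteq> Rn m" and a: "aff a" "\<And>y. y \<in> Q \<Longrightarrow> a (b y) = y"
  shows "opoly (b ` Q)"
proof -
  obtain x where xQ: "x \<in> Q" using opoly_nonempty[OF Q] by blast
  obtain n S where S: "finite S" "\<And>f. f \<in> S \<Longrightarrow> aff f" "x \<in> Rn n" "Q = sign_cell n S x" "bounded Q"
    using opolyE[OF Q xQ] by blast
  obtain M where M: "a ` Rn m \<subseteq> Rn M" using aff_maps_Rn[OF a(1)] by blast
  \<comment> \<open>Membership of \<open>z\<close> in the image is read off through the inverse
    \<open>a\<close>: \<open>S1\<close> says that \<open>a z\<close> satisfies the sign conditions
    of \<open>Q\<close>, \<open>S2\<close> that \<open>b (a z) = z\<close>, and \<open>S3\<close>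
    that \<open>a z\<close> lies in \<open>Rn n\<close>. The bound \<open>M\<close> keeps
    \<open>S3\<close> finite.\<close>
  define S1 where "S1 = (\<lambda>f x. f (a x)) ` S"
  define S2 where "S2 = (\<lambda>i x. coord (b (a x)) i - coord x i) ` {..<m}"
  define S3 where "S3 = (\<lambda>j x. coord (a x) j) ` {n..<M}"
  have ca: "aff (\<lambda>x. coord (a x) j)" for j by (rule aff_compose[OF aff_coord a(1)])
  have cba: "aff (\<lambda>x. coord (b (a x)) i)" for i
    by (rule aff_compose[OF aff_coord aff_compose[OF b(1) a(1)]])
  have "aff g" if "g \<in> S1" for g
  proof -
    obtain f where f: "f \<in> S" "g = (\<lambda>x. f (a x))" using \<open>g \<in> S1\<close> unfolding S1_def by auto
    show ?thesis unfolding f(2) by (rule aff_compose[OF S(2)[OF f(1)] a(1)])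
  qed
  moreover have "aff g" if "g \<in> S2" for g
    using that unfolding S2_def by (auto intro!: aff_diff cba aff_coord)
  moreover have "aff g" if "g \<in> S3" for g using that ca unfolding S3_def by auto
  ultimately have affS: "\<forall>f\<in>S1 \<union> S2 \<union> S3. aff f" by blast
  have fS: "finite (S1 \<union> S2 \<union> S3)" using S(1) by (simp add: S1_def S2_def S3_def)
  have bx: "b x \<in> Rn m" using b(2) xQ by blast
  have abx: "a (b x) = x" by (rule a(2)[OF xQ])
  have "b ` Q = sign_cell m (S1 \<union> S2 \<union> S3) (b x)"
  proof (intro equalityI subsetI)
    fix z assume "z \<in> b ` Q"
    then obtain y where y: "y \<in> Q" "z = b y" by blast
    have az: "a z = y" using a(2)[OF y(1)] y(2) by simp
    have zm: "z \<in> Rn m" using b(2) y by blast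
    have yn: "y \<in> Rn n" "\<And>f. f \<in> S \<Longrightarrow> sgn (f y) = sgn (f x)" using y(1) unfolding S(4) sign_cell_def by auto
    have "sgn (g z) = sgn (g (b x))" if g: "g \<in> S1 \<union> S2 \<union> S3" for g
    proof -
      have "?thesis" if "g \<in> S1" using that yn(2) az abx unfolding S1_def by auto
      moreover have "?thesis" if "g \<in> S2" using that az abx y(2) unfolding S2_def by auto
      moreover have "?thesis" if "g \<in> S3" using that az abx yn(1) S(3) unfolding S3_def by (auto simp: Rn_iff)
      ultimately show ?thesis using g by blast
    qed
    then show "z \<in> sign_cell m (S1 \<union> S2 \<union> S3) (b x)" unfolding sign_cell_def using zm by simp
  next
    fix z assume "z \<in> sign_cell m (S1 \<union> S2 \<union> S3) (b x)"
    then have z: "z \<in> Rn m" "\<And>g. g \<in> S1 \<union> S2 \<union> S3 \<Longrightarrow> sgn (g z) = sgn (g (b x))"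
      unfolding sign_cell_def by auto
    have 1: "sgn (f (a z)) = sgn (f x)" if "f \<in> S" for f
    proof -
      have "(\<lambda>x. f (a x)) \<in> S1" using that unfolding S1_def by blast
      then show ?thesis using z(2)[of "\<lambda>x. f (a x)"] abx by simp
    qed
    have 2: "coord (b (a z)) i = coord z i" if "i < m" for i
    proof -
      have "(\<lambda>x. coord (b (a x)) i - coord x i) \<in> S2" using that unfolding S2_def by blast
      then show ?thesis using z(2)[of "\<lambda>x. coord (b (a x)) i - coord x i"] abx by (simp add: sgn_0_0)
    qed
    have 3: "coord (a z) j = 0" if "n \<le> j" "j < M" for j
    proof -
      have "(\<lambda>x. coord (a x) j) \<in> S3" using that unfolding S3_def by simp
      then have "sgn (coord (a z) j) = sgn (coord x j)" using z(2)[of "\<lambda>x. coord (a x) j"] abx by simp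
      then show ?thesis using S(3) that by (simp add: Rn_iff sgn_0_0)
    qed
    have "a z \<in> Rn M" using M z(1) by blast
    then have "a z \<in> Rn n" using 3 unfolding Rn_iff by (meson not_le)
    then have azQ: "a z \<in> Q" unfolding S(4) sign_cell_def using 1 by simp
    have "b (a z) = z"
    proof (rule poly_mapping_eqI)
      fix i
      have "b (a z) \<in> Rn m" using b(2) azQ by blast
      then show "coord (b (a z)) i = coord z i" using 2 z(1) by (cases "i < m") (simp_all add: Rn_iff)
    qed
    then show "z \<in> b ` Q" using azQ by (metis imageI)
  qed
  moreover have "bounded (b ` Q)"
  proof -
    obtain C where C: "C \<ge> 0" "\<forall>u\<in>Rn n. \<forall>v\<in>Rn n. norm (b u - b v) \<le> C * norm (u - v)"
      using aff_lipschitz[OF b(1), of n] by blast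
    obtain R where R: "\<And>y. y \<in> Q \<Longrightarrow> norm y \<le> R" using S(5) unfolding bounded_iff by blast
    have "norm (b y) \<le> norm (b x) + C * (R + norm x)" if y: "y \<in> Q" for y
    proof -
      have "y \<in> Rn n" using y unfolding S(4) sign_cell_def by blast
      then have "norm (b y - b x) \<le> C * norm (y - x)" using C(2) S(3) by blast
      also have "\<dots> \<le> C * (R + norm x)" using norm_triangle_ineq4[of y x] R[OF y] C(1) by (intro mult_left_mono) auto
      finally show ?thesis using norm_triangle_ineq2[of "b y" "b x"] by linarith
    qed
    then show ?thesis unfolding bounded_iff by blast
  qed
  ultimately show ?thesis unfolding opoly_def using affS fS bx
    by (intro conjI exI[of _ m] exI[of _ "S1 \<union> S2 \<union> S3"] exI[of _ "b x"])
qed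

lemma opoly_int_cube: "opoly (int_cube n)"
proof -
  define S where "S = (\<lambda>i x. 1 - coord x i) ` {..<n} \<union> (\<lambda>i x. 1 + coord x i) ` {..<n}"
  have "int_cube n = sign_cell n S 0"
  proof -
    have 1: "sgn (1 - c) = sgn (1 - 0) \<longleftrightarrow> c < 1" and 2: "sgn (1 + c) = sgn (1 + 0) \<longleftrightarrow> - c < 1" for c :: real
      by (auto simp: sgn_if)
    show ?thesis
      unfolding int_cube_def sign_cell_def S_def ball_Un ball_simps(9) lookup_zero 1 2 abs_less_iff by blast
  qed
  moreover have "\<forall>f\<in>S. aff f" unfolding S_def ball_Un ball_simps(9) by (intro conjI ballI aff_diff aff_add aff_const aff_coord)
  moreover have "finite S" by (simp add: S_def)
  moreover have "bounded (int_cube n)"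
    by (rule bounded_subset[OF compact_imp_bounded[OF compact_cube] int_cube_subset])
  ultimately show ?thesis unfolding opoly_def by (intro conjI exI[of _ n] exI[of _ S] exI[of _ 0]) simp_all
qed

definition const_sign :: "(point \<Rightarrow> real) \<Rightarrow> gcell \<Rightarrow> bool" where
  "const_sign f C \<longleftrightarrow> (\<forall>x\<in>cell_int C. \<forall>y\<in>cell_int C. sgn (f x) = sgn (f y))"

text \<open>If only 0 and one other sign occurred, prolonging a segment beyond a zero would produce
  the opposite sign.\<close>

lemma not_const_sign:
  assumes Q: "opoly (cell_int C)" and f: "aff f" and n: "\<not> const_sign f C"
  shows "\<exists>u\<in>cell_int C. \<exists>v\<in>cell_int C. f u > 0 \<and> f v < 0"
proof -
  obtain x y where xy: "x \<in> cell_int C" "y \<in> cell_int C" "sgn (f x) \<noteq> sgn (f y)" using n unfolding const_sign_def by blast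
  have ext: "\<exists>v\<in>cell_int C. sgn (f v) = - sgn (f x)" if h: "x \<in> cell_int C" "y \<in> cell_int C" "f y = 0" for x y
  proof -
    obtain e where e: "e > 0" "y + e *\<^sub>R (y - x) \<in> cell_int C" using opoly_extend[OF Q h(1,2)] by blast
    have "f (y + e *\<^sub>R (y - x)) = - (e * f x)" using aff_translate[OF f, of y e y x] h(3) by simp
    then have "sgn (f (y + e *\<^sub>R (y - x))) = - sgn (f x)" using e(1) by (simp add: sgn_minus sgn_mult)
    then show ?thesis using e(2) by blast
  qed
  have key: "\<exists>v\<in>cell_int C. sgn (f v) = - sgn (f x)" if h: "x \<in> cell_int C" "y \<in> cell_int C" "sgn (f x) \<noteq> sgn (f y)" "f x \<noteq> 0" for x y
  proof (cases "f y = 0")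
    case True then show ?thesis by (rule ext[OF h(1,2)])
  next
    case False
    then have "sgn (f y) = - sgn (f x)" using h(3,4) by (auto simp: sgn_if split: if_splits)
    then show ?thesis using h(2) by blast
  qed
  have "\<exists>w\<in>cell_int C. \<exists>v\<in>cell_int C. sgn (f v) = - sgn (f w) \<and> f w \<noteq> 0"
  proof (cases "f x = 0")
    case True
    then have "f y \<noteq> 0" using xy(3) by auto
    then show ?thesis using key[OF xy(2,1)] xy by metis
  next
    case False then show ?thesis using key[OF xy] xy(1) by metis
  qed
  then obtain w v where wv: "w \<in> cell_int C" "v \<in> cell_int C" "sgn (f v) = - sgn (f w)" "f w \<noteq> 0" by blast
  show ?thesis
  proof (cases "f w > 0")
    case True
    then have "f v < 0" using wv(3) by (simp add: sgn_if split: if_splits)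
    then show ?thesis using True wv by blast
  next
    case False
    then have "f w < 0" using wv(4) by simp
    moreover from this have "f v > 0" using wv(3) by (simp add: sgn_if split: if_splits)
    ultimately show ?thesis using wv by blast
  qed
qed

section \<open>Characteristic maps adapted to a cutting hyperplane\<close>

lemma aff_linear_part: assumes "aff (h :: 'a::real_vector \<Rightarrow> 'b::real_vector)"
  shows "linear (\<lambda>w. h w - h 0)" "h (p + w) = h p + (h w - h 0)" "h (v - w) - h 0 = h v - h w"
proof -
  obtain g c where g: "linear g" "\<And>x. h x = g x + c" using assms unfolding aff_def by blast
  show "linear (\<lambda>w. h w - h 0)" using g by (simp add: linear_0)
  show "h (p + w) = h p + (h w - h 0)" by (simp add: g(2) linear_add[OF g(1)] linear_0[OF g(1)])
  show "h (v - w) - h 0 = h v - h w" by (simp add: g(2) linear_diff[OF g(1)] linear_0[OF g(1)])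
qed

lemma segment_eq: "(1 - t) *\<^sub>R x + t *\<^sub>R y = x + t *\<^sub>R (y - (x::'a::real_vector))"
  by (simp add: algebra_simps)

lemma PL_on_aff': assumes "compact_polyhedron X" "aff a" shows "PL_on X a"
proof -
  obtain \<P> where "finite \<P>" "\<And>P. P \<in> \<P> \<Longrightarrow> polytope P" "X = \<Union>\<P>"
    using assms(1) unfolding compact_polyhedron_def by metis
  then show ?thesis by (intro PL_onI[of \<P> "\<lambda>P. P" "\<lambda>_. a"]) (use assms(2) in auto)
qed

text \<open>Linear coordinates on the direction space of \<open>Q\<close>, centered at
  \<open>p\<close>, in which \<open>f\<close> becomes the last coordinate. The basis consists of
  directions along which \<open>f\<close> is constant and one vector \<open>v0\<close> along which
  it grows by 1; the points \<open>u\<close> and \<open>v\<close> provide such a vector.\<close>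

lemma opoly_coordinates:
  assumes S: "finite S" "\<forall>a\<in>S. aff a" "p \<in> Rn n" and Q: "Q = sign_cell n S p"
    and f: "aff f" "f p = 0" and uv: "u \<in> Q" "v \<in> Q" "f u > 0" "f v < 0"
  shows "\<exists>m l g. linear l \<and> linear g \<and> (\<forall>x\<in>Rn (Suc m). g (l x) = x) \<and>
    (\<forall>x. l x \<in> Rn n \<and> (\<forall>a\<in>S. a p = 0 \<longrightarrow> a (l x) - a 0 = 0) \<and> f (l x) - f 0 = coord x m) \<and>
    (\<forall>y\<in>Q. g (y - p) \<in> Rn (Suc m) \<and> l (g (y - p)) = y - p)"
proof -
  have lf: "linear (\<lambda>w. f w - f 0)" by (rule aff_linear_part(1)[OF f(1)])
  \<comment> \<open>The directions along which the functionals vanishing at \<open>p\<close> remain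
    0; the other sign conditions are open and do not restrict directions.\<close>
  define V where "V = {w\<in>Rn n. \<forall>a\<in>S. a p = 0 \<longrightarrow> a w - a 0 = 0}"
  have subV: "subspace V"
  proof -
    have "V = Rn n \<inter> (\<Inter>a\<in>{a\<in>S. a p = 0}. {w. a w - a 0 = 0})" unfolding V_def by auto
    moreover have "subspace {w. a w - a 0 = 0}" if "a \<in> S" for a
      by (rule linear_subspace_kernel[OF aff_linear_part(1)[OF S(2)[rule_format, OF that]]])
    ultimately show ?thesis by (simp add: subspace_inter subspace_Inter subspace_Rn)
  qed
  have QV: "y - z \<in> V" if yz: "y \<in> Q" "z \<in> Q" for y z
  proof -
    have "a (y - z) - a 0 = 0" if a: "a \<in> S" "a p = 0" for a
    proof -
      have "a y = 0" "a z = 0" using yz a unfolding Q sign_cell_def by (auto simp: sgn_0_0)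
      then show ?thesis using aff_linear_part(3)[OF S(2)[rule_format, OF a(1)], of y z] by simp
    qed
    moreover have "y - z \<in> Rn n" using yz unfolding Q sign_cell_def by (simp add: Rn_diff)
    ultimately show ?thesis unfolding V_def by blast
  qed
  define V0 where "V0 = {w\<in>V. f w - f 0 = 0}"
  have subV0: "subspace V0"
  proof -
    have "V0 = V \<inter> {w. f w - f 0 = 0}" unfolding V0_def by auto
    then show ?thesis using subV linear_subspace_kernel[OF lf] by (simp add: subspace_inter)
  qed
  define v0 where "v0 = (1 / (f u - f v)) *\<^sub>R (u - v)"
  have v0: "v0 \<in> V" "f v0 - f 0 = 1"
  proof -
    show "v0 \<in> V" unfolding v0_def by (rule subspace_scale[OF subV QV[OF uv(1,2)]])
    have "f v0 - f 0 = (1 / (f u - f v)) * (f (u - v) - f 0)"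
      using linear_scale[OF lf, of "1 / (f u - f v)" "u - v"] by (simp add: v0_def)
    then show "f v0 - f 0 = 1" using aff_linear_part(3)[OF f(1), of u v] uv(3,4) by simp
  qed
  obtain B0 where B0: "B0 \<subseteq> V0" "independent B0" "V0 \<subseteq> span B0" using maximal_independent_subset[of V0] by blast
  have spB0: "span B0 \<subseteq> V0" by (rule span_minimal[OF B0(1) subV0])
  have fB0: "finite B0"
  proof -
    have "B0 \<subseteq> span (unit ` {..<n})" using B0(1) unfolding span_units V0_def V_def by blast
    then show ?thesis using independent_span_bound[of "unit ` {..<n}" B0] B0(2) by simp
  qed
  have v0n: "v0 \<notin> span B0" using spB0 v0(2) unfolding V0_def by auto
  then have v0B: "v0 \<notin> B0" using span_base by blast
  have indB1: "independent (insert v0 B0)" by (rule independent_insertI[OF v0n B0(2)])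
  define m where "m = card B0"
  obtain e where e: "bij_betw e {0..<m} B0" using ex_bij_betw_nat_finite[OF fB0] unfolding m_def by blast
  define bb where "bb = (\<lambda>i. if i < m then e i else v0)"
  have bbB: "bb i \<in> B0" if "i < m" for i using that e unfolding bb_def bij_betw_def by auto
  have bbV: "bb i \<in> V" for i using bbB[of i] B0(1) v0(1) unfolding bb_def V0_def by (cases "i < m") auto
  have img: "bb ` {..<Suc m} = insert v0 B0"
  proof -
    have "bb ` {..<m} = B0" using e unfolding bb_def bij_betw_def by (auto simp: atLeast0LessThan)
    moreover have "bb m = v0" by (simp add: bb_def)
    ultimately show ?thesis by (simp add: lessThan_Suc)
  qed
  have inj: "inj_on bb {..<Suc m}"
  proof (rule inj_onI)
    fix i j assume ij: "i \<in> {..<Suc m}" "j \<in> {..<Suc m}" "bb i = bb j"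
    show "i = j"
    proof (cases "i < m \<and> j < m")
      case True
      then show ?thesis using ij(3) e unfolding bb_def bij_betw_def by (auto dest: inj_onD)
    next
      case False
      have "\<not> (i < m \<and> j = m)" "\<not> (i = m \<and> j < m)"
        using ij(3) bbB v0B unfolding bb_def by (metis less_irrefl)+
      then show ?thesis using False ij by auto
    qed
  qed
  obtain g where g: "linear g" "\<forall>b\<in>insert v0 B0. g b = unit (inv_into {..<Suc m} bb b)"
    using linear_independent_extend[OF indB1, of "\<lambda>b. unit (inv_into {..<Suc m} bb b)"] by blast
  have gb: "g (bb i) = unit i" if "i < Suc m" for i
  proof -
    have "bb i \<in> insert v0 B0" using img that by blast
    then have "g (bb i) = unit (inv_into {..<Suc m} bb (bb i))" using g(2) by blast
    also have "inv_into {..<Suc m} bb (bb i) = i" by (rule inv_into_f_f[OF inj]) (use that in simp)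
    finally show ?thesis .
  qed
  define l where "l = (\<lambda>x. \<Sum>i<Suc m. coord x i *\<^sub>R bb i)"
  have linl: "linear l" unfolding l_def
    by (rule linearI) (simp_all only: lookup_add coord_scaleR scaleR_add_left sum.distrib scaleR_scaleR[symmetric] scaleR_right.sum)
  have lV: "l x \<in> V" for x unfolding l_def by (intro subspace_sum[OF subV] subspace_scale[OF subV] bbV)
  have gl: "g (l x) = x" if x: "x \<in> Rn (Suc m)" for x
  proof -
    have "g (l x) = (\<Sum>i<Suc m. coord x i *\<^sub>R g (bb i))"
      unfolding l_def by (simp only: linear_sum[OF g(1)] linear_scale[OF g(1)])
    also have "\<dots> = (\<Sum>i<Suc m. coord x i *\<^sub>R unit i)" by (rule sum.cong[OF refl]) (simp only: gb lessThan_iff)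
    also have "\<dots> = x" by (rule Rn_expand[OF x, symmetric])
    finally show ?thesis .
  qed
  have lunit: "l (unit i) = bb i" if i: "i < Suc m" for i
  proof -
    have "l (unit i) = (\<Sum>j<Suc m. if j = i then bb i else 0)"
      unfolding l_def by (rule sum.cong) (auto simp: coord_unit)
    then show ?thesis using i by simp
  qed
  have lg: "l (g w) = w \<and> g w \<in> Rn (Suc m)" if w: "w \<in> V" for w
  proof -
    have "span (insert v0 B0) \<subseteq> {w. l (g w) - w = 0} \<inter> {w. g w \<in> Rn (Suc m)}"
    proof (rule span_minimal)
      show "insert v0 B0 \<subseteq> {w. l (g w) - w = 0} \<inter> {w. g w \<in> Rn (Suc m)}"
        unfolding img[symmetric] using gb lunit unit_in_Rn by auto
      have "linear (\<lambda>w. l (g w) - w)"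
        using linear_compose_sub[OF linear_compose[OF g(1) linl] linear_ident] by (simp add: o_def)
      then have "subspace {w. l (g w) - w = 0}" by (rule linear_subspace_kernel)
      moreover have "subspace {w. g w \<in> Rn (Suc m)}"
        using linear_subspace_vimage[OF g(1) subspace_Rn] by (simp add: vimage_def)
      ultimately show "subspace ({w. l (g w) - w = 0} \<inter> {w. g w \<in> Rn (Suc m)})" by (rule subspace_inter)
    qed
    moreover have "w \<in> span (insert v0 B0)"
    proof -
      let ?c = "f w - f 0"
      have "w - ?c *\<^sub>R v0 \<in> V" by (rule subspace_diff[OF subV w subspace_scale[OF subV v0(1)]])
      moreover have "f (w - ?c *\<^sub>R v0) - f 0 = 0"
        using linear_diff[OF lf, of w "?c *\<^sub>R v0"] linear_scale[OF lf, of ?c v0] v0(2) by simp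
      ultimately have "w - ?c *\<^sub>R v0 \<in> V0" unfolding V0_def by blast
      then have "w - ?c *\<^sub>R v0 \<in> span B0" using B0(3) by blast
      then show ?thesis unfolding span_insert by blast
    qed
    ultimately show ?thesis by auto
  qed
  have fl: "f (l x) - f 0 = coord x m" for x
  proof -
    have "f (bb i) - f 0 = (if i = m then 1 else 0)" if "i < Suc m" for i
      using bbB[of i] B0(1) v0(2) that unfolding V0_def by (cases "i < m") (auto simp: bb_def less_Suc_eq)
    then have "(\<Sum>i<Suc m. coord x i * (f (bb i) - f 0)) = (\<Sum>i<Suc m. if i = m then coord x m else 0)"
      by (intro sum.cong) auto
    moreover have "f (l x) - f 0 = (\<Sum>i<Suc m. coord x i * (f (bb i) - f 0))"
      unfolding l_def by (simp only: linear_sum[OF lf] linear_scale[OF lf] real_scaleR_def)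
    ultimately show ?thesis by simp
  qed
  have pQ: "p \<in> Q" using S(3) unfolding Q sign_cell_def by simp
  have R1: "\<forall>x\<in>Rn (Suc m). g (l x) = x" using gl by blast
  have R2: "\<forall>x. l x \<in> Rn n \<and> (\<forall>a\<in>S. a p = 0 \<longrightarrow> a (l x) - a 0 = 0) \<and> f (l x) - f 0 = coord x m"
    using lV fl unfolding V_def by simp
  have R3: "\<forall>y\<in>Q. g (y - p) \<in> Rn (Suc m) \<and> l (g (y - p)) = y - p" using lg[OF QV[OF _ pQ]] by blast
  show ?thesis using linl g(1) R1 R2 R3 by (intro exI[of _ m] exI[of _ l] exI[of _ g] conjI)
qed

text \<open>In coordinates centered at a point \<open>p\<close> of the hyperplane in the cell, the
  cell is the open unit ball of a gauge, and so is the open cube. Both gauges are adapted to one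
  arrangement \<open>F\<close>, so \<open>fan_homeo\<close> maps one ball to the other. As
  \<open>F\<close> contains the last coordinate, which corresponds to \<open>f\<close>, the sign of
  \<open>f\<close> is preserved.\<close>

lemma adapted_cut_map:
  assumes Q: "opoly (cell_int C)" and C: "is_cell j C" and f: "aff f"
    and uv: "u \<in> cell_int C" "v \<in> cell_int C" "f u > 0" "f v < 0"
  shows "\<exists>k \<phi>. 1 \<le> k \<and> char k \<phi> C \<and> (\<forall>x\<in>cube k. sgn (f (\<phi> x)) = sgn (coord x (k - 1)))"
proof -
  let ?Q = "cell_int C"
  define p where "p = u + (f u / (f u - f v)) *\<^sub>R (v - u)"
  have fp: "f p = 0"
  proof -
    have "f u / (f u - f v) * (f v - f u) = - (f u / (f u - f v) * (f u - f v))"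
      by (simp only: minus_mult_right minus_diff_eq)
    also have "f u / (f u - f v) * (f u - f v) = f u"
      by (rule nonzero_eq_divide_eq[THEN iffD1]) (use uv(3,4) in linarith, rule refl)
    finally have "f u + (f u / (f u - f v)) *\<^sub>R (f v - f u) = 0" by (simp only: real_scaleR_def right_minus)
    then show ?thesis using aff_segment[OF f, of u "f u / (f u - f v)" v] unfolding p_def by (rule trans[rotated])
  qed
  have pQ: "p \<in> ?Q"
  proof -
    let ?t = "f u / (f u - f v)"
    have t: "0 \<le> ?t" "0 \<le> 1 - ?t"
    proof -
      have d: "0 < f u - f v" "f u \<le> f u - f v" using uv(3,4) by linarith+
      then show "0 \<le> ?t" using uv(3) by (intro divide_nonneg_pos) linarith+
      show "0 \<le> 1 - ?t" using d by (simp only: diff_ge_0_iff_ge divide_le_eq_1_pos)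
    qed
    have "(1 - ?t) *\<^sub>R u + ?t *\<^sub>R v \<in> ?Q"
      by (rule convexD[OF opoly_convex[OF Q] uv(1,2) t(2,1) diff_add_cancel])
    then show ?thesis unfolding p_def segment_eq .
  qed
  obtain n S where S: "finite S" "\<And>a. a \<in> S \<Longrightarrow> aff a" "p \<in> Rn n" "?Q = sign_cell n S p" "bounded ?Q"
    by (rule opolyE[OF Q pQ]) (rule that)
  obtain m l g where lg: "linear l" "linear g" "\<forall>x\<in>Rn (Suc m). g (l x) = x"
    "\<forall>x. l x \<in> Rn n \<and> (\<forall>a\<in>S. a p = 0 \<longrightarrow> a (l x) - a 0 = 0) \<and> f (l x) - f 0 = coord x m"
    "\<forall>y\<in>?Q. g (y - p) \<in> Rn (Suc m) \<and> l (g (y - p)) = y - p"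
    using opoly_coordinates[OF S(1) _ S(3,4) f fp uv] S(2) by blast
  let ?k = "Suc m"
  define \<alpha> where "\<alpha> = (\<lambda>x. p + l x)"
  have a\<alpha>: "aff \<alpha>" unfolding \<alpha>_def by (rule aff_add[OF aff_const aff_linear[OF lg(1)]])
  \<comment> \<open>Scaled so that \<open>a (\<alpha> x) = a p * (1 - \<gamma> a x)\<close>: then
    \<open>a\<close> has the same sign at \<open>\<alpha> x\<close> as at \<open>p\<close> exactly
    if \<open>\<gamma> a x < 1\<close>. The zero function in \<open>G\<close> makes \<open>G\<close>
    nonempty without affecting this condition.\<close>
  define \<gamma> where "\<gamma> = (\<lambda>(a :: point \<Rightarrow> real) (x :: point). - (1 / a p) * (a (l x) - a 0))"
  define G where "G = insert (\<lambda>x. 0) (\<gamma> ` {a\<in>S. a p \<noteq> 0})"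
  define G0 where "G0 = (\<lambda>i x. coord x i) ` {..<?k} \<union> (\<lambda>i x. - coord x i) ` {..<?k}"
  define F where "F = insert (\<lambda>x. coord x m) ((\<lambda>(g,g') x. g x - g' x) ` (G \<times> G \<union> G0 \<times> G0))"
  have linG: "linear h" if h: "h \<in> G" for h
  proof (cases "h = (\<lambda>x. 0)")
    case True then show ?thesis by (simp add: linear_zero)
  next
    case False
    then obtain a where a: "a \<in> S" "h = \<gamma> a" using h unfolding G_def by blast
    have "linear (\<lambda>x. a (l x) - a 0)"
      using linear_compose[OF lg(1) aff_linear_part(1)[OF S(2)[OF a(1)]]] by (simp add: o_def)
    then have "linear (\<lambda>x. (- (1 / a p)) *\<^sub>R (a (l x) - a 0))" by (rule linear_compose_scale_right)
    then show ?thesis unfolding a(2) \<gamma>_def by simp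
  qed
  have linG0: "linear h" if "h \<in> G0" for h
  proof -
    have "linear (\<lambda>x. - coord x i)" for i using linear_compose_neg[OF linear_coord] .
    then show ?thesis using that linear_coord unfolding G0_def by auto
  qed
  have linF: "linear h" if h: "h \<in> F" for h
  proof (cases "h = (\<lambda>x. coord x m)")
    case True then show ?thesis by (simp add: linear_coord)
  next
    case False
    then obtain g1 g2 where g12: "h = (\<lambda>x. g1 x - g2 x)" "g1 \<in> G \<and> g2 \<in> G \<or> g1 \<in> G0 \<and> g2 \<in> G0"
      using h unfolding F_def by auto
    then have "linear g1" "linear g2" using linG linG0 by blast+
    then show ?thesis unfolding g12(1) by (rule linear_compose_sub)
  qed
  have finG: "finite G" "finite G0" using S(1) by (simp_all add: G_def G0_def)
  have finF: "finite F" unfolding F_def using finG by simp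
  have FI: "(\<lambda>x. g1 x - g2 x) \<in> F" if g12: "g1 \<in> G \<and> g2 \<in> G \<or> g1 \<in> G0 \<and> g2 \<in> G0" for g1 g2
    unfolding F_def by (rule insertI2, rule image_eqI[of _ _ "(g1,g2)"]) (use g12 in auto)
  interpret fan ?k F
  proof (rule fan.intro)
    show "finite F" by (rule finF)
    show "linear h" if "h \<in> F" for h by (rule linF[OF that])
    show "x = 0" if x: "x \<in> Rn ?k" "\<And>h. h \<in> F \<Longrightarrow> h x = 0" for x
    proof (rule poly_mapping_eqI)
      fix i
      show "coord x i = coord 0 i"
      proof (cases "i < ?k")
        case True
        then have "(\<lambda>x. coord x i) \<in> G0" "(\<lambda>x. - coord x i) \<in> G0" unfolding G0_def by blast+
        then have "(\<lambda>x. coord x i - - coord x i) \<in> F" by (intro FI) simp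
        from x(2)[OF this] show ?thesis by simp
      qed (use x(1) in \<open>simp add: Rn_iff\<close>)
    qed
  qed
  have adG: "adapted G" "adapted G0"
  proof -
    have "G \<noteq> {}" "G0 \<noteq> {}" by (auto simp: G_def G0_def)
    then show "adapted G" "adapted G0" unfolding adapted_def using finG linG linG0 FI by simp_all
  qed
  have gle: "gauge G0 x \<le> r \<longleftrightarrow> (\<forall>i\<in>{..<?k}. coord x i \<le> r) \<and> (\<forall>i\<in>{..<?k}. - coord x i \<le> r)" for x r
    by (simp only: gauge_le_iff(1)[OF adG(2)]) (simp only: G0_def ball_Un ball_simps(9))
  have glt: "gauge G0 x < r \<longleftrightarrow> (\<forall>i\<in>{..<?k}. coord x i < r) \<and> (\<forall>i\<in>{..<?k}. - coord x i < r)" for x r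
    by (simp only: gauge_le_iff(2)[OF adG(2)]) (simp only: G0_def ball_Un ball_simps(9))
  have gauge_cube: "x \<in> cube ?k \<longleftrightarrow> x \<in> Rn ?k \<and> gauge G0 x \<le> 1" "x \<in> int_cube ?k \<longleftrightarrow> x \<in> Rn ?k \<and> gauge G0 x < 1" for x
    unfolding cube_def int_cube_def gle glt abs_le_iff abs_less_iff by blast+
  have posG0: "gauge G0 x > 0" if x: "x \<in> Rn ?k" "x \<noteq> 0" for x
  proof (rule ccontr)
    assume "\<not> gauge G0 x > 0"
    then have "gauge G0 x \<le> 0" by simp
    then have z: "\<forall>i\<in>{..<?k}. coord x i \<le> 0" "\<forall>i\<in>{..<?k}. - coord x i \<le> 0" unfolding gle by blast+
    have "x = 0"
    proof (rule poly_mapping_eqI)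
      fix i show "coord x i = coord 0 i"
      proof (cases "i < ?k")
        case True
        then have "coord x i \<le> 0" "- coord x i \<le> 0" using z by blast+
        then show ?thesis by simp
      qed (use x(1) in \<open>simp add: Rn_iff\<close>)
    qed
    then show False using x(2) by blast
  qed
  have in_Q: "\<alpha> x \<in> ?Q \<longleftrightarrow> gauge G x < 1" for x
  proof -
    have s: "sgn (a (\<alpha> x)) = sgn (a p) \<longleftrightarrow> a p = 0 \<or> \<gamma> a x < 1" if a: "a \<in> S" for a
    proof (cases "a p = 0")
      case True
      then have "a (\<alpha> x) = 0" unfolding \<alpha>_def aff_linear_part(2)[OF S(2)[OF a]] using lg(4) a by simp
      then show ?thesis using True by simp
    next
      case False
      have e: "a (\<alpha> x) = a p * (1 - \<gamma> a x)"
        unfolding \<alpha>_def aff_linear_part(2)[OF S(2)[OF a]] \<gamma>_def using False by (simp add: field_simps)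
      show ?thesis unfolding e sgn_mult using False by (auto simp: sgn_if split: if_splits)
    qed
    have "\<alpha> x \<in> Rn n" unfolding \<alpha>_def using S(3) lg(4) by (simp add: Rn_add)
    then have "\<alpha> x \<in> ?Q \<longleftrightarrow> (\<forall>a\<in>S. a p = 0 \<or> \<gamma> a x < 1)" unfolding S(4) sign_cell_def using s by auto
    also have "\<dots> \<longleftrightarrow> (\<forall>h\<in>G. h x < 1)" unfolding G_def by auto
    also have "\<dots> \<longleftrightarrow> gauge G x < 1" by (rule gauge_le_iff(2)[OF adG(1), symmetric])
    finally show ?thesis .
  qed
  \<comment> \<open>A nonzero \<open>x\<close> of gauge at most 0 would span a ray inside the cell,
    which is bounded.\<close>
  have posG: "gauge G x > 0" if x: "x \<in> Rn ?k" "x \<noteq> 0" for x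
  proof (rule ccontr)
    assume n: "\<not> gauge G x > 0"
    have ray: "\<alpha> (t *\<^sub>R x) \<in> ?Q" if "t \<ge> 0" for t
    proof -
      have "gauge G (t *\<^sub>R x) = t * gauge G x" by (rule gauge_scale[OF adG(1) that])
      also have "\<dots> \<le> 0" using n that by (simp add: mult_nonneg_nonpos)
      finally show ?thesis unfolding in_Q by simp
    qed
    obtain R where R: "\<And>y. y \<in> ?Q \<Longrightarrow> norm y \<le> R" using S(5) unfolding bounded_iff by blast
    have "l x \<noteq> 0"
    proof
      assume "l x = 0"
      then have "g (l x) = 0" using linear_0[OF lg(2)] by simp
      then show False using lg(3) x by simp
    qed
    then have nz: "norm (l x) > 0" by simp
    define t where "t = (\<bar>R\<bar> + norm p + 1) / norm (l x)"
    have t: "t \<ge> 0" by (simp add: t_def)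
    have "t * norm (l x) = \<bar>R\<bar> + norm p + 1" using \<open>l x \<noteq> 0\<close> by (simp add: t_def)
    moreover have "norm (l (t *\<^sub>R x)) = t * norm (l x)" using t by (simp add: linear_scale[OF lg(1)])
    moreover have "norm (l (t *\<^sub>R x)) \<le> norm (\<alpha> (t *\<^sub>R x)) + norm p"
      unfolding \<alpha>_def by (metis add_diff_cancel_left' norm_triangle_ineq4)
    moreover have "norm (\<alpha> (t *\<^sub>R x)) \<le> R" by (rule R[OF ray[OF t]])
    ultimately show False by linarith
  qed
  obtain h where h: "PL_on {x\<in>Rn ?k. gauge G0 x \<le> 1} h" "inj_on h (Rn ?k)" "h ` Rn ?k = Rn ?k"
    "\<And>x. x \<in> Rn ?k \<Longrightarrow> gauge G (h x) = gauge G0 x" "\<And>x. x \<in> Rn ?k \<Longrightarrow> same (h x) x"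
    using fan_homeo[OF adG(2) posG0 adG(1) posG] by blast
  have cube_eq: "{x\<in>Rn ?k. gauge G0 x \<le> 1} = cube ?k" using gauge_cube(1) by blast
  have hR: "h x \<in> Rn ?k" if "x \<in> Rn ?k" for x using h(3) that by blast
  have inj\<alpha>: "inj_on \<alpha> (Rn ?k)"
  proof (rule inj_onI)
    fix x y assume xy: "x \<in> Rn ?k" "y \<in> Rn ?k" "\<alpha> x = \<alpha> y"
    then have "g (l x) = g (l y)" unfolding \<alpha>_def by simp
    then show "x = y" using lg(3) xy by simp
  qed
  let ?\<phi> = "\<alpha> \<circ> h"
  have PL: "PL_on (cube ?k) ?\<phi>"
    by (rule PL_on_compose[OF h(1)[unfolded cube_eq] PL_on_aff'[OF PL_on_image[OF h(1)[unfolded cube_eq]] a\<alpha>] order_refl])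
  have inj: "inj_on ?\<phi> (cube ?k)"
  proof (rule inj_on_subset[OF _ cube_subset_Rn])
    show "inj_on ?\<phi> (Rn ?k)" by (rule comp_inj_on[OF h(2)]) (simp add: h(3) inj\<alpha>)
  qed
  have img: "?\<phi> ` int_cube ?k = ?Q"
  proof
    show "?\<phi> ` int_cube ?k \<subseteq> ?Q" using gauge_cube(2) in_Q h(4) by auto
    show "?Q \<subseteq> ?\<phi> ` int_cube ?k"
    proof
      fix y assume y: "y \<in> ?Q"
      let ?x' = "g (y - p)"
      have x': "?x' \<in> Rn ?k" "\<alpha> ?x' = y" using lg(5) y unfolding \<alpha>_def by simp_all
      then obtain x where x: "x \<in> Rn ?k" "h x = ?x'" using h(3) by (metis imageE)
      have "gauge G0 x < 1" using h(4)[OF x(1)] in_Q[of ?x'] x(2) x'(2) y by simp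
      then have "x \<in> int_cube ?k" using gauge_cube(2) x(1) by blast
      then show "y \<in> ?\<phi> ` int_cube ?k" using x(2) x'(2) by (intro image_eqI[of _ _ x]) auto
    qed
  qed
  have "char ?k ?\<phi> (GCell (?\<phi> ` int_cube ?k) (?\<phi> ` bd_cube ?k))"
  proof (rule charI[OF PL inj_on_subset[OF inj int_cube_subset]])
    show "cell_int (GCell (?\<phi> ` int_cube ?k) (?\<phi> ` bd_cube ?k)) \<inter> cell_bd (GCell (?\<phi> ` int_cube ?k) (?\<phi> ` bd_cube ?k)) = {}"
      using inj_on_image_Int[OF inj int_cube_subset bd_cube_subset] int_bd_disjoint by simp
  qed simp_all
  note ch0 = this
  have "GCell (?\<phi> ` int_cube ?k) (?\<phi> ` bd_cube ?k) = C"
    by (rule cell_eqI[OF char_is_cell[OF ch0] C]) (simp only: gcell.sel img)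
  then have ch: "char ?k ?\<phi> C" using ch0 by simp
  have "sgn (f (?\<phi> x)) = sgn (coord x (?k - 1))" if x: "x \<in> cube ?k" for x
  proof -
    have xR: "x \<in> Rn ?k" using x cube_subset_Rn by blast
    have "f (?\<phi> x) = coord (h x) m"
      using aff_linear_part(2)[OF f, of p "l (h x)"] fp lg(4) by (simp add: \<alpha>_def)
    moreover have "(\<lambda>x. coord x m) \<in> F" unfolding F_def by simp
    then have "sgn (coord (h x) m) = sgn (coord x m)" using h(5)[OF xR] unfolding same_def by force
    ultimately show ?thesis by simp
  qed
  then show ?thesis using ch by (intro exI[of _ ?k] exI[of _ ?\<phi>]) simp
qed

section \<open>Cutting along hyperplanes\<close>

text \<open>A frame is a complex \<open>D\<close> whose cells outside \<open>L\<close> are convex, together with a map \<open>\<phi>\<close>, injective on the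
  interiors of these cells, that transports every subdivision of them to the complex below.\<close>

definition push :: "(point \<Rightarrow> point) \<Rightarrow> gcell set \<Rightarrow> gcell set \<Rightarrow> gcell set \<Rightarrow> gcell set" where
  "push \<phi> K L D = K \<union> gmap \<phi> ` (D - L)"

definition frame :: "(point \<Rightarrow> point) \<Rightarrow> gcell set \<Rightarrow> gcell set \<Rightarrow> gcell set \<Rightarrow> bool" where
  "frame \<phi> K L D \<longleftrightarrow> good D \<and> L \<subseteq> D \<and> (\<forall>C\<in>D - L. opoly (cell_int C)) \<and>
    inj_on \<phi> (\<Union>C\<in>D - L. cell_int C) \<and> cellular D (push \<phi> K L D) \<phi> \<and> good (push \<phi> K L D) \<and>
    K \<inter> gmap \<phi> ` (D - L) = {} \<and> gmap \<phi> ` L \<subseteq> K"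

lemma frameD:
  assumes "frame \<phi> K L D"
  shows "good D" "L \<subseteq> D" "\<And>C. C \<in> D \<Longrightarrow> C \<notin> L \<Longrightarrow> opoly (cell_int C)"
    "inj_on \<phi> (\<Union>C\<in>D - L. cell_int C)" "cellular D (push \<phi> K L D) \<phi>" "good (push \<phi> K L D)"
    "K \<inter> gmap \<phi> ` (D - L) = {}" "gmap \<phi> ` L \<subseteq> K"
  using assms unfolding frame_def by blast+

section \<open>One cut of one cell, made upstairs and downstairs at once\<close>

lemma subdiv_compose: "1 \<le> k \<Longrightarrow> subdiv k (\<phi> \<circ> \<psi>) = gmap \<phi> ` subdiv k \<psi>"
  unfolding subdiv_def by (simp add: half_cell_def middle_cell_eq gmap_def image_comp)

lemma cell_subset_Rn: assumes "is_cell n C" shows "\<exists>m. carrier C \<subseteq> Rn m"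
proof -
  obtain \<phi> where c: "char n \<phi> C" using assms unfolding is_cell_def by blast
  have "compact_polyhedron (carrier C)" unfolding char_carrier[OF c] by (rule PL_on_image[OF charD(2)[OF c]])
  then obtain \<P> where P: "finite \<P>" "\<And>P. P \<in> \<P> \<Longrightarrow> polytope P" "carrier C = \<Union>\<P>"
    unfolding compact_polyhedron_def by metis
  then have "\<forall>P\<in>\<P>. \<exists>m. P \<subseteq> Rn m" using polytope_subset_Rn by blast
  from bchoice[OF this] obtain m where m: "\<forall>P\<in>\<P>. P \<subseteq> Rn (m P)" by (rule exE)
  have "P \<subseteq> Rn (Max (m ` \<P>))" if "P \<in> \<P>" for P
  proof -
    have "m P \<le> Max (m ` \<P>)" using P(1) that by simp
    then show ?thesis using m that Rn_mono by blast
  qed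
  then show ?thesis unfolding P(3) by blast
qed

lemma zero_on_carrier:
  assumes C: "is_cell n C" and f: "aff (f :: point \<Rightarrow> real)" and z: "\<And>x. x \<in> cell_int C \<Longrightarrow> f x = 0" and x: "x \<in> carrier C"
  shows "f x = 0"
proof -
  obtain \<phi> where c: "char n \<phi> C" using C unfolding is_cell_def by blast
  obtain m where m: "carrier C \<subseteq> Rn m" using cell_subset_Rn[OF C] by blast
  have "closed {x \<in> carrier C. f x = 0}"
    by (rule continuous_closed_preimage_constant[OF continuous_on_aff[OF f m]])
      (simp add: char_closure[OF c])
  moreover have "cell_int C \<subseteq> {x \<in> carrier C. f x = 0}" using z unfolding carrier_def by blast
  ultimately have "closure (cell_int C) \<subseteq> {x \<in> carrier C. f x = 0}" by (rule closure_minimal[rotated])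
  then show ?thesis using x unfolding char_closure[OF c] by blast
qed

text \<open>Under the characteristic map adapted to \<open>f\<close> the sign of \<open>f\<close> is
  that of the last coordinate. A boundary cell of constant sign whose interior meets the equator has
  sign 0 and so lies in the equator; hence the pullback is saturated. The same pullback serves for
  \<open>\<phi> \<circ> \<psi>\<close> below, so one cut subdivides both complexes.\<close>

lemma frame_step:
  assumes fr: "frame \<phi> K L D" and E: "E \<in> D" "E \<notin> L" and f: "aff f" and nc: "\<not> const_sign f E"
    and bd: "\<And>F. F \<in> D \<Longrightarrow> carrier F \<subseteq> cell_bd E \<Longrightarrow> const_sign f F"
  shows "\<exists>P. frame \<phi> K L ((D - {E}) \<union> P) \<and>
    elementary_subdivision (push \<phi> K L D) (push \<phi> K L ((D - {E}) \<union> P)) \<and>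
    (\<forall>C\<in>P. \<exists>x\<in>cell_int E. cell_int C = {y\<in>cell_int E. sgn (f y) = sgn (f x)}) \<and>
    (\<Union>C\<in>P. carrier C) = carrier E \<and> P \<inter> L = {}"
proof -
  note fD = frameD[OF fr]
  let ?K = "push \<phi> K L D"
  obtain j \<psi>0 where c0: "char j \<psi>0 E" using goodD(3)[OF fD(1) E(1)] by blast
  obtain u v where uv: "u \<in> cell_int E" "v \<in> cell_int E" "f u > 0" "f v < 0"
    using not_const_sign[OF fD(3)[OF E] f nc] by blast
  obtain k \<psi> where k: "1 \<le> k" and c: "char k \<psi> E" and sg: "\<And>x. x \<in> cube k \<Longrightarrow> sgn (f (\<psi> x)) = sgn (coord x (k - 1))"
    using adapted_cut_map[OF fD(3)[OF E] char_is_cell[OF c0] f uv] by blast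
  obtain M where M: "good M" "support M = bd_cube k" "cellular M D \<psi>" using goodD(4)[OF fD(1) E(1) c] by blast
  have sat: "saturated k M"
    unfolding saturated_def
  proof (intro ballI impI)
    fix F assume F: "F \<in> M" "cell_int F \<inter> equator k \<noteq> {}"
    obtain i \<theta> where p: "char i \<theta> F" using goodD(3)[OF M(1) F(1)] by blast
    let ?G = "gmap \<psi> F"
    have G: "?G \<in> D" "char i (\<psi> \<circ> \<theta>) ?G" using cellularD[OF M(3) F(1)] p by blast+
    have "carrier ?G \<subseteq> cell_bd E" unfolding bd_image_cellular[OF c M(2)] using F(1) by blast
    then have cG: "const_sign f ?G" by (rule bd[OF G(1)])
    have Fbd: "carrier F \<subseteq> bd_cube k" using carrier_subset_support[OF F(1)] M(2) by simp
    have Fc: "carrier F \<subseteq> cube k" using Fbd bd_cube_subset by blast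
    obtain x where x: "x \<in> cell_int F" "x \<in> equator k" using F(2) by blast
    have "x \<in> cube k" using x(1) Fc unfolding carrier_def by blast
    then have fx: "f (\<psi> x) = 0" using sg[of x] x(2) unfolding equator_def by (simp add: sgn_0_0)
    have z: "f y = 0" if y: "y \<in> cell_int ?G" for y
    proof -
      have "\<psi> x \<in> cell_int ?G" using x(1) by simp
      then have "sgn (f y) = sgn (f (\<psi> x))" using cG y unfolding const_sign_def by blast
      then show ?thesis using fx by (simp add: sgn_0_0)
    qed
    show "carrier F \<subseteq> equator k"
    proof
      fix y assume y: "y \<in> carrier F"
      have yG: "\<psi> y \<in> carrier ?G" using y by simp
      have "f (\<psi> y) = 0" by (rule zero_on_carrier[OF char_is_cell[OF G(2)] f _ yG]) (rule z)
      then have "coord y (k - 1) = 0" using sg[of y] y Fc by (auto simp: sgn_0_0)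
      then show "y \<in> equator k" using y Fbd unfolding equator_def by blast
    qed
  qed
  define P where "P = subdiv k \<psi>"
  let ?D = "(D - {E}) \<union> P"
  let ?C = "gmap \<phi> E"
  have gD: "good ?D" unfolding P_def by (rule elementary_subdivision_step(2)[OF fD(1) E(1) k c M sat])
  have CK: "?C \<in> ?K" by (rule cellularD(1)[OF fD(5) E(1)])
  have cC: "char k (\<phi> \<circ> \<psi>) ?C" by (rule cellularD(2)[OF fD(5) E(1) c])
  have MK: "cellular M ?K (\<phi> \<circ> \<psi>)" by (rule cellular_compose[OF M(3) fD(5)])
  note st = elementary_subdivision_step[OF fD(6) CK k cC M(1,2) MK sat]
  have PE: "cell_int B \<subseteq> cell_int E" if "B \<in> P" for B
    using subdiv_int_subset[OF k that[unfolded P_def]] charD(4)[OF c] by simp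
  have Pch: "\<exists>i u. u ` cube i \<subseteq> cube k \<and> char i (\<psi> \<circ> u) B \<and> char i (\<phi> \<circ> (\<psi> \<circ> u)) (gmap \<phi> B)" if B: "B \<in> P" for B
  proof -
    obtain i u where u: "u ` cube i \<subseteq> cube k"
      "\<forall>\<psi>' C'. char k \<psi>' C' \<longrightarrow> (\<exists>D'\<in>subdiv k \<psi>'. char i (\<psi>' \<circ> u) D')" "char i (\<psi> \<circ> u) B"
      using char_subdiv[OF c k B[unfolded P_def]] by (elim exE conjE)
    obtain B' where B': "char i (\<phi> \<circ> \<psi> \<circ> u) B'" using u(2)[rule_format, OF cC] by blast
    then have B'': "char i (\<phi> \<circ> (\<psi> \<circ> u)) B'" by (simp add: o_assoc)
    have "B' = gmap \<phi> B" by (rule char_compose_eq[OF u(3) B''])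
    then show ?thesis using u(1,3) B'' by (intro exI[of _ i] exI[of _ u]) simp
  qed
  have Pne: "cell_int B \<noteq> {}" if "B \<in> P" for B using Pch[OF that] char_int_nonempty by blast
  have PL: "P \<inter> L = {}"
  proof (rule ccontr)
    assume "P \<inter> L \<noteq> {}"
    then obtain B where B: "B \<in> P" "B \<in> L" by blast
    have "B = E" by (rule goodD(2)[OF fD(1)]) (use B fD(2) E PE Pne in blast)+
    then show False using B(2) E(2) by simp
  qed
  \<comment> \<open>Different cells outside \<open>L\<close> have different images, so removing
    \<open>E\<close> upstairs removes exactly \<open>?C\<close> from the images below.\<close>
  have ginj: "A = B" if AB: "A \<in> D" "A \<notin> L" "B \<in> D" "B \<notin> L" "gmap \<phi> A = gmap \<phi> B" for A B
  proof -
    let ?U = "\<Union>C\<in>D - L. cell_int C"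
    have sub: "cell_int A \<subseteq> ?U" "cell_int B \<subseteq> ?U" using AB by blast+
    have "\<phi> ` cell_int A = \<phi> ` cell_int B" using arg_cong[OF AB(5), of cell_int] by simp
    then have "cell_int A = cell_int B" using inj_on_image_eq_iff[OF fD(4) sub] by blast
    moreover have "cell_int A \<noteq> {}" using goodD(3)[OF fD(1) AB(1)] char_int_nonempty by blast
    ultimately show ?thesis using goodD(2)[OF fD(1) AB(1,3)] by blast
  qed
  have CnK: "?C \<notin> K" using fD(7) E by blast
  have push_eq: "(?K - {?C}) \<union> subdiv k (\<phi> \<circ> \<psi>) = push \<phi> K L ?D"
  proof -
    have "?D - L = (D - L - {E}) \<union> P" using PL by blast
    then have "push \<phi> K L ?D = K \<union> gmap \<phi> ` (D - L - {E}) \<union> gmap \<phi> ` P" unfolding push_def by blast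
    also have "gmap \<phi> ` (D - L - {E}) = gmap \<phi> ` (D - L) - {?C}" using ginj E by blast
    also have "gmap \<phi> ` P = subdiv k (\<phi> \<circ> \<psi>)" unfolding P_def by (rule subdiv_compose[OF k, symmetric])
    also have "K \<union> (gmap \<phi> ` (D - L) - {?C}) = ?K - {?C}" unfolding push_def using CnK by blast
    finally show ?thesis by (rule sym)
  qed
  have Uint: "(\<Union>C\<in>?D - L. cell_int C) \<subseteq> (\<Union>C\<in>D - L. cell_int C)" using PE E by blast
  have Pint: "\<exists>x\<in>cell_int E. cell_int B = {y\<in>cell_int E. sgn (f y) = sgn (f x)}" if B: "B \<in> P" for B
  proof -
    obtain S t where S: "cell_int B = \<psi> ` S" "S = {x\<in>int_cube k. sgn (coord x (k - 1)) = t}"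
      using subdiv_int[OF k B[unfolded P_def]] by blast
    obtain w where w: "w \<in> S" using Pne[OF B] S(1) by blast
    have sgi: "sgn (f (\<psi> x)) = sgn (coord x (k - 1))" if "x \<in> int_cube k" for x
      using sg subsetD[OF int_cube_subset that] by blast
    have "\<psi> w \<in> cell_int E" using w S(2) charD(4)[OF c] by blast
    moreover have "cell_int B = {y\<in>cell_int E. sgn (f y) = sgn (f (\<psi> w))}"
    proof -
      have "sgn (f (\<psi> w)) = t" using sgi[of w] w S(2) by simp
      then show ?thesis unfolding S(1) charD(4)[OF c] S(2) using sgi by auto
    qed
    ultimately show ?thesis by blast
  qed
  have fr': "frame \<phi> K L ?D"
    unfolding frame_def
  proof (intro conjI ballI)
    show "L \<subseteq> ?D" using fD(2) E(2) by blast
    show "opoly (cell_int C)" if C: "C \<in> ?D - L" for C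
    proof (cases "C \<in> P")
      case True
      then obtain x where x: "x \<in> cell_int E" "cell_int C = {y\<in>cell_int E. sgn (f y) = sgn (f x)}" using Pint by blast
      show ?thesis unfolding x(2) by (rule opoly_sub[OF fD(3)[OF E] f x(1)])
    next
      case False then show ?thesis using C fD(3) by blast
    qed
    show "inj_on \<phi> (\<Union>C\<in>?D - L. cell_int C)" by (rule inj_on_subset[OF fD(4) Uint])
    show "good (push \<phi> K L ?D)" using st(2) unfolding push_eq .
    show "cellular ?D (push \<phi> K L ?D) \<phi>"
    proof (rule cellularI)
      fix F assume F: "F \<in> ?D"
      show "\<exists>i \<theta>. char i \<theta> F \<and> char i (\<phi> \<circ> \<theta>) (gmap \<phi> F) \<and> gmap \<phi> F \<in> push \<phi> K L ?D"
      proof (cases "F \<in> P")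
        case True
        then have "gmap \<phi> F \<in> push \<phi> K L ?D" using PL unfolding push_def by blast
        moreover obtain i u where "char i (\<psi> \<circ> u) F" "char i (\<phi> \<circ> (\<psi> \<circ> u)) (gmap \<phi> F)" using Pch[OF True] by (elim exE conjE)
        ultimately show ?thesis by (intro exI[of _ i] exI[of _ "\<psi> \<circ> u"] conjI)
      next
        case False
        then have FD: "F \<in> D" "F \<noteq> E" using F by blast+
        obtain i \<theta> where p: "char i \<theta> F" using goodD(3)[OF fD(1) FD(1)] by blast
        have "gmap \<phi> F \<in> push \<phi> K L ?D"
        proof (cases "F \<in> L")
          case True then show ?thesis using fD(8) unfolding push_def by blast
        next
          case False then show ?thesis using FD unfolding push_def by blast
        qed
        then show ?thesis using p cellularD(2)[OF fD(5) FD(1) p] by (intro exI[of _ i] exI[of _ \<theta>] conjI)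
      qed
    qed
    show "K \<inter> gmap \<phi> ` (?D - L) = {}"
    proof (rule ccontr)
      assume "K \<inter> gmap \<phi> ` (?D - L) \<noteq> {}"
      then obtain B where B: "B \<in> ?D - L" "gmap \<phi> B \<in> K" by blast
      have "B \<in> P" using B fD(7) by blast
      then have "cell_int (gmap \<phi> B) \<subseteq> cell_int ?C" "cell_int (gmap \<phi> B) \<noteq> {}"
        using image_mono[OF PE, of B \<phi>] Pne[of B] by simp_all
      then have "gmap \<phi> B = ?C"
        using goodD(2)[OF fD(6) _ CK, of "gmap \<phi> B"] B(2) unfolding push_def by blast
      then show False using CnK B(2) by simp
    qed
  qed (use gD fD(8) in simp_all)
  have "(\<Union>C\<in>P. carrier C) = carrier E" unfolding P_def subdiv_carrier[OF k] char_carrier[OF c] ..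
  then show ?thesis using fr' st(1) Pint PL unfolding push_eq by (intro exI[of _ P] conjI) simp_all
qed

text \<open>Every new cell is a union of sign classes of \<open>\<A>\<close> inside one old cell.
  Together with \<open>const_sign\<close> for all members of \<open>\<A>\<close> it is a single sign
  class, which identifies the cells independently of the order of the cuts.\<close>

definition refines :: "(point \<Rightarrow> real) set \<Rightarrow> gcell set \<Rightarrow> gcell set \<Rightarrow> gcell set \<Rightarrow> bool" where
  "refines \<A> L D' D \<longleftrightarrow> (\<forall>C'\<in>D' - L. \<exists>C\<in>D - L. cell_int C' \<subseteq> cell_int C \<and>
    (\<forall>x\<in>cell_int C'. \<forall>y\<in>cell_int C. (\<forall>f\<in>\<A>. sgn (f x) = sgn (f y)) \<longrightarrow> y \<in> cell_int C'))"

lemma refines_refl: "refines \<A> L D D"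
  unfolding refines_def by blast

lemma refines_trans: assumes 1: "refines \<A> L D'' D'" and 2: "refines \<B> L D' D" shows "refines (\<A> \<union> \<B>) L D'' D"
  unfolding refines_def
proof
  fix C'' assume "C'' \<in> D'' - L"
  then obtain C' where C': "C' \<in> D' - L" "cell_int C'' \<subseteq> cell_int C'"
    "\<forall>x\<in>cell_int C''. \<forall>y\<in>cell_int C'. (\<forall>f\<in>\<A>. sgn (f x) = sgn (f y)) \<longrightarrow> y \<in> cell_int C''"
    using 1 unfolding refines_def by blast
  obtain C where C: "C \<in> D - L" "cell_int C' \<subseteq> cell_int C"
    "\<forall>x\<in>cell_int C'. \<forall>y\<in>cell_int C. (\<forall>f\<in>\<B>. sgn (f x) = sgn (f y)) \<longrightarrow> y \<in> cell_int C'"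
    using 2 C'(1) unfolding refines_def by blast
  have y: "y \<in> cell_int C''" if h: "x \<in> cell_int C''" "y \<in> cell_int C" "\<forall>f\<in>\<A> \<union> \<B>. sgn (f x) = sgn (f y)" for x y
  proof -
    have "y \<in> cell_int C'" using C(3) C'(2) h by blast
    then show ?thesis using C'(3) h by blast
  qed
  show "\<exists>C\<in>D - L. cell_int C'' \<subseteq> cell_int C \<and>
    (\<forall>x\<in>cell_int C''. \<forall>y\<in>cell_int C. (\<forall>f\<in>\<A> \<union> \<B>. sgn (f x) = sgn (f y)) \<longrightarrow> y \<in> cell_int C'')"
    by (intro bexI[of _ C] conjI ballI impI subset_trans[OF C'(2) C(2)] C(1)) (rule y)
qed

lemma refines_const: "refines \<A> L D' D \<Longrightarrow> (\<And>C. C \<in> D - L \<Longrightarrow> const_sign f C) \<Longrightarrow> C' \<in> D' - L \<Longrightarrow> const_sign f C'"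
proof -
  assume r: "refines \<A> L D' D" and c: "\<And>C. C \<in> D - L \<Longrightarrow> const_sign f C" and C': "C' \<in> D' - L"
  obtain C where C: "C \<in> D - L" "cell_int C' \<subseteq> cell_int C" using r C' unfolding refines_def by blast
  show "const_sign f C'" using c[OF C(1)] C(2) unfolding const_sign_def by blast
qed

section \<open>Cutting all cells of a frame\<close>

definition reaches :: "(point \<Rightarrow> point) \<Rightarrow> gcell set \<Rightarrow> gcell set \<Rightarrow> (point \<Rightarrow> real) set \<Rightarrow> gcell set \<Rightarrow> gcell set \<Rightarrow> bool" where
  "reaches \<phi> K L \<A> D D' \<longleftrightarrow> frame \<phi> K L D' \<and> elementary_subdivision\<^sup>*\<^sup>* (push \<phi> K L D) (push \<phi> K L D') \<and>
    refines \<A> L D' D \<and> support (D' - L) = support (D - L)"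

lemma reaches_trans: "reaches \<phi> K L \<A> D' D'' \<Longrightarrow> reaches \<phi> K L \<B> D D' \<Longrightarrow> reaches \<phi> K L (\<A> \<union> \<B>) D D''"
proof -
  assume "reaches \<phi> K L \<A> D' D''" and "reaches \<phi> K L \<B> D D'"
  then have 1: "frame \<phi> K L D''" "elementary_subdivision\<^sup>*\<^sup>* (push \<phi> K L D') (push \<phi> K L D'')"
      "refines \<A> L D'' D'" "support (D'' - L) = support (D' - L)"
    and 2: "elementary_subdivision\<^sup>*\<^sup>* (push \<phi> K L D) (push \<phi> K L D')"
      "refines \<B> L D' D" "support (D' - L) = support (D - L)"
    unfolding reaches_def by blast+
  show ?thesis
    unfolding reaches_def
    by (intro conjI 1(1) rtranclp_trans[OF 2(1) 1(2)] refines_trans[OF 1(3) 2(2)] trans[OF 1(4) 2(3)])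
qed

text \<open>Among the cells crossed by the hyperplane, one is cut whose carrier contains the fewest
  cells; the cells in its boundary contain fewer and are therefore not crossed. Its parts are not
  crossed either, so the number of crossed cells drops. The cells of \<open>L\<close> are uncrossed
  by assumption and are never cut.\<close>

lemma cut_frame:
  assumes f: "aff f" and L: "\<And>C. C \<in> L \<Longrightarrow> const_sign f C"
  shows "frame \<phi> K L D \<Longrightarrow> \<exists>D'. reaches \<phi> K L {f} D D' \<and> (\<forall>C\<in>D'. const_sign f C)"
proof (induction "card {C\<in>D. \<not> const_sign f C}" arbitrary: D rule: less_induct)
  case less
  note fD = frameD[OF less.prems]
  show ?case
  proof (cases "\<exists>C\<in>D. \<not> const_sign f C")
    case False
    then show ?thesis using less.prems refines_refl unfolding reaches_def by (intro exI[of _ D]) auto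
  next
    case True
    define N where "N = (\<lambda>C. card {F\<in>D. carrier F \<subseteq> carrier C})"
    obtain E where E: "E \<in> D" "\<not> const_sign f E" and min: "\<And>C. C \<in> D \<Longrightarrow> \<not> const_sign f C \<Longrightarrow> N E \<le> N C"
      using ex_has_least_nat[of "\<lambda>C. C \<in> D \<and> \<not> const_sign f C" _ N] True by blast
    have EL: "E \<notin> L" using L E(2) by blast
    have bd: "const_sign f F" if F: "F \<in> D" "carrier F \<subseteq> cell_bd E" for F
    proof (rule ccontr)
      assume n: "\<not> const_sign f F"
      obtain k \<psi> where c: "char k \<psi> E" using goodD(3)[OF fD(1) E(1)] by blast
      have "\<not> carrier E \<subseteq> carrier F"
        using char_int_nonempty[OF c] charD(6)[OF c] F(2) unfolding carrier_def by blast
      moreover have "carrier F \<subseteq> carrier E" using F(2) unfolding carrier_def by blast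
      ultimately have "{G\<in>D. carrier G \<subseteq> carrier F} \<subset> {G\<in>D. carrier G \<subseteq> carrier E}" using E(1) by blast
      then have "N F < N E" unfolding N_def using goodD(1)[OF fD(1)] by (intro psubset_card_mono) auto
      then show False using min[OF F(1) n] by simp
    qed
    obtain P where P: "frame \<phi> K L ((D - {E}) \<union> P)"
      "elementary_subdivision (push \<phi> K L D) (push \<phi> K L ((D - {E}) \<union> P))"
      "\<forall>C\<in>P. \<exists>x\<in>cell_int E. cell_int C = {y\<in>cell_int E. sgn (f y) = sgn (f x)}"
      "(\<Union>C\<in>P. carrier C) = carrier E" "P \<inter> L = {}"
      using frame_step[OF less.prems E(1) EL f E(2) bd] by blast
    let ?D = "(D - {E}) \<union> P"
    have Pc: "const_sign f C" if "C \<in> P" for C using P(3) that unfolding const_sign_def by fastforce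
    have "{C\<in>?D. \<not> const_sign f C} \<subset> {C\<in>D. \<not> const_sign f C}" using Pc E by blast
    then have "card {C\<in>?D. \<not> const_sign f C} < card {C\<in>D. \<not> const_sign f C}"
      using goodD(1)[OF fD(1)] by (intro psubset_card_mono) auto
    from less.hyps[OF this P(1)] obtain D' where D': "reaches \<phi> K L {f} ?D D'" "\<forall>C\<in>D'. const_sign f C" by blast
    have "refines {f} L ?D D"
      unfolding refines_def
    proof
      fix C' assume C': "C' \<in> ?D - L"
      show "\<exists>C\<in>D - L. cell_int C' \<subseteq> cell_int C \<and>
        (\<forall>x\<in>cell_int C'. \<forall>y\<in>cell_int C. (\<forall>f\<in>{f}. sgn (f x) = sgn (f y)) \<longrightarrow> y \<in> cell_int C')"
      proof (cases "C' \<in> P")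
        case True
        then obtain x where x: "cell_int C' = {y\<in>cell_int E. sgn (f y) = sgn (f x)}" using P(3) by blast
        show ?thesis using E(1) EL unfolding x by (intro bexI[of _ E]) auto
      next
        case False then show ?thesis using C' by (intro bexI[of _ C']) auto
      qed
    qed
    moreover have "support (?D - L) = support (D - L)"
    proof -
      have e: "?D - L = (D - L - {E}) \<union> P" using P(5) by blast
      have "support (?D - L) = (\<Union>C\<in>D - L - {E}. carrier C) \<union> carrier E"
        unfolding e support_def using P(4) by blast
      also have "\<dots> = support (D - L)" unfolding support_def using E(1) EL by blast
      finally show ?thesis .
    qed
    ultimately have "reaches \<phi> K L {f} D ?D" unfolding reaches_def using P(1,2) by blast
    from reaches_trans[OF D'(1) this] show ?thesis using D'(2) by (intro exI[of _ D']) simp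
  qed
qed

lemma cut_frame_finite:
  assumes "finite \<A>" "\<And>f. f \<in> \<A> \<Longrightarrow> aff f" "\<And>f C. f \<in> \<A> \<Longrightarrow> C \<in> L \<Longrightarrow> const_sign f C" and fr: "frame \<phi> K L D"
  shows "\<exists>D'. reaches \<phi> K L \<A> D D' \<and> (\<forall>f\<in>\<A>. \<forall>C\<in>D'. const_sign f C)"
  using assms(1-3)
proof (induction \<A> rule: finite_induct)
  case empty
  then show ?case using fr refines_refl unfolding reaches_def by (intro exI[of _ D]) simp
next
  case (insert f \<A>)
  obtain D1 where D1: "reaches \<phi> K L \<A> D D1" "\<forall>f\<in>\<A>. \<forall>C\<in>D1. const_sign f C"
    using insert.IH insert.prems by (metis insertCI)
  have "frame \<phi> K L D1" using D1(1) unfolding reaches_def by blast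
  from cut_frame[OF insert.prems(1)[OF insertI1] insert.prems(2)[OF insertI1] this]
  obtain D2 where D2: "reaches \<phi> K L {f} D1 D2" "\<forall>C\<in>D2. const_sign f C" by blast
  have r: "refines {f} L D2 D1" using D2(1) unfolding reaches_def by blast
  have "const_sign g C" if g: "g \<in> \<A>" and C: "C \<in> D2" for g C
  proof (cases "C \<in> L")
    case True then show ?thesis using insert.prems(2) g by blast
  next
    case False
    show ?thesis by (rule refines_const[OF r]) (use D1(2) g C False in auto)
  qed
  then have "\<forall>g\<in>insert f \<A>. \<forall>C\<in>D2. const_sign g C" using D2(2) by blast
  moreover have "reaches \<phi> K L (insert f \<A>) D D2" using reaches_trans[OF D2(1) D1(1)] by simp
  ultimately show ?case by blast
qed

section \<open>Subdividing into convex cells\<close>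

text \<open>Cutting a convex subcomplex in place is the case of a frame with identity map and no
  fixed cells upstairs.\<close>

lemma frame_identity:
  assumes K: "good K" and J: "good J" "J \<subseteq> K" and op: "\<forall>C\<in>J. opoly (cell_int C)"
  shows "frame (\<lambda>x. x) (K - J) {} J" "push (\<lambda>x. x) (K - J) {} D = (K - J) \<union> D"
proof -
  have g: "gmap (\<lambda>x. x) ` S = S" for S by (simp add: gmap_id)
  show p: "push (\<lambda>x. x) (K - J) {} D = (K - J) \<union> D" for D unfolding push_def by (simp add: g)
  have "(K - J) \<union> J = K" using J(2) by blast
  then show "frame (\<lambda>x. x) (K - J) {} J"
    unfolding frame_def p using K J op cellular_id[OF J(2)] by (auto simp: g)
qed

lemma subcells_cover_boundary:
  assumes K: "good K" and A: "A \<in> K"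
  defines "J \<equiv> {F\<in>K. carrier F \<subseteq> cell_bd A}"
  shows "good J" "support J = cell_bd A"
proof -
  show "good J" by (rule good_subcomplex[OF K]) (auto simp: J_def carrier_def)
  obtain n \<phi> where c: "char n \<phi> A" using goodD(3)[OF K A] by blast
  obtain L where L: "support L = bd_cube n" "cellular L K \<phi>" using goodD(4)[OF K A c] by blast
  have "gmap \<phi> D \<in> J" if "D \<in> L" for D
    unfolding J_def using cellularD(1)[OF L(2) that] bd_image_cellular[OF c L(1)] that by blast
  then have "cell_bd A \<subseteq> support J" unfolding bd_image_cellular[OF c L(1)] support_def by blast
  then show "support J = cell_bd A" unfolding support_def J_def by blast
qed

lemma good_add_cube:
  assumes L: "good L" "support L = bd_cube n"
  defines "B \<equiv> GCell (int_cube n) (bd_cube n)"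
  shows "good (insert B L)" "B \<notin> L" "char n (\<lambda>x. x) B"
proof -
  show cB: "char n (\<lambda>x. x) B"
    by (rule charI) (simp_all add: B_def int_bd_disjoint PL_on_aff polytope_cube aff_id)
  have dis: "cell_int B \<inter> cell_int D = {}" if "D \<in> L" for D
    using carrier_subset_support[OF that] L(2) int_bd_disjoint[of n] unfolding carrier_def B_def by auto
  show "B \<notin> L" using dis[of B] char_int_nonempty[OF cB] by blast
  show "good (insert B L)"
  proof (rule good_intro1)
    show "finite (insert B L)" using goodD(1)[OF L(1)] by simp
    show "A = A'" if "A \<in> insert B L" "A' \<in> insert B L" "cell_int A \<inter> cell_int A' \<noteq> {}" for A A'
      using that dis goodD(2)[OF L(1), of A A'] by blast
    show "\<exists>n \<phi> M. char n \<phi> A \<and> good M \<and> support M = bd_cube n \<and> cellular M (insert B L) \<phi>" if A: "A \<in> insert B L" for A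
    proof (cases "A = B")
      case True
      have "cellular L (insert B L) (\<lambda>x. x)" by (rule cellular_id) blast
      then show ?thesis unfolding True using cB L by (intro exI[of _ n] exI[of _ "\<lambda>x. x"] exI[of _ L]) simp
    next
      case False
      then have AL: "A \<in> L" using A by blast
      obtain m \<phi> where c: "char m \<phi> A" using goodD(3)[OF L(1) AL] by blast
      obtain M where M: "good M" "support M = bd_cube m" "cellular M L \<phi>" using goodD(4)[OF L(1) AL c] by blast
      have "cellular M (insert B L) \<phi>" by (rule cellular_mono[OF M(3)]) blast
      then show ?thesis using c M by (intro exI[of _ m] exI[of _ \<phi>] exI[of _ M]) simp
    qed
  qed
qed

text \<open>The cells of a pullback lying over a convex cell on which all pulled back hyperplanes have constant
  sign are affine images of it: by connectedness they stay inside one affine piece of the characteristic map.\<close>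

lemma pullback_convex:
  assumes pc: "pieces n \<phi> \<P> A B" and H: "\<And>P. P \<in> \<P> \<Longrightarrow> P = hset n (H P)" "\<And>P. P \<in> \<P> \<Longrightarrow> H P \<subseteq> \<A>"
    and p: "char k \<psi> F" and F: "carrier F \<subseteq> cube n" and fp: "char k (\<phi> \<circ> \<psi>) (gmap \<phi> F)"
    and op: "opoly (cell_int (gmap \<phi> F))" and cs: "\<And>f P. f \<in> \<A> \<Longrightarrow> P \<in> \<P> \<Longrightarrow> const_sign (\<lambda>y. f (B P y)) (gmap \<phi> F)"
  shows "opoly (cell_int F) \<and> (\<forall>f\<in>\<A>. const_sign f F)"
proof -
  note P = piecesD[OF pc]
  let ?C = "gmap \<phi> F"
  let ?U = "\<lambda>P. {u\<in>int_cube k. \<psi> u \<in> P}"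
  have \<psi>c: "\<psi> u \<in> cube n" if "u \<in> int_cube k" for u
    using F subsetD[OF int_cube_subset that] char_carrier[OF p] by blast
  have \<phi>C: "\<phi> (\<psi> u) \<in> cell_int ?C" if "u \<in> int_cube k" for u
    using that charD(4)[OF p] by simp
  \<comment> \<open>The left inverse \<open>B P\<close> recovers \<open>\<psi> u\<close> from its
    image, so constant signs of \<open>f (B P y)\<close> on the cell below become constant signs of
    \<open>f\<close> on the part of the cell that lies in \<open>P\<close>. Within this part the
    functionals bounding \<open>P'\<close> cannot change sign.\<close>
  have same: "\<psi> u' \<in> P'" if h: "P \<in> \<P>" "P' \<in> \<P>" "u \<in> int_cube k" "u' \<in> int_cube k" "\<psi> u \<in> P" "\<psi> u' \<in> P" "\<psi> u \<in> P'" for P P' u u'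
  proof -
    have e: "B P (\<phi> (\<psi> w)) = \<psi> w" if "\<psi> w \<in> P" for w using P(8)[OF h(1) that] P(9)[OF h(1) that] by simp
    have "f (\<psi> u') \<ge> 0" if f: "f \<in> H P'" for f
    proof -
      have "f \<in> \<A>" using H(2)[OF h(2)] f by blast
      from cs[OF this h(1)] have "sgn (f (B P (\<phi> (\<psi> u')))) = sgn (f (B P (\<phi> (\<psi> u))))"
        using \<phi>C[OF h(3)] \<phi>C[OF h(4)] unfolding const_sign_def by blast
      then have "sgn (f (\<psi> u')) = sgn (f (\<psi> u))" using e h(5,6) by simp
      moreover have "f (\<psi> u) \<ge> 0" using h(7) H(1)[OF h(2)] f unfolding hset_def by blast
      ultimately show ?thesis by (auto simp: sgn_if split: if_splits)
    qed
    moreover have "\<psi> u' \<in> Rn n" using \<psi>c[OF h(4)] cube_subset_Rn by blast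
    ultimately have "\<psi> u' \<in> hset n (H P')" unfolding hset_def by blast
    then show ?thesis using H(1)[OF h(2)] by simp
  qed
  have "\<exists>P\<in>\<P>. ?U P = int_cube k"
  proof (rule connected_finite_cover[OF connected_int_cube zero_in_int_cube P(1)])
    show "closedin (top_of_set (int_cube k)) (?U P)" if "P \<in> \<P>" for P
    proof -
      have "closedin (top_of_set (int_cube k)) (int_cube k \<inter> \<psi> -` P)"
        by (rule continuous_closedin_preimage[OF continuous_on_subset[OF char_continuous[OF p] int_cube_subset]])
          (use P(3)[OF that] in \<open>simp add: polytope_imp_closed\<close>)
      moreover have "int_cube k \<inter> \<psi> -` P = ?U P" by blast
      ultimately show ?thesis by simp
    qed
    show "int_cube k \<subseteq> (\<Union>P\<in>\<P>. ?U P)" using \<psi>c P(2) by blast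
    show "?U P = ?U P'" if h: "P \<in> \<P>" "P' \<in> \<P>" "?U P \<inter> ?U P' \<noteq> {}" for P P'
    proof -
      obtain u where u: "u \<in> int_cube k" "\<psi> u \<in> P" "\<psi> u \<in> P'" using h(3) by blast
      show ?thesis using same[OF h(1,2) u(1) _ u(2) _ u(3)] same[OF h(2,1) u(1) _ u(3) _ u(2)] by blast
    qed
  qed
  then obtain P0 where P0: "P0 \<in> \<P>" "\<And>u. u \<in> int_cube k \<Longrightarrow> \<psi> u \<in> P0" by blast
  have e: "B P0 (\<phi> (\<psi> u)) = \<psi> u" "A P0 (\<psi> u) = \<phi> (\<psi> u)" if "u \<in> int_cube k" for u
    using P(8)[OF P0(1) P0(2)[OF that]] P(9)[OF P0(1) P0(2)[OF that]] by simp_all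
  have CE: "cell_int ?C = (\<phi> \<circ> \<psi>) ` int_cube k" by (rule charD(4)[OF fp])
  have FE: "cell_int F = B P0 ` cell_int ?C" unfolding CE charD(4)[OF p] image_comp using e(1) by (intro image_cong) auto
  have "opoly (cell_int F)"
    unfolding FE
  proof (rule opoly_aff_image[OF op P(6)[OF P0(1)] _ P(5)[OF P0(1)]])
    show "B P0 ` cell_int ?C \<subseteq> Rn n" using P(7)[OF P0(1)] by blast
    fix y assume "y \<in> cell_int ?C"
    then obtain u where "u \<in> int_cube k" "y = \<phi> (\<psi> u)" unfolding CE by auto
    then show "A P0 (B P0 y) = y" using e by simp
  qed
  moreover have "const_sign f F" if "f \<in> \<A>" for f
    using cs[OF that P0(1)] unfolding const_sign_def FE by blast
  ultimately show ?thesis by blast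
qed

text \<open>The cuts use two frames: the identity on the boundary cells of \<open>A\<close>, and
  \<open>\<phi>\<close> on the open cube with the pullback \<open>L\<close> as fixed boundary. All
  new cells are convex and no other cell is touched, so \<open>A\<close> disappears from the
  nonconvex cells and none is added.\<close>

lemma convex_step:
  assumes K: "good K" and A: "A \<in> K" and nop: "\<not> opoly (cell_int A)"
    and bd: "\<And>F. F \<in> K \<Longrightarrow> carrier F \<subseteq> cell_bd A \<Longrightarrow> opoly (cell_int F)"
  shows "\<exists>K'. elementary_subdivision\<^sup>*\<^sup>* K K' \<and> good K' \<and> support K' = support K \<and>
    {C\<in>K'. \<not> opoly (cell_int C)} \<subseteq> {C\<in>K. \<not> opoly (cell_int C)} - {A}"
proof -
  define J where "J = {F\<in>K. carrier F \<subseteq> cell_bd A}"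
  have J: "good J" "support J = cell_bd A" using subcells_cover_boundary[OF K A] unfolding J_def by blast+
  have JK: "J \<subseteq> K" and Jop: "\<forall>C\<in>J. opoly (cell_int C)" using bd unfolding J_def by blast+
  obtain n \<phi> where c: "char n \<phi> A" using goodD(3)[OF K A] by blast
  have AJ: "carrier C \<subseteq> cell_bd A \<Longrightarrow> C \<noteq> A" for C
    using char_int_nonempty[OF c] charD(6)[OF c] unfolding carrier_def by blast
  obtain \<P> a b where pc: "pieces n \<phi> \<P> a b" using regular_pieces[OF charD(1)[OF c]] by blast
  note P = piecesD[OF pc]
  have "\<forall>P\<in>\<P>. \<exists>S. finite S \<and> (\<forall>f\<in>S. aff f) \<and> P = hset n S"
  proof
    fix Q assume Q: "Q \<in> \<P>"
    have "Q \<subseteq> Rn n" using Q P(2) cube_subset_Rn by blast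
    then show "\<exists>S. finite S \<and> (\<forall>f\<in>S. aff f) \<and> Q = hset n S" by (rule polytope_hrep[OF P(3)[OF Q]])
  qed
  from bchoice[OF this] obtain H where H: "\<forall>P\<in>\<P>. finite (H P) \<and> (\<forall>f\<in>H P. aff f) \<and> P = hset n (H P)" by (rule exE)
  have H1: "Q = hset n (H Q)" if "Q \<in> \<P>" for Q using H that by blast
  define \<A> where "\<A> = (\<Union>P\<in>\<P>. H P)"
  have fA: "finite \<A>" "\<And>f. f \<in> \<A> \<Longrightarrow> aff f" using H P(1) unfolding \<A>_def by blast+
  have HA: "H Q \<subseteq> \<A>" if "Q \<in> \<P>" for Q using that unfolding \<A>_def by blast
  \<comment> \<open>Different pieces of the characteristic map may lie over one boundary cell, so
    every bounding functional is carried over by the left inverse of every piece.\<close>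
  define \<B> where "\<B> = (\<lambda>(f,P) y. f (b P y)) ` (\<A> \<times> \<P>)"
  have fB: "finite \<B>" using fA(1) P(1) by (simp add: \<B>_def)
  have aB: "aff g" if g: "g \<in> \<B>" for g
  proof -
    obtain f Q where f: "f \<in> \<A>" "Q \<in> \<P>" "g = (\<lambda>y. f (b Q y))" using g unfolding \<B>_def by auto
    show ?thesis unfolding f(3) by (rule aff_compose[OF fA(2)[OF f(1)] P(6)[OF f(2)]])
  qed
  note fid = frame_identity[OF K J(1) JK Jop]
  obtain J' where J': "reaches (\<lambda>x. x) (K - J) {} \<B> J J'" "\<forall>f\<in>\<B>. \<forall>C\<in>J'. const_sign f C"
    using cut_frame_finite[OF fB aB _ fid(1)] by blast
  have frJ: "frame (\<lambda>x. x) (K - J) {} J'" and sJ: "support J' = support J"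
    using J'(1) unfolding reaches_def by simp_all
  note fJ = frameD[OF frJ]
  define K1 where "K1 = (K - J) \<union> J'"
  have gK1: "good K1" using fJ(6) unfolding fid(2) K1_def .
  have KJ: "(K - J) \<union> J = K" using JK by blast
  have es1: "elementary_subdivision\<^sup>*\<^sup>* K K1"
    using J'(1) unfolding reaches_def fid(2) KJ K1_def by blast
  have sK1: "support K1 = support K"
  proof -
    have "support K1 = support (K - J) \<union> support J'" unfolding K1_def support_def by blast
    also have "\<dots> = support (K - J) \<union> support J" by (simp add: sJ)
    also have "\<dots> = support K" unfolding support_def using JK by blast
    finally show ?thesis .
  qed
  have AK1: "A \<in> K1" using A AJ[of A] unfolding K1_def J_def by blast
  have AJ': "A \<notin> J'"
    using AJ[of A] carrier_subset_support[of A J'] sJ J(2) by auto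
  obtain L where L: "good L" "support L = bd_cube n" "cellular L K1 \<phi>" using goodD(4)[OF gK1 AK1 c] by blast
  have LJ: "gmap \<phi> F \<in> J'" if F: "F \<in> L" for F
  proof -
    obtain k \<psi> where p: "char k \<psi> F" using goodD(3)[OF L(1) F] by blast
    have sub: "carrier (gmap \<phi> F) \<subseteq> support J'"
      unfolding sJ J(2) bd_image_cellular[OF c L(2)] using F by blast
    obtain x where x: "x \<in> cell_int (gmap \<phi> F)" using char_int_nonempty[OF cellularD(2)[OF L(3) F p]] by blast
    then obtain C where C: "C \<in> J'" "x \<in> cell_int C" using sub good_support[OF fJ(1)] unfolding carrier_def by blast
    have "gmap \<phi> F = C"
      by (rule good_cell_unique[OF gK1 cellularD(1)[OF L(3) F] _ x C(2)]) (use C(1) K1_def in blast)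
    then show ?thesis using C(1) by simp
  qed
  have Lconv: "opoly (cell_int F) \<and> (\<forall>f\<in>\<A>. const_sign f F)" if F: "F \<in> L" for F
  proof -
    obtain k \<psi> where p: "char k \<psi> F" using goodD(3)[OF L(1) F] by blast
    show ?thesis
    proof (rule pullback_convex[OF pc H1 HA p _ cellularD(2)[OF L(3) F p]])
      show "carrier F \<subseteq> cube n" using carrier_subset_support[OF F] L(2) bd_cube_subset by blast
      show "opoly (cell_int (gmap \<phi> F))" by (rule fJ(3)[OF LJ[OF F]]) simp
      show "const_sign (\<lambda>y. f (b Q y)) (gmap \<phi> F)" if "f \<in> \<A>" "Q \<in> \<P>" for f Q
      proof -
        have "(\<lambda>y. f (b Q y)) \<in> \<B>" unfolding \<B>_def by (rule image_eqI[of _ _ "(f,Q)"]) (use that in auto)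
        then show ?thesis using J'(2) LJ[OF F] by blast
      qed
    qed
  qed
  \<comment> \<open>The cube becomes a complex, its open interior together with the pullback
    \<open>L\<close>. By \<open>Lconv\<close> no cell of \<open>L\<close> is crossed by a hyperplane
    of \<open>\<A>\<close>, so \<open>L\<close> can stay fixed.\<close>
  define Bc where "Bc = GCell (int_cube n) (bd_cube n)"
  define D where "D = insert Bc L"
  have Bc: "good D" "Bc \<notin> L" "char n (\<lambda>x. x) Bc" using good_add_cube[OF L(1,2)] unfolding D_def Bc_def by blast+
  have gBc: "gmap \<phi> Bc = A" using charD(4,5)[OF c] by (simp add: gmap_def Bc_def gcell.expand)
  have DL: "D - L = {Bc}" using Bc(2) unfolding D_def by blast
  have pD: "push \<phi> (K1 - {A}) L D = K1" unfolding push_def DL using gBc AK1 by auto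
  have fr: "frame \<phi> (K1 - {A}) L D"
    unfolding frame_def pD DL
  proof (intro conjI)
    show "L \<subseteq> D" unfolding D_def by blast
    show "\<forall>C\<in>{Bc}. opoly (cell_int C)" using opoly_int_cube by (simp add: Bc_def)
    show "inj_on \<phi> (\<Union>C\<in>{Bc}. cell_int C)" using charD(3)[OF c] by (simp add: Bc_def)
    show "cellular D K1 \<phi>"
    proof (rule cellularI)
      fix F assume F: "F \<in> D"
      show "\<exists>k \<psi>. char k \<psi> F \<and> char k (\<phi> \<circ> \<psi>) (gmap \<phi> F) \<and> gmap \<phi> F \<in> K1"
      proof (cases "F = Bc")
        case True
        show ?thesis unfolding True gBc using Bc(3) c AK1
          by (intro exI[of _ n] exI[of _ "\<lambda>x. x"]) (simp add: o_def)
      next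
        case False
        then have FL: "F \<in> L" using F unfolding D_def by blast
        obtain k \<psi> where p: "char k \<psi> F" using goodD(3)[OF L(1) FL] by blast
        show ?thesis using p cellularD(1)[OF L(3) FL] cellularD(2)[OF L(3) FL p]
          by (intro exI[of _ k] exI[of _ \<psi>] conjI)
      qed
    qed
    show "(K1 - {A}) \<inter> gmap \<phi> ` {Bc} = {}" using gBc by simp
    show "gmap \<phi> ` L \<subseteq> K1 - {A}" using LJ AJ' unfolding K1_def by blast
  qed (use Bc(1) gK1 in simp_all)
  obtain D' where D': "reaches \<phi> (K1 - {A}) L \<A> D D'" "\<forall>f\<in>\<A>. \<forall>C\<in>D'. const_sign f C"
    using cut_frame_finite[OF fA _ fr] Lconv by blast
  have frD: "frame \<phi> (K1 - {A}) L D'" and rD: "refines \<A> L D' D" and sD: "support (D' - L) = support (D - L)"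
    and esD: "elementary_subdivision\<^sup>*\<^sup>* K1 (push \<phi> (K1 - {A}) L D')"
    using D'(1) unfolding reaches_def pD by blast+
  let ?K = "push \<phi> (K1 - {A}) L D'"
  have conv: "opoly (cell_int (gmap \<phi> C))" if C: "C \<in> D'" "C \<notin> L" for C
  proof -
    have op: "opoly (cell_int C)" by (rule frameD(3)[OF frD C])
    have sub: "cell_int C \<subseteq> int_cube n" using rD C unfolding refines_def DL Bc_def by fastforce
    obtain x where x: "x \<in> cell_int C" using opoly_nonempty[OF op] by blast
    obtain Q where Q: "Q \<in> \<P>" "x \<in> Q" using x sub int_cube_subset P(2) by blast
    have CQ: "y \<in> Q" if y: "y \<in> cell_int C" for y
    proof -
      have "f y \<ge> 0" if f: "f \<in> H Q" for f
      proof -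
        have "f \<in> \<A>" using HA[OF Q(1)] f by blast
        then have "sgn (f y) = sgn (f x)" using D'(2) C(1) x y unfolding const_sign_def by blast
        moreover have "f x \<ge> 0" using Q(2) H1[OF Q(1)] f unfolding hset_def by blast
        ultimately show ?thesis by (auto simp: sgn_if split: if_splits)
      qed
      moreover have "y \<in> Rn n" using y sub int_cube_subset_Rn by blast
      ultimately have "y \<in> hset n (H Q)" unfolding hset_def by blast
      then show ?thesis using H1[OF Q(1)] by simp
    qed
    \<comment> \<open>After the cuts each cell outside \<open>L\<close> lies in a single affine
      piece \<open>Q\<close>, so its image under \<open>\<phi>\<close> is an affine image.\<close>
    have e: "\<phi> ` cell_int C = a Q ` cell_int C" by (rule image_cong[OF refl]) (rule P(8)[OF Q(1) CQ])
    obtain m where m: "a Q ` Rn n \<subseteq> Rn m" using aff_maps_Rn[OF P(5)[OF Q(1)]] by blast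
    have "opoly (a Q ` cell_int C)"
    proof (rule opoly_aff_image[OF op P(5)[OF Q(1)] _ P(6)[OF Q(1)]])
      show "a Q ` cell_int C \<subseteq> Rn m" using m sub int_cube_subset_Rn by blast
      show "b Q (a Q y) = y" if "y \<in> cell_int C" for y by (rule P(9)[OF Q(1) CQ[OF that]])
    qed
    then show ?thesis using e by simp
  qed
  have "{C\<in>?K. \<not> opoly (cell_int C)} \<subseteq> {C\<in>K. \<not> opoly (cell_int C)} - {A}"
    unfolding push_def K1_def using conv fJ(3) by blast
  moreover have "good ?K" by (rule frameD(6)[OF frD])
  moreover have "elementary_subdivision\<^sup>*\<^sup>* K ?K" by (rule rtranclp_trans[OF es1 esD])
  moreover have "support ?K = support K"
  proof -
    have "support ?K = support (K1 - {A}) \<union> \<phi> ` support (D' - L)"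
      unfolding push_def support_gmap[symmetric] unfolding support_def by blast
    also have "\<phi> ` support (D' - L) = carrier A"
      unfolding sD DL using char_carrier[OF c] char_carrier[OF Bc(3)] by (simp add: support_def)
    also have "support (K1 - {A}) \<union> carrier A = support K1" unfolding support_def using AK1 by blast
    finally show ?thesis using sK1 by simp
  qed
  ultimately show ?thesis by blast
qed

text \<open>A nonconvex cell whose carrier contains the fewest cells has only convex cells in its
  boundary, so \<open>convex_step\<close> applies to it and lowers the number of nonconvex
  cells.\<close>

lemma convexify:
  "good K \<Longrightarrow> \<exists>T. elementary_subdivision\<^sup>*\<^sup>* K T \<and> good T \<and> support T = support K \<and> (\<forall>C\<in>T. opoly (cell_int C))"
proof (induction "card {C\<in>K. \<not> opoly (cell_int C)}" arbitrary: K rule: less_induct)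
  case less
  show ?case
  proof (cases "\<exists>C\<in>K. \<not> opoly (cell_int C)")
    case False then show ?thesis using less.prems by (intro exI[of _ K]) auto
  next
    case True
    define N where "N = (\<lambda>C. card {F\<in>K. carrier F \<subseteq> carrier C})"
    obtain A where A: "A \<in> K" "\<not> opoly (cell_int A)" and min: "\<And>C. C \<in> K \<Longrightarrow> \<not> opoly (cell_int C) \<Longrightarrow> N A \<le> N C"
      using ex_has_least_nat[of "\<lambda>C. C \<in> K \<and> \<not> opoly (cell_int C)" _ N] True by blast
    have bd: "opoly (cell_int F)" if F: "F \<in> K" "carrier F \<subseteq> cell_bd A" for F
    proof (rule ccontr)
      assume n: "\<not> opoly (cell_int F)"
      obtain k \<psi> where c: "char k \<psi> A" using goodD(3)[OF less.prems A(1)] by blast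
      have "\<not> carrier A \<subseteq> carrier F"
        using char_int_nonempty[OF c] charD(6)[OF c] F(2) unfolding carrier_def by blast
      moreover have "carrier F \<subseteq> carrier A" using F(2) unfolding carrier_def by blast
      ultimately have "{G\<in>K. carrier G \<subseteq> carrier F} \<subset> {G\<in>K. carrier G \<subseteq> carrier A}" using A(1) by blast
      then have "N F < N A" unfolding N_def using goodD(1)[OF less.prems] by (intro psubset_card_mono) auto
      then show False using min[OF F(1) n] by simp
    qed
    obtain K' where K': "elementary_subdivision\<^sup>*\<^sup>* K K'" "good K'" "support K' = support K"
      "{C\<in>K'. \<not> opoly (cell_int C)} \<subseteq> {C\<in>K. \<not> opoly (cell_int C)} - {A}"
      using convex_step[OF less.prems A bd] by blast
    have "{C\<in>K'. \<not> opoly (cell_int C)} \<subset> {C\<in>K. \<not> opoly (cell_int C)}" using K'(4) A by blast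
    then have "card {C\<in>K'. \<not> opoly (cell_int C)} < card {C\<in>K. \<not> opoly (cell_int C)}"
      using goodD(1)[OF less.prems] by (intro psubset_card_mono) auto
    from less.hyps[OF this K'(2)] obtain T where "elementary_subdivision\<^sup>*\<^sup>* K' T" "good T" "support T = support K'"
      "\<forall>C\<in>T. opoly (cell_int C)" by blast
    then show ?thesis using K'(1,3) rtranclp_trans[of elementary_subdivision K K' T] by (intro exI[of _ T]) simp
  qed
qed

section \<open>The common subdivision\<close>

text \<open>Once \<open>\<A>\<close> contains all functionals that define the cells, every cell of
  the refinement is a full sign class of \<open>\<A>\<close> in \<open>Rn N\<close>. The coordinates
  are included because a cell may be defined inside a smaller \<open>Rn n\<close>; their signs 0
  express this.\<close>

lemma convex_refine:
  assumes T: "good T" "\<And>C. C \<in> T \<Longrightarrow> opoly (cell_int C)"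
    and S: "\<And>C. C \<in> T \<Longrightarrow> \<exists>n x. n \<le> N \<and> finite (S C) \<and> S C \<subseteq> \<A> \<and> cell_int C = sign_cell n (S C) x"
    and A: "finite \<A>" "\<And>f. f \<in> \<A> \<Longrightarrow> aff f" "\<And>i. i < N \<Longrightarrow> (\<lambda>x. coord x i) \<in> \<A>"
    and X: "support T \<subseteq> Rn N"
  shows "\<exists>T'. elementary_subdivision\<^sup>*\<^sup>* T T' \<and> good T' \<and> support T' = support T \<and>
    (\<forall>C\<in>T'. \<forall>x\<in>cell_int C. cell_int C = sign_cell N \<A> x)"
proof -
  have Top: "\<forall>C\<in>T. opoly (cell_int C)" using T(2) by blast
  note fid = frame_identity[OF T(1) T(1) order_refl Top]
  obtain T' where T': "reaches (\<lambda>x. x) (T - T) {} \<A> T T'" "\<forall>f\<in>\<A>. \<forall>C\<in>T'. const_sign f C"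
    using cut_frame_finite[OF A(1,2) _ fid(1)] by blast
  have p: "push (\<lambda>x. x) (T - T) {} D = D" for D unfolding fid(2) by simp
  have r: "refines \<A> {} T' T" and s: "support T' = support T" and fr: "frame (\<lambda>x. x) (T - T) {} T'"
    and es: "elementary_subdivision\<^sup>*\<^sup>* T T'"
    using T'(1) unfolding reaches_def p by simp_all
  have "cell_int C = sign_cell N \<A> x" if C: "C \<in> T'" and x: "x \<in> cell_int C" for C x
  proof
    have CX: "cell_int C \<subseteq> Rn N" using carrier_subset_support[OF C] s X unfolding carrier_def by blast
    show "cell_int C \<subseteq> sign_cell N \<A> x"
      using CX T'(2) C x unfolding sign_cell_def const_sign_def by blast
    obtain C0 where C0: "C0 \<in> T" "cell_int C \<subseteq> cell_int C0"
      "\<forall>x\<in>cell_int C. \<forall>y\<in>cell_int C0. (\<forall>f\<in>\<A>. sgn (f x) = sgn (f y)) \<longrightarrow> y \<in> cell_int C"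
      using r C unfolding refines_def by blast
    obtain n x0 where n: "n \<le> N" "S C0 \<subseteq> \<A>" "cell_int C0 = sign_cell n (S C0) x0" using S[OF C0(1)] by blast
    have xC0: "x \<in> sign_cell n (S C0) x0" using C0(2) x n(3) by blast
    show "sign_cell N \<A> x \<subseteq> cell_int C"
    proof
      fix y assume "y \<in> sign_cell N \<A> x"
      then have y: "y \<in> Rn N" "\<And>f. f \<in> \<A> \<Longrightarrow> sgn (f y) = sgn (f x)" unfolding sign_cell_def by blast+
      have xn: "x \<in> Rn n" using xC0 unfolding sign_cell_def by blast
      have "y \<in> Rn n"
        unfolding Rn_iff
      proof (intro allI impI)
        fix i assume i: "n \<le> i"
        show "coord y i = 0"
        proof (cases "i < N")
          case True
          have "sgn (coord y i) = sgn (coord x i)" using y(2)[OF A(3)[OF True]] .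
          then show ?thesis using xn i by (simp add: Rn_iff sgn_0_0)
        qed (use y(1) in \<open>simp add: Rn_iff\<close>)
      qed
      then have "y \<in> sign_cell n (S C0) x" unfolding sign_cell_def using y(2) n(2) by blast
      then have "y \<in> cell_int C0" unfolding n(3) sign_cell_eq[OF xC0] .
      then show "y \<in> cell_int C" using C0(3) x y(2) by simp
    qed
  qed
  then show ?thesis using es frameD(1)[OF fr] s by (intro exI[of _ T']) simp
qed

lemma common_subdivision:
  assumes K: "good K" "good K'" and X: "support K = X" "support K' = X" "X \<subseteq> Rn N"
  shows "\<exists>T. elementary_subdivision\<^sup>*\<^sup>* K T \<and> elementary_subdivision\<^sup>*\<^sup>* K' T"
proof -
  obtain T where T: "elementary_subdivision\<^sup>*\<^sup>* K T" "good T" "support T = X" "\<forall>C\<in>T. opoly (cell_int C)"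
    using convexify[OF K(1)] X(1) by blast
  obtain T' where T': "elementary_subdivision\<^sup>*\<^sup>* K' T'" "good T'" "support T' = X" "\<forall>C\<in>T'. opoly (cell_int C)"
    using convexify[OF K(2)] X(2) by blast
  have "\<forall>C\<in>T \<union> T'. \<exists>p. finite (snd p) \<and> (\<forall>f\<in>snd p. aff f) \<and> (\<exists>x. cell_int C = sign_cell (fst p) (snd p) x)"
  proof
    fix C assume "C \<in> T \<union> T'"
    then have "opoly (cell_int C)" using T(4) T'(4) by blast
    then obtain n S x where "finite S" "\<forall>f\<in>S. aff f" "cell_int C = sign_cell n S x"
      unfolding opoly_def by (elim exE conjE)
    then show "\<exists>p. finite (snd p) \<and> (\<forall>f\<in>snd p. aff f) \<and> (\<exists>x. cell_int C = sign_cell (fst p) (snd p) x)"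
      by (intro exI[of _ "(n,S)"]) auto
  qed
  from bchoice[OF this] obtain p where
    p: "\<forall>C\<in>T \<union> T'. finite (snd (p C)) \<and> (\<forall>f\<in>snd (p C). aff f) \<and> (\<exists>x. cell_int C = sign_cell (fst (p C)) (snd (p C)) x)"
    by (rule exE)
  have fin: "finite (T \<union> T')" using goodD(1)[OF T(2)] goodD(1)[OF T'(2)] by simp
  \<comment> \<open>The cells of the two decompositions may be given as sign classes in spaces
    \<open>Rn n\<close> of different dimension; \<open>M\<close> is large enough for all of them and
    for \<open>X\<close>.\<close>
  define M where "M = Max (insert N ((\<lambda>C. fst (p C)) ` (T \<union> T')))"
  have M: "N \<le> M" "\<And>C. C \<in> T \<union> T' \<Longrightarrow> fst (p C) \<le> M" using fin by (auto simp: M_def)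
  have XM: "X \<subseteq> Rn M" using X(3) Rn_mono[OF M(1)] by blast
  define \<A> where "\<A> = (\<Union>C\<in>T \<union> T'. snd (p C)) \<union> (\<lambda>i x. coord x i) ` {..<M}"
  have fA: "finite \<A>" unfolding \<A>_def using fin p by blast
  have aA: "aff f" if "f \<in> \<A>" for f using that p aff_coord unfolding \<A>_def by blast
  have cA: "(\<lambda>x. coord x i) \<in> \<A>" if "i < M" for i using that unfolding \<A>_def by blast
  have dat: "\<exists>n x. n \<le> M \<and> finite (snd (p C)) \<and> snd (p C) \<subseteq> \<A> \<and> cell_int C = sign_cell n (snd (p C)) x"
    if C: "C \<in> T \<union> T'" for C
  proof -
    obtain x where "cell_int C = sign_cell (fst (p C)) (snd (p C)) x" using p C by blast
    moreover have "snd (p C) \<subseteq> \<A>" using C unfolding \<A>_def by blast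
    ultimately show ?thesis using p C M(2)[OF C] by (intro exI[of _ "fst (p C)"] exI[of _ x]) simp
  qed
  obtain U where U: "elementary_subdivision\<^sup>*\<^sup>* T U" "good U" "support U = X"
    "\<forall>C\<in>U. \<forall>x\<in>cell_int C. cell_int C = sign_cell M \<A> x"
    using convex_refine[OF T(2) _ dat fA aA cA] T(3,4) XM by auto
  obtain U' where U': "elementary_subdivision\<^sup>*\<^sup>* T' U'" "good U'" "support U' = X"
    "\<forall>C\<in>U'. \<forall>x\<in>cell_int C. cell_int C = sign_cell M \<A> x"
    using convex_refine[OF T'(2) _ dat fA aA cA] T'(3,4) XM by auto
  \<comment> \<open>Both refinements consist of sign classes of the same family and have the same
    support, so the cells around a common point have the same interior and coincide by
    \<open>cell_eqI\<close>.\<close>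
  have sub: "V \<subseteq> W" if V: "good V" "support V = X" "\<forall>C\<in>V. \<forall>x\<in>cell_int C. cell_int C = sign_cell M \<A> x"
    and W: "good W" "support W = X" "\<forall>C\<in>W. \<forall>x\<in>cell_int C. cell_int C = sign_cell M \<A> x" for V W
  proof
    fix C assume C: "C \<in> V"
    obtain n \<phi> where c: "char n \<phi> C" using goodD(3)[OF V(1) C] by blast
    obtain x where x: "x \<in> cell_int C" using char_int_nonempty[OF c] by blast
    then have "x \<in> support W" using carrier_subset_support[OF C] V(2) W(2) unfolding carrier_def by blast
    then obtain C' where C': "C' \<in> W" "x \<in> cell_int C'" using good_support[OF W(1)] by blast
    obtain m \<psi> where d: "char m \<psi> C'" using goodD(3)[OF W(1) C'(1)] by blast
    have "cell_int C = cell_int C'" using V(3) W(3) C C' x by metis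
    then have "C = C'" by (rule cell_eqI[OF char_is_cell[OF c] char_is_cell[OF d]])
    then show "C \<in> W" using C'(1) by simp
  qed
  have "U = U'" using sub[OF U(2-4) U'(2-4)] sub[OF U'(2-4) U(2-4)] by blast
  then show ?thesis
    using rtranclp_trans[OF T(1) U(1)] rtranclp_trans[OF T'(1) U'(1)] by blast
qed

lemma rtranclp_imp_equivclp: "r\<^sup>*\<^sup>* x y \<Longrightarrow> equivclp r x y"
  by (induction rule: rtranclp_induct) (auto intro: equivclp_trans r_into_equivclp)

theorem theorem8p1:
  fixes N :: nat and X :: "point set" and K K' :: "gcell set"
  assumes "X \<subseteq> Rn N" and "compact_polyhedron X"
    and "PLCW_decomposition X K" and "PLCW_decomposition X K'"
  shows "K \<sim>\<^sub>e K'"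
proof -
  have K: "good K" "support K = X" and K': "good K'" "support K' = X"
    using assms(3,4) PLCW_imp_good unfolding PLCW_decomposition_def by blast+
  obtain T where T: "elementary_subdivision\<^sup>*\<^sup>* K T" "elementary_subdivision\<^sup>*\<^sup>* K' T"
    using common_subdivision[OF K(1) K'(1) K(2) K'(2) assms(1)] by blast
  show ?thesis
    by (rule equivclp_trans[OF rtranclp_imp_equivclp[OF T(1)] equivclp_sym[OF rtranclp_imp_equivclp[OF T(2)]]])
qed

end
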